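(* Let $p$ be a tree-structured graphical model (Gaussian or discrete) that is Markov on a latent tree $T_p=(W,E_p)$ with $W=V\cup H$, $m=|V|$, and let $\mathbf{D}=[d_{ij}]_{i,j\in V}$ be the matrix of its information distances between observed nodes. If $T_p\in\mathcal{T}_{\ge3}$ is a minimal latent tree and $\mathbf{D}$ is available, then the algorithm CLRG, run on input $(V,\mathbf{D})$, outputs the true latent tree $T_p$ correctly in time $$O\big(m^2\log m+|J|\,\Delta^3(\mathrm{MST}(V;\mathbf{D}))\big),$$ where $|J|:=|V\setminus\mathrm{Leaf}(\mathrm{MST}(V;\mathbf{D}))|<m$ is the number of internal nodes of $\mathrm{MST}(V;\mathbf{D})$ and $\Delta(\mathrm{MST}(V;\mathbf{D}))$ is its maximum degree.
   Context: **Latent trees.** A latent tree is a tree with node set $W=V\cup H$ (disjoint), where $V$ is the set of observed nodes, $m=|V|$, and $H$ is the set of hidden nodes. $\mathcal{T}_{\ge 3}$ (minimal latent trees) is the set of latent trees in which every hidden node has at least three neighbors. $\mathrm{Leaf}(T)$ is the set of degree-1 nodes of $T$, and internal nodes are the non-leaves. $\mathrm{nbd}[i;T]$ is the closed neighborhood of $i$ in $T$ (its neighbors together with $i$). Names of hidden nodes are immaterial. **Models.** A random vector $(X_i)_{i\in W}$ with distribution $p$ is Markov on $T_p$ if each $X_i$ is conditionally independent of all other variables given its neighbors in $T_p$. Either $p$ is a zero-mean Gaussian (all $X_i$ scalar), or all $X_i$ take values in a common finite alphabet $\{1,\dots,K\}$. **Information distances.** Gaussian: $d_{ij}=-\log|\rho_{ij}|$,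 with $\rho_{ij}$ the correlation coefficient. Discrete: $d_{ij}=-\log\frac{|\det \mathbf{J}^{ij}|}{\sqrt{\det\mathbf{M}^i\det\mathbf{M}^j}}$, with $J^{ij}_{ab}=p(x_i=a,x_j=b)$ and $\mathbf{M}^i$ diagonal with $M^i_{aa}=p(x_i=a)$. Standing assumption: there are constants $0<l,u<\infty$ with $l\le d_{ij}\le u$ for all $(i,j)\in E_p$. It is known that these distances are additive on $T_p$: $d_{kl}=\sum_{(i,j)\in \mathrm{Path}((k,l);E_p)}d_{ij}$ for all $k,l\in W$, where $\mathrm{Path}((k,l);E_p)$ is the set of edges on the path connecting $k$ and $l$. **Minimum spanning tree.** $\mathrm{MST}(V;\mathbf{D})=\operatorname{argmin}_{T}\sum_{(i,j)\in T}d_{ij}$ over trees $T$ with vertex set $V$. (For Gaussian and symmetric discrete models it coincides with the Chow-Liu tree of the observed variables.) **TestNodeRelationships** (on a set $Y$ of nodes with known pairwise distances). Put $\Phi_{ijk}=d_{ik}-d_{jk}$. For $i,j\in Y$: (1) if $\Phi_{ijk}=d_{ij}$ for all $k\in Y\setminus\{i,j\}$, declare $i$ a leaf with parent $j$; if $\Phi_{ijk}=-d_{ij}$ for all such $k$, declare $j$ a leaf with parent $i$; (2) if $\Phi_{ijk}$ is constant over $k\in Y\setminus\{i,j\}$ but equal to neither $d_{ij}$ nor $-d_{ij}$, declare $i,j$ leaf nodes and siblings; (3) otherwise declare neither. **Algorithm RG**, input a node set $A$ with its matrix of pairwise distances. 1. Set $Y:=A$. 2. Compute $\Phi_{ijk}=d_{ik}-d_{jk}$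 for all $i,j,k\in Y$. 3. Using TestNodeRelationships on $Y$, let $\{\Pi_l\}_{l=1}^L$ be the coarsest partition of $Y$ such that for every $\Pi_l$ with $|\Pi_l|\ge2$, any two nodes in $\Pi_l$ are either siblings that are leaf nodes or have a parent-child relationship in which the child is a leaf. Set $Y_{\mathrm{new}}:=\bigcup_{l:|\Pi_l|=1}\Pi_l$. 4. For each $l$ with $|\Pi_l|\ge 2$: if $\Pi_l$ contains a parent node $u$, connect $u$ to all other nodes of $\Pi_l$ and add $u$ to $Y_{\mathrm{new}}$; otherwise introduce a new hidden node $h$, connect $h$ (as a parent) to every node in $\Pi_l$, and add $h$ to $Y_{\mathrm{new}}$. 5. Set $Y_{\mathrm{old}}:=Y$, $Y:=Y_{\mathrm{new}}$. 6. For each new hidden node $h\in Y$ with set of children $\mathcal{C}(h)$: for $i,j\in\mathcal{C}(h)$ and any $k\in Y_{\mathrm{old}}\setminus\{i,j\}$ set $d_{ih}=\frac12(d_{ij}+\Phi_{ijk})$; for any other $l\in Y$, using a child $i\in\mathcal{C}(h)$, set $d_{hl}=d_{il}-d_{ih}$ if $l\in Y_{\mathrm{old}}$, and $d_{hl}=d_{ik}-d_{ih}-d_{lk}$ with $k\in\mathcal{C}(l)$ otherwise. 7. If $|Y|\ge3$ return to step 2. If $|Y|=2$, connect the two remaining nodes by an edge and stop. If $|Y|=1$, stop. **Algorithm CLRG**, input $(V,\mathbf{D})$. 1. Construct $\mathrm{MST}(V;\mathbf{D})$ and set $T=\mathrm{MST}(V;\mathbf{D})$. 2. Identify the set of internal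 nodes of $\mathrm{MST}(V;\mathbf{D})$. 3. For each such internal node $i$ in turn, let $\mathrm{nbd}[i;T]$ be its closed neighborhood in the current $T$ and let $S=\mathrm{RG}(\mathrm{nbd}[i;T],\mathbf{D})$ be the output of RG with $\mathrm{nbd}[i;T]$ as the set of input nodes (distances to hidden nodes introduced by earlier RG calls are obtained from known distances by additivity). 4. Replace the subtree of $T$ over $\mathrm{nbd}[i;T]$ by $S$; call the new tree $T$. 5. Repeat steps 3-4 until all internal nodes have been operated on.
   Formalization: Discrete models are required to factorize along the tree, since the local Markov property alone need not give additive distances when p has zeros; ties in the minimum spanning tree are broken by node names, since an arbitrary minimizer can make CLRG fail; the time bound and |J|<m are for m≥2. *)

theory Defs
  imports
    "HOL-Probability.Probability"
    "HOL-Library.While_Combinator"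
    "HOL-Library.Monad_Syntax"
    "Jordan_Normal_Form.Determinant"
begin

hide_const (open) Finite_Cartesian_Product.mat Determinants.det

section \<open>Latent trees\<close>

text \<open>Nodes are natural numbers; an undirected edge is a two-element set of nodes.\<close>

type_synonym edge_set = "nat set set"

definition adjacent :: "edge_set \<Rightarrow> nat rel" where
  "adjacent E = {(a, b). {a, b} \<in> E}"

definition tree :: "nat set \<Rightarrow> edge_set \<Rightarrow> bool" where
  "tree W E \<longleftrightarrow> finite W \<and> W \<noteq> {} \<and> (\<forall>e\<in>E. \<exists>a\<in>W. \<exists>b\<in>W. a \<noteq> b \<and> e = {a, b}) \<and>
     (\<forall>a\<in>W. \<forall>b\<in>W. (a, b) \<in> (adjacent E)\<^sup>*) \<and>
     \<not> (\<exists>c. length c \<ge> 3 \<and> distinct c \<and> successively (\<lambda>a b. {a, b} \<in> E) c \<and>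
          {last c, hd c} \<in> E)"

definition neighbours :: "edge_set \<Rightarrow> nat \<Rightarrow> nat set" where
  "neighbours E i = {j. {i, j} \<in> E}"

definition degree :: "edge_set \<Rightarrow> nat \<Rightarrow> nat" where
  "degree E i = card (neighbours E i)"

definition leaves :: "nat set \<Rightarrow> edge_set \<Rightarrow> nat set" where
  "leaves W E = {i \<in> W. degree E i = 1}"

definition max_degree :: "nat set \<Rightarrow> edge_set \<Rightarrow> nat" where
  "max_degree W E = Max (degree E ` W)"

definition latent_tree :: "nat set \<Rightarrow> nat set \<Rightarrow> edge_set \<Rightarrow> bool" where
  "latent_tree V H E \<longleftrightarrow> V \<inter> H = {} \<and> tree (V \<union> H) E"

definition minimal_latent_tree :: "nat set \<Rightarrow> nat set \<Rightarrow> edge_set \<Rightarrow> bool" where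
  "minimal_latent_tree V H E \<longleftrightarrow> latent_tree V H E \<and> (\<forall>h\<in>H. degree E h \<ge> 3)"

text \<open>Equality of latent trees over the observed nodes \<open>V\<close>, up to the names of hidden nodes.\<close>

definition same_latent_tree ::
    "nat set \<Rightarrow> nat set \<Rightarrow> edge_set \<Rightarrow> nat set \<Rightarrow> edge_set \<Rightarrow> bool" where
  "same_latent_tree V W E W' E' \<longleftrightarrow>
     (\<exists>f. bij_betw f W W' \<and> (\<forall>v\<in>V. f v = v) \<and> E' = (\<lambda>e. f ` e) ` E)"


section \<open>Tree-structured graphical models\<close>

text \<open>The distribution \<open>p\<close> of a real random vector indexed by \<open>W\<close> is a probability measure on
  \<open>\<Pi>\<^sub>M i\<in>W. borel\<close>; the variables are the coordinates. The finite alphabet \<open>{1..K}\<close> is embedded in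
  the reals, so that both families of models share one notion of conditional independence.\<close>

type_synonym distribution = "(nat \<Rightarrow> real) measure"

definition coord_algebra :: "distribution \<Rightarrow> nat set \<Rightarrow> distribution" where
  "coord_algebra p C = vimage_algebra (space p) (\<lambda>x. restrict x C) (\<Pi>\<^sub>M i\<in>C. borel)"

definition cond_indep :: "distribution \<Rightarrow> nat set \<Rightarrow> nat set \<Rightarrow> nat set \<Rightarrow> bool" where
  "cond_indep p A B C \<longleftrightarrow>
     (\<forall>S\<in>sets (coord_algebra p A). \<forall>R\<in>sets (coord_algebra p B). AE x in p.
        real_cond_exp p (coord_algebra p C) (indicator (S \<inter> R)) x =
        real_cond_exp p (coord_algebra p C) (indicator S) x *
        real_cond_exp p (coord_algebra p C) (indicator R) x)"

definition markov_on :: "distribution \<Rightarrow> nat set \<Rightarrow> edge_set \<Rightarrow> bool" where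
  "markov_on p W E \<longleftrightarrow>
     (\<forall>i\<in>W. cond_indep p {i} (W - {i} - neighbours E i) (neighbours E i))"

text \<open>Zero-mean Gaussian with precision matrix \<open>Q\<close>; the constant \<open>c\<close> is determined by \<open>p\<close> being a
  probability measure.\<close>

definition gaussian :: "distribution \<Rightarrow> nat set \<Rightarrow> bool" where
  "gaussian p W \<longleftrightarrow> prob_space p \<and>
     (\<exists>Q c. (\<forall>i\<in>W. \<forall>j\<in>W. Q i j = Q j i) \<and>
        (\<forall>x. (\<exists>i\<in>W. x i \<noteq> 0) \<longrightarrow> (\<Sum>i\<in>W. \<Sum>j\<in>W. Q i j * x i * x j) > 0) \<and>
        p = density (\<Pi>\<^sub>M i\<in>W. lborel)
              (\<lambda>x. ennreal (c * exp (- (\<Sum>i\<in>W. \<Sum>j\<in>W. Q i j * x i * x j) / 2))))"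

definition mean :: "distribution \<Rightarrow> nat \<Rightarrow> real" where
  "mean p i = (LINT x|p. x i)"

definition cov :: "distribution \<Rightarrow> nat \<Rightarrow> nat \<Rightarrow> real" where
  "cov p i j = (LINT x|p. (x i - mean p i) * (x j - mean p j))"

definition correlation :: "distribution \<Rightarrow> nat \<Rightarrow> nat \<Rightarrow> real" where
  "correlation p i j = cov p i j / sqrt (cov p i i * cov p j j)"

definition gaussian_dist :: "distribution \<Rightarrow> nat \<Rightarrow> nat \<Rightarrow> real" where
  "gaussian_dist p i j = - ln \<bar>correlation p i j\<bar>"

definition discrete :: "nat \<Rightarrow> distribution \<Rightarrow> nat set \<Rightarrow> bool" where
  "discrete K p W \<longleftrightarrow> prob_space p \<and> sets p = sets (\<Pi>\<^sub>M i\<in>W. borel) \<and>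
     (AE x in p. \<forall>i\<in>W. x i \<in> real ` {1..K})"

text \<open>Row and column \<open>a\<close> of the following matrices belong to the letter \<open>a + 1\<close>.\<close>

definition joint_matrix :: "nat \<Rightarrow> distribution \<Rightarrow> nat \<Rightarrow> nat \<Rightarrow> real mat" where
  "joint_matrix K p i j = Matrix.mat K K (\<lambda>(a, b).
     measure p {x \<in> space p. x i = real (a + 1) \<and> x j = real (b + 1)})"

definition marginal_matrix :: "nat \<Rightarrow> distribution \<Rightarrow> nat \<Rightarrow> real mat" where
  "marginal_matrix K p i = Matrix.mat K K (\<lambda>(a, b).
     if a = b then measure p {x \<in> space p. x i = real (a + 1)} else 0)"

definition discrete_dist :: "nat \<Rightarrow> distribution \<Rightarrow> nat \<Rightarrow> nat \<Rightarrow> real" where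
  "discrete_dist K p i j =
     - ln (\<bar>Determinant.det (joint_matrix K p i j)\<bar> /
           sqrt (Determinant.det (marginal_matrix K p i) * Determinant.det (marginal_matrix K p j)))"

definition prob_at :: "distribution \<Rightarrow> nat set \<Rightarrow> (nat \<Rightarrow> nat) \<Rightarrow> real" where
  "prob_at p A a = measure p {x \<in> space p. \<forall>i\<in>A. x i = real (a i)}"

text \<open>Factorization along a tree,
  \<open>p(a) = \<Prod>\<^sub>i p(a\<^sub>i) \<cdot> \<Prod>\<^sub>i\<^sub>j p(a\<^sub>i, a\<^sub>j) / (p(a\<^sub>i) p(a\<^sub>j))\<close>. A quotient \<open>0 / 0\<close> is harmless: it only occurs
  when some \<open>p(a\<^sub>i)\<close> vanishes, and then both sides are \<open>0\<close>. If all marginals are positive,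
  this entails the Markov property above; the converse may fail when \<open>p\<close> has zeros.\<close>

definition factorizes :: "nat \<Rightarrow> distribution \<Rightarrow> nat set \<Rightarrow> edge_set \<Rightarrow> bool" where
  "factorizes K p W E \<longleftrightarrow> (\<forall>a\<in>W \<rightarrow> {1..K}.
     prob_at p W a =
       (\<Prod>i\<in>W. prob_at p {i} a) * (\<Prod>e\<in>E. prob_at p e a / (\<Prod>i\<in>e. prob_at p {i} a)))"

text \<open>\<open>\<delta>\<close> is the information distance of the model \<open>p\<close>. For Gaussian models whose edges satisfy
  \<open>0 < \<delta> i j\<close>, the factorization along the tree is a consequence of the Markov property.\<close>

definition tree_model ::
    "distribution \<Rightarrow> nat set \<Rightarrow> edge_set \<Rightarrow> (nat \<Rightarrow> nat \<Rightarrow> real) \<Rightarrow> bool" where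
  "tree_model p W E \<delta> \<longleftrightarrow> markov_on p W E \<and>
     (gaussian p W \<and> \<delta> = gaussian_dist p \<or>
      (\<exists>K. discrete K p W \<and> factorizes K p W E \<and> \<delta> = discrete_dist K p))"


section \<open>Minimum spanning trees\<close>

text \<open>The weight is only used with symmetric \<open>d\<close>.\<close>

definition weight :: "(nat \<Rightarrow> nat \<Rightarrow> real) \<Rightarrow> edge_set \<Rightarrow> real" where
  "weight d E = (\<Sum>e\<in>E. d (Min e) (Max e))"

definition is_mst :: "nat set \<Rightarrow> (nat \<Rightarrow> nat \<Rightarrow> real) \<Rightarrow> edge_set \<Rightarrow> bool" where
  "is_mst V d M \<longleftrightarrow> tree V M \<and> (\<forall>M'. tree V M' \<longrightarrow> weight d M \<le> weight d M')"


section \<open>Programs with running time\<close>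

text \<open>Unit-cost model: exact real arithmetic and comparison, arithmetic and comparison of node
  names, reading or writing an array (a function on nodes) and building or inspecting a list
  cell each take constant time. A bounded number of these may occur between two uses of \<open>ret\<close>,
  each of which costs one unit; everything that traverses a list is written with the combinators
  below. \<open>Diverge\<close> is the outcome of a nonterminating loop.\<close>

datatype 'a tm = Diverge | Result 'a nat

definition ret :: "'a \<Rightarrow> 'a tm" where
  "ret x = Result x 1"

fun bind_tm :: "'a tm \<Rightarrow> ('a \<Rightarrow> 'b tm) \<Rightarrow> 'b tm" where
  "bind_tm Diverge f = Diverge"
| "bind_tm (Result x t) f = (case f x of Diverge \<Rightarrow> Diverge | Result y t' \<Rightarrow> Result y (t + t'))"

adhoc_overloading Monad_Syntax.bind \<rightleftharpoons> bind_tm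

primrec map_tm :: "('a \<Rightarrow> 'b tm) \<Rightarrow> 'a list \<Rightarrow> 'b list tm" where
  "map_tm f [] = ret []"
| "map_tm f (x # xs) = do { y \<leftarrow> f x; ys \<leftarrow> map_tm f xs; ret (y # ys) }"

primrec filter_tm :: "('a \<Rightarrow> bool tm) \<Rightarrow> 'a list \<Rightarrow> 'a list tm" where
  "filter_tm P [] = ret []"
| "filter_tm P (x # xs) =
     do { b \<leftarrow> P x; ys \<leftarrow> filter_tm P xs; ret (if b then x # ys else ys) }"

primrec all_tm :: "('a \<Rightarrow> bool tm) \<Rightarrow> 'a list \<Rightarrow> bool tm" where
  "all_tm P [] = ret True"
| "all_tm P (x # xs) = do { b \<leftarrow> P x; if b then all_tm P xs else ret False }"

primrec ex_tm :: "('a \<Rightarrow> bool tm) \<Rightarrow> 'a list \<Rightarrow> bool tm" where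
  "ex_tm P [] = ret False"
| "ex_tm P (x # xs) = do { b \<leftarrow> P x; if b then ret True else ex_tm P xs }"

primrec fold_tm :: "('a \<Rightarrow> 's \<Rightarrow> 's tm) \<Rightarrow> 'a list \<Rightarrow> 's \<Rightarrow> 's tm" where
  "fold_tm f [] s = ret s"
| "fold_tm f (x # xs) s = do { s' \<leftarrow> f x s; fold_tm f xs s' }"

primrec append_tm :: "'a list \<Rightarrow> 'a list \<Rightarrow> 'a list tm" where
  "append_tm [] ys = ret ys"
| "append_tm (x # xs) ys = do { zs \<leftarrow> append_tm xs ys; ret (x # zs) }"

definition while_tm :: "('s \<Rightarrow> bool) \<Rightarrow> ('s \<Rightarrow> 's tm) \<Rightarrow> 's \<Rightarrow> 's tm" where
  "while_tm b c s =
     (case while_option (\<lambda>r. case r of Diverge \<Rightarrow> False | Result s _ \<Rightarrow> b s)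
             (\<lambda>r. bind_tm r c) (ret s) of
        None \<Rightarrow> Diverge
      | Some r \<Rightarrow> r)"


section \<open>Construction of the minimum spanning tree\<close>

type_synonym edge_list = "(nat \<times> nat) list"
type_synonym dist = "nat \<Rightarrow> nat \<Rightarrow> real"

definition edges :: "edge_list \<Rightarrow> edge_set" where
  "edges T = {{a, b} | a b. (a, b) \<in> set T}"

text \<open>Equally long edges are compared by their node names. Without a rule for ties the
  minimum spanning tree is not unique and an unfortunate choice defeats the algorithm: for a star
  with one hidden node, five observed leaves and equal edge lengths, every tree on the observed
  nodes is minimal, and starting from the path \<open>1-2-3-4-5\<close> with node 3 processed last, two hidden
  nodes are introduced.\<close>

definition closer :: "dist \<Rightarrow> nat \<times> nat \<Rightarrow> nat \<times> nat \<Rightarrow> bool" where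
  "closer d = (\<lambda>(a, b) (a', b').
     d a b < d a' b' \<or>
     d a b = d a' b' \<and> (max a b < max a' b' \<or> max a b = max a' b' \<and> min a b < min a' b'))"

text \<open>Prim's algorithm. The list \<open>near\<close> holds, for each node \<open>v\<close> that is not yet in the tree, the
  pair of \<open>v\<close> and its closest node in the tree.\<close>

definition prim_step :: "dist \<Rightarrow> edge_list \<times> edge_list \<Rightarrow> (edge_list \<times> edge_list) tm" where
  "prim_step d = (\<lambda>(M, near).
     case near of
       [] \<Rightarrow> ret (M, [])
     | e # es \<Rightarrow> do {
         (v, u) \<leftarrow> fold_tm (\<lambda>f g. ret (if closer d f g then f else g)) es e;
         near1 \<leftarrow> filter_tm (\<lambda>(w, x). ret (w \<noteq> v)) near;
         near2 \<leftarrow> map_tm (\<lambda>(w, x). ret (w, if closer d (w, v) (w, x) then v else x)) near1;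
         ret ((v, u) # M, near2)
       })"

definition mst :: "nat list \<Rightarrow> dist \<Rightarrow> edge_list tm" where
  "mst vs d =
     (case vs of
       [] \<Rightarrow> ret []
     | r # rest \<Rightarrow> do {
         near \<leftarrow> map_tm (\<lambda>v. ret (v, r)) rest;
         (M, near') \<leftarrow> fold_tm (\<lambda>_. prim_step d) rest ([], near);
         ret M
       })"


section \<open>Recursive grouping\<close>

definition \<Phi> :: "dist \<Rightarrow> nat \<Rightarrow> nat \<Rightarrow> nat \<Rightarrow> real" where
  "\<Phi> d i j k = d i k - d j k"

text \<open>Is \<open>i\<close> a leaf with parent \<open>j\<close>? (Since \<open>\<Phi> d j i k = - \<Phi> d i j k\<close>, exchanging \<open>i\<close> and \<open>j\<close> gives
  the test for \<open>- d i j\<close>.)\<close>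

definition leaf_of :: "dist \<Rightarrow> nat list \<Rightarrow> nat \<Rightarrow> nat \<Rightarrow> bool tm" where
  "leaf_of d Y i j = all_tm (\<lambda>k. ret (k = i \<or> k = j \<or> \<Phi> d i j k = d i j)) Y"

definition leaf_siblings :: "dist \<Rightarrow> nat list \<Rightarrow> nat \<Rightarrow> nat \<Rightarrow> bool tm" where
  "leaf_siblings d Y i j = do {
     ks \<leftarrow> filter_tm (\<lambda>k. ret (k \<noteq> i \<and> k \<noteq> j)) Y;
     case ks of
       [] \<Rightarrow> ret False
     | k\<^sub>0 # _ \<Rightarrow> do {
         const \<leftarrow> all_tm (\<lambda>k. ret (\<Phi> d i j k = \<Phi> d i j k\<^sub>0)) ks;
         ret (const \<and> \<Phi> d i j k\<^sub>0 \<noteq> d i j \<and> \<Phi> d i j k\<^sub>0 \<noteq> - d i j)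
       }
   }"

definition related :: "dist \<Rightarrow> nat list \<Rightarrow> nat \<Rightarrow> nat \<Rightarrow> bool tm" where
  "related d Y i j = do {
     a \<leftarrow> leaf_of d Y i j;
     b \<leftarrow> leaf_of d Y j i;
     c \<leftarrow> leaf_siblings d Y i j;
     ret (a \<or> b \<or> c)
   }"

text \<open>The partition is built by inserting each node into the first block to all of whose members
  it is related. Whenever a coarsest partition into blocks of pairwise related nodes exists, this
  is the result; see \<open>grouping_coarsest\<close> below.\<close>

primrec insert_block :: "(nat \<Rightarrow> nat \<Rightarrow> bool tm) \<Rightarrow> nat \<Rightarrow> nat list list \<Rightarrow> nat list list tm" where
  "insert_block R x [] = ret [[x]]"
| "insert_block R x (B # Bs) = do {
     ok \<leftarrow> all_tm (R x) B;
     if ok then ret ((x # B) # Bs)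
     else do { Bs' \<leftarrow> insert_block R x Bs; ret (B # Bs') }
   }"

definition grouping :: "(nat \<Rightarrow> nat \<Rightarrow> bool tm) \<Rightarrow> nat list \<Rightarrow> nat list list tm" where
  "grouping R Y = fold_tm (insert_block R) Y []"

text \<open>Treatment of one block. \<open>kept\<close> collects the old nodes that stay active, \<open>hs\<close> the new hidden nodes
  together with the lists of their children, \<open>T\<close> the edges found so far, and \<open>n\<close> is the next
  fresh node name.\<close>

definition join_block ::
    "dist \<Rightarrow> nat list \<Rightarrow> nat list \<Rightarrow> nat list \<times> (nat \<times> nat list) list \<times> edge_list \<times> nat
      \<Rightarrow> (nat list \<times> (nat \<times> nat list) list \<times> edge_list \<times> nat) tm" where
  "join_block d Y B = (\<lambda>(kept, hs, T, n).
     case B of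
       [] \<Rightarrow> ret (kept, hs, T, n)
     | [y] \<Rightarrow> ret (y # kept, hs, T, n)
     | _ \<Rightarrow> do {
         parents \<leftarrow>
           filter_tm (\<lambda>u. ex_tm (\<lambda>i. if i = u then ret False else leaf_of d Y i u) B) B;
         case parents of
           u # _ \<Rightarrow> do {
             T' \<leftarrow> fold_tm (\<lambda>i T. ret (if i = u then T else (u, i) # T)) B T;
             ret (u # kept, hs, T', n)
           }
         | [] \<Rightarrow> do {
             T' \<leftarrow> fold_tm (\<lambda>i T. ret ((n, i) # T)) B T;
             ret (kept, (n, B) # hs, T', Suc n)
           }
       })"

definition set_dist :: "dist \<Rightarrow> nat \<Rightarrow> nat \<Rightarrow> real \<Rightarrow> dist" where
  "set_dist d a b x = d(a := (d a)(b := x), b := ((d(a := (d a)(b := x))) b)(a := x))"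

text \<open>Distances between a new hidden node \<open>h\<close> and its children \<open>C\<close>.\<close>

definition child_dists :: "nat list \<Rightarrow> nat \<times> nat list \<Rightarrow> dist \<Rightarrow> dist tm" where
  "child_dists Y = (\<lambda>(h, C). fold_tm (\<lambda>i d. do {
     js \<leftarrow> filter_tm (\<lambda>j. ret (j \<noteq> i)) C;
     ks \<leftarrow> filter_tm (\<lambda>k. ret (k \<noteq> i \<and> k \<noteq> hd js)) Y;
     ret (set_dist d i h ((d i (hd js) + \<Phi> d i (hd js) (hd ks)) / 2))
   }) C)"

text \<open>Distances between a new hidden node \<open>h\<close> and the other active nodes: first the old ones, then
  the other new hidden nodes \<open>l\<close> with children \<open>C'\<close>.\<close>

definition other_dists ::
    "nat list \<Rightarrow> (nat \<times> nat list) list \<Rightarrow> nat \<times> nat list \<Rightarrow> dist \<Rightarrow> dist tm" where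
  "other_dists kept hs = (\<lambda>(h, C) d. do {
     d' \<leftarrow> fold_tm (\<lambda>l d. ret (set_dist d h l (d (hd C) l - d (hd C) h))) kept d;
     fold_tm (\<lambda>(l, C') d. ret (if l = h then d
       else set_dist d h l (d (hd C) (hd C') - d (hd C) h - d l (hd C')))) hs d'
   })"

text \<open>State of recursive grouping: active nodes, edges found, distances, next fresh node name, and
  the hidden nodes introduced (in this order), each with two of its children.\<close>

type_synonym rg_state = "nat list \<times> edge_list \<times> dist \<times> nat \<times> (nat \<times> nat \<times> nat) list"

definition rg_step :: "rg_state \<Rightarrow> rg_state tm" where
  "rg_step = (\<lambda>(Y, T, d, n, new). do {
     Bs \<leftarrow> grouping (related d Y) Y;
     (kept, hs, T', n') \<leftarrow> fold_tm (join_block d Y) Bs ([], [], T, n);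
     d' \<leftarrow> fold_tm (child_dists Y) hs d;
     d'' \<leftarrow> fold_tm (other_dists kept hs) hs d';
     hidden \<leftarrow> map_tm (\<lambda>(h, C). ret h) hs;
     Y' \<leftarrow> append_tm kept hidden;
     witnesses \<leftarrow> map_tm (\<lambda>(h, C). ret (h, hd C, hd (tl C))) hs;
     new' \<leftarrow> append_tm new witnesses;
     ret (Y', T', d'', n', new')
   })"

definition rg ::
    "nat list \<Rightarrow> dist \<Rightarrow> nat \<Rightarrow> (edge_list \<times> dist \<times> nat \<times> (nat \<times> nat \<times> nat) list) tm" where
  "rg A d n = do {
     s \<leftarrow> rg_step (A, [], d, n, []);
     (Y, T, d', n', new) \<leftarrow> while_tm (\<lambda>(Y, _). length Y \<ge> 3) rg_step s;
     ret (case Y of [a, b] \<Rightarrow> (a, b) # T | _ \<Rightarrow> T, d', n', new)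
   }"


section \<open>CLRG\<close>

text \<open>Distances between a hidden node \<open>h\<close> introduced by recursive grouping and all nodes found so far.
  As \<open>h\<close> lies on the path between its children \<open>i\<close> and \<open>j\<close>, for every node \<open>x\<close> it also lies on the path
  from \<open>x\<close> to \<open>i\<close> or on the path from \<open>x\<close> to \<open>j\<close>; the corresponding difference is the distance
  \<open>d h x\<close> and the other difference is not larger.\<close>

definition extend_dist :: "nat \<times> nat \<times> nat \<Rightarrow> nat list \<times> dist \<Rightarrow> (nat list \<times> dist) tm" where
  "extend_dist = (\<lambda>(h, i, j) (N, d). do {
     d' \<leftarrow> fold_tm (\<lambda>x d. ret (set_dist d h x (max (d i x - d i h) (d j x - d j h)))) N
            (set_dist d h h 0);
     ret (h # N, d')
   })"

text \<open>As \<open>T\<close> is a tree, the edges of its subtree over the closed neighbourhood of \<open>i\<close> are the edges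
  at \<open>i\<close>.\<close>

definition clrg_step ::
    "nat \<Rightarrow> nat list \<times> edge_list \<times> dist \<times> nat \<Rightarrow> (nat list \<times> edge_list \<times> dist \<times> nat) tm" where
  "clrg_step i = (\<lambda>(N, T, d, n). do {
     incident \<leftarrow> filter_tm (\<lambda>(a, b). ret (a = i \<or> b = i)) T;
     nbs \<leftarrow> map_tm (\<lambda>(a, b). ret (if a = i then b else a)) incident;
     (S, d', n', new) \<leftarrow> rg (i # nbs) d n;
     rest \<leftarrow> filter_tm (\<lambda>(a, b). ret (a \<noteq> i \<and> b \<noteq> i)) T;
     T' \<leftarrow> append_tm S rest;
     (N', d'') \<leftarrow> fold_tm extend_dist new (N, d');
     ret (N', T', d'', n')
   })"

definition internal_nodes :: "nat list \<Rightarrow> edge_list \<Rightarrow> nat list tm" where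
  "internal_nodes vs T = filter_tm (\<lambda>v. do {
     incident \<leftarrow> filter_tm (\<lambda>(a, b). ret (a = v \<or> b = v)) T;
     ret (case incident of [_] \<Rightarrow> False | _ \<Rightarrow> True)
   }) vs"

text \<open>The list \<open>vs\<close> enumerates the observed nodes; the result consists of the nodes and the edges of
  the tree that is output.\<close>

definition clrg :: "nat list \<Rightarrow> dist \<Rightarrow> (nat list \<times> edge_list) tm" where
  "clrg vs d = do {
     M \<leftarrow> mst vs d;
     J \<leftarrow> internal_nodes vs M;
     n \<leftarrow> fold_tm (\<lambda>v n. ret (max n (Suc v))) vs 0;
     (N, T, d', n') \<leftarrow> fold_tm clrg_step J (vs, M, d, n);
     ret (N, T)
   }"


section \<open>The grouping is the coarsest partition\<close>

definition clique_partition :: "(nat \<Rightarrow> nat \<Rightarrow> bool) \<Rightarrow> nat set \<Rightarrow> nat set set \<Rightarrow> bool" where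
  "clique_partition Q Y P \<longleftrightarrow> partition_on Y P \<and> (\<forall>B\<in>P. \<forall>i\<in>B. \<forall>j\<in>B. i \<noteq> j \<longrightarrow> Q i j)"

definition coarsest_partition :: "(nat \<Rightarrow> nat \<Rightarrow> bool) \<Rightarrow> nat set \<Rightarrow> nat set set \<Rightarrow> bool" where
  "coarsest_partition Q Y P \<longleftrightarrow> clique_partition Q Y P \<and>
     (\<forall>P'. clique_partition Q Y P' \<longrightarrow> (\<forall>B'\<in>P'. \<exists>B\<in>P. B' \<subseteq> B))"

lemma all_tm_Result:
  assumes "\<And>y. y \<in> set B \<Longrightarrow> \<exists>t. f y = Result (Q y) t"
  shows "\<exists>t. all_tm f B = Result (\<forall>y\<in>set B. Q y) t"
  using assms
proof (induction B)
  case (Cons y B)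
  obtain t where "f y = Result (Q y) t" using Cons.prems by auto
  moreover obtain t' where "all_tm f B = Result (\<forall>y\<in>set B. Q y) t'" using Cons by auto
  ultimately show ?case by (cases "Q y") (auto simp: ret_def)
qed (simp add: ret_def)

lemma insert_block_Result:
  assumes "\<And>y. \<exists>t. R x y = Result (Q x y) t"
  shows "\<exists>Bs' t. insert_block R x Bs = Result Bs' t \<and>
     ((\<forall>b\<in>set Bs. \<not> (\<forall>y\<in>set b. Q x y)) \<and> Bs' = Bs @ [[x]] \<or>
      (\<exists>us b ws. Bs = us @ b # ws \<and> (\<forall>y\<in>set b. Q x y) \<and> Bs' = us @ (x # b) # ws))"
proof (induction Bs)
  case (Cons b Bs)
  obtain t where t: "all_tm (R x) b = Result (\<forall>y\<in>set b. Q x y) t"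
    using all_tm_Result[of b "R x" "Q x"] assms by blast
  show ?case
  proof (cases "\<forall>y\<in>set b. Q x y")
    case True
    have "insert_block R x (b # Bs) = Result ((x # b) # Bs) (t + 1)"
      using t True by (simp add: ret_def)
    then show ?thesis using True by (metis append_Nil)
  next
    case False
    from Cons obtain Bs' t' where r: "insert_block R x Bs = Result Bs' t'"
      and d: "(\<forall>b\<in>set Bs. \<not> (\<forall>y\<in>set b. Q x y)) \<and> Bs' = Bs @ [[x]] \<or>
      (\<exists>us b ws. Bs = us @ b # ws \<and> (\<forall>y\<in>set b. Q x y) \<and> Bs' = us @ (x # b) # ws)" by blast
    have e: "insert_block R x (b # Bs) = Result (b # Bs') (t + (t' + 1))"
      using t False r by (simp add: ret_def)
    from d show ?thesis
    proof
      assume "(\<forall>b\<in>set Bs. \<not> (\<forall>y\<in>set b. Q x y)) \<and> Bs' = Bs @ [[x]]"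
      then show ?thesis using e False by auto
    next
      assume "\<exists>us b ws. Bs = us @ b # ws \<and> (\<forall>y\<in>set b. Q x y) \<and> Bs' = us @ (x # b) # ws"
      then show ?thesis using e by (metis append_Cons)
    qed
  qed
qed (simp add: ret_def)

lemma coarsest_partition_iff:
  assumes P: "coarsest_partition Q Y P" and sym: "\<And>x y. x \<in> Y \<Longrightarrow> y \<in> Y \<Longrightarrow> Q x y = Q y x"
    and x: "x \<in> Y" "y \<in> Y" "x \<noteq> y"
  shows "Q x y \<longleftrightarrow> (\<exists>B\<in>P. x \<in> B \<and> y \<in> B)"
proof
  assume "Q x y"
  define P' where "P' = insert {x, y} ((\<lambda>z. {z}) ` (Y - {x, y}))"
  have "clique_partition Q Y P'"
    unfolding clique_partition_def
  proof
    show "partition_on Y P'"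
      using x unfolding P'_def partition_on_def disjoint_def by auto
    show "\<forall>B\<in>P'. \<forall>i\<in>B. \<forall>j\<in>B. i \<noteq> j \<longrightarrow> Q i j"
      using \<open>Q x y\<close> sym x unfolding P'_def by auto
  qed
  then have "\<forall>B'\<in>P'. \<exists>B\<in>P. B' \<subseteq> B" using P unfolding coarsest_partition_def by blast
  then show "\<exists>B\<in>P. x \<in> B \<and> y \<in> B" unfolding P'_def by auto
next
  assume "\<exists>B\<in>P. x \<in> B \<and> y \<in> B"
  then show "Q x y" using P x unfolding coarsest_partition_def clique_partition_def by blast
qed

lemma grouping_coarsest:
  assumes R: "\<And>x y. \<exists>t. R x y = Result (Q x y) t"
    and sym: "\<And>x y. x \<in> set Y \<Longrightarrow> y \<in> set Y \<Longrightarrow> Q x y = Q y x"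
    and "distinct Y" and P: "coarsest_partition Q (set Y) P"
  shows "\<exists>Bs t. grouping R Y = Result Bs t \<and> set ` set Bs = P"
proof -
  have part: "partition_on (set Y) P"
    using P unfolding coarsest_partition_def clique_partition_def by blast
  note iff = coarsest_partition_iff[OF P sym]
  define traces where "traces X = {B \<inter> X | B. B \<in> P} - {{}}" for X
  have step: "\<exists>Bs' t. fold_tm (insert_block R) zs Bs = Result Bs' t \<and>
      set ` set Bs' = traces (set Y) \<and> distinct (map set Bs')"
    if "X \<union> set zs = set Y" "X \<inter> set zs = {}" "distinct zs"
      "set ` set Bs = traces X" "distinct (map set Bs)" for X zs Bs
    using that
  proof (induction zs arbitrary: X Bs)
    case Nil
    then show ?case by (auto simp: ret_def)
  next
    case (Cons x zs)
    have xY: "x \<in> set Y" and xX: "x \<notin> X" and XY: "X \<subseteq> set Y" using Cons.prems by auto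
    obtain C where C: "C \<in> P" "x \<in> C" using part xY by (auto simp: partition_on_def)
    have uniq: "B = C" if "B \<in> P" "z \<in> B" "z \<in> C" for B z
      using part that C(1) by (auto simp: partition_on_def disjoint_def)
    have ok: "(\<forall>y\<in>B \<inter> X. Q x y) \<longleftrightarrow> B = C" if B: "B \<in> P" "B \<inter> X \<noteq> {}" for B
    proof
      assume a: "\<forall>y\<in>B \<inter> X. Q x y"
      obtain y where y: "y \<in> B" "y \<in> X" using B by auto
      then obtain B' where B': "B' \<in> P" "x \<in> B'" "y \<in> B'"
        using a iff[of x y] xY XY xX by blast
      then show "B = C" using part B(1) y(1) uniq[of B' x] C(2) uniq[of B y] by blast
    next
      assume "B = C"
      show "\<forall>y\<in>B \<inter> X. Q x y"
      proof
        fix y assume "y \<in> B \<inter> X"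
        then show "Q x y" using iff[of x y] xY XY xX C \<open>B = C\<close> by blast
      qed
    qed
    have blk: "\<exists>B\<in>P. set b = B \<inter> X \<and> B \<inter> X \<noteq> {}" if "b \<in> set Bs" for b
    proof -
      have "set b \<in> traces X" using Cons.prems(4) that by auto
      then show ?thesis unfolding traces_def by auto
    qed
    obtain Bs' t where ins: "insert_block R x Bs = Result Bs' t"
      and d: "(\<forall>b\<in>set Bs. \<not> (\<forall>y\<in>set b. Q x y)) \<and> Bs' = Bs @ [[x]] \<or>
        (\<exists>us b ws. Bs = us @ b # ws \<and> (\<forall>y\<in>set b. Q x y) \<and> Bs' = us @ (x # b) # ws)"
      using insert_block_Result[of R x Q Bs, OF R] by blast
    have tr: "traces (insert x X) = insert (insert x (C \<inter> X)) (traces X - {C \<inter> X})"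
    proof (intro equalityI subsetI)
      fix S assume "S \<in> traces (insert x X)"
      then obtain B where B: "B \<in> P" "S = B \<inter> insert x X" "S \<noteq> {}" unfolding traces_def by blast
      show "S \<in> insert (insert x (C \<inter> X)) (traces X - {C \<inter> X})"
      proof (cases "B = C")
        case False
        then have "x \<notin> B" using uniq[OF B(1) _ C(2)] by blast
        then have S: "S = B \<inter> X" using B(2) by blast
        have "S \<noteq> C \<inter> X" using S B(3) uniq[OF B(1)] False by blast
        then show ?thesis using S B(1,3) unfolding traces_def by auto
      next
        case True
        then have "S = insert x (C \<inter> X)" using B(2) C(2) by auto
        then show ?thesis by simp
      qed
    next
      fix S assume "S \<in> insert (insert x (C \<inter> X)) (traces X - {C \<inter> X})"
      then show "S \<in> traces (insert x X)"
      proof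
        assume "S = insert x (C \<inter> X)"
        then have "S = C \<inter> insert x X" "S \<noteq> {}" using C(2) by auto
        then show ?thesis using C(1) unfolding traces_def by blast
      next
        assume "S \<in> traces X - {C \<inter> X}"
        then obtain B where B: "B \<in> P" "S = B \<inter> X" "S \<noteq> {}" "B \<noteq> C"
          unfolding traces_def by blast
        then have "x \<notin> B" using uniq[OF B(1) _ C(2)] by blast
        then have "S = B \<inter> insert x X" using B by blast
        then show ?thesis using B unfolding traces_def by blast
      qed
    qed
    have new: "set ` set Bs' = traces (insert x X) \<and> distinct (map set Bs')"
      using d
    proof
      assume a: "(\<forall>b\<in>set Bs. \<not> (\<forall>y\<in>set b. Q x y)) \<and> Bs' = Bs @ [[x]]"
      have CX: "C \<inter> X = {}"
      proof (rule ccontr)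
        assume ne: "C \<inter> X \<noteq> {}"
        then have "C \<inter> X \<in> traces X" using C(1) unfolding traces_def by auto
        then have "C \<inter> X \<in> set ` set Bs" using Cons.prems(4) by simp
        then obtain b where "b \<in> set Bs" "set b = C \<inter> X" by auto
        then show False using a ok[OF C(1) ne] by blast
      qed
      have "{} \<notin> traces X" unfolding traces_def by blast
      then have "traces (insert x X) = insert {x} (traces X)" using tr CX by simp
      moreover have "{x} \<notin> traces X" using xX unfolding traces_def by auto
      moreover have "set ` set Bs' = insert {x} (set ` set Bs)"
        "distinct (map set Bs') \<longleftrightarrow> distinct (map set Bs) \<and> {x} \<notin> set ` set Bs"
        using a by auto
      ultimately show ?thesis using Cons.prems(4,5) by simp
    next
      assume "\<exists>us b ws. Bs = us @ b # ws \<and> (\<forall>y\<in>set b. Q x y) \<and> Bs' = us @ (x # b) # ws"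
      then obtain us b ws where b: "Bs = us @ b # ws" "\<forall>y\<in>set b. Q x y"
        "Bs' = us @ (x # b) # ws" by blast
      obtain B where B: "B \<in> P" "set b = B \<inter> X" "B \<inter> X \<noteq> {}" using blk[of b] b(1) by auto
      then have sb: "set b = C \<inter> X" using ok[OF B(1,3)] b(2) by blast
      have nb: "C \<inter> X \<notin> set ` (set us \<union> set ws)" using Cons.prems(5) b(1) sb by auto
      have nx: "insert x (C \<inter> X) \<notin> set ` (set us \<union> set ws)"
      proof
        assume "insert x (C \<inter> X) \<in> set ` (set us \<union> set ws)"
        then have "insert x (C \<inter> X) \<in> traces X" using Cons.prems(4) b(1) by auto
        then show False using xX unfolding traces_def by auto
      qed
      have "traces X = insert (C \<inter> X) (set ` (set us \<union> set ws))"
        using Cons.prems(4) b(1) sb by auto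
      then have "traces X - {C \<inter> X} = set ` (set us \<union> set ws)" using nb by blast
      then have "set ` set Bs' = traces (insert x X)" using tr b(3) sb by auto
      moreover have "distinct (map set Bs')" using Cons.prems(5) b(1,3) sb nx by auto
      ultimately show ?thesis by blast
    qed
    have "\<exists>Bs'' t. fold_tm (insert_block R) zs Bs' = Result Bs'' t \<and>
        set ` set Bs'' = traces (set Y) \<and> distinct (map set Bs'')"
      by (rule Cons.IH[of "insert x X"]) (use Cons.prems new in auto)
    then show ?case using ins by auto
  qed
  have "traces {} = {}" unfolding traces_def by blast
  then obtain Bs' t where "grouping R Y = Result Bs' t" "set ` set Bs' = traces (set Y)"
    using step[of "{}" Y "[]"] assms(3) unfolding grouping_def by auto
  moreover have "traces (set Y) = P"
  proof -
    have "B \<inter> set Y = B" if "B \<in> P" for B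
      using part that by (auto simp: partition_on_def)
    then have "(\<lambda>B. B \<inter> set Y) ` P = P" by simp
    moreover have "{} \<notin> P" using part by (simp add: partition_on_def)
    ultimately show ?thesis unfolding traces_def by (simp add: setcompr_eq_image)
  qed
  ultimately show ?thesis by blast
qed

end

theory Submission
  imports Defs
begin

text \<open>In both families of models the dependence between two nodes factors at every node on the path
  between them, so the information distances add up along paths.

  Let \<open>Sg x\<close> be the observed node closest to \<open>x\<close>, ties being broken by name. The fibres of \<open>Sg\<close> are
  subtrees of the latent tree, every edge that Prim's algorithm chooses joins two adjacent fibres, and
  hence the minimum spanning tree is the latent tree with all fibres contracted. Throughout CLRG, the
  current tree is the latent tree with the fibres of the unprocessed nodes contracted: the closed
  neighbourhood of \<open>v\<close> is the set of active nodes of a minimal latent tree, a copy of the fibre of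
  \<open>v\<close> with one leaf attached for each edge that leaves it, and recursive grouping recovers this tree.
  Only fibres of internal nodes contain hidden nodes.

  Each round of recursive grouping removes the outermost layer of the tree, so the number of rounds is
  bounded by the largest number of edges between \<open>v\<close> and a node of its local tree. The nodes on such a
  path which are at distance at most \<open>u\<close> from \<open>v\<close> number at most \<open>u / l + 1\<close>. The remaining ones
  are hidden nodes at distance more than \<open>u\<close> from every observed node; every branch at such a node
  contains an internal node of the spanning tree, and since it has three branches, there are altogether
  at most \<open>|J|\<close> of them. Hence the total number of rounds is linear in \<open>|J|\<close>, and a round on \<open>k\<close> active
  nodes takes time \<open>O(k\<^sup>3)\<close>.\<close>

text \<open>The program invents names for hidden nodes, so every state is described through a map
  \<open>\<sigma>\<close> from names to nodes of the true tree. The map is only extended, never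
  changed on names in use; edges and distances found earlier therefore keep their meaning. The
  invariants also fix the lengths of the edge lists: as a list is as long as the set it denotes, no
  edge occurs twice, and neighbourhoods have the size for which the time bound charges.

  The Gaussian case needs a detour. The Markov property concerns one variable at a time and is
  phrased with conditional expectations, while additivity needs zeros of the precision matrix. They
  are extracted by comparing two expressions for the conditional probability of
  \<open>X_i > 0\<close>. In the discrete case positive edge lengths provide nondegeneracy: they
  make all one-letter marginals positive, so that matrices of conditional probabilities can be
  formed.

  All quadratic costs are absorbed by the term with the logarithm, through
  \<open>ln 2 \<le> ln m\<close> for two or more nodes.\<close>

lemma finite_maximizer:
  fixes f :: "'a \<Rightarrow> real"
  assumes "finite S" "S \<noteq> {}"
  obtains y where "y \<in> S" "\<And>w. w \<in> S \<Longrightarrow> f w \<le> f y"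
proof -
  have "Max (f ` S) \<in> f ` S" using assms by (intro Max_in) auto
  then obtain y where "y \<in> S" "Max (f ` S) = f y" by auto
  then show ?thesis using that Max_ge[of "f ` S"] assms by auto
qed

section \<open>Tree metrics\<close>

text \<open>A tree with positive edge lengths is encoded by its distance function alone: every edge splits
  the nodes into two sides, and distances across the edge decompose. This avoids paths
  as explicit objects; ``\<open>y\<close> lies on the path from \<open>x\<close> to \<open>z\<close>'' reads \<open>d x z = d x y + d y z\<close>.\<close>

locale tree_metric =
  fixes W :: "nat set" and E :: edge_set and d :: dist
  assumes finite_W: "finite W" and W_ne: "W \<noteq> {}"
    and edge_nodes: "{x, y} \<in> E \<Longrightarrow> x \<in> W \<and> y \<in> W \<and> x \<noteq> y"
    and edge_pair: "e \<in> E \<Longrightarrow> \<exists>x y. e = {x, y}"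
    and conn: "x \<in> W \<Longrightarrow> y \<in> W \<Longrightarrow> (x, y) \<in> (adjacent E)\<^sup>*"
    and d_sym: "x \<in> W \<Longrightarrow> y \<in> W \<Longrightarrow> d x y = d y x"
    and d_refl: "x \<in> W \<Longrightarrow> d x x = 0"
    and d_pos: "x \<in> W \<Longrightarrow> y \<in> W \<Longrightarrow> x \<noteq> y \<Longrightarrow> 0 < d x y"
    and split: "{x, y} \<in> E \<Longrightarrow> z \<in> W \<Longrightarrow> d z y = d z x + d x y \<or> d z x = d z y + d y x"
    and cross: "{x, y} \<in> E \<Longrightarrow> a \<in> W \<Longrightarrow> b \<in> W \<Longrightarrow> d a y = d a x + d x y \<Longrightarrow>
      d b x = d b y + d y x \<Longrightarrow> d a b = d a x + d x y + d y b"
begin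

text \<open>The component of \<open>x\<close> after deletion of the edge \<open>{x, y}\<close>.
  Membership is one linear equation between distances, which is what the arithmetic steps below work
  with.\<close>

definition side :: "nat \<Rightarrow> nat \<Rightarrow> nat set" where
  "side x y = {z \<in> W. d z y = d z x + d x y}"

lemma d_nonneg: "x \<in> W \<Longrightarrow> y \<in> W \<Longrightarrow> 0 \<le> d x y"
  using d_pos[of x y] d_refl[of x] by (cases "x = y") auto

lemma edge_sym: "{x, y} \<in> E \<Longrightarrow> {y, x} \<in> E"
  by (simp add: insert_commute)

lemma edge_W: "{x, y} \<in> E \<Longrightarrow> x \<in> W" "{x, y} \<in> E \<Longrightarrow> y \<in> W" "{x, y} \<in> E \<Longrightarrow> x \<noteq> y"
  using edge_nodes by blast+

lemma edge_pos: "{x, y} \<in> E \<Longrightarrow> 0 < d x y"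
  using edge_W[of x y] d_pos by blast

lemma side_W: "z \<in> side x y \<Longrightarrow> z \<in> W"
  by (simp add: side_def)

lemma side_other:
  assumes "{x, y} \<in> E" "z \<in> W"
  shows "z \<notin> side x y \<longleftrightarrow> z \<in> side y x"
  using split[OF assms] edge_pos[OF assms(1)] edge_pos[OF edge_sym[OF assms(1)]] assms(2)
  unfolding side_def mem_Collect_eq by argo

lemma side_self: "{x, y} \<in> E \<Longrightarrow> x \<in> side x y"
  using edge_W[of x y] d_refl by (auto simp: side_def)

lemma side_cross:
  assumes "{x, y} \<in> E" "a \<in> side x y" "b \<in> side y x"
  shows "d a b = d a x + d x y + d y b"
  using assms cross[of x y a b] by (auto simp: side_def)

lemma side_between:
  assumes "{x, y} \<in> E" "a \<in> side x y" "b \<in> side y x"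
  shows "d a b = d a x + d x b" "d a b = d a y + d y b"
proof -
  have W: "x \<in> W" "y \<in> W" "b \<in> W" using edge_W[OF assms(1)] side_W[OF assms(3)] by blast+
  have "d b x = d b y + d y x" "d a y = d a x + d x y" using assms(2,3) by (auto simp: side_def)
  then show "d a b = d a x + d x b" "d a b = d a y + d y b"
    using side_cross[OF assms] d_sym[OF W(3,1)] d_sym[OF W(3,2)] d_sym[OF W(1,2)] by linarith+
qed

text \<open>The crossing edge \<open>{a, b}\<close> has length \<open>d a x + d x y + d y b\<close>;
  applying \<open>split\<close> for it at \<open>x\<close> and at \<open>y\<close> leaves only the
  alternative in which \<open>d a x\<close> and \<open>d y b\<close> vanish. So an edge is the only
  bridge between its two sides.\<close>

lemma crossing:
  assumes e: "{x, y} \<in> E" and f: "{a, b} \<in> E" and a: "a \<in> side x y" and b: "b \<in> side y x"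
  shows "a = x \<and> b = y"
proof -
  have W: "a \<in> W" "b \<in> W" "x \<in> W" "y \<in> W" using edge_W e f by blast+
  have c: "d a b = d a x + d x y + d y b" using side_cross[OF e a b] .
  have pos: "0 < d x y" "0 \<le> d a x" "0 \<le> d y b" using edge_pos e W d_nonneg by blast+
  have s: "d x b = d b x" "d x a = d a x" "d y b = d b y" "d y x = d x y" "d a b = d b a" "d y a = d a y"
    using d_sym W by blast+
  have ab: "d b x = d b y + d y x" "d a y = d a x + d x y" using a b by (auto simp: side_def)
  have 1: "d x b = d x a + d a b \<Longrightarrow> d a x = 0" "\<not> d x a = d x b + d b a"
    using ab c pos s by linarith+
  have 2: "d y a = d y b + d b a \<Longrightarrow> d y b = 0" "\<not> d y b = d y a + d a b"
    using ab c pos s by linarith+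
  have "d a x = 0" by (rule 1(1)) (use 1(2) split[OF f W(3)] in argo)
  moreover have "d y b = 0" by (rule 2(1)) (use 2(2) split[OF edge_sym[OF f] W(4)] in argo)
  ultimately show ?thesis using d_pos[OF W(1) W(3)] d_pos[OF W(4) W(2)] by force
qed

lemma side_step:
  assumes "{x, y} \<in> E" "{a, b} \<in> E" "a \<in> side x y" "b \<notin> side x y"
  shows "a = x \<and> b = y"
  using assms crossing[of x y a b] side_other[of x y b] edge_W[of a b] by blast

text \<open>Stands for the first edge of the path from \<open>x\<close> to \<open>y\<close>. By
  \<open>side_step\<close> the node \<open>x\<close> together with its branches is closed under
  adjacency, hence contains all that is reachable from \<open>x\<close>.\<close>

lemma next_node:
  assumes "x \<in> W" "y \<in> W" "x \<noteq> y"
  obtains z where "{x, z} \<in> E" "y \<in> side z x"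
proof -
  define S where "S = insert x (\<Union>z\<in>neighbours E x. side z x)"
  have "(x, y) \<in> (adjacent E)\<^sup>*" using conn assms by blast
  then have "y \<in> S"
  proof (induction rule: rtrancl_induct)
    case base
    then show ?case by (simp add: S_def)
  next
    case (step a b)
    have ab: "{a, b} \<in> E" using step by (simp add: adjacent_def)
    show ?case
    proof (cases "a = x")
      case True
      then show ?thesis using ab side_self[OF edge_sym, of x b] by (auto simp: S_def neighbours_def)
    next
      case False
      then obtain z where z: "{x, z} \<in> E" "a \<in> side z x"
        using step by (auto simp: S_def neighbours_def)
      then show ?thesis
        using side_step[OF edge_sym, of x z a b] ab by (auto simp: S_def neighbours_def)
    qed
  qed
  then show ?thesis using that assms by (auto simp: S_def neighbours_def)
qed

lemma next_dist:
  assumes "{x, z} \<in> E" "y \<in> side z x"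
  shows "d x y = d x z + d z y"
proof -
  have W: "x \<in> W" "z \<in> W" "y \<in> W" using edge_W[OF assms(1)] side_W[OF assms(2)] by blast+
  have "d y x = d y z + d z x" using assms(2) by (simp add: side_def)
  then show ?thesis using d_sym[OF W(1,3)] d_sym[OF W(3,2)] d_sym[OF W(1,2)] by linarith
qed

text \<open>Induction along the path from \<open>x\<close> to \<open>y\<close>. Real distances are
  not well founded, so the measure is the number of nodes strictly closer to
  \<open>y\<close>.\<close>

lemma path_induct [consumes 2, case_names refl step]:
  assumes "x \<in> W" "y \<in> W" "P y"
    and "\<And>x z. x \<in> W \<Longrightarrow> x \<noteq> y \<Longrightarrow> {x, z} \<in> E \<Longrightarrow> y \<in> side z x \<Longrightarrow> P z \<Longrightarrow> P x"
  shows "P x"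
  using assms(1)
proof (induction "card {w \<in> W. d w y < d x y}" arbitrary: x rule: less_induct)
  case less
  show ?case
  proof (cases "x = y")
    case False
    then obtain z where z: "{x, z} \<in> E" "y \<in> side z x" using next_node less assms(2) by metis
    have lt: "d z y < d x y" using next_dist[OF z] edge_pos[OF z(1)] by simp
    have zW: "z \<in> W" using edge_W z by blast
    have "{w \<in> W. d w y < d z y} \<subset> {w \<in> W. d w y < d x y}" using lt zW by auto
    then have "card {w \<in> W. d w y < d z y} < card {w \<in> W. d w y < d x y}"
      using finite_W by (simp add: psubset_card_mono)
    then have "P z" using less zW by blast
    then show ?thesis using assms(4) less False z by blast
  qed (use assms in auto)
qed

text \<open>With two different branches towards \<open>y\<close>, the way from \<open>z'\<close> to
  \<open>y\<close> would lead back through \<open>x\<close>, while the way from \<open>x\<close> to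
  \<open>y\<close> leads through \<open>z'\<close>; adding up forces
  \<open>d x z' = 0\<close>.\<close>

lemma next_unique:
  assumes "{x, z} \<in> E" "{x, z'} \<in> E" "y \<in> side z x" "y \<in> side z' x"
  shows "z = z'"
proof (rule ccontr)
  assume "z \<noteq> z'"
  then have "z' \<in> side x z"
    using side_step[of x z x z'] side_self[of x z] assms by blast
  from side_cross[OF assms(1) this assms(3)] have "d z' y = d z' x + d x z + d z y" .
  moreover have "d x y = d x z + d z y" "d x y = d x z' + d z' y"
    using next_dist assms by blast+
  moreover have "d z' x = d x z'" "0 < d x z'" using d_sym edge_W edge_pos assms by blast+
  ultimately show False by linarith
qed

lemma other_branch:
  assumes "{x, z} \<in> E" "{x, z'} \<in> E" "z \<noteq> z'" "y \<in> side z' x"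
  shows "y \<in> side x z"
  using next_unique[of x z z' y] assms side_other[of z x y] side_W[of y z' x] edge_sym by blast

lemma branches_between:
  assumes "{x, z} \<in> E" "{x, z'} \<in> E" "z \<noteq> z'" "a \<in> side z x" "b \<in> side z' x"
  shows "d a b = d a x + d x b"
  using side_between(2)[of z x a b] other_branch[of x z z' b] assms edge_sym by blast

text \<open>Not an axiom of the locale. Follow the path from \<open>a\<close> to \<open>b\<close>:
  while \<open>c\<close> lies in the branch ahead, both paths share the next edge; once
  \<open>c\<close> lies behind, \<open>side_cross\<close> gives the exact length of the path from
  \<open>c\<close> to \<open>b\<close>.\<close>

lemma triangle:
  assumes "a \<in> W" "b \<in> W" "c \<in> W"
  shows "d a b \<le> d a c + d c b"
  using assms(1,2)
proof (induction a rule: path_induct)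
  case refl
  then show ?case using assms d_refl d_nonneg[of b c] d_nonneg[of c b] by simp
next
  case (step x z)
  have n: "d x b = d x z + d z b" using next_dist step by blast
  have W: "x \<in> W" "z \<in> W" using step edge_W by blast+
  consider "c \<in> side z x" | "c \<in> side x z" using side_other[of x z c] step assms by blast
  then show ?case
  proof cases
    case 1
    then have "d x c = d x z + d z c" using next_dist[of x z c] step by simp
    then show ?thesis using n step by simp
  next
    case 2
    have "d c b = d c x + d x z + d z b" using side_cross[of x z c b] step 2 by blast
    then show ?thesis using n d_nonneg[of c x] d_nonneg[of x c] W assms by simp
  qed
qed

text \<open>Walk from \<open>x\<close> to \<open>y\<close> and stop at the first edge that leaves
  \<open>S\<close>; the length equation records that this edge lies on the path. Later choices of
  \<open>S\<close> include preimages under the surrogate map and the complement of \<open>V\<close>,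
  which need not be connected.\<close>

lemma cut_edge:
  assumes "x \<in> W" "y \<in> W" "x \<in> S" "y \<notin> S"
  obtains a b where "{a, b} \<in> E" "a \<in> S" "b \<notin> S" "d x y = d x a + d a b + d b y"
proof -
  have "x \<in> S \<longrightarrow> (\<exists>a b. {a, b} \<in> E \<and> a \<in> S \<and> b \<notin> S \<and> d x y = d x a + d a b + d b y)"
    using assms(1,2)
  proof (induction x rule: path_induct)
    case refl
    then show ?case using assms by simp
  next
    case (step x z)
    have n: "d x y = d x z + d z y" using next_dist step by blast
    show ?case
    proof
      assume "x \<in> S"
      show "\<exists>a b. {a, b} \<in> E \<and> a \<in> S \<and> b \<notin> S \<and> d x y = d x a + d a b + d b y"
      proof (cases "z \<in> S")
        case False
        then show ?thesis using \<open>x \<in> S\<close> n step d_refl by (intro exI[of _ x] exI[of _ z]) auto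
      next
        case True
        then obtain a b where ab: "{a, b} \<in> E" "a \<in> S" "b \<notin> S" "d z y = d z a + d a b + d b y"
          using step by blast
        have W: "a \<in> W" "b \<in> W" "z \<in> W" using ab step edge_W by blast+
        have "d x y = d x a + d a b + d b y"
          using n ab triangle[of x a z] triangle[of x y a] triangle[of a y b] W step assms by linarith
        then show ?thesis using ab by blast
      qed
    qed
  qed
  then show ?thesis using that assms by blast
qed

text \<open>The branch at \<open>y\<close> that contains \<open>v\<close> cannot contain both
  \<open>x\<close> and \<open>z\<close>, since its first node would be a shortcut between them. This
  is why two children suffice to place a new hidden node relative to all others.\<close>

lemma between_fork:
  assumes "x \<in> W" "y \<in> W" "z \<in> W" "v \<in> W" "d x z = d x y + d y z"
  shows "d x v = d x y + d y v \<or> d z v = d z y + d y v"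
proof (cases "y = v")
  case True
  then show ?thesis using d_refl assms by simp
next
  case False
  then obtain w where w: "{y, w} \<in> E" "v \<in> side w y" using next_node assms by metis
  show ?thesis
  proof (cases "x \<in> side y w \<or> z \<in> side y w")
    case True
    then show ?thesis using side_between(1)[OF w(1)] w by blast
  next
    case F: False
    then have "x \<in> side w y" "z \<in> side w y" using side_other[OF w(1)] assms by blast+
    then have "d y x = d y w + d w x" "d y z = d y w + d w z" using next_dist w by blast+
    moreover have "0 < d y w" "w \<in> W" using edge_pos edge_W w by blast+
    moreover have "d y x = d x y" "d w x = d x w" using d_sym assms edge_W[OF w(1)] by blast+
    ultimately show ?thesis using triangle[of x z w] assms by linarith
  qed
qed

lemma finite_E: "finite E"
proof -
  have "E \<subseteq> Pow W" using edge_pair edge_nodes by blast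
  then show ?thesis using finite_W finite_subset by blast
qed

lemma neighbours_W: "neighbours E x \<subseteq> W"
  using edge_W by (auto simp: neighbours_def)

lemma finite_neighbours: "finite (neighbours E x)"
  using neighbours_W finite_W finite_subset by blast

lemma two_neighbours_between:
  assumes "a \<in> W" "b \<in> W" "x \<in> W" "d a b = d a x + d x b" "a \<noteq> x" "b \<noteq> x"
  obtains w w' where "{x, w} \<in> E" "{x, w'} \<in> E" "w \<noteq> w'" "a \<in> side w x" "b \<in> side w' x"
proof -
  obtain w where w: "{x, w} \<in> E" "a \<in> side w x" using next_node[of x a] assms by metis
  obtain w' where w': "{x, w'} \<in> E" "b \<in> side w' x" using next_node[of x b] assms by metis
  have "w \<noteq> w'"
  proof
    assume eq: "w = w'"
    have "d x a = d x w + d w a" "d x b = d x w + d w b" using next_dist w w' eq by blast+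
    moreover have "d x a = d a x" "d w a = d a w" using d_sym edge_W w assms by blast+
    moreover have "0 < d x w" "w \<in> W" using edge_pos edge_W w by blast+
    ultimately show False using triangle[of a b w] assms by linarith
  qed
  then show ?thesis using that w w' by blast
qed

lemma farther_neighbour:
  assumes "x \<in> W" "y \<in> W" "{y, w} \<in> E" "x = y \<or> x \<notin> side w y"
  shows "d x w = d x y + d y w"
proof (cases "x = y")
  case True
  then show ?thesis using d_refl assms by simp
next
  case False
  then have "x \<in> side y w" using side_other[of y w x] assms by blast
  then show ?thesis by (simp add: side_def)
qed

lemma side_farther:
  assumes "{x, z} \<in> E" "y \<in> side z x" "{y, w} \<in> E" "x \<notin> side w y"
  shows "w \<in> side z x"
proof (rule ccontr)
  assume "w \<notin> side z x"
  then have "w = x" using side_step[of z x y w] assms edge_sym by blast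
  then show False using side_self[of w y] assms edge_sym by blast
qed

lemma towards_unique:
  assumes "x \<in> W" "y \<in> W" "x \<noteq> y"
  obtains u where "{y, u} \<in> E" "\<And>w. {y, w} \<in> E \<Longrightarrow> x \<in> side w y \<longleftrightarrow> w = u"
proof -
  obtain u where u: "{y, u} \<in> E" "x \<in> side u y" using next_node[of y x] assms by metis
  then show ?thesis using that next_unique[of y u _ x] by blast
qed

text \<open>Take the node of the branch farthest from \<open>x\<close>. A neighbour other than the
  one towards \<open>x\<close> would belong to the branch and be farther still, so the node has
  degree one and cannot lie outside \<open>Y\<close>.\<close>

lemma branch_meets:
  assumes deg: "\<And>x. x \<in> W - Y \<Longrightarrow> 2 \<le> card (neighbours E x)"
    and e: "{x, z} \<in> E"
  shows "\<exists>y\<in>Y. y \<in> side z x"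
proof -
  have fin: "finite (side z x)" "side z x \<noteq> {}"
    using side_self[OF edge_sym[OF e]] finite_W finite_subset[of "side z x" W] side_W by blast+
  obtain y where y: "y \<in> side z x" and mx: "\<And>w. w \<in> side z x \<Longrightarrow> d x w \<le> d x y"
    using finite_maximizer[OF fin] by metis
  have W: "x \<in> W" "y \<in> W" using edge_W e side_W y by blast+
  have ne: "x \<noteq> y" using y side_other[OF e, of x] side_self[OF e] W by blast
  obtain u where u: "{y, u} \<in> E" "\<And>w. {y, w} \<in> E \<Longrightarrow> x \<in> side w y \<longleftrightarrow> w = u"
    using towards_unique[OF W ne] by metis
  have "y \<in> Y"
  proof (rule ccontr)
    assume "y \<notin> Y"
    then have "2 \<le> card (neighbours E y)" using deg W by blast
    then have "\<not> neighbours E y \<subseteq> {u}"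
      using card_mono[of "{u}" "neighbours E y"] by auto
    then obtain w where w: "{y, w} \<in> E" "w \<noteq> u" by (auto simp: neighbours_def)
    then have "x \<notin> side w y" using u by blast
    then have "d x w = d x y + d y w" "w \<in> side z x"
      using farther_neighbour side_farther e y w W by blast+
    then show False using mx[of w] edge_pos[OF w(1)] by simp
  qed
  then show ?thesis using y by blast
qed

text \<open>The metric axioms are universal and pass to subsets; connectedness holds because the
  path between two nodes of a convex set never leaves it.\<close>

lemma convex_sub:
  assumes "W' \<subseteq> W" "W' \<noteq> {}"
    and cv: "\<And>a b x. a \<in> W' \<Longrightarrow> b \<in> W' \<Longrightarrow> x \<in> W \<Longrightarrow> d a b = d a x + d x b \<Longrightarrow> x \<in> W'"
  shows "tree_metric W' {e \<in> E. e \<subseteq> W'} d"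
proof
  show "finite W'" using finite_W assms finite_subset by blast
  show "W' \<noteq> {}" by fact
  fix x y
  show "{x, y} \<in> {e \<in> E. e \<subseteq> W'} \<Longrightarrow> x \<in> W' \<and> y \<in> W' \<and> x \<noteq> y" using edge_nodes by auto
  show "e \<in> {e \<in> E. e \<subseteq> W'} \<Longrightarrow> \<exists>x y. e = {x, y}" for e using edge_pair by auto
  show "x \<in> W' \<Longrightarrow> y \<in> W' \<Longrightarrow> d x y = d y x" using d_sym assms by blast
  show "x \<in> W' \<Longrightarrow> d x x = 0" using d_refl assms by blast
  show "x \<in> W' \<Longrightarrow> y \<in> W' \<Longrightarrow> x \<noteq> y \<Longrightarrow> 0 < d x y" using d_pos assms by blast
  show "{x, y} \<in> {e \<in> E. e \<subseteq> W'} \<Longrightarrow> z \<in> W' \<Longrightarrow> d z y = d z x + d x y \<or> d z x = d z y + d y x" for z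
    using split assms by blast
  show "{x, y} \<in> {e \<in> E. e \<subseteq> W'} \<Longrightarrow> a \<in> W' \<Longrightarrow> b \<in> W' \<Longrightarrow> d a y = d a x + d x y \<Longrightarrow>
      d b x = d b y + d y x \<Longrightarrow> d a b = d a x + d x y + d y b" for a b
    using cross[of x y a b] assms by blast
  assume xy: "x \<in> W'" "y \<in> W'"
  have "x \<in> W" "y \<in> W" using xy assms(1) by blast+
  then have "x \<in> W' \<longrightarrow> (x, y) \<in> (adjacent {e \<in> E. e \<subseteq> W'})\<^sup>*"
  proof (induction x rule: path_induct)
    case (step x z)
    show ?case
    proof
      assume x: "x \<in> W'"
      have "d x y = d x z + d z y" using next_dist step by blast
      then have z: "z \<in> W'" using cv[of x y z] x xy edge_W(2) step by blast
      then have "(x, z) \<in> adjacent {e \<in> E. e \<subseteq> W'}" using step x by (simp add: adjacent_def)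
      then show "(x, y) \<in> (adjacent {e \<in> E. e \<subseteq> W'})\<^sup>*"
        using step z by (meson converse_rtrancl_into_rtrancl)
    qed
  qed simp
  then show "(x, y) \<in> (adjacent {e \<in> E. e \<subseteq> W'})\<^sup>*" using xy by blast
qed

text \<open>A leaf is never strictly between two other nodes, as
  \<open>two_neighbours_between\<close> would give it two neighbours; so deleting leaves keeps the
  node set convex.\<close>

lemma remove_leaves:
  assumes "\<And>i. i \<in> R \<Longrightarrow> card (neighbours E i) = 1" "W - R \<noteq> {}"
  shows "tree_metric (W - R) {e \<in> E. e \<subseteq> W - R} d"
proof (rule convex_sub)
  fix a b x assume *: "a \<in> W - R" "b \<in> W - R" "x \<in> W" "d a b = d a x + d x b"
  show "x \<in> W - R"
  proof (rule ccontr)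
    assume "x \<notin> W - R"
    then have x: "x \<in> R" using * by blast
    then have "a \<noteq> x" "b \<noteq> x" using * by auto
    then obtain w w' where "{x, w} \<in> E" "{x, w'} \<in> E" "w \<noteq> w'"
      using two_neighbours_between[of a b x] * by blast
    then have "{w, w'} \<subseteq> neighbours E x" "card {w, w'} = 2" by (auto simp: neighbours_def)
    then show False using assms(1)[OF x] card_mono[OF finite_neighbours[of x], of "{w, w'}"] by auto
  qed
qed (use assms in auto)

text \<open>In a rooted tree the branching nodes are outnumbered by the marks if every branch carries a
  mark. The induction removes the branching node farthest from the root and one mark
  beyond it.\<close>

lemma card_branching_le:
  assumes "X \<subseteq> W" "finite J" "J \<subseteq> W"
    and "\<And>x. x \<in> X \<Longrightarrow> 3 \<le> card (neighbours E x)"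
    and "\<And>x z. x \<in> X \<Longrightarrow> {x, z} \<in> E \<Longrightarrow> J \<inter> side z x \<noteq> {}"
  shows "card X \<le> card J"
  using assms
proof (induction "card X" arbitrary: X J)
  case 0
  then show ?case by simp
next
  case (Suc n)
  obtain r where r: "r \<in> W" using W_ne by blast
  have fX: "finite X" using finite_subset[OF Suc.prems(1) finite_W] .
  have neX: "X \<noteq> {}" using Suc.hyps(2) by (metis card.empty nat.distinct(1))
  obtain x where x: "x \<in> X" and mx: "\<And>w. w \<in> X \<Longrightarrow> d r w \<le> d r x"
    using finite_maximizer[OF fX neX] by metis
  have xW: "x \<in> W" using x Suc.prems(1) by blast
  \<comment> \<open>\<open>u\<close> is the neighbour of \<open>x\<close> towards the root; if
    \<open>x\<close> is the root itself, every branch leads away and any \<open>u\<close> will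
    do.\<close>
  obtain u where u: "\<And>w. {x, w} \<in> E \<Longrightarrow> w \<noteq> u \<Longrightarrow> r \<notin> side w x"
  proof (cases "\<exists>u. {x, u} \<in> E \<and> r \<in> side u x")
    case True
    then obtain u where "{x, u} \<in> E" "r \<in> side u x" by metis
    then have "r \<notin> side w x" if "{x, w} \<in> E" "w \<noteq> u" for w
      using next_unique[of x w u r] that by metis
    then show ?thesis using that by metis
  next
    case False
    then show ?thesis using that by metis
  qed
  have "2 \<le> card (neighbours E x - {u})"
    using Suc.prems(4)[OF x] finite_neighbours[of x] card_Diff1_le[of "neighbours E x" u]
    by (cases "u \<in> neighbours E x") auto
  then obtain w1 w2 where "w1 \<in> neighbours E x - {u}" "w2 \<in> neighbours E x - {u}" "w1 \<noteq> w2"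
    by (meson card_2_iff' ex_card subsetD)
  then have w: "{x, w1} \<in> E" "{x, w2} \<in> E" "w1 \<noteq> w2" "r \<notin> side w1 x" "r \<notin> side w2 x"
    using u by (auto simp: neighbours_def)
  obtain j1 j2 where j: "j1 \<in> J" "j1 \<in> side w1 x" "j2 \<in> J" "j2 \<in> side w2 x"
    using Suc.prems(5)[OF x w(1)] Suc.prems(5)[OF x w(2)] by blast
  have j2: "j2 \<noteq> j1" using j w next_unique[of x w1 w2 j1] by blast
  have "card (X - {x}) \<le> card (J - {j1})"
  proof (rule Suc.hyps(1))
    show "n = card (X - {x})" using Suc.hyps(2) x fX by simp
    show "X - {x} \<subseteq> W" "finite (J - {j1})" "J - {j1} \<subseteq> W" using Suc.prems(1-3) by auto
    show "3 \<le> card (neighbours E x')" if "x' \<in> X - {x}" for x' using that Suc.prems(4) by blast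
    fix x' z assume x': "x' \<in> X - {x}" "{x', z} \<in> E"
    have x'W: "x' \<in> W" using x' Suc.prems(1) by blast
    \<comment> \<open>Because \<open>x\<close> was chosen farthest from \<open>r\<close>, no other
      node of \<open>X\<close> lies beyond \<open>x\<close>.\<close>
    have far: "x' \<in> side x w" if "{x, w} \<in> E" "r \<notin> side w x" for w
    proof (rule ccontr)
      assume "x' \<notin> side x w"
      then have "x' \<in> side w x" "r \<in> side x w" using side_other[OF that(1)] x'W r that by blast+
      then have "d r x' = d r x + d x x'" using side_between(1)[OF that(1)] by blast
      then show False using mx[of x'] x' d_pos[OF xW x'W] by auto
    qed
    obtain j where j': "j \<in> J" "j \<in> side z x'" using Suc.prems(5) x' by blast
    show "(J - {j1}) \<inter> side z x' \<noteq> {}"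
    proof (cases "j = j1")
      \<comment> \<open>The mark found may be the deleted one. Then the branch leads through
        \<open>x\<close> and therefore contains \<open>j2\<close> as well.\<close>
      case True
      have "d x' j1 = d x' x + d x j1" "d x' j2 = d x' x + d x j2"
        using side_between(1)[of x w1 x' j1] side_between(1)[of x w2 x' j2] far w j by blast+
      moreover have "d x' j1 = d x' z + d z j1" using next_dist x' j' True by blast
      moreover have "z \<in> W" using x' edge_W by blast
      ultimately have "x \<in> side z x'"
        using side_other[OF x'(2) xW] side_between(1)[OF x'(2), of x j1] j' True
          d_sym[OF xW x'W] d_pos[OF x'W xW] x'(1) by fastforce
      then have "d x' x = d x' z + d z x" using next_dist x' by blast
      moreover have "j2 \<in> W" using j Suc.prems(3) by blast
      ultimately have "d x' j2 \<ge> d x' z + d z j2"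
        using \<open>d x' j2 = d x' x + d x j2\<close> triangle[of z j2 x] \<open>z \<in> W\<close> xW by linarith
      then have "j2 \<in> side z x'"
        using side_other[of x' z j2] side_other[of z x' j2] x' \<open>j2 \<in> W\<close> edge_sym[of x' z]
          edge_pos[of x' z] d_sym[of j2 x'] d_sym[of j2 z] \<open>z \<in> W\<close> x'W
        by (auto simp: side_def)
      then show ?thesis using j j2 by blast
    qed (use j' in blast)
  qed
  moreover have "card J \<noteq> 0" using j Suc.prems(2) by auto
  moreover have "card (X - {x}) = card X - 1" "card (J - {j1}) = card J - 1"
    using j x by (simp_all add: card_Diff_singleton)
  ultimately show ?case by linarith
qed

end

section \<open>From the metric encoding back to graphs\<close>

context tree_metric
begin

text \<open>A cycle closed by \<open>{last c, hd c}\<close> walks from \<open>hd c\<close> to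
  \<open>last c\<close> along its other edges. By \<open>side_step\<close> only the closing edge
  itself crosses between its two sides, so the walk never reaches the side of
  \<open>last c\<close>.\<close>

lemma is_tree: "tree W E"
proof -
  have "\<not> {last c, hd c} \<in> E"
    if c: "length c \<ge> 3" "distinct c" "successively (\<lambda>a b. {a, b} \<in> E) c" for c
  proof
    assume e: "{last c, hd c} \<in> E"
    have ne: "c \<noteq> []" using c(1) by auto
    have "c ! k \<in> side (hd c) (last c)" if "k < length c" for k
      using that
    proof (induction k)
      case 0
      then show ?case using side_self[OF edge_sym[OF e]] by (simp add: hd_conv_nth)
    next
      case (Suc k)
      have f: "{c ! k, c ! Suc k} \<in> E" using c(3) Suc.prems by (simp add: successively_conv_nth)
      show ?case
      proof (rule ccontr)
        assume "c ! Suc k \<notin> side (hd c) (last c)"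
        then have "c ! k = hd c \<and> c ! Suc k = last c"
          using side_step[OF edge_sym[OF e] f] Suc by simp
        moreover have "hd c = c ! 0" "last c = c ! (length c - 1)"
          using ne by (simp_all add: hd_conv_nth last_conv_nth)
        ultimately have "c ! k = c ! 0" "c ! Suc k = c ! (length c - 1)" by simp_all
        then have "k = 0" "Suc k = length c - 1"
          using c(1,2) Suc.prems nth_eq_iff_index_eq[OF c(2), of k 0]
            nth_eq_iff_index_eq[OF c(2), of "Suc k" "length c - 1"] by linarith+
        then show False using c(1) by linarith
      qed
    qed
    from this[of "length c - 1"] have "last c \<in> side (hd c) (last c)"
      using c(1) ne by (simp add: last_conv_nth)
    then show False using side_other[OF e, of "last c"] side_self[OF e] edge_W(1)[OF e] by blast
  qed
  moreover have "\<forall>e\<in>E. \<exists>a\<in>W. \<exists>b\<in>W. a \<noteq> b \<and> e = {a, b}"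
    using edge_pair edge_nodes by metis
  ultimately show ?thesis
    unfolding tree_def using finite_W W_ne conn by blast
qed

lemma side_connected:
  assumes e: "{a, b} \<in> E" and x: "x \<in> side a b"
  shows "(x, a) \<in> (adjacent (E - {{a, b}}))\<^sup>*"
proof -
  have "x \<in> W" "a \<in> W" using side_W[OF x] edge_W(1)[OF e] by blast+
  then have "x \<in> side a b \<longrightarrow> (x, a) \<in> (adjacent (E - {{a, b}}))\<^sup>*"
  proof (induction x rule: path_induct)
    case (step x z)
    show ?case
    proof
      assume x: "x \<in> side a b"
      have "b \<in> side b a" using side_self[OF edge_sym[OF e]] .
      then have "x \<noteq> b" using x side_other[OF e, of b] edge_W(2)[OF e] by blast
      then have ne: "{x, z} \<noteq> {a, b}" using step(2) by (auto simp: doubleton_eq_iff)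
      have "z \<in> side a b" using side_step[OF e step(3) x] step(2) by blast
      moreover have "(x, z) \<in> adjacent (E - {{a, b}})" using ne step(3) by (simp add: adjacent_def)
      ultimately show "(x, a) \<in> (adjacent (E - {{a, b}}))\<^sup>*"
        using step(5) by (meson converse_rtrancl_into_rtrancl)
    qed
  qed simp
  then show ?thesis using x by blast
qed

lemma between_sides:
  assumes e: "{a, b} \<in> E" and xy: "x \<in> W" "y \<in> W" and b: "d x y = d x a + d a b + d b y"
  shows "x \<in> side a b" "y \<in> side b a"
proof -
  have W: "a \<in> W" "b \<in> W" using edge_W e by blast+
  have p: "0 < d a b" "d b a = d a b" "d y a = d a y" "d y b = d b y"
    using edge_pos[OF e] d_sym W xy by auto
  have t: "d x y \<le> d x b + d b y" "d x y \<le> d x a + d a y" using triangle xy W by blast+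
  have "\<not> d x a = d x b + d b a" "\<not> d y b = d y a + d a b" using p t b by linarith+
  then have "x \<notin> side b a" "y \<notin> side a b" by (simp_all add: side_def)
  then show "x \<in> side a b" "y \<in> side b a"
    using side_other[OF e xy(1)] side_other[OF e xy(2)] side_other[OF edge_sym[OF e] xy(1)] by blast+
qed

end

section \<open>Operations on tree metrics\<close>

lemma tree_metric_cong:
  assumes t: "tree_metric W E d" and eq: "\<And>x y. x \<in> W \<Longrightarrow> y \<in> W \<Longrightarrow> d' x y = d x y"
  shows "tree_metric W E d'"
proof -
  interpret tree_metric W E d by fact
  show ?thesis
  proof
    show "finite W" "W \<noteq> {}" by (fact finite_W W_ne)+
    fix x y
    show "{x, y} \<in> E \<Longrightarrow> x \<in> W \<and> y \<in> W \<and> x \<noteq> y" using edge_nodes .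
    show "e \<in> E \<Longrightarrow> \<exists>x y. e = {x, y}" for e using edge_pair .
    show "x \<in> W \<Longrightarrow> y \<in> W \<Longrightarrow> (x, y) \<in> (adjacent E)\<^sup>*" using conn .
    show "x \<in> W \<Longrightarrow> y \<in> W \<Longrightarrow> d' x y = d' y x" using d_sym eq by simp
    show "x \<in> W \<Longrightarrow> d' x x = 0" using d_refl eq by simp
    show "x \<in> W \<Longrightarrow> y \<in> W \<Longrightarrow> x \<noteq> y \<Longrightarrow> 0 < d' x y" using d_pos eq by simp
    assume e: "{x, y} \<in> E"
    have W: "x \<in> W" "y \<in> W" using edge_W e by blast+
    show "z \<in> W \<Longrightarrow> d' z y = d' z x + d' x y \<or> d' z x = d' z y + d' y x" for z
      using split[OF e] eq W by simp
    show "a \<in> W \<Longrightarrow> b \<in> W \<Longrightarrow> d' a y = d' a x + d' x y \<Longrightarrow> d' b x = d' b y + d' y x \<Longrightarrow>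
        d' a b = d' a x + d' x y + d' y b" for a b
      using cross[OF e, of a b] eq W by simp
  qed
qed

lemma tree_metric_singleton: "d v v = 0 \<Longrightarrow> tree_metric {v} {} d"
  by unfold_locales auto

lemma adjacent_mono: "E \<subseteq> E' \<Longrightarrow> (a, b) \<in> (adjacent E)\<^sup>* \<Longrightarrow> (a, b) \<in> (adjacent E')\<^sup>*"
  using rtrancl_mono[of "adjacent E" "adjacent E'"] unfolding adjacent_def by blast

lemma adjacent_sym: "(a, b) \<in> (adjacent E)\<^sup>* \<Longrightarrow> (b, a) \<in> (adjacent E)\<^sup>*"
proof -
  have "sym (adjacent E)" by (auto simp: sym_def adjacent_def insert_commute)
  then show "(a, b) \<in> (adjacent E)\<^sup>* \<Longrightarrow> (b, a) \<in> (adjacent E)\<^sup>*"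
    using sym_rtrancl symD by metis
qed

text \<open>The induction step of both constructions of metrics by growth: hop distances in
  \<open>ltree_hop\<close> and information distances in \<open>mult_tree_metric\<close>.\<close>

lemma tree_metric_insert:
  assumes t: "tree_metric W E d" and j: "j \<in> W" and i: "i \<notin> W" and ii: "d i i = 0"
    and pos: "0 < d i j" and ik: "\<And>k. k \<in> W \<Longrightarrow> d i k = d i j + d j k"
    and ki: "\<And>k. k \<in> W \<Longrightarrow> d k i = d i k"
  shows "tree_metric (insert i W) (insert {i, j} E) d"
proof -
  interpret tree_metric W E d by fact
  have nE: "{i, k} \<notin> E" "{k, i} \<notin> E" for k using edge_nodes[of i k] edge_nodes[of k i] i by blast+
  have cs: "(x = i \<and> y = j) \<or> (x = j \<and> y = i) \<or> {x, y} \<in> E" if "{x, y} \<in> insert {i, j} E" for x y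
    using that by (auto simp: doubleton_eq_iff)
  show ?thesis
  proof
    show "finite (insert i W)" "insert i W \<noteq> {}" using finite_W by auto
    fix x y
    show "{x, y} \<in> insert {i, j} E \<Longrightarrow> x \<in> insert i W \<and> y \<in> insert i W \<and> x \<noteq> y"
      using cs[of x y] edge_nodes[of x y] i j by auto
    show "e \<in> insert {i, j} E \<Longrightarrow> \<exists>x y. e = {x, y}" for e using edge_pair by auto
    show "(x, y) \<in> (adjacent (insert {i, j} E))\<^sup>*" if "x \<in> insert i W" "y \<in> insert i W"
    proof -
      have c: "(z, j) \<in> (adjacent (insert {i, j} E))\<^sup>*" if "z \<in> insert i W" for z
      proof (cases "z = i")
        case True
        then show ?thesis by (auto simp: adjacent_def)
      next
        case False
        then show ?thesis using that conn j adjacent_mono[of E "insert {i, j} E"] by blast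
      qed
      show ?thesis using c[OF that(1)] adjacent_sym[OF c[OF that(2)]] by (rule rtrancl_trans)
    qed
    show "x \<in> insert i W \<Longrightarrow> y \<in> insert i W \<Longrightarrow> d x y = d y x" using d_sym ki by (cases "x = i"; cases "y = i") auto
    show "x \<in> insert i W \<Longrightarrow> d x x = 0" using d_refl ii by auto
    have pos': "0 < d i k" if "k \<in> W" for k
      using ik[OF that] pos d_nonneg[OF j that] by linarith
    show "x \<in> insert i W \<Longrightarrow> y \<in> insert i W \<Longrightarrow> x \<noteq> y \<Longrightarrow> 0 < d x y"
      using d_pos pos' ki by (cases "x = i"; cases "y = i") auto
    assume e: "{x, y} \<in> insert {i, j} E"
    show "d z y = d z x + d x y \<or> d z x = d z y + d y x" if "z \<in> insert i W" for z
    proof -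
      consider "x = i" "y = j" | "x = j" "y = i" | "{x, y} \<in> E" using cs[OF e] by blast
      then show ?thesis
      proof cases
        case c: 1
        show ?thesis
        proof (cases "z = i")
          case False
          then have "d z i = d z j + d j i" using that ik ki[OF j] ki d_sym[OF _ j] by simp
          then show ?thesis using c by simp
        qed (use c ii in simp)
      next
        case c: 2
        show ?thesis
        proof (cases "z = i")
          case False
          then have "d z i = d z j + d j i" using that ik ki[OF j] ki d_sym[OF _ j] by simp
          then show ?thesis using c by simp
        qed (use c ii in simp)
      next
        case 3
        then have W: "x \<in> W" "y \<in> W" using edge_W by blast+
        show ?thesis
        proof (cases "z = i")
          case True
          then show ?thesis using split[OF 3 j] ik[OF W(1)] ik[OF W(2)] by auto
        next
          case False
          then show ?thesis using split[OF 3] that by blast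
        qed
      qed
    qed
    show "d a b = d a x + d x y + d y b"
      if a: "a \<in> insert i W" and b: "b \<in> insert i W" and ax: "d a y = d a x + d x y"
        and bx: "d b x = d b y + d y x" for a b
    proof -
      consider "x = i" "y = j" | "x = j" "y = i" | "{x, y} \<in> E" using cs[OF e] by blast
      then show ?thesis
      proof cases
        case 1
        have "a = i"
        proof (rule ccontr)
          assume "a \<noteq> i"
          then have "a \<in> W" using a by blast
          then show False using ax ki[of a] ik[of a] d_sym[of a j] j pos unfolding 1 by linarith
        qed
        moreover have "b \<noteq> i"
        proof
          assume bi: "b = i"
          show False using bx ii ki[OF j] pos unfolding 1 bi by linarith
        qed
        moreover have "b \<in> W" using calculation(2) b by blast
        ultimately show ?thesis unfolding 1 using ii ik[of b] by simp
      next
        case 2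
        have "b = i"
        proof (rule ccontr)
          assume "b \<noteq> i"
          then have "b \<in> W" using b by blast
          then show False using bx ki[of b] ik[of b] d_sym[of b j] j pos unfolding 2 by linarith
        qed
        then show ?thesis using 2 ax ii by simp
      next
        case 3
        then have W: "x \<in> W" "y \<in> W" using edge_W by blast+
        have p: "0 < d x y" "0 < d y x" using edge_pos edge_sym 3 by blast+
        consider "a = i" "b = i" | "a = i" "b \<in> W" | "a \<in> W" "b = i" | "a \<in> W" "b \<in> W"
          using a b by blast
        then show ?thesis
        proof cases
          case 1
          then show ?thesis using ax bx p by simp
        next
          case c: 2
          then have "d j y = d j x + d x y" using ax ik[OF W(1)] ik[OF W(2)] by simp
          then show ?thesis using cross[OF 3 j c(2) _ bx] ik[OF c(2)] ik[OF W(1)] c by simp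
        next
          case c: 3
          then have "d j x = d j y + d y x" using bx ik[OF W(1)] ik[OF W(2)] by simp
          then have "d a j = d a x + d x y + d y j" using cross[OF 3 c(1) j ax] by simp
          then show ?thesis
            using ik[OF c(1)] ik[OF W(2)] ki[OF c(1)] ki[OF W(2)] d_sym[OF c(1) j] d_sym[OF W(2) j]
            unfolding c(2) by linarith
        next
          case 4
          show ?thesis by (rule cross[OF 3 4 ax bx])
        qed
      qed
    qed
  qed
qed

section \<open>Growing trees leaf by leaf\<close>

text \<open>Absence of cycles, as in \<open>tree\<close>, offers no induction. Growth by leaves
  does; \<open>tree_ltree\<close> and \<open>ltree_tree\<close> show that both describe the same
  graphs.\<close>

inductive ltree :: "nat set \<Rightarrow> edge_set \<Rightarrow> bool" where
  single: "ltree {v} {}"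
| add: "ltree W E \<Longrightarrow> j \<in> W \<Longrightarrow> i \<notin> W \<Longrightarrow> ltree (insert i W) (insert {i, j} E)"

lemma ltree_edges: "ltree W E \<Longrightarrow> finite W \<and> W \<noteq> {} \<and> finite E \<and> (\<forall>e\<in>E. \<exists>a\<in>W. \<exists>b\<in>W. a \<noteq> b \<and> e = {a, b})"
proof (induction rule: ltree.induct)
  case (add W E j i)
  have "i \<noteq> j" using add(2,3) by blast
  then have "\<forall>e\<in>insert {i, j} E. \<exists>a\<in>insert i W. \<exists>b\<in>insert i W. a \<noteq> b \<and> e = {a, b}"
    using add(2,4) by (metis insertE insertI1 insertI2)
  then show ?case using add(4) by simp
qed simp

lemma ltree_card: "ltree W E \<Longrightarrow> card E = card W - 1"
proof (induction rule: ltree.induct)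
  case (add W E j i)
  have fin: "finite W" "W \<noteq> {}" "finite E" using ltree_edges[OF add(1)] by simp_all
  have "{i, j} \<notin> E" using ltree_edges[OF add(1)] add(3) by (metis doubleton_eq_iff)
  moreover have "0 < card W" using fin by (simp add: card_gt_0_iff)
  ultimately show ?case using fin add(3,4) by simp
qed simp

lemma ltree_path:
  assumes "ltree W E" "x \<in> W" "y \<in> W"
  shows "\<exists>c. c \<noteq> [] \<and> distinct c \<and> set c \<subseteq> W \<and> successively (\<lambda>a b. {a, b} \<in> E) c \<and> hd c = x \<and> last c = y"
  using assms
proof (induction arbitrary: x y rule: ltree.induct)
  case (single v)
  then show ?case by (intro exI[of _ "[v]"]) auto
next
  case (add W E j i)
  have mono: "successively (\<lambda>a b. {a, b} \<in> insert {i, j} E) c" if "successively (\<lambda>a b. {a, b} \<in> E) c" for c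
    using that by (rule successively_mono) auto
  consider "x = i" "y = i" | "x = i" "y \<in> W" | "x \<in> W" "y = i" | "x \<in> W" "y \<in> W" using add.prems by blast
  then show ?case
  proof cases
    case 1
    then show ?thesis by (intro exI[of _ "[i]"]) auto
  next
    case 2
    obtain c where "c \<noteq> []" "distinct c" "set c \<subseteq> W" "successively (\<lambda>a b. {a, b} \<in> E) c" "hd c = j" "last c = y"
      using add.IH[OF add.hyps(2) 2(2)] by blast
    then show ?thesis using 2 add.hyps mono by (intro exI[of _ "i # c"]) (auto simp: successively_Cons)
  next
    case 3
    obtain c where "c \<noteq> []" "distinct c" "set c \<subseteq> W" "successively (\<lambda>a b. {a, b} \<in> E) c" "hd c = x" "last c = j"
      using add.IH[OF 3(1) add.hyps(2)] by blast
    then show ?thesis using 3 add.hyps mono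
      by (intro exI[of _ "c @ [i]"]) (auto simp: successively_append_iff insert_commute)
  next
    case 4
    obtain c where "c \<noteq> []" "distinct c" "set c \<subseteq> W" "successively (\<lambda>a b. {a, b} \<in> E) c" "hd c = x" "last c = y"
      using add.IH[OF 4] by blast
    then show ?thesis using mono by (intro exI[of _ c]) auto
  qed
qed

lemma rtrancl_leaves_set:
  assumes "(a, b) \<in> r\<^sup>*" "a \<in> S" "b \<notin> S"
  shows "\<exists>x y. (x, y) \<in> r \<and> x \<in> S \<and> y \<notin> S"
  using assms by (induction rule: rtrancl_induct) auto

text \<open>Greedy growth: as long as a node is missing, connectedness supplies an edge of
  \<open>E\<close> that leaves the nodes reached so far.\<close>

lemma spanning_ltree:
  assumes fin: "finite W" "W \<noteq> {}" and nodes: "\<forall>e\<in>E. \<exists>a\<in>W. \<exists>b\<in>W. a \<noteq> b \<and> e = {a, b}"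
    and conn: "\<forall>a\<in>W. \<forall>b\<in>W. (a, b) \<in> (adjacent E)\<^sup>*"
  shows "\<exists>E'\<subseteq>E. ltree W E'"
proof -
  have "\<exists>E''\<subseteq>E. ltree W E''" if "ltree W' E'" "W' \<subseteq> W" "E' \<subseteq> E" for W' E'
    using that
  proof (induction "card (W - W')" arbitrary: W' E' rule: less_induct)
    case less
    show ?case
    proof (cases "W' = W")
      case False
      obtain a b where ab: "a \<in> W'" "b \<in> W" "b \<notin> W'"
        using False less.prems(1,2) ltree_edges by (metis ex_in_conv psubsetI psubset_imp_ex_mem DiffE)
      then have "(a, b) \<in> (adjacent E)\<^sup>*" using conn less.prems(2) by blast
      then obtain x y where xy: "(x, y) \<in> adjacent E" "x \<in> W'" "y \<notin> W'"
        using rtrancl_leaves_set ab by metis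
      then have e: "{y, x} \<in> E" by (simp add: adjacent_def insert_commute)
      then have yW: "y \<in> W" using nodes by (metis doubleton_eq_iff)
      have "W - insert y W' \<subset> W - W'" using xy yW by blast
      then have "card (W - insert y W') < card (W - W')" using fin by (simp add: psubset_card_mono)
      then show ?thesis
        using less.hyps[of "insert y W'" "insert {y, x} E'"] ltree.add[OF less.prems(1) xy(2,3)] less.prems e yW
        by blast
    qed (use less.prems in metis)
  qed
  moreover obtain v where "v \<in> W" using fin by blast
  ultimately show ?thesis using ltree.single[of v] by blast
qed

text \<open>An edge outside a spanning subtree would close a cycle with the path that joins its ends
  inside the subtree.\<close>

lemma tree_ltree:
  assumes t: "tree W E" shows "ltree W E"
proof -
  obtain E' where E': "E' \<subseteq> E" "ltree W E'" using spanning_ltree[of W E] t unfolding tree_def by blast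
  have "E \<subseteq> E'"
  proof
    fix e assume e: "e \<in> E"
    then obtain x y where xy: "x \<in> W" "y \<in> W" "x \<noteq> y" "e = {x, y}" using t unfolding tree_def by blast
    show "e \<in> E'"
    proof (rule ccontr)
      assume n: "e \<notin> E'"
      obtain c where c: "c \<noteq> []" "distinct c" "successively (\<lambda>a b. {a, b} \<in> E') c" "hd c = x" "last c = y"
        using ltree_path[OF E'(2) xy(1,2)] by blast
      \<comment> \<open>A path of one node would make the ends equal; a path of two would be the
        edge \<open>e\<close> itself and put it into \<open>E'\<close>.\<close>
      have "length c \<ge> 3"
      proof (rule ccontr)
        assume "\<not> length c \<ge> 3"
        moreover have "length c \<noteq> 0" using c(1) by simp
        ultimately have "length c = 1 \<or> length c = 2" by linarith
        then show False
        proof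
          assume "length c = 1"
          then show False using c(4,5) xy(3) by (auto simp: length_Suc_conv)
        next
          assume "length c = 2"
          then obtain a b where "c = [a, b]" by (auto simp: numeral_2_eq_2 length_Suc_conv)
          then show False using c xy n by simp
        qed
      qed
      moreover have "successively (\<lambda>a b. {a, b} \<in> E) c" by (rule successively_mono[OF c(3)]) (use E' in blast)
      moreover have "{last c, hd c} \<in> E" using e xy(4) c(4,5) by (simp add: insert_commute)
      ultimately show False using t c(2) unfolding tree_def by blast
    qed
  qed
  then show ?thesis using E' by (metis subset_antisym)
qed

text \<open>A spanning subtree uses up \<open>card W - 1\<close> edges already. In the exchange
  argument this replaces a proof that no cycle arises.\<close>

lemma connected_ltree:
  assumes "finite W" "W \<noteq> {}" "\<forall>e\<in>E. \<exists>a\<in>W. \<exists>b\<in>W. a \<noteq> b \<and> e = {a, b}"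
    and "\<forall>a\<in>W. \<forall>b\<in>W. (a, b) \<in> (adjacent E)\<^sup>*" and "finite E" "card E \<le> card W - 1"
  shows "ltree W E"
proof -
  obtain E' where E': "E' \<subseteq> E" "ltree W E'" using spanning_ltree[OF assms(1-4)] by blast
  then have "E' = E" using card_seteq[OF assms(5) E'(1)] assms(6) ltree_card[OF E'(2)] by simp
  then show ?thesis using E' by simp
qed

text \<open>Counting edges is a tree metric, so sides and cut edges become available for trees
  without given lengths, such as a competing spanning tree. The same metric later counts rounds of
  recursive grouping.\<close>

lemma ltree_hop:
  assumes "ltree W E"
  shows "\<exists>h. tree_metric W E h \<and> (\<forall>x y. {x, y} \<in> E \<longrightarrow> h x y = 1)"
  using assms
proof (induction rule: ltree.induct)
  case (single v)
  show ?case using tree_metric_singleton[of "\<lambda>_ _. 0" v] by auto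
next
  case (add W E j i)
  then obtain h where h: "tree_metric W E h" "\<forall>x y. {x, y} \<in> E \<longrightarrow> h x y = 1" by blast
  interpret tree_metric W E h by fact
  define h' where "h' = (\<lambda>x y. if x = i then (if y = i then 0 else 1 + h j y) else if y = i then 1 + h j x else h x y)"
  have ji: "j \<noteq> i" using add by blast
  have "tree_metric W E h'" by (rule tree_metric_cong[OF h(1)]) (use add(3) in \<open>auto simp: h'_def\<close>)
  then have "tree_metric (insert i W) (insert {i, j} E) h'"
  proof (rule tree_metric_insert)
    show "j \<in> W" "i \<notin> W" by fact+
    show "h' i i = 0" "0 < h' i j" using ji d_refl[OF add(2)] by (auto simp: h'_def)
    show "h' i k = h' i j + h' j k" if "k \<in> W" for k using that add(3) ji d_refl[OF add(2)] by (auto simp: h'_def)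
    show "h' k i = h' i k" if "k \<in> W" for k using that add(3) by (auto simp: h'_def)
  qed
  moreover have "h' x y = 1" if "{x, y} \<in> insert {i, j} E" for x y
  proof (cases "{x, y} \<in> E")
    case True
    then show ?thesis using edge_W[OF True] h(2) add(3) by (auto simp: h'_def)
  next
    case False
    then have "x = i \<and> y = j \<or> x = j \<and> y = i" using that by (auto simp: doubleton_eq_iff)
    then show ?thesis using ji d_refl[OF add(2)] by (auto simp: h'_def)
  qed
  ultimately show ?case by blast
qed

lemma ltree_tree: "ltree W E \<Longrightarrow> tree W E"
  using ltree_hop tree_metric.is_tree by blast

lemma ltree_has_leaf:
  assumes "ltree W E" "2 \<le> card W"
  shows "\<exists>i\<in>W. degree E i = 1"
  using assms(1)
proof cases
  case (add W' E' j i)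
  have "neighbours E i = {j}"
    using ltree_edges[OF add(3)] add by (auto simp: neighbours_def doubleton_eq_iff)
  then show ?thesis using add by (auto simp: degree_def)
qed (use assms in auto)

section \<open>Minimality of a spanning tree with short edges\<close>

lemma weight_pair:
  fixes d :: dist
  assumes "d a b = d b a"
  shows "d (Min {a, b}) (Max {a, b}) = d a b"
  using assms by (cases "a \<le> b") (auto simp: min_def max_def)

text \<open>Exchange argument. An edge \<open>{x, y}\<close> of \<open>M\<close> missing in
  \<open>M'\<close> separates \<open>V\<close>; the path from \<open>x\<close> to \<open>y\<close>
  in \<open>M'\<close> crosses this cut by some \<open>{a, b}\<close>, no shorter by assumption.
  Swapping the two gives a spanning tree that is not heavier than \<open>M'\<close> and shares more
  edges with \<open>M\<close>.\<close>

lemma mst_if_cuts_short: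
  assumes M: "tree_metric V M h"
    and sym: "\<And>a b. a \<in> V \<Longrightarrow> b \<in> V \<Longrightarrow> d a b = d b a"
    and cut: "\<And>x y a b. {x, y} \<in> M \<Longrightarrow> a \<in> tree_metric.side V h x y \<Longrightarrow> b \<in> tree_metric.side V h y x \<Longrightarrow> d x y \<le> d a b"
    and M': "tree V M'"
  shows "weight d M \<le> weight d M'"
  using M'
proof (induction "card (M - M')" arbitrary: M' rule: less_induct)
  case less
  interpret M: tree_metric V M h by fact
  have l': "ltree V M'" using tree_ltree less.prems by blast
  have lM: "ltree V M" using tree_ltree M.is_tree by blast
  have finM: "finite M" "finite M'" using ltree_edges l' lM by blast+
  show ?case
  proof (cases "M \<subseteq> M'")
    case True
    then have "M = M'" using card_seteq[OF finM(2)] ltree_card[OF l'] ltree_card[OF lM] by simp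
    then show ?thesis by simp
  next
    case False
    then obtain x y where xy: "{x, y} \<in> M" "{x, y} \<notin> M'" using M.edge_pair by blast
    have W: "x \<in> V" "y \<in> V" "x \<noteq> y" using M.edge_W xy by blast+
    obtain h' where h': "tree_metric V M' h'" using ltree_hop[OF l'] by blast
    interpret M': tree_metric V M' h' by fact
    have xs: "x \<in> M.side x y" "y \<notin> M.side x y"
      using M.side_self[OF xy(1)] M.side_self[OF M.edge_sym[OF xy(1)]] M.side_other[OF xy(1) W(2)] by blast+
    obtain a b where ab: "{a, b} \<in> M'" "a \<in> M.side x y" "b \<notin> M.side x y"
        "h' x y = h' x a + h' a b + h' b y"
      using M'.cut_edge[OF W(1,2) xs] by metis
    have abV: "a \<in> V" "b \<in> V" "a \<noteq> b" using M'.edge_W ab(1) by blast+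
    have sides: "x \<in> M'.side a b" "y \<in> M'.side b a" using M'.between_sides[OF ab(1) W(1,2) ab(4)] .
    \<comment> \<open>The cut is crossed by no edge of \<open>M\<close> except
      \<open>{x, y}\<close>, so the swap removes nothing that \<open>M\<close> and \<open>M'\<close>
      share.\<close>
    have abM: "{a, b} \<notin> M"
      using M.side_step[OF xy(1) _ ab(2,3)] ab(1) xy(2) by blast
    define F where "F = M' - {{a, b}}"
    define M'' where "M'' = insert {x, y} F"
    have FM: "F \<subseteq> M''" unfolding M''_def by blast
    have toa: "(u, a) \<in> (adjacent M'')\<^sup>*" if "u \<in> M'.side a b" for u
      using M'.side_connected[OF ab(1) that] FM unfolding F_def by (rule adjacent_mono[rotated])
    have tob: "(u, b) \<in> (adjacent M'')\<^sup>*" if "u \<in> M'.side b a" for u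
      using M'.side_connected[OF M'.edge_sym[OF ab(1)] that] FM unfolding F_def
      by (metis adjacent_mono insert_commute)
    have yx: "(y, x) \<in> (adjacent M'')\<^sup>*" unfolding M''_def adjacent_def by (auto simp: insert_commute)
    have ba: "(b, a) \<in> (adjacent M'')\<^sup>*"
      using adjacent_sym[OF tob[OF sides(2)]] yx toa[OF sides(1)] by (meson rtrancl_trans)
    have all: "(u, a) \<in> (adjacent M'')\<^sup>*" if "u \<in> V" for u
      using toa[of u] tob[of u] ba M'.side_other[OF ab(1) that] by (meson rtrancl_trans)
    have conn: "\<forall>u\<in>V. \<forall>w\<in>V. (u, w) \<in> (adjacent M'')\<^sup>*"
      using all adjacent_sym by (meson rtrancl_trans)
    have xyF: "{x, y} \<notin> F" using xy(2) unfolding F_def by blast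
    have cF: "card M' = Suc (card F)" unfolding F_def using ab(1) finM by (metis card.remove)
    have finF: "finite F" unfolding F_def using finM by simp
    have "card M'' = card M'" unfolding M''_def using xyF finF cF by simp
    moreover have "\<forall>e\<in>M''. \<exists>a\<in>V. \<exists>b\<in>V. a \<noteq> b \<and> e = {a, b}"
      using ltree_edges[OF l'] W unfolding M''_def F_def by blast
    ultimately have "ltree V M''"
      using connected_ltree[of V M''] conn ltree_card[OF l'] ltree_edges[OF l'] finF unfolding M''_def by simp
    then have t'': "tree V M''" by (rule ltree_tree)
    have "M - M'' \<subset> M - M'" using xy abM unfolding M''_def F_def by blast
    then have "card (M - M'') < card (M - M')" using finM by (simp add: psubset_card_mono)
    then have "weight d M \<le> weight d M''" using less.hyps t'' by blast
    also have "\<dots> = d x y + weight d F"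
      unfolding weight_def M''_def using xyF finF weight_pair[of d x y] sym[OF W(1,2)] by simp
    also have "\<dots> \<le> d a b + weight d F"
      using cut[OF xy(1) ab(2), of b] M.side_other[OF xy(1) abV(2)] ab(3) by simp
    also have "\<dots> = weight d M'"
      unfolding weight_def F_def using ab(1) finM weight_pair[of d a b] sym[OF abV(1,2)]
      by (simp add: sum.remove)
    finally show ?thesis .
  qed
qed

section \<open>Additivity of the information distances\<close>

text \<open>Covariances in the Gaussian case and determinants of joint distributions in the discrete case
  both satisfy \<open>c i l \<cdot> c j j = c i j \<cdot> c j l\<close> for \<open>j\<close> on the path from \<open>i\<close> to \<open>l\<close>.\<close>

inductive mult_tree :: "(nat \<Rightarrow> nat \<Rightarrow> real) \<Rightarrow> nat set \<Rightarrow> edge_set \<Rightarrow> bool" for c where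
  single: "mult_tree c {v} {}"
| add: "mult_tree c W E \<Longrightarrow> j \<in> W \<Longrightarrow> i \<notin> W \<Longrightarrow> (\<And>l. l \<in> W \<Longrightarrow> c i l * c j j = c i j * c j l) \<Longrightarrow>
    mult_tree c (insert i W) (insert {i, j} E)"

text \<open>With \<open>c\<close> the covariance this is the Gaussian distance. With
  \<open>c\<close> the determinants of the joint matrices it is the discrete one, as the joint
  matrix of a variable with itself is its marginal matrix.\<close>

definition normalized_dist :: "(nat \<Rightarrow> nat \<Rightarrow> real) \<Rightarrow> dist" where
  "normalized_dist c i j = - ln (\<bar>c i j\<bar> / sqrt (c i i * c j j))"

lemma normalized_dist_self: "normalized_dist c i i = 0"
  by (simp add: normalized_dist_def real_sqrt_mult_self)

lemma normalized_dist_eq: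
  assumes "0 < c i i" "0 < c j j" "c i j \<noteq> 0"
  shows "normalized_dist c i j = ln (c i i) / 2 + ln (c j j) / 2 - ln \<bar>c i j\<bar>"
  using assms unfolding normalized_dist_def
  by (simp add: ln_div ln_sqrt ln_mult field_simps)

text \<open>Taking logarithms in the product rule for a new leaf gives additivity. That no
  \<open>c x y\<close> vanishes is carried along in the induction, because the logarithms need
  it.\<close>

lemma mult_tree_metric:
  assumes "mult_tree c W E" "\<And>i j. c i j = c j i" "\<And>i. i \<in> W \<Longrightarrow> 0 < c i i"
    and "\<And>x y. {x, y} \<in> E \<Longrightarrow> 0 < normalized_dist c x y"
  shows "tree_metric W E (normalized_dist c) \<and> (\<forall>x\<in>W. \<forall>y\<in>W. c x y \<noteq> 0)"
  using assms
proof (induction rule: mult_tree.induct)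
  case (single v)
  have "c v v \<noteq> 0" using single(2)[of v] by simp
  then show ?case using tree_metric_singleton[of "normalized_dist c"] normalized_dist_self by simp
next
  case (add W E j i)
  let ?d = "normalized_dist c"
  have IH: "tree_metric W E ?d" "\<And>x y. x \<in> W \<Longrightarrow> y \<in> W \<Longrightarrow> c x y \<noteq> 0"
    using add.IH add.prems by blast+
  have pos: "0 < c i i" "0 < c j j" "\<And>l. l \<in> W \<Longrightarrow> 0 < c l l" using add.prems(2) add.hyps by blast+
  have dij: "0 < ?d i j" using add.prems(3)[of i j] by simp
  \<comment> \<open>Since \<open>ln 0 = 0\<close>, a vanishing \<open>c i j\<close> would give the
    edge length 0.\<close>
  have cij: "c i j \<noteq> 0"
  proof
    assume "c i j = 0"
    then show False using dij by (simp add: normalized_dist_def)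
  qed
  have cil: "c i l \<noteq> 0" if "l \<in> W" for l
    using add.hyps(4)[OF that] cij IH(2)[OF add.hyps(2) that] by auto
  have "tree_metric (insert i W) (insert {i, j} E) ?d"
  proof (rule tree_metric_insert[OF IH(1) add.hyps(2,3)])
    show "?d i i = 0" "0 < ?d i j" using normalized_dist_self dij by auto
    fix l assume l: "l \<in> W"
    show "?d l i = ?d i l" using add.prems(1) by (simp add: normalized_dist_def mult.commute)
    have "\<bar>c i l\<bar> * c j j = \<bar>c i j\<bar> * \<bar>c j l\<bar>"
      using arg_cong[OF add.hyps(4)[OF l], of abs] pos(2) by (simp add: abs_mult)
    then have "ln \<bar>c i l\<bar> + ln (c j j) = ln \<bar>c i j\<bar> + ln \<bar>c j l\<bar>"
      using pos(2) cil[OF l] cij IH(2)[OF add.hyps(2) l] by (metis abs_eq_0 ln_mult zero_less_abs_iff less_numeral_extra(3))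
    then show "?d i l = ?d i j + ?d j l"
      using normalized_dist_eq[OF pos(1) pos(3)[OF l] cil[OF l]]
        normalized_dist_eq[OF pos(1,2) cij]
        normalized_dist_eq[OF pos(2) pos(3)[OF l] IH(2)[OF add.hyps(2) l]] by argo
  qed
  moreover have "c x y \<noteq> 0" if "x \<in> insert i W" "y \<in> insert i W" for x y
    using that cil[of x] cil[of y] IH(2)[of x y] pos(1) add.prems(1)[of x i] by auto
  ultimately show ?case by blast
qed

subsection \<open>Discrete models\<close>

context
  fixes p :: distribution and K :: nat and W :: "nat set"
  assumes disc: "discrete K p W" and finW: "finite W"
begin

interpretation prob_space p using disc by (simp add: discrete_def)

lemma coord_measurable: "i \<in> W \<Longrightarrow> (\<lambda>x. x i) \<in> borel_measurable p"
  using disc measurable_component_singleton[of i W "\<lambda>_. borel"] measurable_cong_sets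
  unfolding discrete_def by blast

lemma coord_event:
  assumes "A \<subseteq> W" shows "{x \<in> space p. \<forall>i\<in>A. x i = r i} \<in> events"
proof (rule sets.sets_Collect_finite_All)
  show "finite A" using assms finW finite_subset by blast
  fix i assume "i \<in> A"
  then have "(\<lambda>x. x i) -` {r i} \<inter> space p \<in> events"
    using coord_measurable assms by (intro measurable_sets[of _ _ borel]) auto
  moreover have "(\<lambda>x. x i) -` {r i} \<inter> space p = {x \<in> space p. x i = r i}" by auto
  ultimately show "{x \<in> space p. x i = r i} \<in> events" by simp
qed

lemma prob_at_cong: "(\<And>i. i \<in> A \<Longrightarrow> a i = b i) \<Longrightarrow> prob_at p A a = prob_at p A b"
  unfolding prob_at_def by (intro arg_cong[where f = "measure p"]) auto

text \<open>Total probability over the letter of \<open>i\<close>. The event on the left and the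
  union of the events on the right differ only where \<open>x i\<close> is not a letter, a null set,
  hence the comparison almost everywhere. The letter is \<open>Suc b\<close> because the alphabet
  starts at 1.\<close>

lemma prob_at_sum:
  assumes "U \<subseteq> W" "i \<in> W" "i \<notin> U"
  shows "prob_at p U a = (\<Sum>b<K. prob_at p (insert i U) (a(i := Suc b)))"
proof -
  define S where "S b = {x \<in> space p. \<forall>k\<in>insert i U. x k = real ((a(i := Suc b)) k)}" for b
  have S: "S b \<in> events" for b unfolding S_def by (rule coord_event) (use assms in auto)
  have xS: "x i = real (Suc b)" if "x \<in> S b" for x b using that unfolding S_def by simp
  have "disjoint_family_on S {..<K}"
    unfolding disjoint_family_on_def
  proof (intro ballI impI)
    fix b b' :: nat assume "b \<noteq> b'"
    show "S b \<inter> S b' = {}"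
    proof (rule equals0I)
      fix x assume x: "x \<in> S b \<inter> S b'"
      have "x i = real (Suc b)" by (rule xS) (use x in blast)
      moreover have "x i = real (Suc b')" by (rule xS) (use x in blast)
      ultimately show False using \<open>b \<noteq> b'\<close> by simp
    qed
  qed
  then have "measure p (\<Union>b<K. S b) = (\<Sum>b<K. measure p (S b))"
    using S by (intro finite_measure_finite_Union) auto
  moreover have "measure p {x \<in> space p. \<forall>k\<in>U. x k = real (a k)} = measure p (\<Union>b<K. S b)"
  proof (rule finite_measure_eq_AE)
    have "AE x in p. x i \<in> real ` {1..K}"
      using disc assms(2) unfolding discrete_def by (auto elim!: AE_mp)
    then show "AE x in p. (x \<in> {x \<in> space p. \<forall>k\<in>U. x k = real (a k)}) = (x \<in> (\<Union>b<K. S b))"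
    proof (rule AE_mp, intro AE_I2 impI)
      fix x assume x: "x \<in> space p" "x i \<in> real ` {1..K}"
      then obtain n where n: "n \<in> {1..K}" "x i = real n" by blast
      then have ex: "\<exists>b\<in>{..<K}. x i = real (Suc b)" by (intro bexI[of _ "n - 1"]) auto
      have eq: "(\<forall>k\<in>U. x k = real ((a(i := Suc b)) k)) \<longleftrightarrow> (\<forall>k\<in>U. x k = real (a k))" for b
        using assms(3) by (metis fun_upd_other)
      have "x \<in> S b \<longleftrightarrow> x i = real (Suc b) \<and> (\<forall>k\<in>U. x k = real (a k))" for b
        using x(1) eq[of b] unfolding S_def by simp
      then show "(x \<in> {x \<in> space p. \<forall>k\<in>U. x k = real (a k)}) = (x \<in> (\<Union>b<K. S b))"
        using x(1) ex by simp
    qed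
    show "{x \<in> space p. \<forall>k\<in>U. x k = real (a k)} \<in> events" by (rule coord_event) fact
    show "(\<Union>b<K. S b) \<in> events" using S by auto
  qed
  ultimately show ?thesis unfolding prob_at_def S_def by simp
qed

text \<open>Keeps the denominators of the factorization away from 0. For trees with an edge it is
  derived from the positive edge lengths in \<open>discrete_tree_metric\<close>.\<close>

definition letter_positive :: "nat set \<Rightarrow> bool" where
  "letter_positive U \<longleftrightarrow> (\<forall>i\<in>U. \<forall>a. a i \<in> {1..K} \<longrightarrow> 0 < prob_at p {i} a)"

lemma letter_positiveD: "letter_positive U \<Longrightarrow> i \<in> U \<Longrightarrow> a \<in> U \<rightarrow> {1..K} \<Longrightarrow> 0 < prob_at p {i} a"
  unfolding letter_positive_def by (meson Pi_mem)

text \<open>\<open>F\<close> collects all factors without the leaf \<open>i\<close>. Summing over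
  the letter of \<open>i\<close> turns the remaining quotient into 1, so \<open>F\<close> is the
  marginal on \<open>W'\<close>. This is the first claim; the second is then the original
  factorization.\<close>

lemma leaf_factor:
  assumes W': "insert i W' \<subseteq> W" "j \<in> W'" "i \<notin> W'" and E': "finite E'" "\<forall>e\<in>E'. e \<subseteq> W'"
    and pos: "letter_positive (insert i W')"
    and fac: "factorizes K p (insert i W') (insert {i, j} E')"
  shows "factorizes K p W' E'"
    and "a \<in> insert i W' \<rightarrow> {1..K} \<Longrightarrow>
      prob_at p (insert i W') a = prob_at p W' a * (prob_at p {i, j} a / prob_at p {j} a)"
proof -
  define F where "F a = (\<Prod>k\<in>W'. prob_at p {k} a) * (\<Prod>e\<in>E'. prob_at p e a / (\<Prod>k\<in>e. prob_at p {k} a))" for a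
  have fin: "finite W'" using W'(1) finW by (meson finite_subset insert_subset)
  have nE: "{i, j} \<notin> E'" using bspec[OF E'(2), of "{i, j}"] W'(3) by auto
  have ij: "i \<noteq> j" using W' by blast
  have eq: "prob_at p (insert i W') a = F a * (prob_at p {i, j} a / prob_at p {j} a)"
    if a: "a \<in> insert i W' \<rightarrow> {1..K}" for a
  proof -
    have pi: "0 < prob_at p {i} a" by (rule letter_positiveD[OF pos _ a]) simp
    have aux: "(A * B) * (C / (A * D) * G) = (B * G) * (C / D)" if "0 < A" for A B C D G :: real
      using that by (cases "D = 0") (simp_all add: field_simps)
    have "prob_at p (insert i W') a = (\<Prod>k\<in>insert i W'. prob_at p {k} a) *
        (\<Prod>e\<in>insert {i, j} E'. prob_at p e a / (\<Prod>k\<in>e. prob_at p {k} a))"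
      using fac a unfolding factorizes_def by (rule bspec)
    also have "\<dots> = (prob_at p {i} a * (\<Prod>k\<in>W'. prob_at p {k} a)) *
        (prob_at p {i, j} a / (prob_at p {i} a * prob_at p {j} a) *
          (\<Prod>e\<in>E'. prob_at p e a / (\<Prod>k\<in>e. prob_at p {k} a)))"
      using fin E'(1) nE ij W'(3) by simp
    also have "\<dots> = F a * (prob_at p {i, j} a / prob_at p {j} a)"
      unfolding F_def by (rule aux[OF pi])
    finally show ?thesis .
  qed
  have Fi: "F (a(i := b)) = F a" for a b
  proof -
    have pr: "prob_at p e (a(i := b)) = prob_at p e a" if "e \<subseteq> W'" for e
    proof (rule prob_at_cong)
      fix k assume "k \<in> e"
      then have "k \<noteq> i" using that W'(3) by blast
      then show "(a(i := b)) k = a k" by simp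
    qed
    have pe: "(\<Prod>k\<in>e. prob_at p {k} (a(i := b))) = (\<Prod>k\<in>e. prob_at p {k} a)" if "e \<subseteq> W'" for e
    proof (rule prod.cong[OF refl])
      fix k assume "k \<in> e"
      then show "prob_at p {k} (a(i := b)) = prob_at p {k} a" using that by (intro pr) blast
    qed
    have "(\<Prod>e\<in>E'. prob_at p e (a(i := b)) / (\<Prod>k\<in>e. prob_at p {k} (a(i := b)))) =
        (\<Prod>e\<in>E'. prob_at p e a / (\<Prod>k\<in>e. prob_at p {k} a))"
      by (rule prod.cong[OF refl]) (simp only: pr pe bspec[OF E'(2)])
    then show ?thesis unfolding F_def by (simp only: pe[OF subset_refl])
  qed
  have Feq: "prob_at p W' a = F a" if a: "a \<in> W' \<rightarrow> {1..K}" for a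
  proof -
    have pj: "0 < prob_at p {j} a"
      using pos a W'(2) unfolding letter_positive_def by (metis Pi_mem insertI2)
    have "prob_at p W' a = (\<Sum>b<K. prob_at p (insert i W') (a(i := Suc b)))"
      by (rule prob_at_sum) (use W' in auto)
    also have "\<dots> = (\<Sum>b<K. F a * (prob_at p {i, j} (a(i := Suc b)) / prob_at p {j} a))"
    proof (intro sum.cong refl)
      fix b assume "b \<in> {..<K}"
      then have "a(i := Suc b) \<in> insert i W' \<rightarrow> {1..K}" using a by auto
      moreover have "prob_at p {j} (a(i := Suc b)) = prob_at p {j} a" by (rule prob_at_cong) (use ij in auto)
      ultimately show "prob_at p (insert i W') (a(i := Suc b)) = F a * (prob_at p {i, j} (a(i := Suc b)) / prob_at p {j} a)"
        using eq Fi by simp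
    qed
    also have "\<dots> = F a * ((\<Sum>b<K. prob_at p {i, j} (a(i := Suc b))) / prob_at p {j} a)"
      by (simp add: sum_distrib_left sum_divide_distrib)
    also have "(\<Sum>b<K. prob_at p {i, j} (a(i := Suc b))) = prob_at p {j} a"
      by (rule prob_at_sum[symmetric]) (use W' ij in auto)
    finally show ?thesis using pj by simp
  qed
  show "factorizes K p W' E'"
    unfolding factorizes_def
  proof
    fix a assume "a \<in> W' \<rightarrow> {1..K}"
    from Feq[OF this] show "prob_at p W' a =
        (\<Prod>i\<in>W'. prob_at p {i} a) * (\<Prod>e\<in>E'. prob_at p e a / (\<Prod>i\<in>e. prob_at p {i} a))"
      unfolding F_def .
  qed
  show "prob_at p (insert i W') a = prob_at p W' a * (prob_at p {i, j} a / prob_at p {j} a)"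
    if "a \<in> insert i W' \<rightarrow> {1..K}"
  proof -
    have "a \<in> W' \<rightarrow> {1..K}" using that by blast
    then show ?thesis using eq[OF that] Feq[of a] by simp
  qed
qed

text \<open>The nodes of \<open>D\<close> are summed out one by one; the quotient only involves
  \<open>i\<close> and \<open>j\<close> and comes out of each sum. With
  \<open>W' - D = {j, l}\<close> this says that \<open>i\<close> and \<open>l\<close> are
  independent given \<open>j\<close>.\<close>

lemma leaf_independent:
  assumes W': "insert i W' \<subseteq> W" "j \<in> W'" "i \<notin> W'"
    and eq: "\<And>a. a \<in> insert i W' \<rightarrow> {1..K} \<Longrightarrow>
      prob_at p (insert i W') a = prob_at p W' a * (prob_at p {i, j} a / prob_at p {j} a)"
    and D: "finite D" "D \<subseteq> W' - {j}" and a: "a \<in> insert i (W' - D) \<rightarrow> {1..K}"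
  shows "prob_at p (insert i (W' - D)) a = prob_at p (W' - D) a * (prob_at p {i, j} a / prob_at p {j} a)"
  using D a
proof (induction D arbitrary: a rule: finite_induct)
  case empty
  then show ?case using eq by simp
next
  case (insert x D)
  define U where "U = W' - insert x D"
  have x: "x \<in> W'" "x \<noteq> j" "x \<noteq> i" "x \<notin> D" using insert W'(3) by auto
  have U: "insert x U = W' - D" "x \<notin> U" "x \<notin> insert i U" "insert x (insert i U) = insert i (W' - D)"
    "U \<subseteq> W" "insert i U \<subseteq> W" "x \<in> W"
    using x W' unfolding U_def by auto
  have "prob_at p (insert i U) a = (\<Sum>b<K. prob_at p (insert i (W' - D)) (a(x := Suc b)))"
    using prob_at_sum[OF U(6,7,3)] U(4) by simp
  also have "\<dots> = (\<Sum>b<K. prob_at p (W' - D) (a(x := Suc b)) * (prob_at p {i, j} a / prob_at p {j} a))"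
  proof (intro sum.cong refl)
    fix b assume "b \<in> {..<K}"
    then have "a(x := Suc b) \<in> insert i (W' - D) \<rightarrow> {1..K}" using insert.prems(2) x by auto
    moreover have "prob_at p {i, j} (a(x := Suc b)) = prob_at p {i, j} a"
      "prob_at p {j} (a(x := Suc b)) = prob_at p {j} a"
      by (rule prob_at_cong, use x in auto)+
    ultimately show "prob_at p (insert i (W' - D)) (a(x := Suc b)) =
        prob_at p (W' - D) (a(x := Suc b)) * (prob_at p {i, j} a / prob_at p {j} a)"
      using insert.IH insert.prems(1) by simp
  qed
  also have "\<dots> = prob_at p U a * (prob_at p {i, j} a / prob_at p {j} a)"
    using prob_at_sum[OF U(5,7,2), of a] U(1) by (simp only: sum_distrib_right)
  finally show ?case unfolding U_def .
qed

lemma joint_matrix_entry: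
  assumes "i \<noteq> j" "\<alpha> < K" "\<beta> < K" "a i = Suc \<alpha>" "a j = Suc \<beta>"
  shows "joint_matrix K p i j $$ (\<alpha>, \<beta>) = prob_at p {i, j} a"
  using assms unfolding joint_matrix_def prob_at_def by simp

lemma joint_matrix_self: "joint_matrix K p i i = marginal_matrix K p i"
proof -
  have "{x \<in> space p. x i = real (a + 1) \<and> x i = real (b + 1)} =
      (if a = b then {x \<in> space p. x i = real (a + 1)} else {})" for a b
    by auto
  then show ?thesis unfolding joint_matrix_def marginal_matrix_def by (intro cong_mat refl) simp
qed

lemma joint_matrix_det_sym: "Determinant.det (joint_matrix K p i j) = Determinant.det (joint_matrix K p j i)"
proof -
  have "joint_matrix K p i j = transpose_mat (joint_matrix K p j i)"
    unfolding joint_matrix_def by (intro eq_matI) (auto intro!: arg_cong[where f = "measure p"])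
  moreover have "joint_matrix K p j i \<in> carrier_mat K K" unfolding joint_matrix_def by simp
  ultimately show ?thesis using det_transpose by metis
qed

lemma marginal_det: "Determinant.det (marginal_matrix K p i) = (\<Prod>a<K. prob_at p {i} (\<lambda>_. Suc a))"
proof -
  have "Determinant.det (marginal_matrix K p i) = prod_list (diag_mat (marginal_matrix K p i))"
    by (rule det_upper_triangular[of _ K]) (auto simp: marginal_matrix_def)
  also have "diag_mat (marginal_matrix K p i) = map (\<lambda>a. prob_at p {i} (\<lambda>_. Suc a)) [0..<K]"
    unfolding diag_mat_def marginal_matrix_def prob_at_def by (auto simp: add.commute)
  also have "prod_list \<dots> = (\<Prod>a<K. prob_at p {i} (\<lambda>_. Suc a))"
    by (simp add: prod.distinct_set_conv_list[symmetric] atLeast0LessThan)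
  finally show ?thesis .
qed

text \<open>\<open>X\<close> holds the conditional probabilities of the letters of \<open>i\<close>
  given those of \<open>j\<close>. Independence of \<open>i\<close> and \<open>l\<close> given
  \<open>j\<close> means that the joint matrix of \<open>i\<close> and \<open>l\<close> is
  \<open>X\<close> times that of \<open>j\<close> and \<open>l\<close>; with \<open>l = j\<close>
  this is how \<open>X\<close> is formed. Now multiply determinants.\<close>

lemma det_joint_leaf:
  assumes W': "insert i W' \<subseteq> W" "j \<in> W'" "i \<notin> W'" "l \<in> W'"
    and pos: "letter_positive (insert i W')"
    and eq: "\<And>a. a \<in> insert i W' \<rightarrow> {1..K} \<Longrightarrow>
      prob_at p (insert i W') a = prob_at p W' a * (prob_at p {i, j} a / prob_at p {j} a)"
  shows "Determinant.det (joint_matrix K p i l) * Determinant.det (joint_matrix K p j j) =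
    Determinant.det (joint_matrix K p i j) * Determinant.det (joint_matrix K p j l)"
proof (cases "l = j")
  case False
  define X where "X = Matrix.mat K K (\<lambda>(\<alpha>, \<epsilon>). joint_matrix K p i j $$ (\<alpha>, \<epsilon>) / prob_at p {j} (\<lambda>_. Suc \<epsilon>))"
  have ne: "i \<noteq> j" "i \<noteq> l" using W' by auto
  have car: "X \<in> carrier_mat K K" "\<And>x y. joint_matrix K p x y \<in> carrier_mat K K"
    unfolding X_def joint_matrix_def by auto
  have pj: "0 < prob_at p {j} (\<lambda>_. Suc \<epsilon>)" if "\<epsilon> < K" for \<epsilon>
    using pos that W'(2) unfolding letter_positive_def by simp
  have 1: "joint_matrix K p i j = X * joint_matrix K p j j"
  proof (rule eq_matI)
    fix \<alpha> \<beta> assume ab: "\<alpha> < dim_row (X * joint_matrix K p j j)" "\<beta> < dim_col (X * joint_matrix K p j j)"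
    then have ab: "\<alpha> < K" "\<beta> < K" using car by (auto simp: joint_matrix_def X_def)
    have "(X * joint_matrix K p j j) $$ (\<alpha>, \<beta>) = (\<Sum>\<epsilon><K. X $$ (\<alpha>, \<epsilon>) * joint_matrix K p j j $$ (\<epsilon>, \<beta>))"
      using ab car(1) car(2)[of j j] by (simp add: scalar_prod_def atLeast0LessThan)
    also have "\<dots> = (\<Sum>\<epsilon><K. if \<epsilon> = \<beta> then X $$ (\<alpha>, \<beta>) * prob_at p {j} (\<lambda>_. Suc \<beta>) else 0)"
      using ab by (intro sum.cong refl) (auto simp: joint_matrix_self marginal_matrix_def prob_at_def)
    also have "\<dots> = joint_matrix K p i j $$ (\<alpha>, \<beta>)"
      using ab pj[OF ab(2)] unfolding X_def by simp
    finally show "joint_matrix K p i j $$ (\<alpha>, \<beta>) = (X * joint_matrix K p j j) $$ (\<alpha>, \<beta>)" by simp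
  qed (auto simp: X_def joint_matrix_def)
  have 2: "joint_matrix K p i l = X * joint_matrix K p j l"
  proof (rule eq_matI)
    fix \<alpha> \<beta> assume ab: "\<alpha> < dim_row (X * joint_matrix K p j l)" "\<beta> < dim_col (X * joint_matrix K p j l)"
    then have ab: "\<alpha> < K" "\<beta> < K" using car by (auto simp: joint_matrix_def X_def)
    define a where "a = (\<lambda>x. if x = i then Suc \<alpha> else if x = l then Suc \<beta> else Suc 0)"
    have sub: "W' - (W' - {j, l}) = {j, l}" using W' by blast
    have fD: "finite (W' - {j, l})" using W'(1) finW by (meson finite_Diff finite_subset insert_subset)
    have sD: "W' - {j, l} \<subseteq> W' - {j}" by blast
    have "joint_matrix K p i l $$ (\<alpha>, \<beta>) = prob_at p {i, l} a"
      using joint_matrix_entry[of i l \<alpha> \<beta> a] ne ab by (simp add: a_def)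
    also have "\<dots> = (\<Sum>\<epsilon><K. prob_at p {j, i, l} (a(j := Suc \<epsilon>)))"
      using prob_at_sum[of "{i, l}" j a] W' ne False by auto
    also have "\<dots> = (\<Sum>\<epsilon><K. X $$ (\<alpha>, \<epsilon>) * joint_matrix K p j l $$ (\<epsilon>, \<beta>))"
    proof (intro sum.cong refl)
      fix \<epsilon> assume e: "\<epsilon> \<in> {..<K}"
      let ?a = "a(j := Suc \<epsilon>)"
      have "?a \<in> insert i (W' - (W' - {j, l})) \<rightarrow> {1..K}" using ab e ne unfolding sub a_def by auto
      from leaf_independent[OF W'(1-3) eq fD sD this]
      have "prob_at p (insert i {j, l}) ?a = prob_at p {j, l} ?a * (prob_at p {i, j} ?a / prob_at p {j} ?a)"
        unfolding sub by simp
      moreover have "prob_at p {j} ?a = prob_at p {j} (\<lambda>_. Suc \<epsilon>)" by (rule prob_at_cong) auto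
      moreover have "prob_at p {j, l} ?a = joint_matrix K p j l $$ (\<epsilon>, \<beta>)"
        using joint_matrix_entry[of j l \<epsilon> \<beta> ?a] False ab e ne by (simp add: a_def)
      moreover have "prob_at p {i, j} ?a = joint_matrix K p i j $$ (\<alpha>, \<epsilon>)"
        using joint_matrix_entry[of i j \<alpha> \<epsilon> ?a] ab e ne by (simp add: a_def)
      ultimately show "prob_at p {j, i, l} ?a = X $$ (\<alpha>, \<epsilon>) * joint_matrix K p j l $$ (\<epsilon>, \<beta>)"
        using ab e unfolding X_def by (simp add: insert_commute)
    qed
    also have "\<dots> = (X * joint_matrix K p j l) $$ (\<alpha>, \<beta>)"
      using ab car(1) car(2)[of j l] by (simp add: scalar_prod_def atLeast0LessThan)
    finally show "joint_matrix K p i l $$ (\<alpha>, \<beta>) = (X * joint_matrix K p j l) $$ (\<alpha>, \<beta>)" .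
  qed (auto simp: X_def joint_matrix_def)
  have "Determinant.det (joint_matrix K p i j) = Determinant.det X * Determinant.det (joint_matrix K p j j)"
    unfolding 1 by (rule det_mult[OF car(1) car(2)])
  moreover have "Determinant.det (joint_matrix K p i l) = Determinant.det X * Determinant.det (joint_matrix K p j l)"
    unfolding 2 by (rule det_mult[OF car(1) car(2)])
  ultimately show ?thesis by simp
qed simp

lemma discrete_mult_tree:
  assumes "ltree W' E'" "W' \<subseteq> W" "letter_positive W'" "factorizes K p W' E'"
  shows "mult_tree (\<lambda>i j. Determinant.det (joint_matrix K p i j)) W' E'"
  using assms
proof (induction rule: ltree.induct)
  case (single v)
  show ?case by (rule mult_tree.single)
next
  case (add W' E' j i)
  have E': "finite E'" using ltree_edges[OF add.hyps(1)] by simp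
  have E'': "e \<subseteq> W'" if "e \<in> E'" for e
  proof -
    obtain a b where "a \<in> W'" "b \<in> W'" "e = {a, b}" using ltree_edges[OF add.hyps(1)] \<open>e \<in> E'\<close> by metis
    then show ?thesis by simp
  qed
  then have "\<forall>e\<in>E'. e \<subseteq> W'" by blast
  note E' = E' this
  note lf = leaf_factor[OF add.prems(1) add.hyps(2,3) E' add.prems(2,3)]
  have lp: "letter_positive W'" using add.prems(2) unfolding letter_positive_def by blast
  have "W' \<subseteq> W" using add.prems(1) by blast
  from add.IH[OF this lp lf(1)] show ?case
    by (rule mult_tree.add[OF _ add.hyps(2,3)])
      (rule det_joint_leaf[OF add.prems(1) add.hyps(2,3) _ add.prems(2) lf(2)])
qed

lemma discrete_tree_metric:
  assumes t: "ltree W E" and fac: "factorizes K p W E"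
    and pos: "\<And>x y. {x, y} \<in> E \<Longrightarrow> 0 < discrete_dist K p x y"
  shows "tree_metric W E (discrete_dist K p)"
proof -
  define c where "c i j = Determinant.det (joint_matrix K p i j)" for i j
  have dd: "discrete_dist K p = normalized_dist c"
    unfolding discrete_dist_def normalized_dist_def c_def by (intro ext) (simp add: joint_matrix_self)
  show ?thesis
  \<comment> \<open>A single node has no edge from which positive marginals could be read
    off.\<close>
  proof (cases "card W = 1")
    case True
    then obtain v where v: "W = {v}" by (auto simp: card_1_singleton_iff)
    then have "E = {}" using ltree_edges[OF t] ltree_card[OF t] by simp
    then show ?thesis using v tree_metric_singleton[of "discrete_dist K p" v] normalized_dist_self dd by simp
  next
    case False
    have cpos: "0 < c i i" and lp: "\<And>a. a i \<in> {1..K} \<Longrightarrow> 0 < prob_at p {i} a" if i: "i \<in> W" for i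
    proof -
      obtain v where "v \<in> W" "v \<noteq> i" using False i by (metis card_1_singleton_iff is_singletonI' is_singleton_def One_nat_def ltree_edges t)
      then obtain x where x: "{i, x} \<in> E"
        using ltree_hop[OF t] tree_metric.next_node i by metis
      \<comment> \<open>A zero on the diagonal makes the quotient under the logarithm 0, and with
        \<open>ln 0 = 0\<close> the edge at \<open>i\<close> would have length 0.\<close>
      have "c i i \<noteq> 0" using pos[OF x] unfolding dd normalized_dist_def by auto
      then have ne: "(\<Prod>a<K. prob_at p {i} (\<lambda>_. Suc a)) \<noteq> 0" unfolding c_def joint_matrix_self marginal_det .
      have nn: "0 \<le> prob_at p {i} b" for b unfolding prob_at_def by simp
      have "0 < (\<Prod>a<K. prob_at p {i} (\<lambda>_. Suc a))" using ne prod_nonneg nn by (metis order_le_less)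
      then show "0 < c i i" unfolding c_def joint_matrix_self marginal_det .
      fix a :: "nat \<Rightarrow> nat" assume a: "a i \<in> {1..K}"
      then have "a i - 1 \<in> {..<K}" by auto
      then have "prob_at p {i} (\<lambda>_. Suc (a i - 1)) \<noteq> 0" using ne by (metis finite_lessThan prod_zero)
      moreover have "prob_at p {i} (\<lambda>_. Suc (a i - 1)) = prob_at p {i} a" by (rule prob_at_cong) (use a in auto)
      ultimately show "0 < prob_at p {i} a" using nn[of a] by simp
    qed
    have "letter_positive W" unfolding letter_positive_def using lp by blast
    then have "mult_tree c W E" using discrete_mult_tree[OF t _ _ fac] unfolding c_def by simp
    then show ?thesis
      using mult_tree_metric[of c W E] cpos pos joint_matrix_det_sym unfolding dd c_def by blast
  qed
qed

end

subsection \<open>Linear algebra of Gaussian models\<close>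

definition pos_def :: "nat set \<Rightarrow> (nat \<Rightarrow> nat \<Rightarrow> real) \<Rightarrow> bool" where
  "pos_def W Q \<longleftrightarrow> (\<forall>x. (\<exists>i\<in>W. x i \<noteq> 0) \<longrightarrow> (\<Sum>i\<in>W. \<Sum>j\<in>W. Q i j * x i * x j) > 0)"

lemma pos_def_diag:
  assumes "pos_def W Q" "finite W" "i \<in> W" shows "0 < Q i i"
proof -
  define x where "x k = (if k = i then 1 else 0 :: real)" for k
  have row: "(\<Sum>b\<in>W. Q a b * x a * x b) = (if a = i then Q i i else 0)" for a
  proof -
    have "(\<Sum>b\<in>W. Q a b * x a * x b) = (\<Sum>b\<in>W. if b = i then Q a i * x a else 0)"
      by (intro sum.cong refl) (simp add: x_def)
    then show ?thesis using assms(2,3) by (simp add: x_def)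
  qed
  have "(\<Sum>a\<in>W. \<Sum>b\<in>W. Q a b * x a * x b) = Q i i" unfolding row using assms(2,3) by simp
  moreover have "\<exists>k\<in>W. x k \<noteq> 0" using assms(3) by (intro bexI[of _ i]) (simp add: x_def)
  ultimately show ?thesis using assms(1)[unfolded pos_def_def, rule_format, of x] by simp
qed

text \<open>Completing the square in the coordinate \<open>i\<close> leaves the Schur complement on the rest.\<close>

definition schur :: "(nat \<Rightarrow> nat \<Rightarrow> real) \<Rightarrow> nat \<Rightarrow> nat \<Rightarrow> nat \<Rightarrow> real" where
  "schur Q i a b = Q a b - Q a i * Q i b / Q i i"

lemma complete_square:
  assumes fin: "finite W" and i: "i \<notin> W" and sym: "\<And>a b. a \<in> insert i W \<Longrightarrow> b \<in> insert i W \<Longrightarrow> Q a b = Q b a"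
    and q: "Q i i \<noteq> 0"
  shows "(\<Sum>a\<in>insert i W. \<Sum>b\<in>insert i W. Q a b * x a * x b) =
    Q i i * (x i + (\<Sum>k\<in>W. Q i k * x k) / Q i i)\<^sup>2 + (\<Sum>a\<in>W. \<Sum>b\<in>W. schur Q i a b * x a * x b)"
proof -
  define s where "s = (\<Sum>k\<in>W. Q i k * x k)"
  have 1: "(\<Sum>b\<in>W. Q i b * x i * x b) = x i * s" unfolding s_def by (simp add: sum_distrib_left ac_simps)
  have "(\<Sum>a\<in>W. Q a i * x a * x i) = (\<Sum>a\<in>W. Q i a * x i * x a)"
    using sym by (intro sum.cong refl) (auto simp: ac_simps)
  then have 2: "(\<Sum>a\<in>W. Q a i * x a * x i) = x i * s" using 1 by simp
  have "(\<Sum>a\<in>W. \<Sum>b\<in>W. Q a i * Q i b / Q i i * x a * x b) = (\<Sum>a\<in>W. \<Sum>b\<in>W. (Q i a * x a) * (Q i b * x b) / Q i i)"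
    using sym by (intro sum.cong refl) (auto simp: ac_simps)
  also have "\<dots> = s * s / Q i i" unfolding s_def by (simp add: sum_product sum_divide_distrib)
  finally have 3: "(\<Sum>a\<in>W. \<Sum>b\<in>W. schur Q i a b * x a * x b) = (\<Sum>a\<in>W. \<Sum>b\<in>W. Q a b * x a * x b) - s * s / Q i i"
    unfolding schur_def by (simp add: left_diff_distrib sum_subtractf)
  have "(\<Sum>a\<in>insert i W. \<Sum>b\<in>insert i W. Q a b * x a * x b) =
      Q i i * x i * x i + x i * s + (x i * s + (\<Sum>a\<in>W. \<Sum>b\<in>W. Q a b * x a * x b))"
    using fin i 1 2 by (simp add: sum.distrib)
  also have "\<dots> = Q i i * (x i + s / Q i i)\<^sup>2 + ((\<Sum>a\<in>W. \<Sum>b\<in>W. Q a b * x a * x b) - s * s / Q i i)"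
    using q by (simp add: power2_eq_square field_simps)
  finally show ?thesis unfolding 3 s_def .
qed

lemma pos_def_schur:
  assumes pd: "pos_def (insert i W) Q" and fin: "finite W" and i: "i \<notin> W"
    and sym: "\<And>a b. a \<in> insert i W \<Longrightarrow> b \<in> insert i W \<Longrightarrow> Q a b = Q b a"
  shows "pos_def W (schur Q i)"
  unfolding pos_def_def
proof (intro allI impI)
  fix x :: "nat \<Rightarrow> real" assume x: "\<exists>k\<in>W. x k \<noteq> 0"
  have q: "0 < Q i i" using pos_def_diag[OF pd] fin by simp
  \<comment> \<open>The coordinate \<open>i\<close> is chosen so that the completed square vanishes
    and only the Schur complement remains.\<close>
  define y where "y = x(i := - (\<Sum>k\<in>W. Q i k * x k) / Q i i)"
  have yk: "y k = x k" if "k \<in> W" for k using that i by (auto simp: y_def)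
  have s: "(\<Sum>k\<in>W. Q i k * y k) = (\<Sum>k\<in>W. Q i k * x k)" using yk by simp
  have "\<exists>k\<in>insert i W. y k \<noteq> 0" using x yk by auto
  then have "0 < (\<Sum>a\<in>insert i W. \<Sum>b\<in>insert i W. Q a b * y a * y b)" using pd unfolding pos_def_def by blast
  also have "\<dots> = Q i i * (y i + (\<Sum>k\<in>W. Q i k * y k) / Q i i)\<^sup>2 + (\<Sum>a\<in>W. \<Sum>b\<in>W. schur Q i a b * y a * y b)"
    by (rule complete_square[OF fin i sym]) (use q in auto)
  also have "y i + (\<Sum>k\<in>W. Q i k * y k) / Q i i = 0" unfolding s by (simp add: y_def)
  finally show "0 < (\<Sum>a\<in>W. \<Sum>b\<in>W. schur Q i a b * x a * x b)" using yk by simp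
qed

text \<open>Eliminate the leaf \<open>i\<close>. Row \<open>i\<close> of \<open>Q\<close> is zero
  except at \<open>i\<close> and \<open>j\<close>, so the equations for \<open>Q S\<close> give
  \<open>S i l\<close> as a fixed multiple of \<open>S j l\<close>, which is the product rule. The
  Schur complement changes \<open>Q\<close> at \<open>(j, j)\<close> only, hence keeps the zeros,
  and its product with \<open>S\<close> is again diagonal.\<close>

lemma gaussian_mult_tree:
  assumes "ltree W E" "\<And>a b. a \<in> W \<Longrightarrow> b \<in> W \<Longrightarrow> Q a b = Q b a" "pos_def W Q"
    and "\<And>a b. a \<in> W \<Longrightarrow> b \<in> W \<Longrightarrow> a \<noteq> b \<Longrightarrow> {a, b} \<notin> E \<Longrightarrow> Q a b = 0"
    and "\<And>a l. a \<in> W \<Longrightarrow> l \<in> W \<Longrightarrow> a \<noteq> l \<Longrightarrow> (\<Sum>k\<in>W. Q a k * S k l) = 0"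
    and "\<And>a b. S a b = S b a"
  shows "mult_tree S W E"
  using assms
proof (induction arbitrary: Q rule: ltree.induct)
  case (single v)
  show ?case by (rule mult_tree.single)
next
  case (add W E j i)
  have fin: "finite W" using ltree_edges[OF add.hyps(1)] by blast
  have q: "0 < Q i i" using pos_def_diag[OF add.prems(2)] fin by simp
  have nE: "{i, k} \<notin> E" for k using ltree_edges[OF add.hyps(1)] add.hyps(3) by (metis doubleton_eq_iff)
  have Qik: "Q i k = 0" if "k \<in> W" "k \<noteq> j" for k
    using add.prems(3)[of i k] that add.hyps(3) nE[of k] by (auto simp: doubleton_eq_iff)
  have row: "(\<Sum>k\<in>W. Q i k * z k) = Q i j * z j" for z :: "nat \<Rightarrow> real"
  proof -
    have "(\<Sum>k\<in>W. Q i k * z k) = (\<Sum>k\<in>W. if k = j then Q i j * z j else 0)"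
      using Qik by (intro sum.cong refl) auto
    then show ?thesis using fin add.hyps(2) by simp
  qed
  have Sil: "S i l = - (Q i j / Q i i) * S j l" if l: "l \<in> W" for l
  proof -
    have "i \<noteq> l" using l add.hyps(3) by blast
    then have "Q i i * S i l + Q i j * S j l = 0"
      using add.prems(4)[of i l] l row[of "\<lambda>k. S k l"] fin add.hyps(3) by simp
    then show ?thesis using q by (simp add: field_simps)
  qed
  have "mult_tree S W E"
  proof (rule add.IH[of "schur Q i"])
    show "schur Q i a b = schur Q i b a" if "a \<in> W" "b \<in> W" for a b
      using that add.prems(1)[of a b] add.prems(1)[of a i] add.prems(1)[of b i] by (simp add: schur_def)
    show "pos_def W (schur Q i)" by (rule pos_def_schur[OF add.prems(2) fin add.hyps(3) add.prems(1)])
    show "schur Q i a b = 0" if ab: "a \<in> W" "b \<in> W" "a \<noteq> b" "{a, b} \<notin> E" for a b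
    proof -
      have "{a, b} \<notin> insert {i, j} E" using ab add.hyps(3) by (auto simp: doubleton_eq_iff)
      then have "Q a b = 0" using add.prems(3) ab by blast
      moreover have "Q a i = 0 \<or> Q i b = 0" using Qik[of a] Qik[of b] add.prems(1)[of a i] ab by auto
      ultimately show ?thesis by (auto simp: schur_def)
    qed
    show "(\<Sum>k\<in>W. schur Q i a k * S k l) = 0" if al: "a \<in> W" "l \<in> W" "a \<noteq> l" for a l
    proof -
      have "(\<Sum>k\<in>W. schur Q i a k * S k l) = (\<Sum>k\<in>W. Q a k * S k l) - Q a i / Q i i * (\<Sum>k\<in>W. Q i k * S k l)"
        unfolding schur_def by (simp add: left_diff_distrib sum_subtractf sum_distrib_left mult.assoc)
      also have "\<dots> = (\<Sum>k\<in>W. Q a k * S k l) + Q a i * S i l"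
        unfolding row Sil[OF al(2)] by simp
      also have "\<dots> = 0" using add.prems(4)[of a l] al fin add.hyps(3) by simp
      finally show ?thesis .
    qed
    show "S a b = S b a" for a b by (rule add.prems(5))
  qed
  then show ?case
  proof (rule mult_tree.add[OF _ add.hyps(2,3)])
    show "S i l * S j j = S i j * S j l" if "l \<in> W" for l
      unfolding Sil[OF that] Sil[OF add.hyps(2)] by simp
  qed
qed

subsection \<open>Gaussian integrals\<close>

abbreviation leb :: "nat set \<Rightarrow> (nat \<Rightarrow> real) measure" where
  "leb W \<equiv> \<Pi>\<^sub>M i\<in>W. lborel"

interpretation lborel_product: product_sigma_finite "\<lambda>_::nat. lborel :: real measure"
  by standard

definition quad :: "nat set \<Rightarrow> (nat \<Rightarrow> nat \<Rightarrow> real) \<Rightarrow> (nat \<Rightarrow> real) \<Rightarrow> real" where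
  "quad W Q x = (\<Sum>a\<in>W. \<Sum>b\<in>W. Q a b * x a * x b)"

text \<open>With \<open>W\<close> the set of the other nodes,
  \<open>- row_sum W Q i x / Q i i\<close> is the conditional mean of coordinate \<open>i\<close>
  given the rest.\<close>

definition row_sum :: "nat set \<Rightarrow> (nat \<Rightarrow> nat \<Rightarrow> real) \<Rightarrow> nat \<Rightarrow> (nat \<Rightarrow> real) \<Rightarrow> real" where
  "row_sum W Q i x = (\<Sum>k\<in>W. Q i k * x k)"

lemma quad_measurable [measurable]: "quad W Q \<in> borel_measurable (leb W)"
  unfolding quad_def by measurable

lemma row_sum_measurable [measurable]: "U \<subseteq> W \<Longrightarrow> row_sum U Q i \<in> borel_measurable (leb W)"
  unfolding row_sum_def
  by (intro borel_measurable_sum borel_measurable_times borel_measurable_const) (auto intro!: measurable_component_singleton)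

lemma row_sum_upd: "i \<notin> W \<Longrightarrow> row_sum W Q a (y(i := t)) = row_sum W Q a y"
  unfolding row_sum_def by (intro sum.cong refl) auto

lemma gauss_kernel:
  assumes "0 < q"
  shows "exp (- (q * (t + s / q)\<^sup>2) / 2) = sqrt (2 * pi / q) * normal_density (- s / q) (1 / sqrt q) t"
proof -
  have "sqrt (2 * pi / q) * (1 / sqrt (2 * pi * (1 / sqrt q)\<^sup>2)) = 1"
    using assms by (simp add: power_divide real_sqrt_divide)
  moreover have "- (t - - s / q)\<^sup>2 / (2 * (1 / sqrt q)\<^sup>2) = - (q * (t + s / q)\<^sup>2) / 2"
    using assms by (simp add: power_divide)
  ultimately show ?thesis unfolding normal_density_def by (simp only: mult.assoc[symmetric] mult_1_left)
qed

context
  fixes q :: real assumes q: "0 < q"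
begin

lemma gauss_kernel_integrable:
  "integrable lborel (\<lambda>t. (t + s / q) ^ k * exp (- (q * (t + s / q)\<^sup>2) / 2))"
proof -
  have "integrable lborel (\<lambda>t. sqrt (2 * pi / q) * (normal_density (- s / q) (1 / sqrt q) t * (t - - s / q) ^ k))"
    using q by (intro integrable_mult_right integrable_normal_moment) simp
  then show ?thesis unfolding gauss_kernel[OF q] by (simp add: ac_simps)
qed

lemma gauss_kernel_integral:
  "(\<integral>t. exp (- (q * (t + s / q)\<^sup>2) / 2) \<partial>lborel) = sqrt (2 * pi / q)"
  "(\<integral>t. (t + s / q) * exp (- (q * (t + s / q)\<^sup>2) / 2) \<partial>lborel) = 0"
proof -
  have s: "0 < 1 / sqrt q" using q by simp
  show "(\<integral>t. exp (- (q * (t + s / q)\<^sup>2) / 2) \<partial>lborel) = sqrt (2 * pi / q)"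
    unfolding gauss_kernel[OF q] using integral_normal_density[OF s] by simp
  have "(\<integral>t. sqrt (2 * pi / q) * (normal_density (- s / q) (1 / sqrt q) t * (t - - s / q) ^ (2 * 0 + 1)) \<partial>lborel) = 0"
    using integral_normal_moment_odd[OF s, of "- s / q" 0] by simp
  then show "(\<integral>t. (t + s / q) * exp (- (q * (t + s / q)\<^sup>2) / 2) \<partial>lborel) = 0"
    unfolding gauss_kernel[OF q] by (simp add: ac_simps)
qed

lemma gauss_kernel_nn_integral:
  "(\<integral>\<^sup>+t. ennreal (exp (- (q * (t + s / q)\<^sup>2) / 2)) \<partial>lborel) = ennreal (sqrt (2 * pi / q))"
  using gauss_kernel_integrable[of s 0] gauss_kernel_integral(1)[of s]
  by (subst nn_integral_eq_integral) auto

text \<open>The weight of the half line \<open>t > 0\<close> as a function of the mean \<open>- s / q\<close>.\<close>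

definition half_weight :: "real \<Rightarrow> real" where
  "half_weight s = (\<integral>t. indicator {0<..} t * exp (- (q * (t + s / q)\<^sup>2) / 2) \<partial>lborel)"

lemma half_weight_integrable:
  "integrable lborel (\<lambda>t. indicator {0<..} t * exp (- (q * (t + s / q)\<^sup>2) / 2))"
proof -
  have "integrable lborel (\<lambda>t. indicator {0<..} t *\<^sub>R ((t + s / q) ^ 0 * exp (- (q * (t + s / q)\<^sup>2) / 2)))"
    by (rule integrable_mult_indicator[OF _ gauss_kernel_integrable]) simp
  then show ?thesis by (simp only: power_0 mult_1_left real_scaleR_def)
qed

text \<open>After the translation \<open>u = t + s / q\<close> the parameter \<open>s\<close> only
  moves the end of the half line. Monotonicity in \<open>s\<close> can then be read off.\<close>

lemma half_weight_shift:
  "half_weight s = (\<integral>u. indicator {s / q<..} u * exp (- (q * u\<^sup>2) / 2) \<partial>lborel)"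
  "integrable lborel (\<lambda>u. indicator {s / q<..} u * exp (- (q * u\<^sup>2) / 2))"
proof -
  have e: "(\<lambda>u. indicator {0<..} (- (s / q) + 1 * u) * exp (- (q * ((- (s / q) + 1 * u) + s / q)\<^sup>2) / 2)) =
      (\<lambda>u. indicator {s / q<..} u * exp (- (q * u\<^sup>2) / 2))"
    by (intro ext) (simp add: indicator_def)
  show "half_weight s = (\<integral>u. indicator {s / q<..} u * exp (- (q * u\<^sup>2) / 2) \<partial>lborel)"
    unfolding half_weight_def
    using lborel_integral_real_affine[of 1 "\<lambda>t. indicator {0<..} t * exp (- (q * (t + s / q)\<^sup>2) / 2)" "- (s / q)"]
    unfolding e by simp
  show "integrable lborel (\<lambda>u. indicator {s / q<..} u * exp (- (q * u\<^sup>2) / 2))"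
    using lborel_integrable_real_affine[OF half_weight_integrable[of s], of 1 "- (s / q)"] unfolding e by simp
qed

text \<open>The difference integrates a positive function over the interval from
  \<open>s / q\<close> to \<open>s' / q\<close>, which has positive length.\<close>

lemma half_weight_less:
  assumes "s < s'" shows "half_weight s' < half_weight s"
proof -
  define f where "f u = indicator {s / q<..} u * exp (- (q * u\<^sup>2) / 2) - indicator {s' / q<..} u * exp (- (q * u\<^sup>2) / 2)" for u
  have lt: "s / q < s' / q" using assms q by (simp add: divide_strict_right_mono)
  have int: "integrable lborel f" unfolding f_def by (intro Bochner_Integration.integrable_diff half_weight_shift)
  have nn: "0 \<le> f u" for u using lt by (auto simp: f_def indicator_def)
  have "(\<integral>u. f u \<partial>lborel) \<noteq> 0"
  proof
    assume "(\<integral>u. f u \<partial>lborel) = 0"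
    then have "AE u in lborel. f u = 0" using integral_nonneg_eq_0_iff_AE[OF int] nn by simp
    then have "AE u in lborel. u \<notin> {s / q<..<s' / q}"
    proof eventually_elim
      case (elim u)
      show ?case
      proof
        assume "u \<in> {s / q<..<s' / q}"
        then have "f u = exp (- (q * u\<^sup>2) / 2)" by (simp add: f_def)
        then show False using elim by simp
      qed
    qed
    then have "{s / q<..<s' / q} \<in> null_sets lborel" by (subst AE_iff_null_sets) auto
    then have "emeasure lborel {s / q<..<s' / q} = 0" by (rule null_setsD1)
    then show False using lt emeasure_lborel_Ioo[of "s / q" "s' / q"] q assms by simp
  qed
  moreover have "0 \<le> (\<integral>u. f u \<partial>lborel)" using nn by simp
  moreover have "(\<integral>u. f u \<partial>lborel) = half_weight s - half_weight s'"
    unfolding f_def half_weight_shift(1) by (intro Bochner_Integration.integral_diff half_weight_shift)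
  ultimately show ?thesis by linarith
qed

lemma half_weight_measurable [measurable]: "half_weight \<in> borel_measurable borel"
proof -
  have "mono (\<lambda>s. - half_weight s)"
    using half_weight_less by (intro monoI) (metis neg_le_iff_le order_le_less)
  then have "(\<lambda>s. - half_weight s) \<in> borel_measurable borel" by (rule borel_measurable_mono)
  then have "(\<lambda>s. - (- half_weight s)) \<in> borel_measurable borel" by (rule borel_measurable_uminus)
  then show ?thesis by simp
qed

lemma half_weight_bounds: "0 \<le> half_weight s" "half_weight s \<le> sqrt (2 * pi / q)"
proof -
  show "0 \<le> half_weight s" unfolding half_weight_def by (intro integral_nonneg_AE) auto
  have "half_weight s \<le> (\<integral>t. exp (- (q * (t + s / q)\<^sup>2) / 2) \<partial>lborel)"
    unfolding half_weight_def using gauss_kernel_integrable[of s 0]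
    by (intro integral_mono half_weight_integrable) (auto simp: indicator_def)
  then show "half_weight s \<le> sqrt (2 * pi / q)" unfolding gauss_kernel_integral(1) .
qed

text \<open>The kernel has total mass \<open>sqrt (2 * pi / q)\<close>, so the quotient is the
  conditional probability of the half line; subtracting it centres the indicator.\<close>

lemma half_weight_centered:
  "(\<integral>t. (indicator {0<..} t - half_weight s / sqrt (2 * pi / q)) * exp (- (q * (t + s / q)\<^sup>2) / 2) \<partial>lborel) = 0"
proof -
  have z: "sqrt (2 * pi / q) \<noteq> 0" using q by simp
  have "(\<integral>t. (indicator {0<..} t - half_weight s / sqrt (2 * pi / q)) * exp (- (q * (t + s / q)\<^sup>2) / 2) \<partial>lborel) =
      (\<integral>t. indicator {0<..} t * exp (- (q * (t + s / q)\<^sup>2) / 2) - half_weight s / sqrt (2 * pi / q) * exp (- (q * (t + s / q)\<^sup>2) / 2) \<partial>lborel)"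
    by (simp add: left_diff_distrib)
  also have "\<dots> = half_weight s - half_weight s / sqrt (2 * pi / q) * sqrt (2 * pi / q)"
    using half_weight_integrable[of s] gauss_kernel_integrable[of s 0] gauss_kernel_integral(1)[of s]
    by (subst Bochner_Integration.integral_diff) (auto simp: half_weight_def)
  finally show ?thesis using z by simp
qed

end

text \<open>The density as marginal of the remaining coordinates times conditional density of
  \<open>i\<close>, both without normalization.\<close>

lemma quad_split:
  assumes fin: "finite W" and i: "i \<notin> W" and sym: "\<And>a b. a \<in> insert i W \<Longrightarrow> b \<in> insert i W \<Longrightarrow> Q a b = Q b a"
    and q: "0 < Q i i"
  shows "exp (- quad (insert i W) Q (y(i := t)) / 2) =
    exp (- quad W (schur Q i) y / 2) * exp (- (Q i i * (t + row_sum W Q i y / Q i i)\<^sup>2) / 2)"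
proof -
  have "(\<Sum>k\<in>W. Q i k * (y(i := t)) k) = row_sum W Q i y"
    using row_sum_upd[OF i] unfolding row_sum_def by blast
  moreover have "(\<Sum>a\<in>W. \<Sum>b\<in>W. schur Q i a b * (y(i := t)) a * (y(i := t)) b) = quad W (schur Q i) y"
    unfolding quad_def using i by (intro sum.cong refl) auto
  ultimately have "quad (insert i W) Q (y(i := t)) =
      Q i i * (t + row_sum W Q i y / Q i i)\<^sup>2 + quad W (schur Q i) y"
    using complete_square[where Q = Q and x = "y(i := t)", OF fin i sym] q unfolding quad_def by simp
  then show ?thesis by (simp add: mult_exp_exp add_divide_distrib)
qed

text \<open>All coordinates except \<open>a\<close> are integrated out, each leaving a Schur
  complement and a constant factor, until a normal integral in \<open>a\<close> remains. With the
  weight \<open>1 + (x a)\<^sup>2\<close> first and second moments are dominated at once.\<close>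

lemma gauss_second_moment_finite:
  assumes "finite W" "a \<notin> W" "\<And>x y. x \<in> insert a W \<Longrightarrow> y \<in> insert a W \<Longrightarrow> Q x y = Q y x"
    and "pos_def (insert a W) Q"
  shows "(\<integral>\<^sup>+x. ennreal ((1 + (x a)\<^sup>2) * exp (- quad (insert a W) Q x / 2)) \<partial>leb (insert a W)) < \<infinity>"
  using assms
proof (induction W arbitrary: Q rule: finite_induct)
  case empty
  have q: "0 < Q a a" using pos_def_diag[OF empty(3)] by simp
  have "(\<integral>\<^sup>+x. ennreal ((1 + (x a)\<^sup>2) * exp (- quad {a} Q x / 2)) \<partial>leb {a}) =
      (\<integral>\<^sup>+t. ennreal ((1 + t\<^sup>2) * exp (- (Q a a * (t + 0 / Q a a)\<^sup>2) / 2)) \<partial>lborel)"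
    using lborel_product.product_nn_integral_singleton[of "\<lambda>t. ennreal ((1 + t\<^sup>2) * exp (- (Q a a * (t + 0 / Q a a)\<^sup>2) / 2))" a]
    by (simp add: quad_def power2_eq_square mult.assoc)
  also have "\<dots> < \<infinity>"
  proof -
    have "integrable lborel (\<lambda>t. (t + 0 / Q a a) ^ 0 * exp (- (Q a a * (t + 0 / Q a a)\<^sup>2) / 2) + (t + 0 / Q a a) ^ 2 * exp (- (Q a a * (t + 0 / Q a a)\<^sup>2) / 2))"
      by (intro Bochner_Integration.integrable_add gauss_kernel_integrable q)
    then have "integrable lborel (\<lambda>t. (1 + t\<^sup>2) * exp (- (Q a a * (t + 0 / Q a a)\<^sup>2) / 2))"
      by (simp add: distrib_right)
    then show ?thesis using nn_integral_eq_integral by (subst nn_integral_eq_integral) auto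
  qed
  finally show ?case by simp
next
  case (insert i W)
  have i: "i \<notin> insert a W" "i \<noteq> a" using insert by auto
  have pd: "pos_def (insert i (insert a W)) Q" using insert.prems(3) by (simp add: insert_commute)
  have sym: "Q x y = Q y x" if "x \<in> insert i (insert a W)" "y \<in> insert i (insert a W)" for x y
    using that insert.prems(2)[of x y] by (simp add: insert_commute)
  have q: "0 < Q i i" using pos_def_diag[OF pd] insert by simp
  have fin: "finite (insert a W)" using insert by simp
  let ?c = "ennreal (sqrt (2 * pi / Q i i))"
  have mf: "(\<lambda>x. ennreal ((1 + (x a)\<^sup>2) * exp (- quad (insert i (insert a W)) Q x / 2))) \<in> borel_measurable (leb (insert i (insert a W)))"
    by measurable
  have qs: "exp (- quad (insert i (insert a W)) Q (y(i := t)) / 2) = exp (- quad (insert a W) (schur Q i) y / 2) *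
      exp (- (Q i i * (t + row_sum (insert a W) Q i y / Q i i)\<^sup>2) / 2)" for y t
    by (rule quad_split[where Q = Q, OF fin i(1) _ q]) (rule sym)
  have "(\<integral>\<^sup>+x. ennreal ((1 + (x a)\<^sup>2) * exp (- quad (insert i (insert a W)) Q x / 2)) \<partial>leb (insert i (insert a W))) =
      (\<integral>\<^sup>+y. (\<integral>\<^sup>+t. ennreal ((1 + ((y(i := t)) a)\<^sup>2) * exp (- quad (insert i (insert a W)) Q (y(i := t)) / 2)) \<partial>lborel) \<partial>leb (insert a W))"
    by (rule lborel_product.product_nn_integral_insert[OF fin i(1) mf])
  also have "\<dots> = (\<integral>\<^sup>+y. ennreal ((1 + (y a)\<^sup>2) * exp (- quad (insert a W) (schur Q i) y / 2)) * ?c \<partial>leb (insert a W))"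
  proof (rule nn_integral_cong)
    fix y
    have "(\<integral>\<^sup>+t. ennreal ((1 + ((y(i := t)) a)\<^sup>2) * exp (- quad (insert i (insert a W)) Q (y(i := t)) / 2)) \<partial>lborel) =
        (\<integral>\<^sup>+t. ennreal ((1 + (y a)\<^sup>2) * exp (- quad (insert a W) (schur Q i) y / 2)) *
          ennreal (exp (- (Q i i * (t + row_sum (insert a W) Q i y / Q i i)\<^sup>2) / 2)) \<partial>lborel)"
      unfolding qs using i(2)
      by (intro nn_integral_cong) (simp add: ennreal_mult[symmetric] mult.assoc)
    also have "\<dots> = ennreal ((1 + (y a)\<^sup>2) * exp (- quad (insert a W) (schur Q i) y / 2)) * ?c"
      using gauss_kernel_nn_integral[OF q] by (subst nn_integral_cmult) auto
    finally show "(\<integral>\<^sup>+t. ennreal ((1 + ((y(i := t)) a)\<^sup>2) * exp (- quad (insert i (insert a W)) Q (y(i := t)) / 2)) \<partial>lborel) = \<dots>" .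
  qed
  also have "\<dots> = (\<integral>\<^sup>+y. ennreal ((1 + (y a)\<^sup>2) * exp (- quad (insert a W) (schur Q i) y / 2)) \<partial>leb (insert a W)) * ?c"
    by (rule nn_integral_multc) measurable
  also have "\<dots> < \<infinity>"
  proof -
    have "(\<integral>\<^sup>+y. ennreal ((1 + (y a)\<^sup>2) * exp (- quad (insert a W) (schur Q i) y / 2)) \<partial>leb (insert a W)) < \<infinity>"
    proof (rule insert.IH)
      show "a \<notin> W" using insert by simp
      show "pos_def (insert a W) (schur Q i)" by (rule pos_def_schur[OF pd fin i(1) sym])
      show "schur Q i x y = schur Q i y x" if "x \<in> insert a W" "y \<in> insert a W" for x y
        using that sym[of x y] sym[of x i] sym[of y i] by (simp add: schur_def)
    qed
    then show ?thesis by (simp add: ennreal_mult_less_top)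
  qed
  finally show ?case by (simp add: insert_commute)
qed

section \<open>Integrals against a fixed Gaussian density\<close>

context
  fixes W :: "nat set" and Q :: "nat \<Rightarrow> nat \<Rightarrow> real"
  assumes fin: "finite W" and sym: "\<And>a b. a \<in> W \<Longrightarrow> b \<in> W \<Longrightarrow> Q a b = Q b a" and pd: "pos_def W Q"
begin

lemma gauss_second_moment_integrable:
  assumes "a \<in> W"
  shows "integrable (leb W) (\<lambda>x. (1 + (x a)\<^sup>2) * exp (- quad W Q x / 2))"
proof (rule integrableI_bounded)
  have W: "insert a (W - {a}) = W" using assms by blast
  show "(\<lambda>x. (1 + (x a)\<^sup>2) * exp (- quad W Q x / 2)) \<in> borel_measurable (leb W)"
    using assms by measurable
  have "(\<integral>\<^sup>+x. ennreal ((1 + (x a)\<^sup>2) * exp (- quad W Q x / 2)) \<partial>leb W) < \<infinity>"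
    using gauss_second_moment_finite[of "W - {a}" a Q] fin sym pd unfolding W by blast
  moreover have "ennreal (norm ((1 + (x a)\<^sup>2) * exp (- quad W Q x / 2))) = ennreal ((1 + (x a)\<^sup>2) * exp (- quad W Q x / 2))" for x
    by (simp add: abs_mult)
  ultimately show "(\<integral>\<^sup>+x. ennreal (norm ((1 + (x a)\<^sup>2) * exp (- quad W Q x / 2))) \<partial>leb W) < \<infinity>" by simp
qed

lemma gauss_dominated:
  assumes "a \<in> W" "b \<in> W" and f: "f \<in> borel_measurable (leb W)"
    and bnd: "\<And>x. \<bar>f x\<bar> \<le> C * (2 + (x a)\<^sup>2 + (x b)\<^sup>2)"
  shows "integrable (leb W) (\<lambda>x. f x * exp (- quad W Q x / 2))"
proof (rule Bochner_Integration.integrable_bound)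
  show "integrable (leb W) (\<lambda>x. C * ((1 + (x a)\<^sup>2) * exp (- quad W Q x / 2) + (1 + (x b)\<^sup>2) * exp (- quad W Q x / 2)))"
    by (intro integrable_mult_right Bochner_Integration.integrable_add gauss_second_moment_integrable assms)
  show "(\<lambda>x. f x * exp (- quad W Q x / 2)) \<in> borel_measurable (leb W)" using f by measurable
  show "AE x in leb W. norm (f x * exp (- quad W Q x / 2)) \<le>
      norm (C * ((1 + (x a)\<^sup>2) * exp (- quad W Q x / 2) + (1 + (x b)\<^sup>2) * exp (- quad W Q x / 2)))"
  proof (rule AE_I2)
    fix x
    have "norm (f x * exp (- quad W Q x / 2)) = \<bar>f x\<bar> * exp (- quad W Q x / 2)" by (simp add: abs_mult)
    also have "\<dots> \<le> C * (2 + (x a)\<^sup>2 + (x b)\<^sup>2) * exp (- quad W Q x / 2)"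
      using bnd[of x] by (intro mult_right_mono) auto
    also have "\<dots> = C * ((1 + (x a)\<^sup>2) * exp (- quad W Q x / 2) + (1 + (x b)\<^sup>2) * exp (- quad W Q x / 2))"
      by (simp add: algebra_simps)
    also have "\<dots> \<le> norm \<dots>" by simp
    finally show "norm (f x * exp (- quad W Q x / 2)) \<le>
      norm (C * ((1 + (x a)\<^sup>2) * exp (- quad W Q x / 2) + (1 + (x b)\<^sup>2) * exp (- quad W Q x / 2)))" .
  qed
qed

lemma abs_mult_le_squares: "\<bar>u * v\<bar> \<le> 2 + u\<^sup>2 + v\<^sup>2" for u v :: real
proof -
  have "0 \<le> (\<bar>u\<bar> - \<bar>v\<bar>)\<^sup>2" by simp
  then have "2 * (\<bar>u\<bar> * \<bar>v\<bar>) \<le> u\<^sup>2 + v\<^sup>2" by (simp add: power2_diff)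
  moreover have "0 \<le> \<bar>u\<bar> * \<bar>v\<bar>" by simp
  ultimately have "\<bar>u\<bar> * \<bar>v\<bar> \<le> 2 + u\<^sup>2 + v\<^sup>2" by argo
  then show ?thesis by (simp add: abs_mult)
qed

lemma gauss_integrable:
  assumes "a \<in> W" "b \<in> W"
  shows "integrable (leb W) (\<lambda>x. x a * x b * exp (- quad W Q x / 2))"
    and "integrable (leb W) (\<lambda>x. x a * exp (- quad W Q x / 2))"
proof -
  show "integrable (leb W) (\<lambda>x. x a * x b * exp (- quad W Q x / 2))"
  proof (rule gauss_dominated[OF assms, of _ 1])
    show "(\<lambda>x. x a * x b) \<in> borel_measurable (leb W)" using assms by measurable
    show "\<bar>x a * x b\<bar> \<le> 1 * (2 + (x a)\<^sup>2 + (x b)\<^sup>2)" for x :: "nat \<Rightarrow> real"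
      using abs_mult_le_squares[of "x a" "x b"] by simp
  qed
  show "integrable (leb W) (\<lambda>x. x a * exp (- quad W Q x / 2))"
  proof (rule gauss_dominated[OF assms, of _ 1])
    show "(\<lambda>x. x a) \<in> borel_measurable (leb W)" using assms by measurable
    show "\<bar>x a\<bar> \<le> 1 * (2 + (x a)\<^sup>2 + (x b)\<^sup>2)" for x :: "nat \<Rightarrow> real"
    proof -
      have "0 \<le> (\<bar>x a\<bar> - 1)\<^sup>2" by simp
      then have "2 * \<bar>x a\<bar> \<le> (x a)\<^sup>2 + 1" by (simp add: power2_diff)
      moreover have "0 \<le> (x a)\<^sup>2" "0 \<le> (x b)\<^sup>2" by simp_all
      ultimately have "\<bar>x a\<bar> \<le> 2 + (x a)\<^sup>2 + (x b)\<^sup>2" by argo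
      then show ?thesis by simp
    qed
  qed
qed

text \<open>Average first over coordinate \<open>i\<close> with the others fixed: by
  \<open>quad_split\<close> the density factors, and the inner integral is assumed to vanish. Used
  for the normal equations and for the events in \<open>precision_zero\<close>.\<close>

lemma gauss_fubini_zero:
  assumes i: "i \<in> W" and int: "integrable (leb W) (\<lambda>x. g x * exp (- quad W Q x / 2))"
    and inner: "\<And>y. y \<in> space (leb (W - {i})) \<Longrightarrow>
      (\<integral>t. g (y(i := t)) * exp (- (Q i i * (t + row_sum (W - {i}) Q i y / Q i i)\<^sup>2) / 2) \<partial>lborel) = 0"
  shows "(\<integral>x. g x * exp (- quad W Q x / 2) \<partial>leb W) = 0"
proof -
  have W: "insert i (W - {i}) = W" and nin: "i \<notin> W - {i}" and fin': "finite (W - {i})" using i fin by auto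
  have q: "0 < Q i i" using pos_def_diag[OF pd fin i] .
  have qs: "exp (- quad W Q (y(i := t)) / 2) = exp (- quad (W - {i}) (schur Q i) y / 2) *
      exp (- (Q i i * (t + row_sum (W - {i}) Q i y / Q i i)\<^sup>2) / 2)" for y t
    using quad_split[where Q = Q, OF fin' nin _ q] sym unfolding W by simp
  have "(\<integral>x. g x * exp (- quad W Q x / 2) \<partial>leb W) =
      (\<integral>y. (\<integral>t. g (y(i := t)) * exp (- quad W Q (y(i := t)) / 2) \<partial>lborel) \<partial>leb (W - {i}))"
    using lborel_product.product_integral_insert[OF fin' nin, of "\<lambda>x. g x * exp (- quad W Q x / 2)"] int
    unfolding W by simp
  also have "\<dots> = (\<integral>y. 0 \<partial>leb (W - {i}))"
  proof (rule Bochner_Integration.integral_cong[OF refl])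
    fix y assume y: "y \<in> space (leb (W - {i}))"
    have "(\<integral>t. g (y(i := t)) * exp (- quad W Q (y(i := t)) / 2) \<partial>lborel) =
        (\<integral>t. exp (- quad (W - {i}) (schur Q i) y / 2) *
          (g (y(i := t)) * exp (- (Q i i * (t + row_sum (W - {i}) Q i y / Q i i)\<^sup>2) / 2)) \<partial>lborel)"
      unfolding qs by (simp add: ac_simps)
    also have "\<dots> = 0" using inner[OF y] by simp
    finally show "(\<integral>t. g (y(i := t)) * exp (- quad W Q (y(i := t)) / 2) \<partial>lborel) = 0" .
  qed
  finally show ?thesis by simp
qed

text \<open>Row \<open>i\<close> of \<open>Q\<close> applied to \<open>x\<close> is
  \<open>Q i i\<close> times the deviation of \<open>x i\<close> from its conditional mean. It
  averages to zero against any \<open>g\<close> that ignores coordinate \<open>i\<close>; the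
  constant yields the means, a coordinate \<open>x l\<close> the covariances.\<close>

lemma gauss_normal_equation:
  assumes i: "i \<in> W" and g: "g = (\<lambda>x. 1) \<or> (\<exists>l\<in>W. l \<noteq> i \<and> g = (\<lambda>x. x l))"
  shows "(\<Sum>k\<in>W. Q i k * (\<integral>x. x k * g x * exp (- quad W Q x / 2) \<partial>leb W)) = 0"
proof -
  have q: "0 < Q i i" using pos_def_diag[OF pd fin i] .
  have int: "integrable (leb W) (\<lambda>x. x k * g x * exp (- quad W Q x / 2))" if "k \<in> W" for k
    using g
  proof (elim disjE bexE conjE)
    assume g1: "g = (\<lambda>x. 1)"
    show ?thesis unfolding g1 mult_1_right by (rule gauss_integrable(2)[OF that that])
  next
    fix l assume l: "l \<in> W" and gl: "g = (\<lambda>x. x l)"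
    show ?thesis unfolding gl by (rule gauss_integrable(1)[OF that l])
  qed
  have gi: "\<exists>c. \<forall>t. g (y(i := t)) = c" for y
    using g
  proof (elim disjE bexE conjE)
    fix l assume l: "l \<noteq> i" and gl: "g = (\<lambda>x. x l)"
    show ?thesis unfolding gl using l by simp
  next
    assume g1: "g = (\<lambda>x. 1)"
    show ?thesis unfolding g1 by simp
  qed
  have e: "row_sum W Q i x * g x * exp (- quad W Q x / 2) = (\<Sum>k\<in>W. Q i k * (x k * g x * exp (- quad W Q x / 2)))" for x
    unfolding row_sum_def sum_distrib_right by (simp add: mult.assoc)
  have "(\<integral>x. row_sum W Q i x * g x * exp (- quad W Q x / 2) \<partial>leb W) =
      (\<Sum>k\<in>W. (\<integral>x. Q i k * (x k * g x * exp (- quad W Q x / 2)) \<partial>leb W))"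
    unfolding e by (rule Bochner_Integration.integral_sum) (rule integrable_mult_right, rule int)
  then have "(\<Sum>k\<in>W. Q i k * (\<integral>x. x k * g x * exp (- quad W Q x / 2) \<partial>leb W)) =
      (\<integral>x. row_sum W Q i x * g x * exp (- quad W Q x / 2) \<partial>leb W)" by simp
  also have "\<dots> = 0"
  proof (rule gauss_fubini_zero[OF i])
    show "integrable (leb W) (\<lambda>x. row_sum W Q i x * g x * exp (- quad W Q x / 2))"
      unfolding e by (intro Bochner_Integration.integrable_sum integrable_mult_right int)
    fix y
    have rs: "row_sum W Q i (y(i := t)) = Q i i * (t + row_sum (W - {i}) Q i y / Q i i)" for t
    proof -
      have "row_sum W Q i (y(i := t)) = Q i i * t + row_sum (W - {i}) Q i (y(i := t))"
        unfolding row_sum_def using sum.remove[OF fin i, of "\<lambda>k. Q i k * (y(i := t)) k"] by simp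
      also have "row_sum (W - {i}) Q i (y(i := t)) = row_sum (W - {i}) Q i y" by (rule row_sum_upd) simp
      finally show ?thesis using q by (simp add: distrib_left del: fun_upd_apply)
    qed
    obtain c where c: "\<And>t. g (y(i := t)) = c" using gi by metis
    let ?e = "\<lambda>t. exp (- (Q i i * (t + row_sum (W - {i}) Q i y / Q i i)\<^sup>2) / 2)"
    have "(\<integral>t. row_sum W Q i (y(i := t)) * g (y(i := t)) * ?e t \<partial>lborel) =
        (\<integral>t. (Q i i * c) * ((t + row_sum (W - {i}) Q i y / Q i i) * ?e t) \<partial>lborel)"
      unfolding rs c by (simp only: mult.assoc mult.left_commute mult.commute)
    also have "\<dots> = 0" using gauss_kernel_integral(2)[OF q] by simp
    finally show "(\<integral>t. row_sum W Q i (y(i := t)) * g (y(i := t)) * ?e t \<partial>lborel) = 0" .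
  qed
  finally show ?thesis .
qed

end

section \<open>Covariances and zeros of the precision matrix\<close>

lemma half_line_not_null:
  fixes a b :: real assumes "a \<noteq> 0"
  shows "emeasure lborel {t. 0 < b + a * t} \<noteq> 0"
proof -
  define I where "I = (if a > 0 then {- b / a<..<- b / a + 1} else {- b / a - 1<..<- b / a})"
  have "I \<subseteq> {t. 0 < b + a * t}"
  proof
    fix t assume t: "t \<in> I"
    have "0 < a * (t - (- b / a))"
      using t assms by (cases "a > 0") (auto simp: I_def zero_less_mult_iff)
    also have "a * (t - (- b / a)) = b + a * t" using assms by (simp add: field_simps)
    finally show "t \<in> {t. 0 < b + a * t}" by simp
  qed
  moreover have "{t. 0 < b + a * t} \<in> sets lborel" by measurable
  ultimately have "emeasure lborel I \<le> emeasure lborel {t. 0 < b + a * t}" by (intro emeasure_mono)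
  moreover have "emeasure lborel I = 1" by (simp add: I_def)
  ultimately show ?thesis by auto
qed

context
  fixes p :: distribution and W :: "nat set" and Q :: "nat \<Rightarrow> nat \<Rightarrow> real" and c :: real
  assumes fin: "finite W" and sym: "\<And>a b. a \<in> W \<Longrightarrow> b \<in> W \<Longrightarrow> Q a b = Q b a" and pd: "pos_def W Q"
    and prob: "prob_space p" and p: "p = density (leb W) (\<lambda>x. ennreal (c * exp (- quad W Q x / 2)))"
begin

interpretation prob_space p by (rule prob)

lemma c_pos: "0 < c"
proof (rule ccontr)
  assume "\<not> 0 < c"
  then have "c * exp (- quad W Q x / 2) \<le> 0" for x by (simp add: mult_nonpos_nonneg)
  then have z: "ennreal (c * exp (- quad W Q x / 2)) = 0" for x by (simp add: ennreal_neg)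
  have "emeasure p (space p) = 0" unfolding p z by (simp add: emeasure_density)
  then show False using emeasure_space_1 by simp
qed

lemma space_p: "space p = (\<Pi>\<^sub>E i\<in>W. UNIV)"
  unfolding p by (simp add: space_PiM)

lemma measurable_p: "f \<in> borel_measurable p \<longleftrightarrow> f \<in> borel_measurable (leb W)"
  unfolding p by simp

lemma integral_p:
  assumes "f \<in> borel_measurable (leb W)"
  shows "(\<integral>x. f x \<partial>p) = c * (\<integral>x. f x * exp (- quad W Q x / 2) \<partial>leb W)"
    and "integrable p f \<longleftrightarrow> integrable (leb W) (\<lambda>x. f x * exp (- quad W Q x / 2))"
proof -
  have nn: "AE x in leb W. 0 \<le> c * exp (- quad W Q x / 2)" using c_pos by simp
  have eq: "c * exp (- quad W Q x / 2) * f x = c * (f x * exp (- quad W Q x / 2))" for x by (simp only: mult.commute mult.left_commute)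
  have m: "(\<lambda>x. c * exp (- quad W Q x / 2)) \<in> borel_measurable (leb W)" by measurable
  show "(\<integral>x. f x \<partial>p) = c * (\<integral>x. f x * exp (- quad W Q x / 2) \<partial>leb W)"
    unfolding p integral_density[OF assms m nn] real_scaleR_def eq by simp
  show "integrable p f \<longleftrightarrow> integrable (leb W) (\<lambda>x. f x * exp (- quad W Q x / 2))"
    unfolding p integrable_density[OF assms m nn] real_scaleR_def eq using c_pos by simp
qed

lemma coord_leb: "a \<in> W \<Longrightarrow> (\<lambda>x. x a) \<in> borel_measurable (leb W)"
  by measurable

text \<open>The vector \<open>\<mu>\<close> of unnormalized means solves \<open>Q \<mu> = 0\<close>,
  so the quadratic form vanishes at \<open>\<mu>\<close>, and positive definiteness gives
  \<open>\<mu> = 0\<close>.\<close>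

lemma mean_zero:
  assumes "a \<in> W" shows "mean p a = 0"
proof -
  define \<mu> where "\<mu> k = (\<integral>x. x k * 1 * exp (- quad W Q x / 2) \<partial>leb W)" for k
  have ne: "(\<Sum>k\<in>W. Q i k * \<mu> k) = 0" if "i \<in> W" for i
    unfolding \<mu>_def using gauss_normal_equation[OF fin sym pd that, of "\<lambda>x. 1"] by simp
  have "(\<Sum>i\<in>W. \<Sum>k\<in>W. Q i k * \<mu> i * \<mu> k) = (\<Sum>i\<in>W. \<mu> i * (\<Sum>k\<in>W. Q i k * \<mu> k))"
    by (simp add: sum_distrib_left ac_simps)
  also have "\<dots> = 0" using ne by simp
  finally have "\<not> (\<exists>i\<in>W. \<mu> i \<noteq> 0)" using pd[unfolded pos_def_def, rule_format, of \<mu>] by force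
  then have "\<mu> a = 0" using assms by blast
  then show ?thesis
    unfolding mean_def using integral_p(1)[OF coord_leb[OF assms]] by (simp add: \<mu>_def)
qed

lemma cov_eq:
  assumes "a \<in> W" "b \<in> W"
  shows "cov p a b = c * (\<integral>x. x a * x b * exp (- quad W Q x / 2) \<partial>leb W)"
  unfolding cov_def mean_zero[OF assms(1)] mean_zero[OF assms(2)] diff_zero
  by (rule integral_p(1)) (use coord_leb assms in measurable)

lemma cov_normal_equation:
  assumes "a \<in> W" "l \<in> W" "a \<noteq> l"
  shows "(\<Sum>k\<in>W. Q a k * cov p k l) = 0"
proof -
  have "(\<Sum>k\<in>W. Q a k * cov p k l) = c * (\<Sum>k\<in>W. Q a k * (\<integral>x. x k * x l * exp (- quad W Q x / 2) \<partial>leb W))"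
    unfolding sum_distrib_left using cov_eq[OF _ assms(2)] by (intro sum.cong refl) (simp add: mult.left_commute)
  also have "\<dots> = 0"
  proof -
    have "\<exists>l'\<in>W. l' \<noteq> a \<and> (\<lambda>x :: nat \<Rightarrow> real. x l) = (\<lambda>x. x l')" by (rule bexI[of _ l]) (use assms in auto)
    from gauss_normal_equation[OF fin sym pd assms(1) disjI2[OF this]] show ?thesis by simp
  qed
  finally show ?thesis .
qed

lemma coord_algebra_subalgebra:
  assumes "C \<subseteq> W" shows "subalgebra p (coord_algebra p C)"
proof -
  have "(\<lambda>x. restrict x C) \<in> measurable p (\<Pi>\<^sub>M i\<in>C. borel)"
  proof (rule measurable_restrict)
    fix i assume "i \<in> C"
    then show "(\<lambda>x. x i) \<in> borel_measurable p" using assms coord_leb measurable_p by blast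
  qed
  then have "sets (vimage_algebra (space p) (\<lambda>x. restrict x C) (\<Pi>\<^sub>M i\<in>C. borel)) \<subseteq> sets p"
    by (intro sets_image_in_sets) auto
  then show ?thesis by (simp add: subalgebra_def coord_algebra_def)
qed

lemma coord_algebra_measurable:
  assumes "k \<in> C" shows "(\<lambda>x. x k) \<in> borel_measurable (coord_algebra p C)"
proof -
  have "(\<lambda>x. restrict x C) \<in> measurable (coord_algebra p C) (\<Pi>\<^sub>M i\<in>C. borel)"
    unfolding coord_algebra_def by (intro measurable_vimage_algebra1) (auto simp: space_PiM)
  then have "(\<lambda>x. (restrict x C) k) \<in> borel_measurable (coord_algebra p C)"
    using measurable_component_singleton[OF assms] by (rule measurable_compose)
  then show ?thesis using assms by simp
qed

lemma coord_algebra_space: "space (coord_algebra p C) = space p"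
  by (simp add: coord_algebra_def)

lemma coord_algebra_upd:
  assumes A: "A \<in> sets (coord_algebra p C)" and k: "k \<notin> C" "k \<in> W" and x: "x \<in> space p"
  shows "x(k := t) \<in> A \<longleftrightarrow> x \<in> A"
proof -
  have x': "x(k := t) \<in> space p" using x k(2) unfolding space_p by (auto simp: PiE_iff extensional_def)
  have r: "restrict (x(k := t)) C = restrict x C" using k(1) by (auto simp: restrict_def)
  obtain B where "A = (\<lambda>x. restrict x C) -` B \<inter> space p"
    using A unfolding coord_algebra_def by (subst (asm) sets_vimage_algebra2) (auto simp: space_PiM)
  then show ?thesis using r x x' by simp
qed

text \<open>Given all other variables, the probability of \<open>X\<^sub>i > 0\<close> is a strictly decreasing function of the
  linear form \<open>row_sum (W - {i}) Q i\<close>. Conditional independence makes it a function of the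
  neighbours only, so the form cannot involve the remaining variables.\<close>

lemma precision_zero:
  assumes i: "i \<in> W" and N: "N \<subseteq> W - {i}" and k: "k \<in> W - {i} - N"
    and ci: "cond_indep p {i} (W - {i} - N) N"
  shows "Q i k = 0"
proof (rule ccontr)
  assume Qk: "Q i k \<noteq> 0"
  define R where "R = W - {i} - N"
  define C where "C = coord_algebra p N"
  have q: "0 < Q i i" using pos_def_diag[OF pd fin i] .
  define z where "z = sqrt (2 * pi / Q i i)"
  have z: "0 < z" using q by (simp add: z_def)
  \<comment> \<open>For the linear form \<open>s\<close> below, \<open>h (s x)\<close> is the
    conditional probability of \<open>X_i > 0\<close> given all other coordinates, \<open>z\<close>
    being the mass of the kernel.\<close>
  define h where "h s = half_weight (Q i i) s / z" for s
  have h_less: "s < s' \<Longrightarrow> h s' < h s" for s s'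
    using half_weight_less[OF q] z by (simp add: h_def divide_strict_right_mono)
  have h_bd: "0 \<le> h s" "h s \<le> 1" for s using half_weight_bounds[OF q, of s] z by (simp_all add: h_def z_def)
  have h_meas [measurable]: "h \<in> borel_measurable borel"
    unfolding h_def using half_weight_measurable[OF q] by measurable
  define s where "s = row_sum (W - {i}) Q i"
  define sN where "sN = row_sum N Q i"
  define sR where "sR = row_sum R Q i"
  have s_eq: "s x = sN x + sR x" for x
  proof -
    have "W - {i} = N \<union> R" "N \<inter> R = {}" using N by (auto simp: R_def)
    moreover have "finite N" "finite R" using fin N finite_subset by (auto simp: R_def)
    ultimately show ?thesis unfolding s_def sN_def sR_def row_sum_def by (simp add: sum.union_disjoint)
  qed
  have [measurable]: "s \<in> borel_measurable (leb W)" "sN \<in> borel_measurable (leb W)" "sR \<in> borel_measurable (leb W)"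
    unfolding s_def sN_def sR_def using N by (auto intro!: row_sum_measurable simp: R_def)
  have NW: "N \<subseteq> W" "R \<subseteq> W" "{i} \<subseteq> W" "k \<in> R" "k \<in> W" "k \<notin> N" "k \<noteq> i" "i \<notin> N" "i \<notin> R"
    using N k i by (auto simp: R_def)
  have sub: "subalgebra p C" unfolding C_def by (rule coord_algebra_subalgebra[OF NW(1)])
  interpret C: finite_measure_subalgebra p C by unfold_locales (rule sub)
  define S where "S = {x \<in> space p. 0 < x i}"
  have S_i: "S \<in> sets (coord_algebra p {i})"
  proof -
    have "(\<lambda>x. x i) -` {0<..} \<inter> space (coord_algebra p {i}) \<in> sets (coord_algebra p {i})"
      by (rule measurable_sets[OF coord_algebra_measurable]) auto
    moreover have "(\<lambda>x. x i) -` {0<..} \<inter> space (coord_algebra p {i}) = S"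
      unfolding coord_algebra_space S_def by auto
    ultimately show ?thesis by simp
  qed
  have S_p: "S \<in> sets p" using coord_algebra_subalgebra[OF NW(3)] S_i unfolding subalgebra_def by blast
  define g where "g = real_cond_exp p C (indicator S)"
  have g_C: "g \<in> borel_measurable C" unfolding g_def by measurable
  have int_S: "integrable p (indicator S :: _ \<Rightarrow> real)" using S_p by (simp add: integrable_indicator_iff emeasure_finite less_top[symmetric])
  have g_int: "integrable p g" unfolding g_def by (rule C.real_cond_exp_int(1)[OF int_S])
  have g_p: "g \<in> borel_measurable p" using g_int by (rule borel_measurable_integrable)
  have sN_C: "sN \<in> borel_measurable C"
    unfolding sN_def row_sum_def C_def
    by (intro borel_measurable_sum borel_measurable_times borel_measurable_const coord_algebra_measurable)
  \<comment> \<open>\<open>A\<close> and its complement \<open>B\<close> are determined by the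
    neighbours. On \<open>A\<close> the conditional probability \<open>g\<close> exceeds
    \<open>h\<close> at the neighbours' share \<open>sN\<close> of the form, on \<open>B\<close> it
    does not. A positive remainder \<open>sR\<close> lowers \<open>h (s x)\<close>, a negative one
    raises it, so the sign of the difference between \<open>g x\<close> and \<open>h (s x)\<close>
    is known on \<open>A\<close> where \<open>sR\<close> is positive and on \<open>B\<close> where
    it is negative.\<close>
  define A where "A = {x \<in> space p. h (sN x) < g x}"
  have A_C: "A \<in> sets C"
  proof -
    have "{x \<in> space C. h (sN x) < g x} \<in> sets C"
      using g_C measurable_compose[OF sN_C h_meas] by (rule borel_measurable_less[rotated])
    then show ?thesis by (simp add: A_def C_def coord_algebra_space)
  qed
  define B where "B = space p - A"
  have B_C: "B \<in> sets C" using sets.compl_sets[OF A_C] by (simp add: B_def C_def coord_algebra_space)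
  have C_p: "X \<in> sets p" if "X \<in> sets C" for X using sub that unfolding subalgebra_def by blast
  define \<sigma> :: "bool \<Rightarrow> real" where "\<sigma> b = (if b then 1 else -1)" for b
  define H where "H b = {x \<in> space p. 0 < \<sigma> b * sR x}" for b
  have H_R: "H b \<in> sets (coord_algebra p R)" for b
  proof -
    have "sR \<in> borel_measurable (coord_algebra p R)"
      unfolding sR_def row_sum_def
      by (intro borel_measurable_sum borel_measurable_times borel_measurable_const coord_algebra_measurable)
    then have "(\<lambda>x. \<sigma> b * sR x) \<in> borel_measurable (coord_algebra p R)" by (intro borel_measurable_times borel_measurable_const)
    then have "{x \<in> space (coord_algebra p R). 0 < \<sigma> b * sR x} \<in> sets (coord_algebra p R)"
      by (intro borel_measurable_less borel_measurable_const)
    then show ?thesis by (simp add: H_def coord_algebra_space)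
  qed
  have H_p: "H b \<in> sets p" for b using coord_algebra_subalgebra[OF NW(2)] H_R unfolding subalgebra_def by blast
  \<comment> \<open>Conditional independence: against events over \<open>N\<close> and the events
    \<open>H b\<close>, the indicator of \<open>S\<close> may be replaced by
    \<open>g\<close>.\<close>
  have indep: "(\<integral>x. indicator X x * indicator (H b) x * indicator S x \<partial>p) = (\<integral>x. indicator X x * indicator (H b) x * g x \<partial>p)"
    if X: "X \<in> sets C" for X b
  proof -
    define r where "r = real_cond_exp p C (indicator (H b))"
    have ae: "AE x in p. real_cond_exp p C (indicator (S \<inter> H b)) x = g x * r x"
      using ci S_i H_R[of b] unfolding cond_indep_def R_def[symmetric] C_def[symmetric] g_def r_def by blast
    have iX [measurable]: "indicator X \<in> borel_measurable C" using X by simp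
    have mX [measurable]: "indicator X \<in> borel_measurable p" "indicator (H b) \<in> borel_measurable p"
      "indicator S \<in> borel_measurable p" "indicator (S \<inter> H b) \<in> borel_measurable p"
      using C_p[OF X] H_p[of b] S_p by auto
    have i1: "integrable p (\<lambda>x. indicator X x * indicator (S \<inter> H b) x :: real)"
      by (rule integrable_const_bound[where B = 1], rule AE_I2, simp split: split_indicator, measurable)
    have i2: "integrable p (\<lambda>x. indicator X x * g x * indicator (H b) x)"
      by (rule Bochner_Integration.integrable_bound[OF g_int], intro borel_measurable_times mX g_p,
        rule AE_I2, simp split: split_indicator)
    have gX: "(\<lambda>x. indicator X x * g x) \<in> borel_measurable C" using g_C iX by (rule borel_measurable_times[rotated])
    have "(\<integral>x. indicator X x * indicator (H b) x * indicator S x \<partial>p) = (\<integral>x. (indicator X x * indicator (S \<inter> H b) x :: real) \<partial>p)"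
      by (intro Bochner_Integration.integral_cong refl) (auto simp: indicator_def)
    also have "\<dots> = (\<integral>x. indicator X x * real_cond_exp p C (indicator (S \<inter> H b)) x \<partial>p)"
      by (rule C.real_cond_exp_intg(2)[symmetric, OF i1 iX mX(4)])
    also have "\<dots> = (\<integral>x. indicator X x * g x * r x \<partial>p)"
    proof (rule integral_cong_AE)
      show "AE x in p. indicator X x * real_cond_exp p C (indicator (S \<inter> H b)) x = indicator X x * g x * r x"
        using ae by eventually_elim simp
      show "(\<lambda>x. indicator X x * g x * r x) \<in> borel_measurable p"
        unfolding r_def using g_p by (intro borel_measurable_times mX(1) borel_measurable_cond_exp2)
      show "(\<lambda>x. indicator X x * real_cond_exp p C (indicator (S \<inter> H b)) x) \<in> borel_measurable p"
        by (intro borel_measurable_times mX(1) borel_measurable_cond_exp2)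
    qed
    also have "\<dots> = (\<integral>x. indicator X x * g x * indicator (H b) x \<partial>p)"
      unfolding r_def by (rule C.real_cond_exp_intg(2)[OF i2 gX mX(2)])
    finally show ?thesis by (simp add: ac_simps)
  qed
  have hb: "norm ((indicator S x - h (s x)) * (indicator X x * indicator Y x)) \<le> 1" for X Y x
    using h_bd[of "s x"] by (simp split: split_indicator)
  \<comment> \<open>The explicit density says that it may likewise be replaced by
    \<open>h (s x)\<close>: these events do not involve coordinate \<open>i\<close>, which is
    averaged first.\<close>
  have fub: "(\<integral>x. (indicator S x - h (s x)) * (indicator X x * indicator (H b) x) \<partial>p) = 0" if X: "X \<in> sets C" for X b
  proof -
    let ?f = "\<lambda>x. (indicator S x - h (s x)) * (indicator X x * indicator (H b) x)"
    have mf: "?f \<in> borel_measurable (leb W)"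
      using S_p C_p[OF X] H_p[of b] unfolding p by measurable
    have "integrable p ?f"
      by (rule integrable_const_bound[where B = 1], rule AE_I2, rule hb) (use mf measurable_p in blast)
    then have int: "integrable (leb W) (\<lambda>x. ?f x * exp (- quad W Q x / 2))" using integral_p(2)[OF mf] by blast
    have "(\<integral>x. ?f x * exp (- quad W Q x / 2) \<partial>leb W) = 0"
    proof (rule gauss_fubini_zero[OF fin sym pd i int])
      fix y assume y: "y \<in> space (leb (W - {i}))"
      have W: "insert i (W - {i}) = W" using i by blast
      have yt: "y(i := t) \<in> space p" for t
        using y i unfolding space_p by (auto simp: space_PiM PiE_iff extensional_def)
      have s1: "s (y(i := t)) = s y" for t unfolding s_def by (rule row_sum_upd) simp
      have s2: "sR (y(i := t)) = sR y" for t unfolding sR_def by (rule row_sum_upd[OF NW(9)])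
      have X1: "y(i := t) \<in> X \<longleftrightarrow> y(i := 0) \<in> X" for t
        using coord_algebra_upd[of X N i "y(i := 0)" t] X NW(8) i yt[of 0] unfolding C_def by simp
      define w where "w = (indicator X (y(i := 0)) * (if 0 < \<sigma> b * sR y then 1 else 0) :: real)"
      have fe: "?f (y(i := t)) = w * (indicator {0<..} t - h (s y))" for t
        unfolding w_def using yt[of t] s1[of t] s2[of t] X1[of t]
        by (simp add: indicator_def S_def H_def)
      have "(\<integral>t. ?f (y(i := t)) * exp (- (Q i i * (t + row_sum (W - {i}) Q i y / Q i i)\<^sup>2) / 2) \<partial>lborel) =
          (\<integral>t. w * ((indicator {0<..} t - half_weight (Q i i) (s y) / sqrt (2 * pi / Q i i)) *
            exp (- (Q i i * (t + s y / Q i i)\<^sup>2) / 2)) \<partial>lborel)"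
        unfolding fe unfolding h_def z_def s_def by (simp only: mult.assoc)
      also have "\<dots> = 0" using half_weight_centered[OF q, of "s y"] by simp
      finally show "(\<integral>t. ?f (y(i := t)) * exp (- (Q i i * (t + row_sum (W - {i}) Q i y / Q i i)\<^sup>2) / 2) \<partial>lborel) = 0" .
    qed
    then show ?thesis using integral_p(1)[OF mf] by simp
  qed
  have zero: "(\<integral>x. (g x - h (s x)) * (indicator X x * indicator (H b) x) \<partial>p) = 0"
    and zint: "integrable p (\<lambda>x. (g x - h (s x)) * (indicator X x * indicator (H b) x))" if X: "X \<in> sets C" for X b
  proof -
    have m [measurable]: "X \<in> sets p" "H b \<in> sets p" "S \<in> sets p" "(\<lambda>x. h (s x)) \<in> borel_measurable p" "g \<in> borel_measurable p"
      using C_p[OF X] H_p S_p g_p by (simp_all add: measurable_p)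
    have i1: "integrable p (\<lambda>x. indicator X x * indicator (H b) x * g x)"
      by (rule Bochner_Integration.integrable_bound[OF g_int], measurable, rule AE_I2, simp split: split_indicator)
    have i2: "integrable p (\<lambda>x. indicator X x * indicator (H b) x * indicator S x :: real)"
      by (rule integrable_const_bound[where B = 1], rule AE_I2, simp split: split_indicator, measurable)
    have i3: "integrable p (\<lambda>x. (indicator S x - h (s x)) * (indicator X x * indicator (H b) x))"
      by (rule integrable_const_bound[where B = 1], rule AE_I2, rule hb, measurable)
    have e: "(g x - h (s x)) * (indicator X x * indicator (H b) x) =
        indicator X x * indicator (H b) x * g x - indicator X x * indicator (H b) x * indicator S x +
        (indicator S x - h (s x)) * (indicator X x * indicator (H b) x)" for x by (simp add: algebra_simps)
    show "integrable p (\<lambda>x. (g x - h (s x)) * (indicator X x * indicator (H b) x))"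
      unfolding e by (intro Bochner_Integration.integrable_add Bochner_Integration.integrable_diff i1 i2 i3)
    have "(\<integral>x. (g x - h (s x)) * (indicator X x * indicator (H b) x) \<partial>p) =
        (\<integral>x. indicator X x * indicator (H b) x * g x \<partial>p) - (\<integral>x. indicator X x * indicator (H b) x * indicator S x \<partial>p) +
        (\<integral>x. (indicator S x - h (s x)) * (indicator X x * indicator (H b) x) \<partial>p)"
      unfolding e by (subst Bochner_Integration.integral_add, intro Bochner_Integration.integrable_diff i1 i2, rule i3,
        subst Bochner_Integration.integral_diff, rule i1, rule i2, rule refl)
    then show "(\<integral>x. (g x - h (s x)) * (indicator X x * indicator (H b) x) \<partial>p) = 0"
      using indep[OF X, of b] fub[OF X, of b] by simp
  qed
  \<comment> \<open>An integrand that is strictly positive on this event, and zero off it, has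
    integral zero.\<close>
  have nullA: "AE x in p. x \<notin> A \<inter> H True"
  proof -
    have pos: "h (s x) < g x" if "x \<in> A" "x \<in> H True" for x
    proof -
      have "sN x < s x" using that(2) by (simp add: H_def \<sigma>_def s_eq)
      then show ?thesis using h_less[of "sN x" "s x"] that(1) by (simp add: A_def)
    qed
    then have nn: "0 \<le> (g x - h (s x)) * (indicator A x * indicator (H True) x)" for x
      by (simp add: indicator_def less_imp_le)
    have "AE x in p. (g x - h (s x)) * (indicator A x * indicator (H True) x) = 0"
      using integral_nonneg_eq_0_iff_AE[OF zint[OF A_C, of True]] zero[OF A_C, of True] nn by simp
    then show ?thesis
    proof eventually_elim
      case (elim x)
      then show ?case using pos[of x] by (auto simp: indicator_def)
    qed
  qed
  have nullB: "AE x in p. x \<notin> B \<inter> H False"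
  proof -
    have pos: "g x < h (s x)" if "x \<in> B" "x \<in> H False" for x
    proof -
      have "s x < sN x" using that(2) by (simp add: H_def \<sigma>_def s_eq)
      moreover have "g x \<le> h (sN x)" using that(1) by (auto simp: A_def B_def)
      ultimately show ?thesis using h_less[of "s x" "sN x"] by linarith
    qed
    then have nn: "0 \<le> - ((g x - h (s x)) * (indicator B x * indicator (H False) x))" for x
      by (simp add: indicator_def less_imp_le)
    have "(\<integral>x. - ((g x - h (s x)) * (indicator B x * indicator (H False) x)) \<partial>p) = 0"
      using zero[OF B_C, of False] by simp
    then have "AE x in p. - ((g x - h (s x)) * (indicator B x * indicator (H False) x)) = 0"
      using integral_nonneg_eq_0_iff_AE[OF integrable_minus[OF zint[OF B_C, of False]]] nn by simp
    then show ?thesis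
    proof eventually_elim
      case (elim x)
      then show ?case using pos[of x] by (auto simp: indicator_def)
    qed
  qed
  define Z where "Z = (A \<inter> H True) \<union> (B \<inter> H False)"
  have Z_p: "Z \<in> sets p" unfolding Z_def using C_p[OF A_C] C_p[OF B_C] H_p by blast
  have Z_leb: "Z \<in> sets (leb W)" using Z_p unfolding p by simp
  have "AE x in p. x \<notin> Z" using nullA nullB unfolding Z_def by eventually_elim blast
  then have "AE x in leb W. 0 < ennreal (c * exp (- quad W Q x / 2)) \<longrightarrow> x \<notin> Z"
    unfolding p by (subst (asm) AE_density) auto
  then have "AE x in leb W. x \<notin> Z" using c_pos by simp
  then have "emeasure (leb W) Z = 0" using Z_leb by (simp add: AE_iff_null_sets[symmetric] null_setsD1)
  then have i0: "(\<integral>\<^sup>+x. indicator Z x \<partial>leb W) = 0" using Z_leb by simp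
  have Wk: "insert k (W - {k}) = W" "k \<notin> W - {k}" "finite (W - {k})" using NW fin by auto
  have zz: "(\<integral>\<^sup>+x. indicator Z x \<partial>leb W) = (\<integral>\<^sup>+y. (\<integral>\<^sup>+t. indicator Z (y(k := t)) \<partial>lborel) \<partial>leb (W - {k}))"
    using lborel_product.product_nn_integral_insert[OF Wk(3,2), of "indicator Z"] Z_leb unfolding Wk(1) by simp
  \<comment> \<open>Along coordinate \<open>k\<close> membership in \<open>A\<close> is constant,
    while \<open>sR\<close> is an affine function of \<open>t\<close> with slope
    \<open>Q i k\<close>, nonzero by assumption. So every line in this direction meets
    \<open>Z\<close> in a set that contains a half line.\<close>
  have inner: "(\<integral>\<^sup>+t. indicator Z (y(k := t)) \<partial>lborel) \<noteq> 0" if y: "y \<in> space (leb (W - {k}))" for y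
  proof -
    have yt: "y(k := t) \<in> space p" for t
      using y NW(5) unfolding space_p by (auto simp: space_PiM PiE_iff extensional_def)
    define b where "b \<longleftrightarrow> y(k := 0) \<in> A"
    have "y(k := t) \<in> A \<longleftrightarrow> b" for t
      using coord_algebra_upd[of A N k "y(k := 0)" t] A_C NW yt[of 0] unfolding C_def b_def by simp
    then have Zb: "y(k := t) \<in> H b \<Longrightarrow> y(k := t) \<in> Z" for t
      unfolding Z_def B_def using yt[of t] by (cases b) auto
    have sRt: "sR (y(k := t)) = row_sum (R - {k}) Q i y + Q i k * t" for t
    proof -
      have "finite R" using fin NW(2) finite_subset by metis
      then have "sR (y(k := t)) = Q i k * t + row_sum (R - {k}) Q i (y(k := t))"
        unfolding sR_def row_sum_def using sum.remove[of R k "\<lambda>j. Q i j * (y(k := t)) j"] NW(4) by simp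
      also have "row_sum (R - {k}) Q i (y(k := t)) = row_sum (R - {k}) Q i y" by (rule row_sum_upd) simp
      finally show ?thesis by (simp del: fun_upd_apply)
    qed
    define T where "T = {t. 0 < \<sigma> b * row_sum (R - {k}) Q i y + \<sigma> b * Q i k * t}"
    have T: "indicator T t \<le> (indicator Z (y(k := t)) :: ennreal)" for t
    proof (cases "t \<in> T")
      case True
      then have "y(k := t) \<in> H b" using yt[of t] unfolding H_def T_def mem_Collect_eq sRt by (simp add: distrib_left mult.assoc)
      then show ?thesis using Zb by (simp split: split_indicator)
    qed simp
    have "\<sigma> b * Q i k \<noteq> 0" using Qk by (simp add: \<sigma>_def)
    then have "emeasure lborel T \<noteq> 0" unfolding T_def by (rule half_line_not_null)
    moreover have "T \<in> sets lborel" unfolding T_def by measurable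
    then have "emeasure lborel T \<le> (\<integral>\<^sup>+t. indicator Z (y(k := t)) \<partial>lborel)"
      using nn_integral_mono[of lborel "indicator T" "\<lambda>t. indicator Z (y(k := t))"] T by simp
    ultimately show ?thesis by auto
  qed
  have meas: "(\<lambda>y. \<integral>\<^sup>+t. indicator Z (y(k := t)) \<partial>lborel) \<in> borel_measurable (leb (W - {k}))"
  proof -
    have "(\<lambda>(y, t). y(k := t)) \<in> measurable (leb (W - {k}) \<Otimes>\<^sub>M lborel) (leb (insert k (W - {k})))"
      by (rule measurable_add_dim)
    then have "(\<lambda>x. indicator Z (case x of (y, t) \<Rightarrow> y(k := t)) :: ennreal) \<in> borel_measurable (leb (W - {k}) \<Otimes>\<^sub>M lborel)"
      unfolding Wk(1) using borel_measurable_indicator[OF Z_leb] by (rule measurable_compose)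
    then show ?thesis
      by (intro lborel.borel_measurable_nn_integral) (simp add: case_prod_beta)
  qed
  have "AE y in leb (W - {k}). (\<integral>\<^sup>+t. indicator Z (y(k := t)) \<partial>lborel) = 0"
    using nn_integral_0_iff_AE[OF meas] i0 zz by simp
  \<comment> \<open>No line meets the null set \<open>Z\<close> in a null set, so the space of lines
    itself is null. This contradicts that \<open>p\<close> has mass 1.\<close>
  then have "AE y in leb (W - {k}). False"
  proof (rule AE_mp, intro AE_I2 impI)
    fix y assume "y \<in> space (leb (W - {k}))" "(\<integral>\<^sup>+t. indicator Z (y(k := t)) \<partial>lborel) = 0"
    then show False using inner by blast
  qed
  then have z0: "(\<integral>\<^sup>+y. f y \<partial>leb (W - {k})) = 0" for f :: "_ \<Rightarrow> ennreal"
  proof -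
    have "AE y in leb (W - {k}). f y = 0" using \<open>AE y in leb (W - {k}). False\<close> by eventually_elim simp
    then have "(\<integral>\<^sup>+y. f y \<partial>leb (W - {k})) = (\<integral>\<^sup>+y. 0 \<partial>leb (W - {k}))" by (rule nn_integral_cong_AE)
    then show ?thesis by simp
  qed
  have "emeasure p (space p) = (\<integral>\<^sup>+x. 1 \<partial>p)" by simp
  also have "\<dots> = (\<integral>\<^sup>+x. ennreal (c * exp (- quad W Q x / 2)) \<partial>leb W)"
    unfolding p by (subst nn_integral_density) simp_all
  also have "\<dots> = 0"
    using lborel_product.product_nn_integral_insert[OF Wk(3,2), of "\<lambda>x. ennreal (c * exp (- quad W Q x / 2))"] z0
    unfolding Wk(1) by simp
  finally show False using emeasure_space_1 by simp
qed

end

lemma gaussian_tree_metric: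
  assumes t: "ltree W E" and g: "gaussian p W" and mk: "markov_on p W E"
    and pos: "\<And>x y. {x, y} \<in> E \<Longrightarrow> 0 < gaussian_dist p x y"
  shows "tree_metric W E (gaussian_dist p)"
proof -
  have fin: "finite W" using ltree_edges[OF t] by simp
  obtain Q c where Q: "\<forall>i\<in>W. \<forall>j\<in>W. Q i j = Q j i" "pos_def W Q"
    and p: "p = density (leb W) (\<lambda>x. ennreal (c * exp (- quad W Q x / 2)))" and prob: "prob_space p"
    using g unfolding gaussian_def pos_def_def[symmetric] unfolding quad_def[symmetric]
    by (elim conjE exE) (rule that)
  have sym: "Q a b = Q b a" if "a \<in> W" "b \<in> W" for a b using Q(1) that by blast
  have EW: "a \<in> W \<and> b \<in> W \<and> a \<noteq> b" if "{a, b} \<in> E" for a b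
    using ltree_edges[OF t] that by (metis doubleton_eq_iff)
  have gd: "gaussian_dist p = normalized_dist (cov p)"
  proof (intro ext)
    fix i j
    have "\<bar>cov p i j / sqrt (cov p i i * cov p j j)\<bar> = \<bar>cov p i j\<bar> / sqrt (cov p i i * cov p j j)"
    proof -
      have "0 \<le> cov p x x" for x unfolding cov_def by (intro integral_nonneg_AE) simp
      then have "0 \<le> sqrt (cov p i i * cov p j j)" by simp
      then show ?thesis by (simp only: abs_divide abs_of_nonneg)
    qed
    then show "gaussian_dist p i j = normalized_dist (cov p) i j"
      unfolding gaussian_dist_def correlation_def normalized_dist_def by (simp only:)
  qed
  show ?thesis
  proof (cases "card W = 1")
    case True
    then obtain v where v: "W = {v}" by (auto simp: card_1_singleton_iff)
    then have "E = {}" using ltree_edges[OF t] ltree_card[OF t] by simp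
    then show ?thesis using v tree_metric_singleton normalized_dist_self gd by simp
  next
    case False
    have cpos: "0 < cov p i i" if i: "i \<in> W" for i
    proof -
      obtain v where "v \<in> W" "v \<noteq> i" using False i by (metis card_1_singleton_iff is_singletonI' is_singleton_def One_nat_def ltree_edges t)
      then obtain x where x: "{i, x} \<in> E"
        using ltree_hop[OF t] tree_metric.next_node i by metis
      have "cov p i i \<noteq> 0" using pos[OF x] unfolding gd normalized_dist_def by auto
      moreover have "0 \<le> cov p i i" unfolding cov_def by (intro integral_nonneg_AE) simp
      ultimately show ?thesis by simp
    qed
    have cs: "cov p a b = cov p b a" for a b unfolding cov_def by (simp add: mult.commute)
    have "mult_tree (cov p) W E"
    proof (rule gaussian_mult_tree[OF t sym Q(2)])
      show "Q a b = 0" if ab: "a \<in> W" "b \<in> W" "a \<noteq> b" "{a, b} \<notin> E" for a b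
      proof (rule precision_zero[OF fin sym Q(2) prob p ab(1)])
        show "neighbours E a \<subseteq> W - {a}" using EW by (auto simp: neighbours_def)
        show "b \<in> W - {a} - neighbours E a" using ab by (auto simp: neighbours_def)
        show "cond_indep p {a} (W - {a} - neighbours E a) (neighbours E a)" using mk ab(1) unfolding markov_on_def by blast
      qed
      show "(\<Sum>k\<in>W. Q a k * cov p k l) = 0" if "a \<in> W" "l \<in> W" "a \<noteq> l" for a l
        by (rule cov_normal_equation[OF fin sym Q(2) prob p that])
      show "cov p a b = cov p b a" for a b by (rule cs)
    qed
    then show ?thesis using mult_tree_metric[of "cov p" W E] cpos pos cs unfolding gd by blast
  qed
qed

lemma information_distance_additive:
  assumes "tree W E" "tree_model p W E \<delta>" "\<And>x y. {x, y} \<in> E \<Longrightarrow> 0 < \<delta> x y"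
  shows "tree_metric W E \<delta>"
proof -
  have t: "ltree W E" using tree_ltree assms(1) .
  have fin: "finite W" using ltree_edges[OF t] by simp
  show ?thesis
    using assms(2) unfolding tree_model_def
  proof (elim conjE disjE exE)
    assume "markov_on p W E" "gaussian p W" "\<delta> = gaussian_dist p"
    then show ?thesis using gaussian_tree_metric[OF t] assms(3) by simp
  next
    fix K assume "discrete K p W" "factorizes K p W E" "\<delta> = discrete_dist K p"
    then show ?thesis using discrete_tree_metric[OF _ fin t] assms(3) by simp
  qed
qed

section \<open>Reasoning about running time\<close>

text \<open>A total-correctness triple with a time bound; in particular \<open>c\<close> does not
  diverge.\<close>

definition tms :: "'a tm \<Rightarrow> nat \<Rightarrow> ('a \<Rightarrow> bool) \<Rightarrow> bool" where
  "tms c k P \<longleftrightarrow> (\<exists>x t. c = Result x t \<and> t \<le> k \<and> P x)"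

lemma tms_ret: "P x \<Longrightarrow> 1 \<le> k \<Longrightarrow> tms (ret x) k P"
  by (simp add: tms_def ret_def)

lemma tms_weaken: "tms c k P \<Longrightarrow> k \<le> k' \<Longrightarrow> (\<And>x. P x \<Longrightarrow> Q x) \<Longrightarrow> tms c k' Q"
proof -
  assume "tms c k P" and k: "k \<le> k'" and PQ: "\<And>x. P x \<Longrightarrow> Q x"
  then obtain x t where "c = Result x t" "t \<le> k" "P x" unfolding tms_def by metis
  then show ?thesis unfolding tms_def using k PQ by (intro exI[of _ x] exI[of _ t]) simp
qed

lemma tms_bind:
  assumes "tms c k Q" "\<And>x. Q x \<Longrightarrow> tms (f x) k' P" "k + k' \<le> k''"
  shows "tms (bind_tm c f) k'' P"
proof -
  obtain x t where x: "c = Result x t" "t \<le> k" "Q x" using assms(1) unfolding tms_def by blast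
  obtain y t' where y: "f x = Result y t'" "t' \<le> k'" "P y" using assms(2)[OF x(3)] unfolding tms_def by blast
  have "bind_tm c f = Result y (t + t')" using x y by simp
  then show ?thesis using x(2) y(2,3) assms(3) unfolding tms_def by auto
qed

lemma tms_map:
  assumes "\<And>x. x \<in> set xs \<Longrightarrow> tms (f x) k (\<lambda>y. y = g x)"
  shows "tms (map_tm f xs) ((k + 1) * length xs + 1) (\<lambda>ys. ys = map g xs)"
  using assms
proof (induction xs)
  case (Cons x xs)
  have "tms (map_tm f xs) ((k + 1) * length xs + 1) (\<lambda>ys. ys = map g xs)" using Cons by simp
  then have "tms (bind_tm (map_tm f xs) (\<lambda>ys. ret (y # ys))) ((k + 1) * length xs + 2) (\<lambda>zs. zs = y # map g xs)" for y
    by (rule tms_bind[where k' = 1]) (auto intro: tms_ret)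
  then show ?case
    unfolding map_tm.simps using Cons.prems[of x] by (intro tms_bind[where k = k and Q = "\<lambda>y. y = g x"]) auto
qed (simp add: tms_ret)

lemma tms_filter:
  assumes "\<And>x. x \<in> set xs \<Longrightarrow> tms (f x) k (\<lambda>b. b = P x)"
  shows "tms (filter_tm f xs) ((k + 1) * length xs + 1) (\<lambda>ys. ys = filter P xs)"
  using assms
proof (induction xs)
  case (Cons x xs)
  have "tms (filter_tm f xs) ((k + 1) * length xs + 1) (\<lambda>ys. ys = filter P xs)" using Cons by simp
  then have "tms (bind_tm (filter_tm f xs) (\<lambda>ys. ret (if b then x # ys else ys))) ((k + 1) * length xs + 2)
      (\<lambda>zs. zs = (if b then x # filter P xs else filter P xs))" for b
    by (rule tms_bind[where k' = 1]) (auto intro: tms_ret)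
  then show ?case
    unfolding filter_tm.simps using Cons.prems[of x]
    by (intro tms_bind[where k = k and k' = "(k + 1) * length xs + 2" and Q = "\<lambda>b. b = P x"]) auto
qed (simp add: tms_ret)

lemma tms_all:
  assumes "\<And>x. x \<in> set xs \<Longrightarrow> tms (f x) k (\<lambda>b. b = P x)"
  shows "tms (all_tm f xs) ((k + 1) * length xs + 1) (\<lambda>b. b = (\<forall>x\<in>set xs. P x))"
  using assms
proof (induction xs)
  case (Cons x xs)
  have "tms (all_tm f xs) ((k + 1) * length xs + 1) (\<lambda>b. b = (\<forall>x\<in>set xs. P x))" using Cons by simp
  then have "tms (if b then all_tm f xs else ret False) ((k + 1) * length xs + 1) (\<lambda>r. r = (b \<and> (\<forall>x\<in>set xs. P x)))" for b
    by (cases b) (auto intro: tms_ret)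
  then show ?case
    unfolding all_tm.simps using Cons.prems[of x]
    by (intro tms_bind[where k = k and k' = "(k + 1) * length xs + 1" and Q = "\<lambda>b. b = P x"]) auto
qed (simp add: tms_ret)

lemma tms_ex:
  assumes "\<And>x. x \<in> set xs \<Longrightarrow> tms (f x) k (\<lambda>b. b = P x)"
  shows "tms (ex_tm f xs) ((k + 1) * length xs + 1) (\<lambda>b. b = (\<exists>x\<in>set xs. P x))"
  using assms
proof (induction xs)
  case (Cons x xs)
  have "tms (ex_tm f xs) ((k + 1) * length xs + 1) (\<lambda>b. b = (\<exists>x\<in>set xs. P x))" using Cons by simp
  then have "tms (if b then ret True else ex_tm f xs) ((k + 1) * length xs + 1) (\<lambda>r. r = (b \<or> (\<exists>x\<in>set xs. P x)))" for b
    by (cases b) (auto intro: tms_ret)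
  then show ?case
    unfolding ex_tm.simps using Cons.prems[of x]
    by (intro tms_bind[where k = k and k' = "(k + 1) * length xs + 1" and Q = "\<lambda>b. b = P x"]) auto
qed (simp add: tms_ret)

lemma tms_append: "tms (append_tm xs ys) (length xs + 1) (\<lambda>zs. zs = xs @ ys)"
proof (induction xs)
  case (Cons x xs)
  then show ?case
    unfolding append_tm.simps
    by (intro tms_bind[where k = "length xs + 1" and k' = 1 and Q = "\<lambda>zs. zs = xs @ ys"]) (auto intro: tms_ret)
qed (simp add: tms_ret)

text \<open>The invariant \<open>I\<close> refers to the prefix consumed so far. Costs may vary with
  the element: for blocks and for internal nodes the sum of the individual costs can be much smaller
  than length times maximum.\<close>

lemma tms_fold:
  assumes "\<And>us x vs s. xs = us @ x # vs \<Longrightarrow> I us s \<Longrightarrow> tms (f x s) (k x) (I (us @ [x]))"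
    and "I [] s"
  shows "tms (fold_tm f xs s) (sum_list (map k xs) + 1) (I xs)"
proof -
  have "tms (fold_tm f vs s) (sum_list (map k vs) + 1) (I xs)" if "xs = us @ vs" "I us s" for us vs s
    using that
  proof (induction vs arbitrary: us s)
    case Nil
    then show ?case by (simp add: tms_ret)
  next
    case (Cons x vs)
    have "tms (fold_tm f vs s') (sum_list (map k vs) + 1) (I xs)" if "I (us @ [x]) s'" for s'
      using Cons.IH[of "us @ [x]" s'] Cons.prems(1) that by simp
    then show ?case
      unfolding fold_tm.simps by (rule tms_bind[OF assms(1)[OF Cons.prems]]) simp_all
  qed
  from this[of "[]" xs s] show ?thesis using assms(2) by simp
qed

lemma tms_fold_const:
  assumes "\<And>us x vs s. xs = us @ x # vs \<Longrightarrow> I us s \<Longrightarrow> tms (f x s) k (I (us @ [x]))"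
    and "I [] s"
  shows "tms (fold_tm f xs s) (k * length xs + 1) (I xs)"
proof -
  have "sum_list (map (\<lambda>_. k) xs) = k * length xs" by (induction xs) auto
  then show ?thesis using tms_fold[of xs I f "\<lambda>_. k" s] assms by simp
qed

text \<open>The number in \<open>Inv\<close> is fuel. It drops with each iteration and cannot be 0
  while the guard holds, which yields termination and time together; the final 1 is the initial
  \<open>ret\<close>.\<close>

lemma tms_while:
  assumes step: "\<And>s n. Inv s n \<Longrightarrow> b s \<Longrightarrow> \<exists>n'. n = Suc n' \<and> tms (c s) k (\<lambda>s'. Inv s' n')"
    and s: "Inv s n"
  shows "tms (while_tm b c s) (n * k + 1) (\<lambda>s'. \<not> b s' \<and> (\<exists>n'. Inv s' n'))"
proof -
  define test where "test r = (case r of Diverge \<Rightarrow> False | Result s _ \<Rightarrow> b s)" for r :: "'a tm"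
  have "\<exists>s' t'. while_option test (\<lambda>r. bind_tm r c) (Result s t) = Some (Result s' t') \<and> t' \<le> t + n * k \<and> \<not> b s' \<and> (\<exists>n'. Inv s' n')"
    if "Inv s n" for s n t
    using that
  proof (induction n arbitrary: s t)
    case 0
    then have "\<not> b s" using step by blast
    then have "while_option test (\<lambda>r. bind_tm r c) (Result s t) = Some (Result s t)"
      by (subst while_option_unfold) (simp add: test_def)
    then show ?case using 0 \<open>\<not> b s\<close> by (intro exI[of _ s] exI[of _ t]) auto
  next
    case (Suc n)
    show ?case
    proof (cases "b s")
      case False
      then have "while_option test (\<lambda>r. bind_tm r c) (Result s t) = Some (Result s t)"
        by (subst while_option_unfold) (simp add: test_def)
      then show ?thesis using Suc.prems False trans_le_add1 by blast
    next
      case True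
      then have "tms (c s) k (\<lambda>s'. Inv s' n)" using step[OF Suc.prems] by auto
      then obtain s1 t1 where s1: "c s = Result s1 t1" "t1 \<le> k" "Inv s1 n" unfolding tms_def by blast
      have "while_option test (\<lambda>r. bind_tm r c) (Result s t) = while_option test (\<lambda>r. bind_tm r c) (Result s1 (t + t1))"
        using True s1(1) by (subst while_option_unfold) (simp add: test_def)
      moreover obtain s' t' where "while_option test (\<lambda>r. bind_tm r c) (Result s1 (t + t1)) = Some (Result s' t')"
        "t' \<le> t + t1 + n * k" "\<not> b s'" "\<exists>n'. Inv s' n'" using Suc.IH[OF s1(3)] by blast
      ultimately show ?thesis using s1(2) by auto
    qed
  qed
  from this[OF s, of 1] show ?thesis
    unfolding while_tm_def ret_def tms_def test_def[symmetric] by (auto simp: test_def[abs_def])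
qed

section \<open>Prim's algorithm\<close>

lemma closer_irrefl: "\<not> closer d e e"
  unfolding closer_def by (simp split: prod.split)

lemma closer_asym: "closer d e f \<Longrightarrow> \<not> closer d f e"
  unfolding closer_def by (auto split: prod.splits)

text \<open>\<open>closer\<close> is the strict part of a total preorder, a lexicographic comparison
  of length and node names, so its negation is transitive.\<close>

lemma not_closer_trans: "\<not> closer d g f \<Longrightarrow> \<not> closer d h g \<Longrightarrow> \<not> closer d h f"
proof -
  have lex: "\<not> (x < y \<or> x = y \<and> (m < n \<or> m = n \<and> i < j)) \<Longrightarrow> \<not> (z < x \<or> z = x \<and> (r < m \<or> r = m \<and> s < i)) \<Longrightarrow>
      \<not> (z < y \<or> z = y \<and> (r < n \<or> r = n \<and> s < j))" for x y z :: real and m n i j r s :: nat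
    by auto
  obtain a b a' b' a'' b'' where "f = (a, b)" "g = (a', b')" "h = (a'', b'')" by (metis surj_pair)
  then show "\<not> closer d g f \<Longrightarrow> \<not> closer d h g \<Longrightarrow> \<not> closer d h f"
    unfolding closer_def by (simp only: prod.case) (rule lex)
qed

lemma edges_Cons: "edges ((a, b) # T) = insert {a, b} (edges T)"
  unfolding edges_def by auto

lemma edges_Nil: "edges [] = {}"
  unfolding edges_def by simp

text \<open>The cut property behind Prim's algorithm: some cut is crossed best, ties included, by
  this edge. The identification of the tree with the contracted latent tree rests on it.\<close>

definition greedy_edge :: "nat set \<Rightarrow> dist \<Rightarrow> nat \<times> nat \<Rightarrow> bool" where
  "greedy_edge V d = (\<lambda>(a, b). \<exists>U\<subseteq>V. a \<in> V - U \<and> b \<in> U \<and> (\<forall>v\<in>V - U. \<forall>u\<in>U. \<not> closer d (v, u) (a, b)))"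

definition prim_inv :: "nat set \<Rightarrow> dist \<Rightarrow> edge_list \<Rightarrow> edge_list \<Rightarrow> nat set \<Rightarrow> bool" where
  "prim_inv V d M near U \<longleftrightarrow> U \<subseteq> V \<and> distinct (map fst near) \<and> fst ` set near = V - U \<and>
     (\<forall>(w, x)\<in>set near. x \<in> U \<and> (\<forall>u\<in>U. \<not> closer d (w, u) (w, x))) \<and>
     ltree U (edges M) \<and> length M = card U - 1 \<and> (\<forall>e\<in>set M. greedy_edge V d e)"

lemma prim_inv_step:
  assumes inv: "prim_inv V d M near U" and vu: "(v, u) \<in> set near" and mn: "\<And>g. g \<in> set near \<Longrightarrow> \<not> closer d g (v, u)"
  shows "prim_inv V d ((v, u) # M)
    (map (\<lambda>(w, x). (w, if closer d (w, v) (w, x) then v else x)) (filter (\<lambda>(w, x). w \<noteq> v) near)) (insert v U)"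
proof -
  have U: "U \<subseteq> V" and dist: "distinct (map fst near)" and fs: "fst ` set near = V - U"
    and nr: "\<And>w x. (w, x) \<in> set near \<Longrightarrow> x \<in> U \<and> (\<forall>u\<in>U. \<not> closer d (w, u) (w, x))"
    and lt: "ltree U (edges M)" "length M = card U - 1" "\<forall>e\<in>set M. greedy_edge V d e"
    using inv unfolding prim_inv_def by auto
  have v: "v \<in> V" "v \<notin> U" using vu fs by (metis DiffE fst_conv image_eqI)+
  have u: "u \<in> U" using nr[OF vu] by blast
  let ?near = "map (\<lambda>(w, x). (w, if closer d (w, v) (w, x) then v else x)) (filter (\<lambda>(w, x). w \<noteq> v) near)"
  have mf: "map fst ?near = filter (\<lambda>w. w \<noteq> v) (map fst near)"
    by (induction near) auto
  have fin: "finite U" "U \<noteq> {}" using ltree_edges[OF lt(1)] by simp_all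
  \<comment> \<open>Compare through the entry of \<open>w\<close> in \<open>near\<close>: it is at
    least as good as \<open>(w, y)\<close>, and the selected pair is at least as good as that
    entry.\<close>
  have "\<not> closer d (w, y) (v, u)" if "w \<in> V - U" "y \<in> U" for w y
  proof -
    obtain x where x: "(w, x) \<in> set near" using \<open>w \<in> V - U\<close> fs by (metis imageE prod.collapse)
    show ?thesis using not_closer_trans[OF mn[OF x]] nr[OF x] that(2) by blast
  qed
  then have "greedy_edge V d (v, u)" unfolding greedy_edge_def using U v u by auto
  moreover have "ltree (insert v U) (edges ((v, u) # M))" unfolding edges_Cons by (rule ltree.add[OF lt(1) u v(2)])
  moreover have "distinct (map fst ?near)" unfolding mf using dist by simp
  moreover have "fst ` set ?near = V - insert v U"
  proof -
    have "fst ` set ?near = set (map fst ?near)" by (simp only: set_map)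
    also have "\<dots> = V - insert v U" unfolding mf using fs by auto
    finally show ?thesis .
  qed
  moreover have "\<forall>(w, x)\<in>set ?near. x \<in> insert v U \<and> (\<forall>u\<in>insert v U. \<not> closer d (w, u) (w, x))"
  proof (intro ballI, clarify)
    fix w x' assume "(w, x') \<in> set ?near"
    then obtain x where x: "(w, x) \<in> set near" "x' = (if closer d (w, v) (w, x) then v else x)" by auto
    show "x' \<in> insert v U \<and> (\<forall>u\<in>insert v U. \<not> closer d (w, u) (w, x'))"
    proof (cases "closer d (w, v) (w, x)")
      case True
      have "\<not> closer d (w, y) (w, v)" if "y \<in> U" for y
      proof
        assume "closer d (w, y) (w, v)"
        then have "\<not> closer d (w, v) (w, y)" by (rule closer_asym)
        then show False using not_closer_trans[of d "(w, y)" "(w, x)" "(w, v)"] nr[OF x(1)] that True by blast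
      qed
      then show ?thesis using x(2) True closer_irrefl by auto
    qed (use x nr[OF x(1)] in auto)
  qed
  moreover have "length ((v, u) # M) = card (insert v U) - 1"
    using lt(2) fin v(2) by (simp add: card_gt_0_iff Suc_leI)
  ultimately show ?thesis
    unfolding prim_inv_def using U v lt(3) by auto
qed

lemma mst_greedy:
  assumes vs: "distinct vs" "set vs = V" "vs \<noteq> []"
  shows "tms (mst vs d) (20 * (length vs)\<^sup>2) (\<lambda>M. ltree V (edges M) \<and> length M = card V - 1 \<and> (\<forall>e\<in>set M. greedy_edge V d e))"
proof -
  obtain r rest where r: "vs = r # rest" using vs(3) by (cases vs) auto
  define n where "n = length rest"
  define I where "I us = (\<lambda>(M, near). length near = n - length us \<and> (\<exists>U. prim_inv V d M near U))" for us :: "nat list"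
  have step: "tms (prim_step d s) (5 * n + 5) (I (us @ [x]))" if "rest = us @ x # xs" "I us s" for us x xs s
  proof -
    obtain M near where s: "s = (M, near)" by (cases s)
    obtain U where U: "length near = n - length us" "prim_inv V d M near U" using \<open>I us s\<close> unfolding I_def s by auto
    have "length us < n" using \<open>rest = us @ x # xs\<close> by (simp add: n_def)
    then obtain e es where near: "near = e # es" using U(1) by (cases near) auto
    have len: "length near \<le> n" using U(1) by simp
    have f1: "tms (fold_tm (\<lambda>f g. ret (if closer d f g then f else g)) es e) (1 * length es + 1)
        (\<lambda>m. m \<in> set (e # es) \<and> (\<forall>g\<in>set (e # es). \<not> closer d g m))"
    proof (rule tms_fold_const[where I = "\<lambda>us m. m \<in> set (e # us) \<and> (\<forall>g\<in>set (e # us). \<not> closer d g m)"])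
      fix us f xs m assume m: "m \<in> set (e # us) \<and> (\<forall>g\<in>set (e # us). \<not> closer d g m)"
      show "tms (ret (if closer d f m then f else m)) 1 (\<lambda>m. m \<in> set (e # us @ [f]) \<and> (\<forall>g\<in>set (e # us @ [f]). \<not> closer d g m))"
      proof (rule tms_ret)
        have "\<not> closer d g f" if "closer d f m" "g \<in> set (e # us)" for g
          using not_closer_trans[OF closer_asym[OF that(1)], of g] m that(2) by blast
        then show "(if closer d f m then f else m) \<in> set (e # us @ [f]) \<and>
            (\<forall>g\<in>set (e # us @ [f]). \<not> closer d g (if closer d f m then f else m))"
          using m closer_irrefl by auto
      qed simp
    qed (simp add: closer_irrefl)
    have "tms (prim_step d (M, near)) (5 * n + 5) (I (us @ [x]))"
      unfolding prim_step_def near prod.case list.case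
    proof (rule tms_bind[OF f1])
      fix m assume m: "m \<in> set (e # es) \<and> (\<forall>g\<in>set (e # es). \<not> closer d g m)"
      obtain v u where vu: "m = (v, u)" by (cases m)
      let ?n1 = "filter (\<lambda>(w, x). w \<noteq> v) near"
      let ?n2 = "map (\<lambda>(w, x). (w, if closer d (w, v) (w, x) then v else x)) ?n1"
      have inv: "prim_inv V d ((v, u) # M) ?n2 (insert v U)"
        using prim_inv_step[OF U(2), of v u] m unfolding near vu by blast
      have len2: "length ?n2 = n - length (us @ [x])"
      proof -
        have "distinct (map fst near)" using U(2) unfolding prim_inv_def by blast
        moreover have "map fst ?n1 = removeAll v (map fst near)" by (induction near) auto
        moreover have "v \<in> set (map fst near)" using m unfolding near vu by force
        ultimately have "length (map fst ?n1) = length (map fst near) - 1"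
          by (metis distinct_remove1_removeAll length_remove1)
        then show ?thesis using U(1) by simp
      qed
      show "tms (case m of (v, u) \<Rightarrow> bind_tm (filter_tm (\<lambda>(w, x). ret (w \<noteq> v)) (e # es)) (\<lambda>near1.
          bind_tm (map_tm (\<lambda>(w, x). ret (w, if closer d (w, v) (w, x) then v else x)) near1) (\<lambda>near2. ret ((v, u) # M, near2))))
          (4 * n + 4) (I (us @ [x]))"
        unfolding vu prod.case near[symmetric]
      proof (rule tms_bind)
        show "tms (filter_tm (\<lambda>(w, x). ret (w \<noteq> v)) near) ((1 + 1) * length near + 1) (\<lambda>ys. ys = ?n1)"
          by (rule tms_filter) (auto intro: tms_ret)
      next
        fix near1 assume n1: "near1 = ?n1"
        show "tms (bind_tm (map_tm (\<lambda>(w, x). ret (w, if closer d (w, v) (w, x) then v else x)) near1) (\<lambda>near2. ret ((v, u) # M, near2)))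
            (2 * length near + 2) (I (us @ [x]))"
        proof (rule tms_bind)
          show "tms (map_tm (\<lambda>(w, x). ret (w, if closer d (w, v) (w, x) then v else x)) near1) ((1 + 1) * length near1 + 1) (\<lambda>ys. ys = ?n2)"
            unfolding n1 by (rule tms_map) (auto intro: tms_ret)
        next
          fix near2 assume "near2 = ?n2"
          then show "tms (ret ((v, u) # M, near2)) 1 (I (us @ [x]))"
            using inv len2 unfolding I_def by (intro tms_ret) auto
        next
          show "(1 + 1) * length near1 + 1 + 1 \<le> 2 * length near + 2"
          proof -
            have "length near1 \<le> length near" unfolding n1 by (rule length_filter_le)
            then show ?thesis by simp
          qed
        qed
      next
        show "(1 + 1) * length near + 1 + (2 * length near + 2) \<le> 4 * n + 4" using len by simp
      qed
    next
      show "1 * length es + 1 + (4 * n + 4) \<le> 5 * n + 5" using len near by simp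
    qed
    then show ?thesis unfolding s .
  qed
  have n: "length vs = Suc n" using r by (simp add: n_def)
  show ?thesis
    unfolding mst_def r list.case
  proof (rule tms_bind)
    show "tms (map_tm (\<lambda>v. ret (v, r)) rest) ((1 + 1) * length rest + 1) (\<lambda>near. near = map (\<lambda>v. (v, r)) rest)"
      by (rule tms_map) (auto intro: tms_ret)
  next
    fix near assume near: "near = map (\<lambda>v. (v, r)) rest"
    have "prim_inv V d [] near {r}"
      unfolding prim_inv_def near edges_Nil using vs r ltree.single[of r] closer_irrefl
      by (auto simp: comp_def image_image)
    then have I0: "I [] ([], near)" unfolding I_def near by (auto simp: n_def)
    have fold: "tms (fold_tm (\<lambda>_. prim_step d) rest ([], near)) ((5 * n + 5) * length rest + 1) (I rest)"
      by (rule tms_fold_const[where I = I]) (use step I0 in auto)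
    show "tms (bind_tm (fold_tm (\<lambda>_. prim_step d) rest ([], near)) (\<lambda>(M, near'). ret M)) ((5 * n + 5) * n + 2)
        (\<lambda>M. ltree V (edges M) \<and> length M = card V - 1 \<and> (\<forall>e\<in>set M. greedy_edge V d e))"
    proof (rule tms_bind[OF fold])
      fix s assume "I rest s"
      then obtain M near' U where s: "s = (M, near')" "length near' = 0" "prim_inv V d M near' U"
        unfolding I_def n_def by (cases s) auto
      then have "U = V" unfolding prim_inv_def by auto
      then show "tms (case s of (M, near') \<Rightarrow> ret M) 1 (\<lambda>M. ltree V (edges M) \<and> length M = card V - 1 \<and> (\<forall>e\<in>set M. greedy_edge V d e))"
        using s unfolding prim_inv_def by (auto intro: tms_ret)
    qed (simp add: n_def)
  next
    show "(1 + 1) * length rest + 1 + ((5 * n + 5) * n + 2) \<le> 20 * (length (r # rest))\<^sup>2"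
      unfolding n_def[symmetric] list.size(4) by (simp add: power2_eq_square algebra_simps n_def)
  qed
qed

section \<open>Surrogates and contractions\<close>

text \<open>Instantiated at three levels: the whole latent tree, the local tree around an observed
  node, and the shrinking trees between rounds of recursive grouping, where \<open>V\<close> is the
  set of active nodes.\<close>

locale latent = tree_metric +
  fixes V :: "nat set"
  assumes V_sub: "V \<subseteq> W" and V_ne: "V \<noteq> {}"
    and hidden_deg: "x \<in> W - V \<Longrightarrow> 3 \<le> card (neighbours E x)"
begin

text \<open>Ties between closest observed nodes are broken by the node name, in accordance with \<open>closer\<close>.\<close>

definition Sg :: "nat \<Rightarrow> nat" where
  "Sg x = (LEAST v. v \<in> V \<and> (\<forall>w\<in>V. d x v \<le> d x w))"

lemma finite_V: "finite V"
  using V_sub finite_W finite_subset by metis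

lemma Sg_props: "Sg x \<in> V" "w \<in> V \<Longrightarrow> d x (Sg x) \<le> d x w"
proof -
  obtain v where "v \<in> V" "\<And>w. w \<in> V \<Longrightarrow> - d x w \<le> - d x v"
    using finite_maximizer[OF finite_V V_ne, of "\<lambda>w. - d x w"] by metis
  then have "v \<in> V \<and> (\<forall>w\<in>V. d x v \<le> d x w)" by simp
  then have "Sg x \<in> V \<and> (\<forall>w\<in>V. d x (Sg x) \<le> d x w)" unfolding Sg_def by (rule LeastI)
  then show "Sg x \<in> V" "w \<in> V \<Longrightarrow> d x (Sg x) \<le> d x w" by simp_all
qed

lemma Sg_tie: "w \<in> V \<Longrightarrow> d x w = d x (Sg x) \<Longrightarrow> Sg x \<le> w"
  using Sg_props(2)[of _ x] unfolding Sg_def by (intro Least_le) simp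

lemma Sg_eqI:
  assumes "v \<in> V" "\<And>w. w \<in> V \<Longrightarrow> d x v \<le> d x w" "\<And>w. w \<in> V \<Longrightarrow> d x w = d x v \<Longrightarrow> v \<le> w"
  shows "Sg x = v"
proof -
  have "d x (Sg x) = d x v" using Sg_props assms(1,2) by (metis order_antisym)
  then show ?thesis using Sg_tie[OF assms(1)] assms(3)[OF Sg_props(1)] by (metis order_antisym)
qed

lemma Sg_W: "Sg x \<in> W"
  using Sg_props(1) V_sub by blast

lemma Sg_self: "v \<in> V \<Longrightarrow> Sg v = v"
proof (rule Sg_eqI)
  assume v: "v \<in> V"
  then have vW: "v \<in> W" using V_sub by blast
  fix w assume "w \<in> V"
  then have wW: "w \<in> W" using V_sub by blast
  show "d v v \<le> d v w" using d_refl[OF vW] d_nonneg[OF vW wW] by simp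
  show "v \<le> w" if "d v w = d v v" using d_pos[OF vW wW] d_refl[OF vW] that by (cases "v = w") auto
qed

text \<open>A better candidate for \<open>y\<close> would, through \<open>y\<close>, be a better one
  for \<open>x\<close>; a tie at \<open>y\<close> likewise forces a tie at \<open>x\<close>. Hence
  fibres are connected.\<close>

lemma Sg_between:
  assumes "x \<in> W" "y \<in> W" "d x (Sg x) = d x y + d y (Sg x)"
  shows "Sg y = Sg x"
proof (rule Sg_eqI)
  show "Sg x \<in> V" by (rule Sg_props)
  fix w assume w: "w \<in> V"
  then have t: "d x w \<le> d x y + d y w" using triangle[of x w y] assms V_sub by blast
  show "d y (Sg x) \<le> d y w" using t Sg_props(2)[OF w, of x] assms(3) by linarith
  assume "d y w = d y (Sg x)"
  then have "d x w = d x (Sg x)" using t Sg_props(2)[OF w, of x] assms(3) by linarith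
  then show "Sg x \<le> w" by (rule Sg_tie[OF w])
qed

text \<open>If \<open>z\<close> and its surrogate were on different sides, both \<open>x\<close> and
  \<open>y\<close> would lie on the path between them and share that surrogate by
  \<open>Sg_between\<close>.\<close>

lemma exit_sides:
  assumes e: "{x, y} \<in> E" and ne: "Sg x \<noteq> Sg y" and z: "z \<in> W"
  shows "z \<in> side x y \<longleftrightarrow> Sg z \<in> side x y"
proof -
  have W: "x \<in> W" "y \<in> W" using edge_W e by blast+
  have "Sg z \<in> side x y" if "z \<in> side x y" "{x, y} \<in> E" "Sg x \<noteq> Sg y" "x \<in> W" "y \<in> W" for x y
  proof (rule ccontr)
    assume "Sg z \<notin> side x y"
    then have "Sg z \<in> side y x" using side_other[OF that(2) Sg_W] by metis
    then have "d z (Sg z) = d z x + d x (Sg z)" "d z (Sg z) = d z y + d y (Sg z)"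
      using side_between[OF that(2,1)] by metis+
    then have "Sg x = Sg z" "Sg y = Sg z" using Sg_between[OF z] that by metis+
    then show False using that by simp
  qed
  from this[OF _ e ne W] this[OF _ edge_sym[OF e] ne[symmetric] W(2,1)]
  show ?thesis using side_other[OF e z] side_other[OF e Sg_W] by metis
qed

text \<open>By \<open>exit_sides\<close> nodes lie on the same side as their surrogates, so
  \<open>crossing\<close> applies. In particular two fibres are joined by at most one edge.\<close>

lemma exit_unique:
  assumes e: "{x, y} \<in> E" "Sg x \<noteq> Sg y" and f: "{x', y'} \<in> E"
    and s: "Sg x' \<in> side x y" "Sg y' \<in> side y x"
  shows "x' = x \<and> y' = y"
proof -
  have "x' \<in> side x y" using exit_sides[OF e] edge_W(1)[OF f] s(1) by metis
  moreover have "y' \<in> side y x" using exit_sides[OF edge_sym[OF e(1)] e(2)[symmetric]] edge_W(2)[OF f] s(2) by metis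
  ultimately show ?thesis using crossing[OF e(1) f] by metis
qed

lemma Sg_exit_side:
  assumes "{x, y} \<in> E" "Sg x \<noteq> Sg y"
  shows "Sg x \<in> side x y" "Sg y \<in> side y x"
  using exit_sides[OF assms, of x] exit_sides[OF edge_sym[OF assms(1)] assms(2)[symmetric], of y]
    side_self edge_W assms(1) edge_sym by metis+

text \<open>Contraction of the fibres of \<open>Sg\<close> over \<open>P\<close>. For \<open>P = V\<close> this is the minimum spanning tree, for
  \<open>P = {}\<close> the latent tree.\<close>

definition rep :: "nat set \<Rightarrow> nat \<Rightarrow> nat" where
  "rep P x = (if Sg x \<in> P then Sg x else x)"

definition contr :: "nat set \<Rightarrow> edge_set" where
  "contr P = {{rep P x, rep P y} | x y. {x, y} \<in> E \<and> rep P x \<noteq> rep P y}"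

lemma rep_V: "rep V x = Sg x"
  by (simp add: rep_def Sg_props)

lemma Sg_rep: "Sg (rep P x) = Sg x"
  by (simp add: rep_def Sg_self Sg_props)

lemma rep_W: "x \<in> W \<Longrightarrow> rep P x \<in> W"
  by (simp add: rep_def Sg_W)

lemma contrI: "{x, y} \<in> E \<Longrightarrow> rep P x \<noteq> rep P y \<Longrightarrow> {rep P x, rep P y} \<in> contr P"
  unfolding contr_def by blast

lemma contrE:
  assumes "e \<in> contr P"
  obtains x y where "{x, y} \<in> E" "rep P x \<noteq> rep P y" "e = {rep P x, rep P y}"
  using assms unfolding contr_def by blast

lemma contr_pair_E:
  assumes "{a, b} \<in> contr P"
  obtains x y where "{x, y} \<in> E" "a = rep P x" "b = rep P y" "a \<noteq> b"
proof -
  obtain x y where xy: "{x, y} \<in> E" "rep P x \<noteq> rep P y" "{a, b} = {rep P x, rep P y}"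
    using contrE[OF assms] by metis
  then consider "a = rep P x" "b = rep P y" | "a = rep P y" "b = rep P x" by (auto simp: doubleton_eq_iff)
  then show ?thesis
  proof cases
    case 1
    then show ?thesis using that xy by metis
  next
    case 2
    then show ?thesis using that[of y x] xy edge_sym by metis
  qed
qed

lemma finite_contr: "finite (contr P)" and card_contr: "card (contr P) \<le> card E"
proof -
  have sub: "contr P \<subseteq> (\<lambda>e. rep P ` e) ` E"
  proof
    fix e assume "e \<in> contr P"
    then obtain x y where xy: "{x, y} \<in> E" "e = {rep P x, rep P y}" by (rule contrE)
    then have "e = rep P ` {x, y}" by simp
    then show "e \<in> (\<lambda>e. rep P ` e) ` E" using xy(1) by (rule image_eqI)
  qed
  show "finite (contr P)" by (rule finite_subset[OF sub finite_imageI[OF finite_E]])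
  have "card (contr P) \<le> card ((\<lambda>e. rep P ` e) ` E)" by (rule card_mono[OF finite_imageI[OF finite_E] sub])
  also have "\<dots> \<le> card E" by (rule card_image_le[OF finite_E])
  finally show "card (contr P) \<le> card E" .
qed

text \<open>On the latent path from \<open>v\<close> to \<open>u\<close> some edge
  \<open>{x, y}\<close> changes from a surrogate outside \<open>U\<close> to one in
  \<open>U\<close>. Its surrogates \<open>a\<close> and \<open>b\<close> are no farther apart than
  \<open>v\<close> and \<open>u\<close> and, if equally far, have names no larger. As
  \<open>(v, u)\<close> is the best pair across the cut, they coincide with \<open>v\<close> and
  \<open>u\<close>.\<close>

lemma greedy_contracted:
  assumes g: "greedy_edge V D (v, u)" and D: "\<And>a b. a \<in> V \<Longrightarrow> b \<in> V \<Longrightarrow> D a b = d a b"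
  shows "{v, u} \<in> contr V"
proof -
  obtain U where U: "U \<subseteq> V" "v \<in> V" "v \<notin> U" "u \<in> U" "\<And>a b. a \<in> V - U \<Longrightarrow> b \<in> U \<Longrightarrow> \<not> closer D (a, b) (v, u)"
    using g unfolding greedy_edge_def by auto
  have W: "v \<in> W" "u \<in> W" "u \<in> V" using U V_sub by blast+
  obtain x y where xy: "{x, y} \<in> E" "Sg x \<notin> U" "Sg y \<in> U" "d v u = d v x + d x y + d y u"
    using cut_edge[OF W(1,2), of "{x. Sg x \<notin> U}"] Sg_self U(2,3,4) W(3) by (metis mem_Collect_eq)
  define a where "a = Sg x"
  define b where "b = Sg y"
  have ab: "a \<in> V - U" "b \<in> U" "b \<in> V" using xy Sg_props(1) U(1) by (auto simp: a_def b_def)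
  have xyW: "x \<in> W" "y \<in> W" "a \<in> W" "b \<in> W" using edge_W[OF xy(1)] ab V_sub by blast+
  have da: "d x a \<le> d x v" "d y b \<le> d y u" unfolding a_def b_def using Sg_props(2) U(2) W(3) by blast+
  have tr: "d a b \<le> d a x + d x b" "d x b \<le> d x y + d y b" using triangle xyW by blast+
  have s: "d a x = d x a" "d v x = d x v" using d_sym xyW W by blast+
  have nc: "\<not> closer D (a, b) (v, u)" using U(5) ab by blast
  have DD: "D a b = d a b" "D v u = d v u" using D ab U(2) W(3) by blast+
  have le: "d v u \<le> d a b" using nc DD unfolding closer_def by auto
  have eq: "d x v = d x a" "d y u = d y b" "d a b = d v u" using le da tr s xy(4) by linarith+
  have "a \<le> v" "b \<le> u" unfolding a_def b_def using Sg_tie U(2) W(3) eq(1,2) a_def b_def by metis+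
  moreover have "\<not> max a b < max v u" "max a b = max v u \<Longrightarrow> \<not> min a b < min v u"
    using nc DD eq(3) unfolding closer_def by auto
  ultimately have "a = v" "b = u" by (auto simp: max_def min_def split: if_splits)
  moreover have "v \<noteq> u" using U by blast
  ultimately show ?thesis using contrI[OF xy(1), of V] unfolding rep_V a_def b_def by metis
qed

text \<open>An edge of the contraction comes from an exit edge of \<open>E\<close> that separates
  surrogates. \<open>M\<close>, connecting \<open>V\<close>, must cross this separation, and by
  \<open>exit_unique\<close> only that very edge of the contraction does.\<close>

lemma mst_contraction:
  assumes M: "ltree V M" "M \<subseteq> contr V"
  shows "M = contr V"
proof
  show "contr V \<subseteq> M"
  proof
    fix e assume "e \<in> contr V"
    then obtain x y where xy: "{x, y} \<in> E" "Sg x \<noteq> Sg y" "e = {Sg x, Sg y}" using contrE rep_V by metis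
    obtain h where "tree_metric V M h" using ltree_hop M(1) by blast
    then interpret M: tree_metric V M h .
    have "Sg y \<notin> side x y" using Sg_exit_side(2)[OF xy(1,2)] side_other[OF xy(1) Sg_W] by metis
    then obtain a b where ab: "{a, b} \<in> M" "a \<in> side x y" "b \<notin> side x y"
      using M.cut_edge[OF Sg_props(1) Sg_props(1) Sg_exit_side(1)[OF xy(1,2)]] by metis
    then have "{a, b} \<in> contr V" using M(2) by blast
    then obtain x' y' where xy': "{x', y'} \<in> E" "a = Sg x'" "b = Sg y'" using contr_pair_E rep_V by metis
    have "b \<in> side y x" using ab(3) side_other[OF xy(1) Sg_W] xy'(3) by metis
    then have "x' = x \<and> y' = y" using exit_unique[OF xy(1,2) xy'(1)] ab(2) xy'(2,3) by metis
    then show "e \<in> M" using ab(1) xy' xy(3) by simp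
  qed
qed (rule M(2))

text \<open>To compare \<open>{a, b}\<close> with a pair \<open>a'\<close>, \<open>b'\<close> across
  its cut: some edge on the latent path from \<open>a'\<close> to \<open>b'\<close> moves the
  surrogate across the cut, so it induces \<open>{a, b}\<close>, and its ends are no farther from
  their surrogates than from \<open>a'\<close> and \<open>b'\<close>.\<close>

lemma contraction_is_mst:
  assumes lt: "ltree V (contr V)" and D: "\<And>a b. a \<in> V \<Longrightarrow> b \<in> V \<Longrightarrow> D a b = d a b"
  shows "is_mst V D (contr V)"
proof -
  obtain h where h: "tree_metric V (contr V) h" using ltree_hop lt by blast
  interpret M: tree_metric V "contr V" h by fact
  have "weight D (contr V) \<le> weight D M'" if "tree V M'" for M'
  proof (rule mst_if_cuts_short[OF h _ _ that])
    show "D a b = D b a" if "a \<in> V" "b \<in> V" for a b using D that d_sym V_sub by (metis subsetD)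
    fix a b a' b' assume e: "{a, b} \<in> contr V" and s: "a' \<in> M.side a b" "b' \<in> M.side b a"
    have V: "a \<in> V" "b \<in> V" "a' \<in> V" "b' \<in> V" using M.edge_W[OF e] M.side_W s by blast+
    then have W: "a \<in> W" "b \<in> W" "a' \<in> W" "b' \<in> W" using V_sub by blast+
    have "b' \<notin> M.side a b" using s(2) M.side_other[OF e V(4)] by blast
    then obtain x y where xy: "{x, y} \<in> E" "Sg x \<in> M.side a b" "Sg y \<notin> M.side a b" "d a' b' = d a' x + d x y + d y b'"
      using cut_edge[OF W(3,4), of "{z. Sg z \<in> M.side a b}"] Sg_self V s(1) by (metis mem_Collect_eq)
    have "{Sg x, Sg y} \<in> contr V" using contrI[OF xy(1), of V] rep_V xy(2,3) by metis
    then have eq: "Sg x = a" "Sg y = b" using M.side_step[OF e _ xy(2,3)] by blast+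
    have xyW: "x \<in> W" "y \<in> W" using edge_W[OF xy(1)] by blast+
    have "d x a \<le> d x a'" "d y b \<le> d y b'" using Sg_props(2) V eq by metis+
    moreover have "d a b \<le> d a x + d x b" "d x b \<le> d x y + d y b" using triangle W xyW by blast+
    moreover have "d a x = d x a" "d a' x = d x a'" using d_sym W xyW by blast+
    ultimately have "d a b \<le> d a' b'" using xy(4) by linarith
    then show "D a b \<le> D a' b'" using D V by simp
  qed
  then show ?thesis unfolding is_mst_def using ltree_tree[OF lt] by blast
qed

section \<open>The latent tree around one observed node\<close>

definition fibre :: "nat \<Rightarrow> nat set" where
  "fibre v = {x \<in> W. Sg x = v}"

definition exits :: "nat \<Rightarrow> (nat \<times> nat) set" where
  "exits v = {(x, y). {x, y} \<in> E \<and> Sg x = v \<and> Sg y \<noteq> v}"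

definition nbrs :: "nat set \<Rightarrow> nat \<Rightarrow> nat set" where
  "nbrs P v = (\<lambda>(x, y). rep P y) ` exits v"

definition local_nodes :: "nat set \<Rightarrow> nat \<Rightarrow> nat set" where
  "local_nodes P v = fibre v \<union> nbrs P v"

text \<open>An edge to an attached leaf stands for the whole latent path from \<open>x\<close> to
  \<open>rep P y\<close>. It need not belong to \<open>E\<close>, and the bound \<open>u\<close> on
  edge lengths does not apply to it.\<close>

definition local_edges :: "nat set \<Rightarrow> nat \<Rightarrow> edge_set" where
  "local_edges P v = {{x, y} | x y. {x, y} \<in> E \<and> Sg x = v \<and> Sg y = v} \<union> {{x, rep P y} | x y. (x, y) \<in> exits v}"

lemma exitD: "(x, y) \<in> exits v \<Longrightarrow> {x, y} \<in> E" "(x, y) \<in> exits v \<Longrightarrow> Sg x = v" "(x, y) \<in> exits v \<Longrightarrow> Sg y \<noteq> v"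
  "(x, y) \<in> exits v \<Longrightarrow> Sg x \<noteq> Sg y"
  unfolding exits_def by auto

lemma nbrs_E:
  assumes "w \<in> nbrs P v" obtains x y where "(x, y) \<in> exits v" "w = rep P y"
  using assms unfolding nbrs_def by auto

lemma nbrs_I: "(x, y) \<in> exits v \<Longrightarrow> rep P y \<in> nbrs P v"
  unfolding nbrs_def by force

lemma nbrs_Sg: "w \<in> nbrs P v \<Longrightarrow> w \<in> W \<and> Sg w \<noteq> v"
  using nbrs_E exitD edge_W(2) rep_W Sg_rep by metis

lemma finite_exits: "finite (exits v)"
proof -
  have "exits v \<subseteq> W \<times> W"
  proof clarify
    fix a b assume "(a, b) \<in> exits v"
    from exitD(1)[OF this] show "a \<in> W \<and> b \<in> W" using edge_W(1,2) by metis
  qed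
  then show ?thesis by (rule finite_subset[OF _ finite_cartesian_product[OF finite_W finite_W]])
qed

lemma fibre_self: "v \<in> V \<Longrightarrow> v \<in> fibre v"
  unfolding fibre_def using Sg_self V_sub by blast

lemma rep_exit_side: "(x, y) \<in> exits v \<Longrightarrow> rep P y \<in> side y x"
  using Sg_exit_side(2)[OF exitD(1) exitD(4)] side_self[OF edge_sym[OF exitD(1)]] by (auto simp: rep_def)

lemma fibre_side:
  assumes "(x, y) \<in> exits v" "z \<in> fibre v" shows "z \<in> side x y"
proof (rule ccontr)
  have z: "z \<in> W" "Sg z = v" using assms(2) unfolding fibre_def by auto
  have e: "{x, y} \<in> E" "Sg x = v" "Sg y \<noteq> v" "Sg x \<noteq> Sg y" using exitD[OF assms(1)] by blast+
  assume "z \<notin> side x y"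
  then have "Sg z \<notin> side x y" using exit_sides[OF e(1,4) z(1)] by metis
  then show False using Sg_exit_side(1)[OF e(1,4)] e(2) z(2) by simp
qed

text \<open>Were the leaf of another exit beyond \<open>(x, y)\<close>, the edge of that exit would
  join surrogates on the two sides, and \<open>exit_unique\<close> would identify the exits. So the
  leaves attached to different exits are different nodes.\<close>

lemma exit_side_other:
  assumes "(x, y) \<in> exits v" "(x', y') \<in> exits v" "(x', y') \<noteq> (x, y)"
  shows "rep P y' \<in> side x y"
proof (rule ccontr)
  have e: "{x, y} \<in> E" "Sg x = v" "Sg x \<noteq> Sg y" and e': "{x', y'} \<in> E" "Sg x' = v"
    using exitD[OF assms(1)] exitD[OF assms(2)] by blast+
  assume "rep P y' \<notin> side x y"
  then have "Sg y' \<in> side y x"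
    using exit_sides[OF e(1,3) rep_W[OF edge_W(2)[OF e'(1)]]] Sg_rep side_other[OF e(1) Sg_W] by metis
  then have "x' = x \<and> y' = y" using exit_unique[OF e(1,3) e'(1)] Sg_exit_side(1)[OF e(1,3)] e(2) e'(2) by metis
  then show False using assms(3) by simp
qed

lemma rep_exit_inj: "inj_on (\<lambda>(x, y). rep P y) (exits v)"
proof (rule inj_onI, clarify)
  fix x y x' y' assume a: "(x, y) \<in> exits v" "(x', y') \<in> exits v" "rep P y = rep P y'"
  have "rep P y \<notin> side x y"
    using rep_exit_side[OF a(1)] side_other[OF exitD(1)[OF a(1)] rep_W[OF edge_W(2)[OF exitD(1)[OF a(1)]]]] by metis
  then have "(x', y') = (x, y)" using exit_side_other[OF a(1,2)] a(3) by metis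
  then show "x = x' \<and> y = y'" by simp
qed

lemma card_nbrs: "card (nbrs P v) = card (exits v)"
  unfolding nbrs_def by (rule card_image[OF rep_exit_inj])

text \<open>Every local node but the leaf itself lies on the near side of the exit edge, by
  \<open>fibre_side\<close> or \<open>exit_side_other\<close>, so the leaf hangs off
  \<open>x\<close>.\<close>

lemma local_split:
  assumes ex: "(x, y) \<in> exits v" and z: "z \<in> local_nodes P v"
  shows "z = rep P y \<or> d z (rep P y) = d z x + d x (rep P y)"
proof (cases "z \<in> fibre v")
  case True
  then show ?thesis using side_between(1)[OF exitD(1)[OF ex] fibre_side[OF ex] rep_exit_side[OF ex]] by metis
next
  case False
  then obtain x' y' where e': "(x', y') \<in> exits v" "z = rep P y'"
    using z nbrs_E unfolding local_nodes_def by blast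
  show ?thesis
  proof (cases "(x', y') = (x, y)")
    case False
    then show ?thesis
      using side_between(1)[OF exitD(1)[OF ex] exit_side_other[OF ex e'(1) False] rep_exit_side[OF ex]] e'(2) by metis
  qed (use e' in simp)
qed

lemma local_W: "local_nodes P v \<subseteq> W"
  unfolding local_nodes_def fibre_def using nbrs_Sg by blast

lemma local_edge_cases:
  assumes "{a, b} \<in> local_edges P v"
  obtains "{a, b} \<in> E" "Sg a = v" "Sg b = v" | y where "(a, y) \<in> exits v" "b = rep P y" | y where "(b, y) \<in> exits v" "a = rep P y"
proof -
  from assms consider x y where "{a, b} = {x, y}" "{x, y} \<in> E" "Sg x = v" "Sg y = v"
    | x y where "{a, b} = {x, rep P y}" "(x, y) \<in> exits v"
    unfolding local_edges_def by blast
  then show ?thesis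
  proof cases
    case 1
    then have "Sg a = v" "Sg b = v" by (metis doubleton_eq_iff)+
    then show ?thesis using that(1) 1 by metis
  next
    case 2
    then have "a = x \<and> b = rep P y \<or> a = rep P y \<and> b = x" by (auto simp: doubleton_eq_iff)
    then show ?thesis using that(2,3) 2 by metis
  qed
qed

text \<open>Edges inside the fibre inherit \<open>split\<close> and \<open>cross\<close> from the
  whole tree, as distances are the same. For an edge to a leaf both follow from
  \<open>local_split\<close>. Connectedness uses \<open>Sg_between\<close>: the path from a node to
  its surrogate stays in the fibre.\<close>

lemma local_tree:
  assumes v: "v \<in> V"
  shows "tree_metric (local_nodes P v) (local_edges P v) d"
proof
  have LW: "z \<in> W" if "z \<in> local_nodes P v" for z using local_W that by blast
  have exL: "x \<in> local_nodes P v" "rep P y \<in> local_nodes P v" "x \<in> W" "rep P y \<in> W" "x \<noteq> rep P y" if "(x, y) \<in> exits v" for x y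
  proof -
    have x: "x \<in> fibre v" using exitD[OF that] edge_W unfolding fibre_def by blast
    show 1: "x \<in> local_nodes P v" "rep P y \<in> local_nodes P v" using x nbrs_I[OF that] unfolding local_nodes_def by blast+
    show "x \<in> W" "rep P y \<in> W" using 1 LW by blast+
    show "x \<noteq> rep P y" using nbrs_Sg[OF nbrs_I[OF that]] exitD(2)[OF that] by metis
  qed
  have inL: "a \<in> local_nodes P v" if "a \<in> W" "Sg a = v" for a using that unfolding local_nodes_def fibre_def by blast
  show "finite (local_nodes P v)" using local_W finite_W finite_subset by metis
  show "local_nodes P v \<noteq> {}" using fibre_self[OF v] unfolding local_nodes_def by blast
  show "a \<in> local_nodes P v \<and> b \<in> local_nodes P v \<and> a \<noteq> b" if "{a, b} \<in> local_edges P v" for a b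
    using that
  proof (cases rule: local_edge_cases)
    case 1
    then show ?thesis using inL edge_W by blast
  next
    case (2 y)
    then show ?thesis using exL by metis
  next
    case (3 y)
    then show ?thesis using exL by metis
  qed
  show "\<exists>x y. e = {x, y}" if "e \<in> local_edges P v" for e using that unfolding local_edges_def by blast
  show "d a b = d b a" if "a \<in> local_nodes P v" "b \<in> local_nodes P v" for a b
    by (rule d_sym[OF LW[OF that(1)] LW[OF that(2)]])
  show "d a a = 0" if "a \<in> local_nodes P v" for a by (rule d_refl[OF LW[OF that]])
  show "0 < d a b" if "a \<in> local_nodes P v" "b \<in> local_nodes P v" "a \<noteq> b" for a b
    by (rule d_pos[OF LW[OF that(1)] LW[OF that(2)] that(3)])
  have split1: "d z b = d z a + d a b \<or> d z a = d z b + d b a" if "{a, b} \<in> local_edges P v" "z \<in> local_nodes P v" for a b z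
    using that(1)
  proof (cases rule: local_edge_cases)
    case 1
    then show ?thesis using split that(2) LW by blast
  next
    case (2 y)
    have "d b b = 0" using d_refl exL(4)[OF 2(1)] 2(2) by metis
    moreover have "d b a = d b b + d b a" using calculation by simp
    ultimately show ?thesis using local_split[OF 2(1) that(2)] 2(2) by metis
  next
    case (3 y)
    have "d a a = 0" using d_refl exL(4)[OF 3(1)] 3(2) by metis
    moreover have "d a b = d a a + d a b" using calculation by simp
    ultimately show ?thesis using local_split[OF 3(1) that(2)] 3(2) by metis
  qed
  then show "{a, b} \<in> local_edges P v \<Longrightarrow> z \<in> local_nodes P v \<Longrightarrow> d z b = d z a + d a b \<or> d z a = d z b + d b a" for a b z .
  show "d a' b' = d a' a + d a b + d b b'"
    if e: "{a, b} \<in> local_edges P v" and L: "a' \<in> local_nodes P v" "b' \<in> local_nodes P v"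
      and s: "d a' b = d a' a + d a b" "d b' a = d b' b + d b a" for a b a' b'
    using e
  proof (cases rule: local_edge_cases)
    case 1
    then show ?thesis using cross s L LW by blast
  next
    case (2 y)
    have W: "a \<in> W" "b \<in> W" "a' \<in> W" "b' \<in> W" using exL[OF 2(1)] 2(2) L LW by blast+
    have p: "0 < d a b" "d b a = d a b" "d b' a = d a b'" "d b' b = d b b'" "d a a = 0" "d b b = 0"
      using d_pos d_sym d_refl W exL(5)[OF 2(1)] 2(2) by metis+
    have "\<not> d b' b = d b' a + d a b" using s(2) p by linarith
    then have "b' = b" using local_split[OF 2(1) L(2)] 2(2) by metis
    then show ?thesis using s(1) p by simp
  next
    case (3 y)
    have W: "a \<in> W" "b \<in> W" "a' \<in> W" "b' \<in> W" using exL[OF 3(1)] 3(2) L LW by blast+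
    have p: "0 < d a b" "d b a = d a b" "d b' a = d a b'" "d b' b = d b b'" "d a a = 0" "d b b = 0"
      using d_pos d_sym d_refl W exL(5)[OF 3(1)] 3(2) by metis+
    have "\<not> d a' a = d a' b + d b a" using s(1) p by linarith
    then have "a' = a" using local_split[OF 3(1) L(1)] 3(2) by metis
    then show ?thesis using s(2) p by simp
  qed
  have tov: "(x, v) \<in> (adjacent (local_edges P v))\<^sup>*" if x: "x \<in> W" "Sg x = v" for x
  proof -
    have vW: "v \<in> W" using v V_sub by blast
    have "Sg x = v \<longrightarrow> (x, v) \<in> (adjacent (local_edges P v))\<^sup>*"
      using x(1) vW
    proof (induction x rule: path_induct)
      case (step x z)
      show ?case
      proof
        assume xv: "Sg x = v"
        have "d x v = d x z + d z v" using next_dist step by blast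
        then have zv: "Sg z = v" using Sg_between[of x z] xv step(1) edge_W(2)[OF step(3)] by metis
        then have "(x, z) \<in> adjacent (local_edges P v)"
          using step(3) xv unfolding adjacent_def local_edges_def by blast
        then show "(x, v) \<in> (adjacent (local_edges P v))\<^sup>*" using step(5) zv by (meson converse_rtrancl_into_rtrancl)
      qed
    qed simp
    then show ?thesis using x by blast
  qed
  have tov': "(z, v) \<in> (adjacent (local_edges P v))\<^sup>*" if z: "z \<in> local_nodes P v" for z
  proof (cases "Sg z = v")
    case True
    then show ?thesis using tov LW z by blast
  next
    case False
    then obtain x y where e: "(x, y) \<in> exits v" "z = rep P y" using z nbrs_E unfolding local_nodes_def fibre_def by blast
    then have "{z, x} \<in> local_edges P v" unfolding local_edges_def by (auto simp: insert_commute)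
    then have "(z, x) \<in> adjacent (local_edges P v)" by (simp add: adjacent_def)
    moreover have "(x, v) \<in> (adjacent (local_edges P v))\<^sup>*" using tov exL(3)[OF e(1)] exitD(2)[OF e(1)] by blast
    ultimately show ?thesis by (meson converse_rtrancl_into_rtrancl)
  qed
  show "(a, b) \<in> (adjacent (local_edges P v))\<^sup>*" if "a \<in> local_nodes P v" "b \<in> local_nodes P v" for a b
    using tov'[OF that(1)] adjacent_sym[OF tov'[OF that(2)]] by (rule rtrancl_trans)
qed

text \<open>Neighbours outside the fibre are exchanged for attached leaves, and
  \<open>rep_exit_inj\<close> shows that none are merged. Hence hidden nodes still have degree at
  least three in the local tree.\<close>

lemma local_degree:
  assumes x: "x \<in> W" "Sg x = v"
  shows "card (neighbours (local_edges P v) x) = card (neighbours E x)"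
proof -
  define f where "f y = (if Sg y = v then y else rep P y)" for y
  have "inj_on f (neighbours E x)"
  proof (rule inj_onI)
    fix y y' assume y: "y \<in> neighbours E x" "y' \<in> neighbours E x" "f y = f y'"
    have "Sg (f y) = Sg y" "Sg (f y') = Sg y'" using Sg_rep by (simp_all add: f_def)
    then have s: "Sg y = Sg y'" using y(3) by metis
    show "y = y'"
    proof (cases "Sg y = v")
      case False
      then have "(x, y) \<in> exits v" "(x, y') \<in> exits v" using y s x unfolding exits_def neighbours_def by auto
      moreover have "rep P y = rep P y'" using y(3) s False by (simp add: f_def)
      ultimately show ?thesis using rep_exit_inj[of P v] unfolding inj_on_def by auto
    qed (use y(3) s in \<open>simp add: f_def\<close>)
  qed
  moreover have "f ` neighbours E x = neighbours (local_edges P v) x"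
  proof (intro equalityI subsetI)
    fix z assume "z \<in> f ` neighbours E x"
    then obtain y where y: "{x, y} \<in> E" "z = f y" unfolding neighbours_def by auto
    then show "z \<in> neighbours (local_edges P v) x"
      using x unfolding neighbours_def local_edges_def f_def exits_def by (cases "Sg y = v") auto
  next
    fix z assume "z \<in> neighbours (local_edges P v) x"
    then have "{x, z} \<in> local_edges P v" by (simp add: neighbours_def)
    then show "z \<in> f ` neighbours E x"
    proof (cases rule: local_edge_cases)
      case 1
      then show ?thesis by (intro image_eqI[of _ _ z]) (simp_all add: f_def neighbours_def)
    next
      case (2 y)
      then show ?thesis using exitD[OF 2(1)] by (intro image_eqI[of _ _ y]) (simp_all add: f_def neighbours_def)
    next
      case (3 y)
      then have "Sg x = Sg y" using Sg_rep by metis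
      then show ?thesis using exitD(3)[OF 3(1)] x(2) by metis
    qed
  qed
  ultimately show ?thesis by (metis card_image)
qed

lemma local_latent:
  assumes v: "v \<in> V"
  shows "latent (local_nodes P v) (local_edges P v) d (insert v (nbrs P v))"
proof -
  interpret L: tree_metric "local_nodes P v" "local_edges P v" d by (rule local_tree[OF v])
  show ?thesis
  proof
    show "insert v (nbrs P v) \<subseteq> local_nodes P v" unfolding local_nodes_def using fibre_self[OF v] by blast
    show "insert v (nbrs P v) \<noteq> {}" by simp
    fix x assume "x \<in> local_nodes P v - insert v (nbrs P v)"
    then have x: "x \<in> W" "Sg x = v" "x \<noteq> v" unfolding local_nodes_def fibre_def by auto
    then have "x \<in> W - V" using Sg_self by auto
    then show "3 \<le> card (neighbours (local_edges P v) x)" using hidden_deg local_degree[OF x(1,2)] by metis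
  qed
qed

text \<open>Ties the local tree to the program, which hands the closed neighbourhood of
  \<open>v\<close> in the current tree to recursive grouping: these are the nodes that the local
  tree treats as active.\<close>

lemma contr_neighbours:
  assumes v: "v \<in> P" "P \<subseteq> V"
  shows "neighbours (contr P) v = nbrs P v"
proof (intro equalityI subsetI)
  fix z assume "z \<in> neighbours (contr P) v"
  then have "{v, z} \<in> contr P" by (simp add: neighbours_def)
  then obtain x y where xy: "{x, y} \<in> E" "v = rep P x" "z = rep P y" "v \<noteq> z" by (rule contr_pair_E)
  have "Sg v = v" using Sg_self v by blast
  then have "Sg x = v" using xy(2) Sg_rep by metis
  moreover have "Sg y \<noteq> v" using xy(3,4) v(1) by (auto simp: rep_def)
  ultimately have "(x, y) \<in> exits v" using xy(1) by (simp add: exits_def)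
  then show "z \<in> nbrs P v" using nbrs_I xy(3) by metis
next
  fix z assume "z \<in> nbrs P v"
  then obtain x y where e: "(x, y) \<in> exits v" "z = rep P y" by (rule nbrs_E)
  have "rep P x = v" using exitD(2)[OF e(1)] v(1) by (simp add: rep_def)
  moreover have "v \<noteq> z" using nbrs_Sg[OF nbrs_I[OF e(1)], of P] e(2) Sg_self v by (metis subsetD)
  ultimately have "{v, z} \<in> contr P" using contrI[OF exitD(1)[OF e(1)], of P] e(2) by metis
  then show "z \<in> neighbours (contr P) v" by (simp add: neighbours_def)
qed

text \<open>Undoing the contraction of one fibre affects only edges with an end in it; in
  \<open>contr P\<close> these are the edges at \<open>v\<close>. This is the replacement of a
  neighbourhood performed by CLRG.\<close>

lemma contr_step:
  assumes v: "v \<in> P" "P \<subseteq> V"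
  shows "contr (P - {v}) = {e \<in> contr P. v \<notin> e} \<union> local_edges P v"
proof -
  have Sv: "Sg v = v" using Sg_self v by blast
  have r: "rep (P - {v}) x = (if Sg x = v then x else rep P x)" for x by (simp add: rep_def)
  have rv: "rep P x = v \<longleftrightarrow> Sg x = v" for x using Sg_rep[of P x] Sv v(1) by (metis rep_def)
  show ?thesis
  proof (intro equalityI subsetI)
    fix e assume "e \<in> contr (P - {v})"
    then obtain x y where xy: "{x, y} \<in> E" "rep (P - {v}) x \<noteq> rep (P - {v}) y" "e = {rep (P - {v}) x, rep (P - {v}) y}" by (rule contrE)
    consider "Sg x = v" "Sg y = v" | "Sg x = v" "Sg y \<noteq> v" | "Sg x \<noteq> v" "Sg y = v" | "Sg x \<noteq> v" "Sg y \<noteq> v" by blast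
    then show "e \<in> {e \<in> contr P. v \<notin> e} \<union> local_edges P v"
    proof cases
      case 1
      then show ?thesis using xy r unfolding local_edges_def by auto
    next
      case 2
      then have "(x, y) \<in> exits v" using xy(1) by (simp add: exits_def)
      then show ?thesis using xy(3) 2 r unfolding local_edges_def by auto
    next
      case 3
      then have "(y, x) \<in> exits v" using edge_sym[OF xy(1)] by (simp add: exits_def)
      then show ?thesis using xy(3) 3 r unfolding local_edges_def by (auto simp: insert_commute)
    next
      case 4
      then have "e = {rep P x, rep P y}" "rep P x \<noteq> rep P y" using xy r by simp_all
      then show ?thesis using contrI[OF xy(1), of P] rv 4 by auto
    qed
  next
    fix e assume "e \<in> {e \<in> contr P. v \<notin> e} \<union> local_edges P v"
    then show "e \<in> contr (P - {v})"
    proof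
      assume e: "e \<in> {e \<in> contr P. v \<notin> e}"
      then obtain x y where xy: "{x, y} \<in> E" "rep P x \<noteq> rep P y" "e = {rep P x, rep P y}" using contrE by blast
      then have "rep P x \<noteq> v" "rep P y \<noteq> v" using e by auto
      then have "Sg x \<noteq> v" "Sg y \<noteq> v" using rv by metis+
      then show ?thesis using contrI[OF xy(1), of "P - {v}"] xy r by simp
    next
      assume e: "e \<in> local_edges P v"
      then obtain a b where ab: "e = {a, b}" unfolding local_edges_def by blast
      have "{a, b} \<in> local_edges P v" using e ab by simp
      then show ?thesis
      proof (cases rule: local_edge_cases)
        case 1
        then show ?thesis using contrI[OF 1(1), of "P - {v}"] r edge_W(3)[OF 1(1)] ab by simp
      next
        case (2 y)
        have "b \<noteq> a" using nbrs_Sg[OF nbrs_I[OF 2(1)], of P] 2(2) exitD(2)[OF 2(1)] by metis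
        then show ?thesis using contrI[OF exitD(1)[OF 2(1)], of "P - {v}"] r exitD(2,3)[OF 2(1)] 2(2) ab by simp
      next
        case (3 y)
        have "b \<noteq> a" using nbrs_Sg[OF nbrs_I[OF 3(1)], of P] 3(2) exitD(2)[OF 3(1)] by metis
        then show ?thesis using contrI[OF exitD(1)[OF 3(1)], of "P - {v}"] r exitD(2,3)[OF 3(1)] 3(2) ab
          by (simp add: insert_commute)
      qed
    qed
  qed
qed

section \<open>Few deep hidden nodes\<close>

text \<open>The node of the fibre farthest from \<open>v\<close> is hidden, and its neighbours away
  from \<open>v\<close>, at least two, lie outside the fibre. So observed nodes with a single exit
  are alone in their fibre and may be left unprocessed.\<close>

lemma hidden_fibre_exits:
  assumes x: "x \<in> fibre v" "x \<notin> V" and v: "v \<in> V"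
  shows "2 \<le> card (exits v)"
proof -
  have vW: "v \<in> W" using v V_sub by blast
  have fin: "finite (fibre v)" "fibre v \<noteq> {}" using x(1) finite_W unfolding fibre_def by auto
  obtain q where q: "q \<in> fibre v" "\<And>w. w \<in> fibre v \<Longrightarrow> d v w \<le> d v q" using finite_maximizer[OF fin] by metis
  have qW: "q \<in> W" "Sg q = v" using q(1) unfolding fibre_def by auto
  have xv: "x \<in> W" "x \<noteq> v" using x v unfolding fibre_def by auto
  have "q \<noteq> v" using q(2)[OF x(1)] d_pos[OF vW xv(1)] d_refl[OF vW] xv(2) by auto
  then have qV: "q \<notin> V" using Sg_self qW(2) by metis
  obtain u where u: "{q, u} \<in> E" "\<And>w. {q, w} \<in> E \<Longrightarrow> v \<in> side w q \<longleftrightarrow> w = u"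
    using towards_unique[OF vW qW(1)] \<open>q \<noteq> v\<close> by metis
  have ex: "(q, w) \<in> exits v" if "w \<in> neighbours E q - {u}" for w
  proof -
    have w: "{q, w} \<in> E" "w \<noteq> u" using that by (auto simp: neighbours_def)
    have "d v w = d v q + d q w" using farther_neighbour[OF vW qW(1) w(1)] u(2)[OF w(1)] w(2) by metis
    then have "w \<notin> fibre v" using q(2)[of w] edge_pos[OF w(1)] by auto
    then have "Sg w \<noteq> v" using edge_W(2)[OF w(1)] unfolding fibre_def by blast
    then show ?thesis using w(1) qW(2) by (simp add: exits_def)
  qed
  have "3 \<le> card (neighbours E q)" using hidden_deg qW(1) qV by blast
  then have "2 \<le> card (neighbours E q - {u})"
    using u(1) finite_neighbours[of q] by (simp add: neighbours_def card_Diff_singleton)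
  also have "\<dots> = card (Pair q ` (neighbours E q - {u}))" by (simp add: card_image inj_on_def)
  also have "\<dots> \<le> card (exits v)" using ex finite_exits by (intro card_mono) auto
  finally show ?thesis .
qed

definition deep :: "real \<Rightarrow> nat set" where
  "deep u = {x \<in> W. \<forall>w\<in>V. u < d x w}"

text \<open>On the way into the branch take an edge \<open>{q, a}\<close> from a hidden to an
  observed node. The surrogate of \<open>q\<close> is within \<open>u\<close>, so the deep node
  \<open>x\<close> cannot lie between them and the surrogate stays in the branch. Its fibre contains
  the hidden \<open>q\<close> and thus has two exits.\<close>

lemma deep_branch:
  assumes u: "\<And>x y. {x, y} \<in> E \<Longrightarrow> d x y \<le> u" and x: "x \<in> deep u" and e: "{x, z} \<in> E"
  shows "{v \<in> V. 2 \<le> card (exits v)} \<inter> side z x \<noteq> {}"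
proof -
  have W: "x \<in> W" "z \<in> W" using edge_W e by blast+
  have far: "u < d x w" if "w \<in> V" for w using x that unfolding deep_def by blast
  have zV: "z \<notin> V" using far[of z] u[OF e] by auto
  obtain y where y: "y \<in> V" "y \<in> side z x" using branch_meets[of V x z] hidden_deg e by fastforce
  have yW: "y \<in> W" using y V_sub by blast
  obtain q a where qa: "{q, a} \<in> E" "q \<notin> V" "a \<in> V" "d z y = d z q + d q a + d a y"
    using cut_edge[OF W(2) yW, of "- V"] zV y(1) by auto
  have qW: "q \<in> W" "a \<in> W" using edge_W[OF qa(1)] by blast+
  have qs: "q \<in> side z x"
  proof (rule ccontr)
    assume "q \<notin> side z x"
    then have "q \<in> side x z" using side_other[OF edge_sym[OF e] qW(1)] by blast
    then have "d q y = d q x + d x z + d z y" using side_cross[OF e _ y(2)] by blast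
    moreover have "d q y \<le> d q a + d a y" "0 \<le> d q x" "0 < d x z" "0 \<le> d z q"
      using triangle d_nonneg edge_pos[OF e] W qW yW by blast+
    ultimately show False using qa(4) by linarith
  qed
  have near: "d q (Sg q) \<le> u" using Sg_props(2)[OF qa(3), of q] u[OF qa(1)] by linarith
  have "Sg q \<in> side z x"
  proof (rule ccontr)
    assume "Sg q \<notin> side z x"
    then have "Sg q \<in> side x z" using side_other[OF edge_sym[OF e] Sg_W] by blast
    then have "d q (Sg q) = d q x + d x (Sg q)" using side_between(2)[OF edge_sym[OF e] qs] by blast
    then show False using near far[OF Sg_props(1)] d_nonneg[OF qW(1) W(1)] by (smt (verit))
  qed
  moreover have "2 \<le> card (exits (Sg q))"
    using hidden_fibre_exits[of q "Sg q"] qa(2) qW(1) Sg_props(1) unfolding fibre_def by blast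
  ultimately show ?thesis using Sg_props(1) by blast
qed

lemma card_deep:
  assumes u: "\<And>x y. {x, y} \<in> E \<Longrightarrow> d x y \<le> u" and "0 \<le> u"
  shows "card (deep u) \<le> card {v \<in> V. 2 \<le> card (exits v)}"
proof (rule card_branching_le)
  show "deep u \<subseteq> W" unfolding deep_def by blast
  show "finite {v \<in> V. 2 \<le> card (exits v)}" using finite_V by simp
  show "{v \<in> V. 2 \<le> card (exits v)} \<subseteq> W" using V_sub by blast
  show "3 \<le> card (neighbours E x)" if x: "x \<in> deep u" for x
  proof (rule hidden_deg)
    have "x \<notin> V"
    proof
      assume "x \<in> V"
      then have "u < d x x" using x unfolding deep_def by blast
      then show False using d_refl[of x] x assms(2) unfolding deep_def by simp
    qed
    then show "x \<in> W - V" using x unfolding deep_def by blast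
  qed
  show "{v \<in> V. 2 \<le> card (exits v)} \<inter> side z x \<noteq> {}" if "x \<in> deep u" "{x, z} \<in> E" for x z
    by (rule deep_branch[OF u that])
qed

text \<open>The same count with all observed nodes as marks; every branch contains one by
  \<open>branch_meets\<close>.\<close>

lemma card_hidden: "card (W - V) \<le> card V"
proof (rule card_branching_le)
  show "V \<inter> side z x \<noteq> {}" if "{x, z} \<in> E" for x z
    using branch_meets[of V x z] hidden_deg that by fastforce
qed (use finite_V V_sub hidden_deg in auto)

lemma local_hops:
  assumes v: "v \<in> V" and u: "0 \<le> u" and l: "0 < l" "\<And>x y. {x, y} \<in> E \<Longrightarrow> l \<le> d x y"
    and h: "tree_metric (local_nodes P v) (local_edges P v) h" "\<And>x y. {x, y} \<in> local_edges P v \<Longrightarrow> h x y = 1"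
    and z: "z \<in> local_nodes P v"
  shows "h z v \<le> u / l + real (card (deep u \<inter> fibre v)) + 1"
proof -
  interpret h: tree_metric "local_nodes P v" "local_edges P v" h by fact
  have vW: "v \<in> W" "v \<in> local_nodes P v" using v V_sub fibre_self[OF v] unfolding local_nodes_def by blast+
  have inL: "x \<in> local_nodes P v" if "x \<in> fibre v" for x using that unfolding local_nodes_def by blast
  \<comment> \<open>\<open>F x\<close> collects the deep nodes of the fibre no farther from
    \<open>v\<close> than \<open>x\<close>. On a path leaving \<open>v\<close> it grows with every
    deep node met, while nodes that are not deep are handled by \<open>hop\<close>.\<close>
  define F where "F x = {y \<in> deep u \<inter> fibre v. d y v \<le> d x v}" for x
  have finF: "finite (F x)" for x unfolding F_def fibre_def using finite_W by simp
  have nstep: "z \<in> fibre v \<and> h x v \<le> 1 + h z v \<and> d x v = d x z + d z v"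
    if "x \<in> fibre v" "{x, z} \<in> E" "v \<in> side z x" for x z
  proof -
    have dx: "d x v = d x z + d z v" using next_dist that by blast
    have xW: "x \<in> W" "Sg x = v" "z \<in> W" using that edge_W unfolding fibre_def by auto
    then have "Sg z = v" using Sg_between[of x z] dx by metis
    then have zf: "z \<in> fibre v" using xW unfolding fibre_def by blast
    have "{x, z} \<in> local_edges P v" using that(2) xW \<open>Sg z = v\<close> unfolding local_edges_def by blast
    then have "h x z = 1" using h(2) by blast
    moreover have "h x v \<le> h x z + h z v" using h.triangle inL that(1) zf vW(2) by blast
    ultimately show ?thesis using zf dx by simp
  qed
  have hop: "x \<in> fibre v \<longrightarrow> l * h x v \<le> d x v" if "x \<in> W" for x
    using that vW(1)
  proof (induction x rule: path_induct)
    case refl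
    then show ?case using h.d_refl[OF vW(2)] d_refl[OF vW(1)] by simp
  next
    case (step x z)
    show ?case
    proof
      assume "x \<in> fibre v"
      from nstep[OF this step(3,4)] have s: "z \<in> fibre v" "h x v \<le> 1 + h z v" "d x v = d x z + d z v" by blast+
      have "l * h x v \<le> l * (1 + h z v)" using s(2) l(1) by simp
      also have "\<dots> \<le> d x v" using step(5) s(1,3) l(2)[OF step(3)] by (simp add: distrib_left)
      finally show "l * h x v \<le> d x v" .
    qed
  qed
  have bound: "x \<in> fibre v \<longrightarrow> h x v \<le> u / l + card (F x)" if "x \<in> W" for x
    using that vW(1)
  proof (induction x rule: path_induct)
    case refl
    have "h v v = 0" using h.d_refl[OF vW(2)] .
    then show ?case using u l(1) by simp
  next
    case (step x z)
    show ?case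
    proof
      assume xf: "x \<in> fibre v"
      from nstep[OF this step(3,4)] have s: "z \<in> fibre v" "h x v \<le> 1 + h z v" "d x v = d x z + d z v" by blast+
      have xW: "x \<in> W" "Sg x = v" using xf unfolding fibre_def by auto
      show "h x v \<le> u / l + card (F x)"
      proof (cases "x \<in> deep u")
        case True
        have "insert x (F z) \<subseteq> F x" using True xf s(3) edge_pos[OF step(3)] unfolding F_def by auto
        moreover have "x \<notin> F z" using s(3) edge_pos[OF step(3)] unfolding F_def by auto
        ultimately have "Suc (card (F z)) \<le> card (F x)" using finF card_mono[of "F x" "insert x (F z)"] by simp
        then show ?thesis using step(5) s(1,2) by simp
      next
        case False
        then obtain w where "w \<in> V" "d x w \<le> u" using xW unfolding deep_def by (auto simp: not_less)
        then have "d x v \<le> u" using Sg_props(2)[of w x] xW(2) by simp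
        then have "l * h x v \<le> u" using hop[OF xW(1)] xf by simp
        then have "h x v \<le> u / l" using l(1) by (simp add: field_simps)
        then show ?thesis by simp
      qed
    qed
  qed
  have fb: "h x v \<le> u / l + card (deep u \<inter> fibre v)" if "x \<in> fibre v" for x
  proof -
    have "finite (deep u \<inter> fibre v)" unfolding fibre_def using finite_W by simp
    then have "card (F x) \<le> card (deep u \<inter> fibre v)" by (rule card_mono) (auto simp: F_def)
    moreover have "x \<in> W" using that unfolding fibre_def by blast
    ultimately show ?thesis using bound[of x] that by simp
  qed
  show ?thesis
  proof (cases "z \<in> fibre v")
    case True
    then show ?thesis using fb[OF True] by simp
  next
    \<comment> \<open>An attached leaf is one edge beyond the fibre; this is the last summand
      1.\<close>
    case False
    then obtain x y where e: "(x, y) \<in> exits v" "z = rep P y" using z nbrs_E unfolding local_nodes_def by blast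
    have x: "x \<in> fibre v" using exitD[OF e(1)] edge_W(1) unfolding fibre_def by blast
    have "{x, z} \<in> local_edges P v" using e unfolding local_edges_def by blast
    then have "h x z = 1" using h(2) by blast
    then have "h z x = 1" using h.d_sym[OF inL[OF x] z] by simp
    moreover have "h z v \<le> h z x + h x v" using h.triangle[OF z vW(2) inL[OF x]] .
    ultimately show ?thesis using fb[OF x] by simp
  qed
qed

end

section \<open>One round of recursive grouping\<close>

context latent
begin

definition leaf :: "nat \<Rightarrow> bool" where
  "leaf i \<longleftrightarrow> card (neighbours E i) = 1"

definition par :: "nat \<Rightarrow> nat" where
  "par i = (THE z. {i, z} \<in> E)"

text \<open>The node that represents the block of \<open>i\<close>.\<close>

definition cls :: "nat \<Rightarrow> nat" where
  "cls i = (if leaf i then par i else i)"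

lemma leaf_edge: "leaf i \<Longrightarrow> {i, z} \<in> E \<longleftrightarrow> z = par i"
proof -
  assume "leaf i"
  then obtain w where "neighbours E i = {w}" unfolding leaf_def by (auto simp: card_1_singleton_iff)
  then have w: "{i, z} \<in> E \<longleftrightarrow> z = w" for z by (metis mem_Collect_eq neighbours_def singleton_iff)
  have "par i = w" unfolding par_def by (rule the_equality) (simp_all add: w)
  then show ?thesis using w by metis
qed

lemma leaf_par: "leaf i \<Longrightarrow> {i, par i} \<in> E"
  using leaf_edge by metis

lemma leaf_side:
  assumes "leaf i" "k \<in> W" "k \<noteq> i"
  shows "k \<in> side (par i) i" "d i k = d i (par i) + d (par i) k"
proof -
  have "i \<in> W" using leaf_par[OF assms(1)] edge_W by blast
  then obtain z where z: "{i, z} \<in> E" "k \<in> side z i" using next_node[of i k] assms by metis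
  then show 1: "k \<in> side (par i) i" using leaf_edge[OF assms(1)] by metis
  show "d i k = d i (par i) + d (par i) k" by (rule next_dist[OF leaf_par[OF assms(1)] 1])
qed

lemma leafI:
  assumes "{i, z} \<in> E" "\<And>w. {i, w} \<in> E \<Longrightarrow> w = z"
  shows "leaf i" "par i = z"
proof -
  have "neighbours E i = {z}"
  proof (intro equalityI subsetI)
    fix w assume "w \<in> neighbours E i"
    then have "{i, w} \<in> E" by (simp add: neighbours_def)
    from assms(2)[OF this] show "w \<in> {z}" by simp
  qed (use assms(1) in \<open>simp add: neighbours_def\<close>)
  then show 1: "leaf i" unfolding leaf_def by simp
  show "par i = z" using leaf_edge[OF 1] assms(1) by simp
qed

text \<open>A hidden node makes itself felt through a witness: having degree three or more,
  \<open>z\<close> has a branch that contains neither \<open>i\<close> nor \<open>j\<close>, and an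
  active \<open>y\<close> in it sees both through \<open>z\<close>.\<close>

lemma third_branch:
  assumes z: "z \<in> W" "z \<notin> V" and ij: "i \<in> W" "j \<in> W" "i \<noteq> z" "j \<noteq> z"
  obtains y where "y \<in> V" "y \<noteq> i" "y \<noteq> j" "d i y = d i z + d z y" "d j y = d j z + d z y"
proof -
  obtain a where a: "{z, a} \<in> E" "i \<in> side a z" using next_node[of z i] z ij by metis
  obtain b where b: "{z, b} \<in> E" "j \<in> side b z" using next_node[of z j] z ij by metis
  have "3 \<le> card (neighbours E z)" using hidden_deg z by blast
  moreover have "card {a, b} \<le> 2" by (cases "a = b") auto
  ultimately have "\<not> neighbours E z \<subseteq> {a, b}" using card_mono[of "{a, b}" "neighbours E z"] by auto
  then obtain c where c: "{z, c} \<in> E" "c \<noteq> a" "c \<noteq> b" unfolding neighbours_def by auto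
  obtain y where y: "y \<in> V" "y \<in> side c z" using branch_meets[of V z c] hidden_deg c(1) by fastforce
  have "d i y = d i z + d z y" "d j y = d j z + d z y"
    using branches_between[OF a(1) c(1) _ a(2) y(2)] branches_between[OF b(1) c(1) _ b(2) y(2)] c by auto
  moreover have "y \<noteq> i" using next_unique[OF a(1) c(1) a(2)] y(2) c(2) by metis
  moreover have "y \<noteq> j" using next_unique[OF b(1) c(1) b(2)] y(2) c(3) by metis
  ultimately show ?thesis using that y(1) by metis
qed

definition leaf_test :: "nat \<Rightarrow> nat \<Rightarrow> bool" where
  "leaf_test i j \<longleftrightarrow> (\<forall>k\<in>V. k = i \<or> k = j \<or> d i k - d j k = d i j)"

text \<open>The common value is quantified, so that no reference node has to be chosen; the program
  compares with the first suitable one.\<close>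

definition sibling_test :: "nat \<Rightarrow> nat \<Rightarrow> bool" where
  "sibling_test i j \<longleftrightarrow> (\<exists>c. c \<noteq> d i j \<and> c \<noteq> - d i j \<and> (\<forall>k\<in>V. k = i \<or> k = j \<or> d i k - d j k = c))"

lemma away_branch:
  assumes ij: "i \<in> W" "j \<in> W" "i \<noteq> j" and z: "{i, z} \<in> E" "j \<notin> side z i"
  obtains y where "y \<in> V" "y \<noteq> i" "y \<noteq> j" "d y j = d y i + d i j"
proof -
  obtain y where y: "y \<in> V" "y \<in> side z i" using branch_meets[of V i z] hidden_deg z(1) by fastforce
  have "j \<in> side i z" using side_other[OF edge_sym[OF z(1)] ij(2)] z(2) by blast
  then have "d y j = d y i + d i j" using side_between(2)[OF edge_sym[OF z(1)] y(2)] by blast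
  moreover have "y \<noteq> i" using y(2) side_self[OF z(1)] side_other[OF z(1) ij(1)] by metis
  ultimately show ?thesis using that y z(2) by metis
qed

text \<open>A second neighbour of \<open>i\<close> yields a witness with \<open>\<Phi>\<close> equal
  to \<open>- d i j\<close>. A node between \<open>i\<close> and \<open>j\<close> is refuted by
  itself when active, and by a witness from a third branch when hidden.\<close>

lemma leaf_test_iff:
  assumes ij: "i \<in> V" "j \<in> V" "i \<noteq> j"
  shows "leaf_test i j \<longleftrightarrow> leaf i \<and> par i = j"
proof
  have W: "i \<in> W" "j \<in> W" using ij V_sub by blast+
  have dij: "0 < d i j" using d_pos W ij(3) by blast
  assume t: "leaf_test i j"
  have td: "d i k = d i j + d j k" if "k \<in> V" "k \<noteq> i" "k \<noteq> j" for k
    using t that unfolding leaf_test_def by force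
  obtain z where z: "{i, z} \<in> E" "j \<in> side z i" using next_node[OF W ij(3)] by metis
  have only: "w = z" if w: "{i, w} \<in> E" for w
  proof (rule ccontr)
    assume "w \<noteq> z"
    then have "j \<notin> side w i" using next_unique[OF w z(1)] z(2) by metis
    then obtain y where y: "y \<in> V" "y \<noteq> i" "y \<noteq> j" "d y j = d y i + d i j" using away_branch[OF W ij(3) w] by metis
    have "y \<in> W" using y V_sub by blast
    then have "d y j = d j y" "d y i = d i y" using d_sym W by blast+
    then show False using td[OF y(1-3)] y(4) dij by linarith
  qed
  have zW: "z \<in> W" using edge_W z by blast
  have dj: "d i j = d i z + d z j" using next_dist z by blast
  have "z = j"
  proof (rule ccontr)
    assume "z \<noteq> j"
    then have pz: "0 < d z j" "d z j = d j z" using d_pos d_sym zW W by blast+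
    show False
    proof (cases "z \<in> V")
      case True
      then show False using td[OF True] edge_W(3)[OF z(1)] \<open>z \<noteq> j\<close> dj pz by force
    next
      case False
      obtain y where y: "y \<in> V" "y \<noteq> i" "y \<noteq> j" "d i y = d i z + d z y" "d j y = d j z + d z y"
        using third_branch[OF zW False W] edge_W(3)[OF z(1)] \<open>z \<noteq> j\<close> by metis
      then show False using td[OF y(1-3)] dj pz by linarith
    qed
  qed
  then show "leaf i \<and> par i = j" using leafI[OF z(1) only] by blast
next
  assume l: "leaf i \<and> par i = j"
  show "leaf_test i j"
    unfolding leaf_test_def
  proof
    fix k assume "k \<in> V"
    then show "k = i \<or> k = j \<or> d i k - d j k = d i j" using leaf_side(2)[of i k] l V_sub by auto
  qed
qed

text \<open>One half of the sibling test, to be applied again with \<open>i\<close> and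
  \<open>j\<close> exchanged and \<open>c\<close> negated. The value \<open>c\<close> reappears as
  the difference of the distances to \<open>par i\<close>, so it locates the parent.\<close>

lemma sibling_end:
  assumes ij: "i \<in> V" "j \<in> V" "i \<noteq> j" and k: "k \<in> V" "k \<noteq> i" "k \<noteq> j"
    and c: "c \<noteq> d i j" "c \<noteq> - d i j" "\<And>k. k \<in> V \<Longrightarrow> k \<noteq> i \<Longrightarrow> k \<noteq> j \<Longrightarrow> d i k - d j k = c"
  shows "leaf i" "par i \<noteq> j" "d i (par i) - d j (par i) = c" "d i j = d i (par i) + d (par i) j"
proof -
  have W: "i \<in> W" "j \<in> W" using ij V_sub by blast+
  obtain z where z: "{i, z} \<in> E" "j \<in> side z i" using next_node[OF W ij(3)] by metis
  have only: "w = z" if w: "{i, w} \<in> E" for w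
  proof (rule ccontr)
    assume "w \<noteq> z"
    then have "j \<notin> side w i" using next_unique[OF w z(1)] z(2) by metis
    then obtain y where y: "y \<in> V" "y \<noteq> i" "y \<noteq> j" "d y j = d y i + d i j" using away_branch[OF W ij(3) w] by metis
    have "y \<in> W" using y V_sub by blast
    then have "d y j = d j y" "d y i = d i y" using d_sym W by blast+
    then show False using c(3)[OF y(1-3)] y(4) c(2) by linarith
  qed
  show l: "leaf i" and p: "d i j = d i (par i) + d (par i) j"
    using leafI[OF z(1) only] next_dist[OF z] by simp_all
  have pz: "par i = z" using leafI[OF z(1) only] by simp
  have zW: "z \<in> W" "z \<noteq> i" using edge_W[OF z(1)] by auto
  show nj: "par i \<noteq> j"
  proof
    assume "par i = j"
    then have "d i k = d i j + d j k" using leaf_side(2)[OF l, of k] k V_sub by auto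
    then show False using c(3)[OF k] c(1) by linarith
  qed
  show "d i (par i) - d j (par i) = c"
  proof (cases "z \<in> V")
    case True
    then show ?thesis using c(3)[OF True zW(2)] nj pz by metis
  next
    case False
    obtain y where y: "y \<in> V" "y \<noteq> i" "y \<noteq> j" "d i y = d i z + d z y" "d j y = d j z + d z y"
      using third_branch[OF zW(1) False W] zW(2) nj pz by metis
    then show ?thesis using c(3)[OF y(1-3)] pz by simp
  qed
qed

text \<open>By \<open>sibling_end\<close> the constant fixes how far along the path from
  \<open>i\<close> to \<open>j\<close> each parent lies. The two positions agree, so the parents
  coincide.\<close>

lemma sibling_test_iff:
  assumes ij: "i \<in> V" "j \<in> V" "i \<noteq> j" and V3: "3 \<le> card V"
  shows "sibling_test i j \<longleftrightarrow> leaf i \<and> leaf j \<and> par i = par j"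
proof
  have W: "i \<in> W" "j \<in> W" using ij V_sub by blast+
  have "\<not> V \<subseteq> {i, j}" using card_mono[of "{i, j}" V] V3 ij(3) by auto
  then obtain k where k: "k \<in> V" "k \<noteq> i" "k \<noteq> j" by auto
  {
    assume "sibling_test i j"
    then obtain c where c: "c \<noteq> d i j" "c \<noteq> - d i j" "\<And>k. k \<in> V \<Longrightarrow> k \<noteq> i \<Longrightarrow> k \<noteq> j \<Longrightarrow> d i k - d j k = c"
      unfolding sibling_test_def by metis
    have ds: "d i j = d j i" using d_sym W by blast
    note a = sibling_end[OF ij k c]
    have c': "- c \<noteq> d j i" "- c \<noteq> - d j i" using c(1,2) ds by auto
    have c3: "d j k - d i k = - c" if "k \<in> V" "k \<noteq> j" "k \<noteq> i" for k using c(3)[OF that(1,3,2)] by simp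
    note b = sibling_end[OF ij(2,1) ij(3)[symmetric] k(1,3,2) c' c3]
    have bi: "par j \<noteq> i" by (rule b(2))
    have pW: "par i \<in> W" "par j \<in> W" using edge_W(2)[OF leaf_par] a(1) b(1) by blast+
    have s: "d j (par i) = d (par i) j" "d i (par j) = d (par j) i" "d j (par j) = d (par j) j"
      using d_sym W pW by blast+
    have "d i (par i) = d i (par j)" using a(3,4) b(3,4) ds s by linarith
    moreover have "d i (par j) = d i (par i) + d (par i) (par j)" using leaf_side(2)[OF a(1) pW(2) bi] .
    ultimately have "d (par i) (par j) = 0" by simp
    then have "par i = par j" using d_pos[OF pW] by force
    then show "leaf i \<and> leaf j \<and> par i = par j" using a(1) b(1) by blast
  next
    assume l: "leaf i \<and> leaf j \<and> par i = par j"
    define z where "z = par i"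
    have zW: "z \<in> W" "z \<noteq> i" "z \<noteq> j" using edge_W[OF leaf_par, of i] edge_W[OF leaf_par, of j] l unfolding z_def by auto
    have "d i j = d i z + d z j" using leaf_side(2)[of i j] l W ij(3) unfolding z_def by blast
    moreover have "0 < d i z" "0 < d z j" "d j z = d z j" using d_pos d_sym W zW by blast+
    ultimately have "d i z - d j z \<noteq> d i j" "d i z - d j z \<noteq> - d i j" by linarith+
    moreover have "k = i \<or> k = j \<or> d i k - d j k = d i z - d j z" if "k \<in> V" for k
    proof (cases "k = i \<or> k = j")
      case False
      have kW: "k \<in> W" using that V_sub by blast
      have "d i k = d i z + d z k" "d j k = d j z + d z k"
        using leaf_side(2)[of i k] leaf_side(2)[of j k] l kW False unfolding z_def by metis+
      then show ?thesis by simp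
    qed metis
    ultimately show "sibling_test i j" unfolding sibling_test_def by (intro exI[of _ "d i z - d j z"]) blast
  }
qed

text \<open>Two adjacent leaves would be the whole tree: a third node would have to be reached from
  each of them through the other.\<close>

lemma par_not_leaf:
  assumes "leaf i" "3 \<le> card V" shows "\<not> leaf (par i)"
proof
  assume l: "leaf (par i)"
  have e: "{i, par i} \<in> E" by (rule leaf_par[OF assms(1)])
  have W: "i \<in> W" "par i \<in> W" "i \<noteq> par i" using edge_W[OF e] by auto
  have pp: "par (par i) = i" using leaf_edge[OF l] edge_sym[OF e] by metis
  have "\<not> V \<subseteq> {i, par i}" using card_mono[of "{i, par i}" V] assms(2) W(3) by auto
  then obtain k where k: "k \<in> W" "k \<noteq> i" "k \<noteq> par i" using V_sub by auto
  have "d i k = d i (par i) + d (par i) k" "d (par i) k = d (par i) i + d i k"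
    using leaf_side(2)[OF assms(1) k(1,2)] leaf_side(2)[OF l k(1,3)] pp by simp_all
  then show False using d_pos[OF W] d_pos[OF W(2,1)] W(3) by linarith
qed

text \<open>The relation tested by the program is thus an equivalence, with \<open>cls\<close>
  naming the centre of each class. A coarsest partition into related nodes therefore exists.\<close>

lemma related_iff:
  assumes ij: "i \<in> V" "j \<in> V" "i \<noteq> j" and V3: "3 \<le> card V"
  shows "leaf_test i j \<or> leaf_test j i \<or> sibling_test i j \<longleftrightarrow> cls i = cls j"
proof -
  have nl: "leaf i \<Longrightarrow> \<not> leaf (par i)" "leaf j \<Longrightarrow> \<not> leaf (par j)" using par_not_leaf V3 by metis+
  note ts = leaf_test_iff[OF ij] leaf_test_iff[OF ij(2,1) ij(3)[symmetric]] sibling_test_iff[OF ij V3]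
  show ?thesis
  proof (cases "leaf i")
    case True
    show ?thesis unfolding ts cls_def using True nl ij(3) by (cases "leaf j") (simp_all, metis+)
  next
    case False
    show ?thesis unfolding ts cls_def using False nl ij(3) by (cases "leaf j") (simp_all, metis+)
  qed
qed

definition removed :: "nat set" where
  "removed = {i \<in> V. leaf i \<and> (\<exists>j\<in>V. j \<noteq> i \<and> cls j = cls i)}"

abbreviation nodes' where "nodes' \<equiv> W - removed"
abbreviation edges' where "edges' \<equiv> {e \<in> E. e \<subseteq> W - removed}"
abbreviation active' where "active' \<equiv> (V - removed) \<union> par ` removed"

lemma par_W: "leaf i \<Longrightarrow> par i \<in> W"
  using edge_W(2)[OF leaf_par] .

lemma removed_leaf: "i \<in> removed \<Longrightarrow> leaf i" "i \<in> removed \<Longrightarrow> i \<in> V"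
  unfolding removed_def by auto

lemma par_removed: "3 \<le> card V \<Longrightarrow> i \<in> removed \<Longrightarrow> par i \<in> nodes'"
  using par_not_leaf par_W removed_leaf by blast

lemma removed_neighbour: "{x, i} \<in> E \<Longrightarrow> i \<in> removed \<Longrightarrow> x = par i"
  using leaf_edge[OF removed_leaf(1)] edge_sym by blast

lemma nodes'_ne: "3 \<le> card V \<Longrightarrow> nodes' \<noteq> {}"
  using par_removed W_ne by blast

lemma round_metric:
  assumes V3: "3 \<le> card V" and h: "tree_metric W E h"
  shows "tree_metric nodes' edges' h"
  using tree_metric.remove_leaves[OF h, of removed] removed_leaf(1) nodes'_ne[OF V3] unfolding leaf_def by blast

text \<open>A node that loses a neighbour is the parent of a removed leaf and becomes active. The
  nodes that stay hidden therefore keep all their neighbours.\<close>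

lemma round_latent:
  assumes V3: "3 \<le> card V" shows "latent nodes' edges' d active'"
proof -
  interpret T: tree_metric nodes' edges' d by (rule round_metric[OF V3]) unfold_locales
  show ?thesis
  proof
    show "active' \<subseteq> nodes'" using par_removed[OF V3] V_sub by blast
    show "active' \<noteq> {}"
    proof
      assume "active' = {}"
      then have "removed = {}" "V \<subseteq> removed" by blast+
      then show False using V_ne by blast
    qed
    fix x assume x: "x \<in> nodes' - active'"
    have "neighbours edges' x = neighbours E x"
    proof
      show "neighbours edges' x \<subseteq> neighbours E x" unfolding neighbours_def by blast
      show "neighbours E x \<subseteq> neighbours edges' x"
      proof
        fix y assume "y \<in> neighbours E x"
        then have y: "{x, y} \<in> E" by (simp add: neighbours_def)
        have "y \<notin> removed"
        proof
          assume "y \<in> removed"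
          then show False using removed_neighbour[OF y] x by blast
        qed
        then show "y \<in> neighbours edges' x" using y edge_W[OF y] x by (simp add: neighbours_def)
      qed
    qed
    moreover have "x \<in> W - V" using x by blast
    ultimately show "3 \<le> card (neighbours edges' x)" using hidden_deg by simp
  qed
qed

text \<open>The second equation is what later shows that no edge is emitted twice.\<close>

lemma round_edges:
  assumes V3: "3 \<le> card V"
  shows "E = edges' \<union> (\<lambda>i. {i, par i}) ` removed" "card E = card edges' + card removed"
proof -
  have inj: "inj_on (\<lambda>i. {i, par i}) removed"
  proof (rule inj_onI)
    fix i j assume a: "i \<in> removed" "j \<in> removed" "{i, par i} = {j, par j}"
    then have "i = j \<or> i = par j" by (auto simp: doubleton_eq_iff)
    then show "i = j" using par_removed[OF V3 a(2)] a(1) by blast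
  qed
  show eq: "E = edges' \<union> (\<lambda>i. {i, par i}) ` removed"
  proof (intro equalityI subsetI)
    fix e assume e: "e \<in> E"
    then obtain x y where xy: "e = {x, y}" "{x, y} \<in> E" using edge_pair by blast
    show "e \<in> edges' \<union> (\<lambda>i. {i, par i}) ` removed"
    proof (cases "x \<in> removed \<or> y \<in> removed")
      case True
      then show ?thesis
      proof
        assume x: "x \<in> removed"
        then have "y = par x" using removed_neighbour[OF edge_sym[OF xy(2)]] by blast
        then show ?thesis using x xy by blast
      next
        assume y: "y \<in> removed"
        then have "x = par y" using removed_neighbour[OF xy(2)] by blast
        then show ?thesis using y xy by (auto simp: insert_commute)
      qed
    next
      case False
      then show ?thesis using xy edge_W[OF xy(2)] by simp
    qed
  next
    fix e assume "e \<in> edges' \<union> (\<lambda>i. {i, par i}) ` removed"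
    then show "e \<in> E" using leaf_par removed_leaf(1) by auto
  qed
  have fr: "finite removed" using finite_V removed_leaf(2) finite_subset by (metis subsetI)
  have "edges' \<inter> (\<lambda>i. {i, par i}) ` removed = {}" by auto
  then have "card (edges' \<union> (\<lambda>i. {i, par i}) ` removed) = card edges' + card ((\<lambda>i. {i, par i}) ` removed)"
    using finite_E fr by (intro card_Un_disjoint) auto
  then show "card E = card edges' + card removed" using eq card_image[OF inj] by simp
qed

text \<open>The deepest nodes, seen from \<open>r\<close>, are leaves with a removed sibling or an active parent.\<close>

lemma round_hops:
  assumes V3: "3 \<le> card V" and h: "tree_metric W E h" "\<And>x y. {x, y} \<in> E \<Longrightarrow> h x y = 1"
    and r: "r \<in> W" "\<And>x. x \<in> W \<Longrightarrow> h r x \<le> real L"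
  shows "\<exists>L'. L = Suc L' \<and> (\<exists>r'\<in>nodes'. \<forall>x\<in>nodes'. h r' x \<le> real L')"
proof -
  interpret h: tree_metric W E h by fact
  have "\<not> V \<subseteq> {r}" using card_mono[of "{r}" V] V3 by auto
  then obtain k where k: "k \<in> W" "k \<noteq> r" using V_sub by auto
  obtain z0 where z0: "{r, z0} \<in> E" "k \<in> h.side z0 r" using h.next_node[OF r(1) k(1)] k(2) by metis
  have "h r k = 1 + h z0 k" using h.next_dist[OF z0] h(2)[OF z0(1)] by simp
  moreover have "0 \<le> h z0 k" using h.d_nonneg h.edge_W(2)[OF z0(1)] k(1) by blast
  ultimately have "1 \<le> real L" using r(2)[OF k(1)] by linarith
  then obtain L' where L: "L = Suc L'" by (cases L) auto
  show ?thesis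
  proof (cases "r \<in> removed")
    \<comment> \<open>If the root itself is removed, its parent takes over, and every remaining node
      is one edge closer.\<close>
    case True
    have lr: "leaf r" by (rule removed_leaf(1)[OF True])
    have "h (par r) x \<le> real L'" if x: "x \<in> nodes'" for x
    proof -
      have xr: "x \<in> W" "x \<noteq> r" using x True by blast+
      obtain w where w: "{r, w} \<in> E" "x \<in> h.side w r" using h.next_node[OF r(1) xr(1)] xr(2) by metis
      have "w = par r" using leaf_edge[OF lr] w(1) by blast
      then have "h r x = 1 + h (par r) x" using h.next_dist[OF w] h(2)[OF w(1)] by simp
      then show ?thesis using r(2)[OF xr(1)] L by simp
    qed
    then show ?thesis using L par_removed[OF V3 True] by blast
  next
    case False
    have "h r x \<le> real L'" if x: "x \<in> nodes'" for x
    proof (rule ccontr)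
      assume far: "\<not> h r x \<le> real L'"
      have xW: "x \<in> W" using x by blast
      have xr: "r \<noteq> x" using far h.d_refl[OF r(1)] by auto
      \<comment> \<open>Beyond depth \<open>L'\<close> a still farther neighbour would exceed the
        bound \<open>L\<close>, so such a node is a leaf, and leaves are active by the degree
        condition.\<close>
      have end_leaf: "leaf y \<and> y \<in> V" if y: "{y, w} \<in> E" "r \<in> h.side w y" "real L' < h r y" for y w
      proof -
        have yW: "y \<in> W" using h.edge_W y by blast
        have "w' = w" if w': "{y, w'} \<in> E" for w'
        proof (rule ccontr)
          assume "w' \<noteq> w"
          then have "r \<notin> h.side w' y" using h.next_unique[OF y(1) w' y(2)] by metis
          then have "h r w' = h r y + 1" using h.farther_neighbour[OF r(1) yW w'] h(2)[OF w'] by simp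
          then show False using r(2)[OF h.edge_W(2)[OF w']] y(3) L by simp
        qed
        then have l: "leaf y" using leafI(1)[OF y(1)] by metis
        have "y \<in> V"
        proof (rule ccontr)
          assume "y \<notin> V"
          then show False using hidden_deg[of y] yW l unfolding leaf_def by simp
        qed
        then show ?thesis using l by blast
      qed
      obtain z where z: "{x, z} \<in> E" "r \<in> h.side z x" using h.next_node[OF xW r(1)] xr by metis
      have lx: "leaf x" "x \<in> V" using end_leaf[OF z] far by auto
      have pz: "par x = z" using leaf_edge[OF lx(1)] z(1) by metis
      have zW: "z \<in> W" using h.edge_W z by blast
      have znl: "\<not> leaf z" using par_not_leaf[OF lx(1) V3] pz by simp
      have cx: "cls x = z" using lx(1) pz by (simp add: cls_def)
      have hx: "h r x = h r z + 1"
        using h.next_dist[OF z] h(2)[OF z(1)] h.d_sym[OF r(1) xW] h.d_sym[OF r(1) zW] by simp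
      have "\<exists>j\<in>V. j \<noteq> x \<and> cls j = z"
      proof (cases "z \<in> V")
        case True
        then show ?thesis using znl h.edge_W(3)[OF z(1)] by (intro bexI[of _ z]) (auto simp: cls_def)
      next
        case False
        have "\<exists>u. \<forall>w. {z, w} \<in> E \<longrightarrow> w \<noteq> u \<longrightarrow> r = z \<or> r \<notin> h.side w z"
        proof (cases "r = z")
          case False
          then obtain u where "{z, u} \<in> E" "\<And>w. {z, w} \<in> E \<Longrightarrow> r \<in> h.side w z \<longleftrightarrow> w = u"
            using h.towards_unique[OF r(1) zW] by metis
          then show ?thesis by metis
        qed simp
        then obtain u where u: "\<And>w. {z, w} \<in> E \<Longrightarrow> w \<noteq> u \<Longrightarrow> r = z \<or> r \<notin> h.side w z" by metis
        have "3 \<le> card (neighbours E z)" using hidden_deg zW False by blast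
        moreover have "card {u, x} \<le> 2" by (cases "u = x") auto
        ultimately have "\<not> neighbours E z \<subseteq> {u, x}" using card_mono[of "{u, x}" "neighbours E z"] by auto
        \<comment> \<open>Besides \<open>x\<close> and the neighbour towards the root,
          \<open>z\<close> has a third neighbour \<open>w\<close>. It is as deep as
          \<open>x\<close>, hence a leaf too and a sibling of \<open>x\<close>.\<close>
        then obtain w where w: "{z, w} \<in> E" "w \<noteq> u" "w \<noteq> x" unfolding neighbours_def by auto
        have hw: "h r w = h r z + 1" using h.farther_neighbour[OF r(1) zW w(1) u[OF w(1,2)]] h(2)[OF w(1)] by simp
        have rw: "r \<in> h.side z w"
        proof (rule ccontr)
          assume n: "r \<notin> h.side z w"
          then have "r \<in> h.side w z" using h.side_other[OF w(1) r(1)] by blast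
          then have "h z r = h z w + h w r" using h.next_dist[OF w(1)] by blast
          then show False using hw h.d_sym[OF zW r(1)] h.d_sym[OF h.edge_W(2)[OF w(1)] r(1)] h(2)[OF w(1)] by simp
        qed
        have lw: "leaf w" "w \<in> V" using end_leaf[OF h.edge_sym[OF w(1)] rw] far hx hw by auto
        then have "cls w = z" using leaf_edge[OF lw(1)] edge_sym[OF w(1)] by (simp add: cls_def)
        then show ?thesis using lw w(3) by blast
      qed
      then have "x \<in> removed" unfolding removed_def using lx cx by auto
      then show False using x by blast
    qed
    then show ?thesis using L r(1) False by blast
  qed
qed

text \<open>A hidden node would have three branches, each containing an active node of its own. So
  the remaining tree is visible entirely, which is why the program may stop at two active
  nodes.\<close>

lemma few_active:
  assumes "card V \<le> 2"
  shows "W = V" "card V = 1 \<Longrightarrow> E = {}" "V = {a, b} \<Longrightarrow> a \<noteq> b \<Longrightarrow> E = {{a, b}}"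
proof -
  show WV: "W = V"
  proof (rule ccontr)
    assume "W \<noteq> V"
    then obtain x where x: "x \<in> W" "x \<notin> V" using V_sub by blast
    have "\<exists>y. y \<in> V \<and> y \<in> side z x" if "z \<in> neighbours E x" for z
      using branch_meets[of V x z] hidden_deg that unfolding neighbours_def by fastforce
    then obtain f where f: "\<And>z. z \<in> neighbours E x \<Longrightarrow> f z \<in> V \<and> f z \<in> side z x" by metis
    have "inj_on f (neighbours E x)"
    proof (rule inj_onI)
      fix z z' assume "z \<in> neighbours E x" "z' \<in> neighbours E x" "f z = f z'"
      then show "z = z'" using f[of z] f[of z'] next_unique[of x z z' "f z"] unfolding neighbours_def by simp
    qed
    then have "card (neighbours E x) \<le> card V" using f finite_V by (intro card_inj_on_le[of f]) auto
    then show False using hidden_deg[of x] x assms by simp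
  qed
  have cE: "card E = card V - 1" using ltree_card[OF tree_ltree[OF is_tree]] WV by simp
  show "E = {}" if "card V = 1" using cE that finite_E by simp
  show "E = {{a, b}}" if ab: "V = {a, b}" "a \<noteq> b"
  proof -
    have "a \<in> W" "b \<in> W" using ab WV by auto
    then obtain z where z: "{a, z} \<in> E" using next_node[of a b] ab(2) by metis
    then have "z = b" using edge_W[OF z] WV ab by auto
    moreover have "card E = 1" using cE ab by simp
    ultimately show ?thesis using z by (auto simp: card_1_singleton_iff)
  qed
qed

end

section \<open>Grouping into blocks\<close>

text \<open>The pure counterpart of \<open>insert_block\<close> when the relation is equality of
  \<open>f\<close>; it separates the shape of the result from its cost.\<close>

primrec insert_class :: "(nat \<Rightarrow> 'b) \<Rightarrow> nat \<Rightarrow> nat list list \<Rightarrow> nat list list" where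
  "insert_class f x [] = [[x]]"
| "insert_class f x (B # Bs) = (if \<forall>y\<in>set B. f x = f y then (x # B) # Bs else B # insert_class f x Bs)"

lemma tms_insert_block:
  assumes "\<And>B y. B \<in> set Bs \<Longrightarrow> y \<in> set B \<Longrightarrow> tms (R x y) k (\<lambda>b. b = (f x = f y))" "[] \<notin> set Bs"
  shows "tms (insert_block R x Bs) ((k + 3) * length (concat Bs) + 1) (\<lambda>Bs'. Bs' = insert_class f x Bs)"
  using assms
proof (induction Bs)
  case Nil
  then show ?case by (simp add: tms_ret)
next
  case (Cons B Bs)
  have IH: "tms (insert_block R x Bs) ((k + 3) * length (concat Bs) + 1) (\<lambda>Bs'. Bs' = insert_class f x Bs)"
  proof (rule Cons.IH)
    show "tms (R x y) k (\<lambda>b. b = (f x = f y))" if "B' \<in> set Bs" "y \<in> set B'" for B' y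
      using Cons.prems(1)[of B' y] that by simp
    show "[] \<notin> set Bs" using Cons.prems(2) by simp
  qed
  \<comment> \<open>Blocks are nonempty, so the constant overhead of each failed test is charged to
    a member of the block.\<close>
  have B: "1 \<le> length B" using Cons.prems(2) by (cases B) auto
  have a: "tms (all_tm (R x) B) ((k + 1) * length B + 1) (\<lambda>b. b = (\<forall>y\<in>set B. f x = f y))"
    by (rule tms_all) (rule Cons.prems(1)[of B], simp_all)
  show ?case
    unfolding insert_block.simps
  proof (rule tms_bind[OF a])
    fix ok assume ok: "ok = (\<forall>y\<in>set B. f x = f y)"
    show "tms (if ok then ret ((x # B) # Bs) else bind_tm (insert_block R x Bs) (\<lambda>Bs'. ret (B # Bs')))
        ((k + 3) * length (concat Bs) + 2) (\<lambda>Bs'. Bs' = insert_class f x (B # Bs))"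
    proof (cases ok)
      case True
      then show ?thesis using ok by (simp add: tms_ret)
    next
      case False
      have "tms (bind_tm (insert_block R x Bs) (\<lambda>Bs'. ret (B # Bs'))) ((k + 3) * length (concat Bs) + 2)
          (\<lambda>Bs'. Bs' = B # insert_class f x Bs)"
        by (rule tms_bind[OF IH, where k' = 1]) (auto intro: tms_ret)
      moreover have ns: "\<not> (\<forall>y\<in>set B. f x = f y)" using False ok by simp
      ultimately show ?thesis unfolding insert_class.simps if_not_P[OF ns] if_not_P[OF False] by blast
    qed
  next
    show "(k + 1) * length B + 1 + ((k + 3) * length (concat Bs) + 2) \<le> (k + 3) * length (concat (B # Bs)) + 1"
      using B by (simp add: algebra_simps)
  qed
qed

definition blocks_of :: "(nat \<Rightarrow> 'b) \<Rightarrow> nat set \<Rightarrow> nat list list \<Rightarrow> bool" where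
  "blocks_of f S Bs \<longleftrightarrow> distinct (concat Bs) \<and> set (concat Bs) = S \<and> [] \<notin> set Bs \<and>
     (\<forall>B\<in>set Bs. \<forall>x\<in>set B. set B = {y \<in> S. f y = f x})"

lemma insert_class_set: "set (concat (insert_class f x Bs)) = insert x (set (concat Bs))"
  by (induction Bs) auto

lemma insert_class_distinct: "distinct (concat Bs) \<Longrightarrow> x \<notin> set (concat Bs) \<Longrightarrow> distinct (concat (insert_class f x Bs))"
proof (induction Bs)
  case (Cons B Bs)
  then show ?case using insert_class_set[of f x Bs] by auto
qed simp

lemma insert_class_blocks_of:
  assumes b: "blocks_of f S Bs" and x: "x \<notin> S"
  shows "blocks_of f (insert x S) (insert_class f x Bs)"
proof -
  \<comment> \<open>Generalized to the part of the list still to be searched; the last premise says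
    that no block passed so far contains a node with the value of \<open>x\<close>.\<close>
  have main: "\<forall>B\<in>set (insert_class f x Bs). \<forall>z\<in>set B. set B = {y \<in> insert x S. f y = f z}"
    if "\<forall>B\<in>set Bs. \<forall>z\<in>set B. set B = {y \<in> S. f y = f z}" "distinct (concat Bs)" "[] \<notin> set Bs"
      "\<And>y. y \<in> S \<Longrightarrow> f y = f x \<Longrightarrow> y \<in> set (concat Bs)" for Bs
    using that
  proof (induction Bs)
    case Nil
    then show ?case by auto
  next
    case (Cons B Bs)
    have B: "\<forall>z\<in>set B. set B = {y \<in> S. f y = f z}" "B \<noteq> []" using Cons.prems by auto
    show ?case
    proof (cases "\<forall>y\<in>set B. f x = f y")
      case True
      obtain b where b: "b \<in> set B" using B(2) by (cases B) auto
      have fb: "f x = f b" using True b by blast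
      have SB: "set B = {y \<in> S. f y = f x}" unfolding fb by (rule bspec[OF B(1) b])
      have "set (x # B) = {y \<in> insert x S. f y = f z}" if "z \<in> set (x # B)" for z
      proof -
        have "f z = f x"
        proof (cases "z = x")
          case False
          then have "z \<in> {y \<in> S. f y = f x}" using that SB by simp
          then show ?thesis by simp
        qed simp
        moreover have "set (x # B) = {y \<in> insert x S. f y = f x}" unfolding list.set SB by blast
        ultimately show ?thesis by simp
      qed
      moreover have "set C = {y \<in> insert x S. f y = f z}" if C: "C \<in> set Bs" "z \<in> set C" for C z
      proof -
        have SC: "set C = {y \<in> S. f y = f z}" using Cons.prems(1) C by simp
        have "z \<notin> set B" using Cons.prems(2) C by auto
        moreover have "z \<in> S" using SC C(2) by blast
        ultimately have "f z \<noteq> f x" using SB by blast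
        then show ?thesis unfolding SC by auto
      qed
      ultimately show ?thesis using True by simp
    next
      case False
      have "\<forall>B\<in>set (insert_class f x Bs). \<forall>z\<in>set B. set B = {y \<in> insert x S. f y = f z}"
      proof (rule Cons.IH)
        fix y assume y: "y \<in> S" "f y = f x"
        have "y \<notin> set B"
        proof
          assume yB: "y \<in> set B"
          then have "set B = {w \<in> S. f w = f y}" using B(1) by blast
          then have "\<forall>w\<in>set B. f x = f w" using y(2) by auto
          then show False using False by blast
        qed
        then show "y \<in> set (concat Bs)" using Cons.prems(4)[OF y] by simp
      qed (use Cons.prems in auto)
      moreover have "set B = {y \<in> insert x S. f y = f z}" if z: "z \<in> set B" for z
      proof -
        have SB: "set B = {y \<in> S. f y = f z}" using B(1) z by blast
        have "f x \<noteq> f z"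
        proof
          assume "f x = f z"
          then have "\<forall>w\<in>set B. f x = f w" using SB by auto
          then show False using False by blast
        qed
        then show ?thesis unfolding SB by auto
      qed
      moreover have "insert_class f x (B # Bs) = B # insert_class f x Bs" using False by simp
      ultimately show ?thesis by simp
    qed
  qed
  have bs: "distinct (concat Bs)" "set (concat Bs) = S" "[] \<notin> set Bs"
    "\<forall>B\<in>set Bs. \<forall>z\<in>set B. set B = {y \<in> S. f y = f z}" using b unfolding blocks_of_def by metis+
  have ne: "[] \<notin> set Bs \<Longrightarrow> [] \<notin> set (insert_class f x Bs)" for Bs by (induction Bs) auto
  show ?thesis
    unfolding blocks_of_def
  proof (intro conjI)
    show "distinct (concat (insert_class f x Bs))" by (rule insert_class_distinct) (simp_all only: bs x not_False_eq_True)
    show "set (concat (insert_class f x Bs)) = insert x S" by (simp only: insert_class_set bs)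
    show "[] \<notin> set (insert_class f x Bs)" by (rule ne[OF bs(3)])
    show "\<forall>B\<in>set (insert_class f x Bs). \<forall>z\<in>set B. set B = {y \<in> insert x S. f y = f z}"
      by (rule main[OF bs(4,1,3)]) (simp only: bs)
  qed
qed

lemma blocks_of_length:
  assumes "blocks_of f S Bs" "finite S"
  shows "length (concat Bs) = card S" "length Bs \<le> card S" "B \<in> set Bs \<Longrightarrow> length B \<le> card S"
proof -
  have d: "distinct (concat Bs)" "set (concat Bs) = S" "[] \<notin> set Bs" using assms unfolding blocks_of_def by auto
  show l: "length (concat Bs) = card S" using d distinct_card by metis
  have "length Bs \<le> length (concat Bs)" using d(3)
  proof (induction Bs)
    case (Cons B Bs)
    then show ?case by (cases B) auto
  qed simp
  then show "length Bs \<le> card S" using l by simp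
  show "length B \<le> card S" if "B \<in> set Bs"
  proof -
    have "length B \<le> sum_list (map length Bs)" using that by (auto intro!: member_le_sum_list)
    then show ?thesis using l by (simp add: length_concat)
  qed
qed

lemma tms_grouping:
  assumes R: "\<And>x y. x \<in> set Y \<Longrightarrow> y \<in> set Y \<Longrightarrow> x \<noteq> y \<Longrightarrow> tms (R x y) k (\<lambda>b. b = (f x = f y))" and Y: "distinct Y"
  shows "tms (grouping R Y) (((k + 3) * length Y + 1) * length Y + 1) (blocks_of f (set Y))"
proof -
  have "tms (fold_tm (insert_block R) Y []) (((k + 3) * length Y + 1) * length Y + 1) (\<lambda>Bs. blocks_of f (set Y) Bs)"
  proof (rule tms_fold_const[where I = "\<lambda>us Bs. blocks_of f (set us) Bs"])
    fix us x vs Bs assume Ys: "Y = us @ x # vs" and b: "blocks_of f (set us) Bs"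
    have len: "length (concat Bs) \<le> length Y"
      using blocks_of_length(1)[OF b] card_length[of us] Ys by simp
    have xn: "x \<notin> set us" using Y Ys by simp
    have "tms (insert_block R x Bs) ((k + 3) * length (concat Bs) + 1) (\<lambda>Bs'. Bs' = insert_class f x Bs)"
    proof (rule tms_insert_block)
      show "[] \<notin> set Bs" using b unfolding blocks_of_def by blast
      fix B y assume "B \<in> set Bs" "y \<in> set B"
      then have "y \<in> set us" using b unfolding blocks_of_def by auto
      then show "tms (R x y) k (\<lambda>b. b = (f x = f y))" using R[of x y] Ys xn by auto
    qed
    then show "tms (insert_block R x Bs) ((k + 3) * length Y + 1) (blocks_of f (set (us @ [x])))"
      by (rule tms_weaken) (use insert_class_blocks_of[OF b xn] len in auto)
  qed (simp add: blocks_of_def)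
  then show ?thesis unfolding grouping_def .
qed

section \<open>Correctness of a round\<close>

lemma set_dist_apply: "set_dist d a b x p q = (if p = a \<and> q = b \<or> p = b \<and> q = a then x else d p q)"
  unfolding set_dist_def by auto

text \<open>A map \<open>\<sigma>\<close> takes the node names used by the algorithm to the nodes of the true tree, whose distances
  are \<open>d\<close>; \<open>dd\<close> is the array maintained by the algorithm.\<close>

definition stored :: "(nat \<Rightarrow> nat) \<Rightarrow> dist \<Rightarrow> dist \<Rightarrow> nat \<Rightarrow> nat \<Rightarrow> bool" where
  "stored \<sigma> d dd a b \<longleftrightarrow> dd a b = d (\<sigma> a) (\<sigma> b) \<and> dd b a = d (\<sigma> a) (\<sigma> b)"

lemma stored_set:
  assumes "x = d (\<sigma> a) (\<sigma> b)" "d (\<sigma> a) (\<sigma> b) = d (\<sigma> b) (\<sigma> a)"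
  shows "stored \<sigma> d (set_dist dd a b x) a b" "stored \<sigma> d dd p q \<Longrightarrow> stored \<sigma> d (set_dist dd a b x) p q"
  using assms unfolding stored_def set_dist_apply by auto

definition image_edges :: "(nat \<Rightarrow> nat) \<Rightarrow> edge_list \<Rightarrow> edge_set" where
  "image_edges \<sigma> T = (\<lambda>(a, b). {\<sigma> a, \<sigma> b}) ` set T"

lemma image_edges_eq: "image_edges \<sigma> T = (\<lambda>e. \<sigma> ` e) ` edges T"
proof -
  have "edges T = (\<lambda>(a, b). {a, b}) ` set T" unfolding edges_def by auto
  then show ?thesis unfolding image_edges_def by (simp add: image_image case_prod_beta)
qed

lemma image_edges_append: "image_edges \<sigma> (S @ T) = image_edges \<sigma> S \<union> image_edges \<sigma> T"
  unfolding image_edges_def by auto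

text \<open>Reversed because the fold puts later edges in front. The filter concerns the case in
  which the centre is itself a member of the block.\<close>

definition star :: "nat \<Rightarrow> nat list \<Rightarrow> edge_list" where
  "star c B = rev (map (Pair c) (filter (\<lambda>i. i \<noteq> c) B))"

lemma image_edges_star: "image_edges \<sigma> (star c B) = (\<lambda>i. {\<sigma> c, \<sigma> i}) ` (set B - {c})"
  unfolding image_edges_def star_def by (auto simp: image_image)

lemma length_star: "distinct B \<Longrightarrow> length (star c B) = card (set B - {c})"
proof -
  assume "distinct B"
  then have "length (filter (\<lambda>i. i \<noteq> c) B) = card (set (filter (\<lambda>i. i \<noteq> c) B))"
    by (intro distinct_card[symmetric] distinct_filter)
  also have "set (filter (\<lambda>i. i \<noteq> c) B) = set B - {c}" by auto
  finally show ?thesis by (simp add: star_def)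
qed

lemma tms_star_fold:
  "tms (fold_tm (\<lambda>i T. ret (if i = c then T else (c, i) # T)) B T) (length B + 1) (\<lambda>T'. T' = star c B @ T)"
proof -
  have "tms (fold_tm (\<lambda>i T. ret (if i = c then T else (c, i) # T)) B T) (1 * length B + 1) (\<lambda>T'. T' = star c B @ T)"
    by (rule tms_fold_const[where I = "\<lambda>us T'. T' = star c us @ T"]) (auto intro!: tms_ret simp: star_def)
  then show ?thesis by simp
qed

section \<open>One round of the program under a naming map\<close>

context latent
begin

context
  fixes Y :: "nat list" and \<sigma> :: "nat \<Rightarrow> nat" and dd :: dist and n :: nat
  assumes V3: "3 \<le> card V" and Y: "distinct Y" "set Y \<subseteq> {..<n}" and \<sigma>: "inj_on \<sigma> (set Y)" "\<sigma> ` set Y = V"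
    and dd_all: "\<forall>a\<in>set Y. \<forall>b\<in>set Y. a \<noteq> b \<longrightarrow> dd a b = d (\<sigma> a) (\<sigma> b)"
begin

lemma dd: "a \<in> set Y \<Longrightarrow> b \<in> set Y \<Longrightarrow> a \<noteq> b \<Longrightarrow> dd a b = d (\<sigma> a) (\<sigma> b)"
  by (rule dd_all[rule_format])

lemma length_Y: "length Y = card V"
  using card_image[OF \<sigma>(1)] \<sigma>(2) distinct_card[OF Y(1)] by simp

lemma \<sigma>_V: "a \<in> set Y \<Longrightarrow> \<sigma> a \<in> V"
  using \<sigma>(2) by blast

lemma \<sigma>_W: "a \<in> set Y \<Longrightarrow> \<sigma> a \<in> W"
  using \<sigma>_V V_sub by blast

lemma \<sigma>_eq: "a \<in> set Y \<Longrightarrow> b \<in> set Y \<Longrightarrow> \<sigma> a = \<sigma> b \<longleftrightarrow> a = b"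
  using \<sigma>(1) by (meson inj_on_eq_iff)

lemma ball_V: "(\<forall>v\<in>V. P v) \<longleftrightarrow> (\<forall>k\<in>set Y. P (\<sigma> k))"
  using \<sigma>(2) by blast

lemma tms_leaf_of:
  assumes "i \<in> set Y" "j \<in> set Y" "i \<noteq> j"
  shows "tms (leaf_of dd Y i j) (2 * length Y + 1) (\<lambda>b. b = leaf_test (\<sigma> i) (\<sigma> j))"
proof -
  have "(\<sigma> k = \<sigma> i \<or> \<sigma> k = \<sigma> j \<or> d (\<sigma> i) (\<sigma> k) - d (\<sigma> j) (\<sigma> k) = d (\<sigma> i) (\<sigma> j)) \<longleftrightarrow>
      (k = i \<or> k = j \<or> \<Phi> dd i j k = dd i j)" if k: "k \<in> set Y" for k
  proof (cases "k = i \<or> k = j")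
    case True
    then show ?thesis by (elim disjE) simp_all
  next
    case False
    then have ne: "i \<noteq> k" "j \<noteq> k" by simp_all
    show ?thesis
      unfolding \<Phi>_def dd[OF assms] dd[OF assms(1) k ne(1)] dd[OF assms(2) k ne(2)]
        \<sigma>_eq[OF k assms(1)] \<sigma>_eq[OF k assms(2)] by (rule refl)
  qed
  then have eq: "leaf_test (\<sigma> i) (\<sigma> j) = (\<forall>k\<in>set Y. k = i \<or> k = j \<or> \<Phi> dd i j k = dd i j)"
    unfolding leaf_test_def ball_V by (rule ball_cong[OF refl])
  have "tms (leaf_of dd Y i j) ((1 + 1) * length Y + 1) (\<lambda>b. b = (\<forall>k\<in>set Y. k = i \<or> k = j \<or> \<Phi> dd i j k = dd i j))"
    unfolding leaf_of_def by (rule tms_all) (intro tms_ret refl le_refl)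
  then show ?thesis unfolding eq one_add_one .
qed

lemma third_active: "\<exists>k\<in>set Y. k \<noteq> i \<and> k \<noteq> j"
proof -
  have "\<not> set Y \<subseteq> {i, j}"
    using card_mono[of "{i, j}" "set Y"] distinct_card[OF Y(1)] length_Y V3 card_insert_le_m1[of 2 "{j}" i] by force
  then show ?thesis by auto
qed

lemma tms_leaf_siblings:
  assumes "i \<in> set Y" "j \<in> set Y" "i \<noteq> j"
  shows "tms (leaf_siblings dd Y i j) (4 * length Y + 3) (\<lambda>b. b = sibling_test (\<sigma> i) (\<sigma> j))"
  unfolding leaf_siblings_def
proof (rule tms_bind)
  show "tms (filter_tm (\<lambda>k. ret (k \<noteq> i \<and> k \<noteq> j)) Y) ((1 + 1) * length Y + 1) (\<lambda>ks. ks = filter (\<lambda>k. k \<noteq> i \<and> k \<noteq> j) Y)"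
    by (rule tms_filter) (simp add: tms_ret)
next
  fix ks assume ks: "ks = filter (\<lambda>k. k \<noteq> i \<and> k \<noteq> j) Y"
  have "ks \<noteq> []" using third_active[of i j] unfolding ks filter_empty_conv by metis
  then obtain k0 ks' where k0: "ks = k0 # ks'" by (meson neq_Nil_conv)
  have sks: "set ks = {k \<in> set Y. k \<noteq> i \<and> k \<noteq> j}" using ks by auto
  have k0s: "k0 \<in> set ks" using k0 by simp
  have P: "\<Phi> dd i j k = d (\<sigma> i) (\<sigma> k) - d (\<sigma> j) (\<sigma> k)" if "k \<in> set ks" for k
  proof -
    have k: "k \<in> set Y" "i \<noteq> k" "j \<noteq> k" using that unfolding sks by simp_all
    show ?thesis unfolding \<Phi>_def dd[OF assms(1) k(1,2)] dd[OF assms(2) k(1,3)] ..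
  qed
  have "sibling_test (\<sigma> i) (\<sigma> j) \<longleftrightarrow> (\<forall>k\<in>set ks. \<Phi> dd i j k = \<Phi> dd i j k0) \<and> \<Phi> dd i j k0 \<noteq> dd i j \<and> \<Phi> dd i j k0 \<noteq> - dd i j"
  proof -
    have "(\<forall>k\<in>V. k = \<sigma> i \<or> k = \<sigma> j \<or> d (\<sigma> i) k - d (\<sigma> j) k = c) \<longleftrightarrow> (\<forall>k\<in>set ks. \<Phi> dd i j k = c)" for c
    proof -
      have "(\<sigma> k = \<sigma> i \<or> \<sigma> k = \<sigma> j \<or> d (\<sigma> i) (\<sigma> k) - d (\<sigma> j) (\<sigma> k) = c) \<longleftrightarrow> (k \<in> set ks \<longrightarrow> \<Phi> dd i j k = c)" if "k \<in> set Y" for k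
      proof (cases "k \<in> set ks")
        case True
        then show ?thesis unfolding P[OF True] \<sigma>_eq[OF that assms(1)] \<sigma>_eq[OF that assms(2)] sks by simp
      next
        case False
        then have "k = i \<or> k = j" using that unfolding sks by simp
        then show ?thesis using False by blast
      qed
      then have "(\<forall>k\<in>V. k = \<sigma> i \<or> k = \<sigma> j \<or> d (\<sigma> i) k - d (\<sigma> j) k = c) \<longleftrightarrow> (\<forall>k\<in>set Y. k \<in> set ks \<longrightarrow> \<Phi> dd i j k = c)"
        unfolding ball_V by (rule ball_cong[OF refl])
      also have "\<dots> \<longleftrightarrow> (\<forall>k\<in>set ks. \<Phi> dd i j k = c)" unfolding sks by blast
      finally show ?thesis .
    qed
    then have "sibling_test (\<sigma> i) (\<sigma> j) \<longleftrightarrow> (\<exists>c. c \<noteq> dd i j \<and> c \<noteq> - dd i j \<and> (\<forall>k\<in>set ks. \<Phi> dd i j k = c))"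
      unfolding sibling_test_def dd[OF assms] by presburger
    also have "\<dots> \<longleftrightarrow> (\<forall>k\<in>set ks. \<Phi> dd i j k = \<Phi> dd i j k0) \<and> \<Phi> dd i j k0 \<noteq> dd i j \<and> \<Phi> dd i j k0 \<noteq> - dd i j"
    proof (intro iffI)
      assume "\<exists>c. c \<noteq> dd i j \<and> c \<noteq> - dd i j \<and> (\<forall>k\<in>set ks. \<Phi> dd i j k = c)"
      then obtain c where c: "c \<noteq> dd i j" "c \<noteq> - dd i j" "\<forall>k\<in>set ks. \<Phi> dd i j k = c" by auto
      have "\<Phi> dd i j k0 = c" using c(3) k0s by (rule bspec)
      then show "(\<forall>k\<in>set ks. \<Phi> dd i j k = \<Phi> dd i j k0) \<and> \<Phi> dd i j k0 \<noteq> dd i j \<and> \<Phi> dd i j k0 \<noteq> - dd i j"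
        using c by simp
    next
      assume "(\<forall>k\<in>set ks. \<Phi> dd i j k = \<Phi> dd i j k0) \<and> \<Phi> dd i j k0 \<noteq> dd i j \<and> \<Phi> dd i j k0 \<noteq> - dd i j"
      then show "\<exists>c. c \<noteq> dd i j \<and> c \<noteq> - dd i j \<and> (\<forall>k\<in>set ks. \<Phi> dd i j k = c)"
        by (intro exI[of _ "\<Phi> dd i j k0"] conjI) simp_all
    qed
    finally show ?thesis .
  qed
  moreover have "tms (bind_tm (all_tm (\<lambda>k. ret (\<Phi> dd i j k = \<Phi> dd i j k0)) ks)
      (\<lambda>const. ret (const \<and> \<Phi> dd i j k0 \<noteq> dd i j \<and> \<Phi> dd i j k0 \<noteq> - dd i j))) (2 * length Y + 2)
      (\<lambda>b. b = ((\<forall>k\<in>set ks. \<Phi> dd i j k = \<Phi> dd i j k0) \<and> \<Phi> dd i j k0 \<noteq> dd i j \<and> \<Phi> dd i j k0 \<noteq> - dd i j))"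
  proof (rule tms_bind)
    show "tms (all_tm (\<lambda>k. ret (\<Phi> dd i j k = \<Phi> dd i j k0)) ks) ((1 + 1) * length ks + 1)
        (\<lambda>b. b = (\<forall>k\<in>set ks. \<Phi> dd i j k = \<Phi> dd i j k0))"
      by (rule tms_all) (simp add: tms_ret)
  next
    have "length ks \<le> length Y" unfolding ks by (rule length_filter_le)
    then show "(1 + 1) * length ks + 1 + 1 \<le> 2 * length Y + 2" by simp
  qed (simp add: tms_ret)
  ultimately show "tms (case ks of [] \<Rightarrow> ret False | k\<^sub>0 # _ \<Rightarrow> bind_tm (all_tm (\<lambda>k. ret (\<Phi> dd i j k = \<Phi> dd i j k\<^sub>0)) ks)
      (\<lambda>const. ret (const \<and> \<Phi> dd i j k\<^sub>0 \<noteq> dd i j \<and> \<Phi> dd i j k\<^sub>0 \<noteq> - dd i j))) (2 * length Y + 2)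
      (\<lambda>b. b = sibling_test (\<sigma> i) (\<sigma> j))"
    unfolding k0 by simp
qed simp

lemma tms_related:
  assumes "i \<in> set Y" "j \<in> set Y" "i \<noteq> j"
  shows "tms (related dd Y i j) (8 * length Y + 6) (\<lambda>b. b = (cls (\<sigma> i) = cls (\<sigma> j)))"
proof -
  have V: "\<sigma> i \<in> V" "\<sigma> j \<in> V" "\<sigma> i \<noteq> \<sigma> j" using \<sigma>_V \<sigma>_eq assms by auto
  have "tms (related dd Y i j) (8 * length Y + 6) (\<lambda>b. b = (leaf_test (\<sigma> i) (\<sigma> j) \<or> leaf_test (\<sigma> j) (\<sigma> i) \<or> sibling_test (\<sigma> i) (\<sigma> j)))"
    unfolding related_def
    by (rule tms_bind[OF tms_leaf_of[OF assms], where k' = "6 * length Y + 5"],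
      rule tms_bind[OF tms_leaf_of[OF assms(2,1) assms(3)[symmetric]], where k' = "4 * length Y + 4"],
      rule tms_bind[OF tms_leaf_siblings[OF assms], where k' = 1]) (auto intro: tms_ret)
  then show ?thesis unfolding related_iff[OF V V3] .
qed

text \<open>The centre of the star that a block forms in the true tree: the common parent of its
  leaves, or its only member if that is no leaf. All members agree on it, so the first may be
  used.\<close>

definition bcls :: "nat list \<Rightarrow> nat" where
  "bcls B = cls (\<sigma> (hd B))"

definition hid :: "nat list \<Rightarrow> bool" where
  "hid B \<longleftrightarrow> length B \<noteq> 1 \<and> bcls B \<notin> V"

definition keep :: "nat list \<Rightarrow> nat" where
  "keep B = (if length B = 1 then hd B else inv_into (set Y) \<sigma> (bcls B))"

definition join :: "nat list \<Rightarrow> nat list \<times> (nat \<times> nat list) list \<times> edge_list \<times> nat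
    \<Rightarrow> nat list \<times> (nat \<times> nat list) list \<times> edge_list \<times> nat" where
  "join B = (\<lambda>(kept, hs, T, m). if length B = 1 then (keep B # kept, hs, T, m)
     else if hid B then (kept, (m, B) # hs, star m B @ T, Suc m)
     else (keep B # kept, hs, star (keep B) B @ T, m))"

context
  fixes Bs :: "nat list list"
  assumes Bs: "blocks_of (\<lambda>a. cls (\<sigma> a)) (set Y) Bs"
begin

lemma block:
  assumes "B \<in> set Bs"
  shows "B \<noteq> []" "distinct B" "set B \<subseteq> set Y" "hd B \<in> set B" "x \<in> set B \<Longrightarrow> cls (\<sigma> x) = bcls B"
    "x \<in> set Y \<Longrightarrow> cls (\<sigma> x) = bcls B \<Longrightarrow> x \<in> set B"
proof -
  show ne: "B \<noteq> []" using Bs assms unfolding blocks_of_def by blast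
  then show hd: "hd B \<in> set B" by simp
  have eq: "set B = {y \<in> set Y. cls (\<sigma> y) = bcls B}" using Bs assms hd unfolding blocks_of_def bcls_def by blast
  show "distinct B" using Bs assms unfolding blocks_of_def by (simp add: distinct_concat_iff)
  show "set B \<subseteq> set Y" "x \<in> set B \<Longrightarrow> cls (\<sigma> x) = bcls B" "x \<in> set Y \<Longrightarrow> cls (\<sigma> x) = bcls B \<Longrightarrow> x \<in> set B"
    using eq by auto
qed

lemma distinct_Bs: "distinct Bs"
proof -
  have "[] \<notin> set Bs" "distinct (removeAll [] Bs)" using Bs unfolding blocks_of_def distinct_concat_iff by - (elim conjE, assumption)+
  then show ?thesis using removeAll_id[of "[]" Bs] by simp
qed

lemma other_member:
  assumes "B \<in> set Bs" "length B \<noteq> 1" obtains y where "y \<in> set B" "y \<noteq> x"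
proof -
  have "length B \<noteq> 0" using block(1)[OF assms(1)] by simp
  then have l: "1 < card (set B)" using distinct_card[OF block(2)[OF assms(1)]] assms(2) by linarith
  have "\<not> set B \<subseteq> {x}"
  proof
    assume "set B \<subseteq> {x}"
    then have "card (set B) \<le> card {x}" by (rule card_mono[rotated]) simp
    then show False using l by simp
  qed
  then show ?thesis using that by auto
qed

lemma block_removed:
  assumes B: "B \<in> set Bs" "length B \<noteq> 1" and x: "x \<in> set B" "\<sigma> x \<noteq> bcls B"
  shows "leaf (\<sigma> x)" "par (\<sigma> x) = bcls B" "\<sigma> x \<in> removed"
proof -
  have c: "cls (\<sigma> x) = bcls B" by (rule block(5)[OF B(1) x(1)])
  show l: "leaf (\<sigma> x)" using c x(2) unfolding cls_def by metis
  then show "par (\<sigma> x) = bcls B" using c unfolding cls_def by simp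
  obtain y where y: "y \<in> set B" "y \<noteq> x" using other_member[OF B] by metis
  have xy: "x \<in> set Y" "y \<in> set Y" using block(3)[OF B(1)] x(1) y(1) by auto
  have "\<sigma> y \<noteq> \<sigma> x" using \<sigma>_eq[OF xy(2,1)] y(2) by simp
  moreover have "cls (\<sigma> y) = cls (\<sigma> x)" using block(5)[OF B(1) y(1)] c by simp
  ultimately show "\<sigma> x \<in> removed" unfolding removed_def using l \<sigma>_V[OF xy(1)] \<sigma>_V[OF xy(2)] by blast
qed

lemma block_centre:
  assumes B: "B \<in> set Bs" "length B \<noteq> 1"
  shows "\<exists>x\<in>set B. \<sigma> x \<noteq> bcls B" "\<not> leaf (bcls B)" "bcls B \<in> W" "bcls B \<in> par ` removed"
proof -
  obtain y where y: "y \<in> set B" "y \<noteq> hd B" using other_member[OF B] by metis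
  have "\<sigma> y \<noteq> \<sigma> (hd B)" using \<sigma>_eq[of y "hd B"] y block[OF B(1)] by blast
  then show 1: "\<exists>x\<in>set B. \<sigma> x \<noteq> bcls B" using y(1) block(4)[OF B(1)] by metis
  then obtain x where x: "x \<in> set B" "\<sigma> x \<noteq> bcls B" by blast
  note r = block_removed[OF B x]
  show "\<not> leaf (bcls B)" using par_not_leaf[OF r(1) V3] r(2) by simp
  show "bcls B \<in> W" using par_W[OF r(1)] r(2) by simp
  show "bcls B \<in> par ` removed" using r(2,3) by (metis image_eqI)
qed

lemma keep_props:
  assumes B: "B \<in> set Bs" "\<not> hid B"
  shows "keep B \<in> set B" "length B \<noteq> 1 \<Longrightarrow> \<sigma> (keep B) = bcls B" "\<sigma> (keep B) \<notin> removed"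
proof -
  have centre: "\<sigma> (keep B) = bcls B \<and> keep B \<in> set B" if l: "length B \<noteq> 1"
  proof -
    have "bcls B \<in> \<sigma> ` set Y" using B(2) l \<sigma>(2) unfolding hid_def by simp
    then have k: "keep B \<in> set Y" "\<sigma> (keep B) = bcls B" using l unfolding keep_def by (auto simp: inv_into_into f_inv_into_f)
    have "cls (\<sigma> (keep B)) = bcls B" using k(2) block_centre(2)[OF B(1) l] by (simp add: cls_def)
    then show ?thesis using k block(6)[OF B(1)] by blast
  qed
  then show "length B \<noteq> 1 \<Longrightarrow> \<sigma> (keep B) = bcls B" by blast
  show k: "keep B \<in> set B" using centre block(4)[OF B(1)] by (cases "length B = 1") (auto simp: keep_def)
  show "\<sigma> (keep B) \<notin> removed"
  proof (cases "length B = 1")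
    case True
    then obtain b where b: "B = [b]" by (auto simp: length_Suc_conv)
    then have kb: "keep B = b" by (simp add: keep_def)
    have only: "y = b" if "y \<in> set Y" "cls (\<sigma> y) = cls (\<sigma> b)" for y
      using block(6)[OF B(1) that(1)] that(2) b unfolding bcls_def by simp
    show ?thesis
    proof
      assume "\<sigma> (keep B) \<in> removed"
      then obtain v where v: "v \<in> V" "v \<noteq> \<sigma> b" "cls v = cls (\<sigma> b)" unfolding removed_def kb by blast
      obtain y where "y \<in> set Y" "v = \<sigma> y" using v(1) \<sigma>(2) by blast
      then show False using only v by blast
    qed
  next
    case False
    then show ?thesis using centre block_centre(2)[OF B(1) False] removed_leaf(1) by metis
  qed
qed

text \<open>The cost is charged per member of the block. Summed over all blocks this stays cubic in
  the number of active nodes.\<close>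

lemma tms_join_block:
  assumes B: "B \<in> set Bs" and m: "n \<le> m"
  shows "tms (join_block dd Y B (kept, hs, T, m)) ((2 * (length Y)\<^sup>2 + 2 * length Y + 6) * length B)
    (\<lambda>s. s = join B (kept, hs, T, m))"
proof (cases "length B = 1")
  case True
  then obtain b where b: "B = [b]" by (auto simp: length_Suc_conv)
  then show ?thesis unfolding join_block_def b by (auto intro!: tms_ret simp: join_def keep_def)
next
  case False
  define N where "N = length Y"
  have Bl: "length B \<noteq> 0" "length B \<le> N"
    using block(1)[OF B] blocks_of_length(3)[OF Bs _ B] distinct_card[OF Y(1)] unfolding N_def by auto
  define P where "P u \<longleftrightarrow> (\<exists>i\<in>set B. i \<noteq> u \<and> leaf_test (\<sigma> i) (\<sigma> u))" for u
  have BY: "x \<in> set B \<Longrightarrow> x \<in> set Y" for x using block(3)[OF B] by blast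
  \<comment> \<open>The search for a parent inside the block succeeds exactly at the member that is
    the centre of the block.\<close>
  have P_iff: "P u \<longleftrightarrow> \<sigma> u = bcls B" if u: "u \<in> set B" for u
  proof
    assume "P u"
    then obtain i where i: "i \<in> set B" "i \<noteq> u" "leaf_test (\<sigma> i) (\<sigma> u)" unfolding P_def by blast
    have "\<sigma> i \<noteq> \<sigma> u" using \<sigma>_eq[OF BY[OF i(1)] BY[OF u]] i(2) by simp
    then have "leaf (\<sigma> i) \<and> par (\<sigma> i) = \<sigma> u" using leaf_test_iff[OF \<sigma>_V[OF BY[OF i(1)]] \<sigma>_V[OF BY[OF u]]] i(3) by simp
    then show "\<sigma> u = bcls B" using block(5)[OF B i(1)] unfolding cls_def by simp
  next
    assume su: "\<sigma> u = bcls B"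
    obtain i where i: "i \<in> set B" "i \<noteq> u" using other_member[OF B False] by metis
    have ne: "\<sigma> i \<noteq> \<sigma> u" using \<sigma>_eq[OF BY[OF i(1)] BY[OF u]] i(2) by simp
    then have "leaf (\<sigma> i) \<and> par (\<sigma> i) = \<sigma> u" using block_removed[OF B False i(1)] su by simp
    then have "leaf_test (\<sigma> i) (\<sigma> u)" using leaf_test_iff[OF \<sigma>_V[OF BY[OF i(1)]] \<sigma>_V[OF BY[OF u]] ne] by simp
    then show "P u" unfolding P_def using i by blast
  qed
  obtain b1 b2 bs where b: "B = b1 # b2 # bs" using False Bl(1) by (cases B; cases "tl B") auto
  have par_t: "tms (filter_tm (\<lambda>u. ex_tm (\<lambda>i. if i = u then ret False else leaf_of dd Y i u) B) B)
      ((((2 * N + 1) + 1) * length B + 1 + 1) * length B + 1) (\<lambda>us. us = filter P B)"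
  proof (rule tms_filter)
    fix u assume u: "u \<in> set B"
    have "tms (ex_tm (\<lambda>i. if i = u then ret False else leaf_of dd Y i u) B) (((2 * N + 1) + 1) * length B + 1)
        (\<lambda>b. b = (\<exists>i\<in>set B. i \<noteq> u \<and> leaf_test (\<sigma> i) (\<sigma> u)))"
    proof (rule tms_ex)
      fix i assume i: "i \<in> set B"
      show "tms (if i = u then ret False else leaf_of dd Y i u) (2 * N + 1) (\<lambda>b. b = (i \<noteq> u \<and> leaf_test (\<sigma> i) (\<sigma> u)))"
        using tms_leaf_of[OF BY[OF i] BY[OF u]] unfolding N_def by (cases "i = u") (auto intro: tms_ret)
    qed
    then show "tms (ex_tm (\<lambda>i. if i = u then ret False else leaf_of dd Y i u) B) (((2 * N + 1) + 1) * length B + 1) (\<lambda>b. b = P u)"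
      unfolding P_def .
  qed
  have cost: "(((2 * N + 1) + 1) * length B + 1 + 1) * length B + 1 + (length B + 2) \<le> (2 * N\<^sup>2 + 2 * N + 6) * length B"
  proof -
    have "(2 * N + 2) * length B * length B \<le> (2 * N + 2) * N * length B" using Bl(2) by (intro mult_right_mono mult_left_mono) auto
    moreover have "1 \<le> length B" using Bl(1) by (simp add: Suc_leI)
    moreover have "(((2 * N + 1) + 1) * length B + 1 + 1) * length B + 1 + (length B + 2) =
        (2 * N + 2) * length B * length B + 3 * length B + 3" by (simp add: algebra_simps)
    moreover have "(2 * N\<^sup>2 + 2 * N + 6) * length B = (2 * N + 2) * N * length B + 6 * length B"
      by (simp add: algebra_simps power2_eq_square)
    ultimately show ?thesis by linarith
  qed
  show ?thesis
    unfolding join_block_def prod.case b list.case unfolding b[symmetric]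
  proof (rule tms_bind[OF par_t[unfolded N_def] _ cost[unfolded N_def]])
    fix ps assume ps: "ps = filter P B"
    show "tms (case ps of [] \<Rightarrow> bind_tm (fold_tm (\<lambda>i T. ret ((m, i) # T)) B T) (\<lambda>T'. ret (kept, (m, B) # hs, T', Suc m))
        | u # _ \<Rightarrow> bind_tm (fold_tm (\<lambda>i T. ret (if i = u then T else (u, i) # T)) B T) (\<lambda>T'. ret (u # kept, hs, T', m)))
        (length B + 2) (\<lambda>s. s = join B (kept, hs, T, m))"
    proof (cases "bcls B \<in> V")
      case True
      then have nh: "\<not> hid B" unfolding hid_def by blast
      have k: "keep B \<in> set B" "\<sigma> (keep B) = bcls B" using keep_props[OF B nh] False by auto
      then have "keep B \<in> set ps" using ps P_iff by auto
      moreover have uq: "u = keep B" if "u \<in> set ps" for u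
      proof -
        have u: "u \<in> set B" "\<sigma> u = bcls B" using that ps P_iff by auto
        then show ?thesis using \<sigma>_eq[OF BY BY[OF k(1)]] k(2) by metis
      qed
      ultimately obtain ps' where ps': "ps = keep B # ps'" by (cases ps) auto
      show ?thesis unfolding ps' list.case
        by (rule tms_bind[OF tms_star_fold, where k' = 1]) (use False nh in \<open>auto intro!: tms_ret simp: join_def\<close>)
    next
      case F: False
      then have h: "hid B" unfolding hid_def using False by blast
      have "ps = []"
      proof (rule ccontr)
        assume "ps \<noteq> []"
        then obtain u where "u \<in> set ps" by (cases ps) auto
        then have "u \<in> set B" "\<sigma> u = bcls B" using ps P_iff by auto
        then show False using F \<sigma>_V[OF BY] by metis
      qed
      \<comment> \<open>The fresh name is no member of \<open>B\<close>, so both folds agree and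
        \<open>tms_star_fold\<close> covers this case too.\<close>
      moreover have "fold_tm (\<lambda>i T. ret ((m, i) # T)) B T = fold_tm (\<lambda>i T. ret (if i = m then T else (m, i) # T)) B T"
      proof -
        have mB: "m \<notin> set B"
        proof
          assume "m \<in> set B"
          then have "m \<in> {..<n}" using BY Y(2) by blast
          then show False using m by simp
        qed
        have "fold_tm (\<lambda>i T. ret ((m, i) # T)) xs T = fold_tm (\<lambda>i T. ret (if i = m then T else (m, i) # T)) xs T" if "m \<notin> set xs" for xs T
          using that by (induction xs arbitrary: T) (auto simp: ret_def)
        then show ?thesis using mB by blast
      qed
      ultimately show ?thesis
        by simp (rule tms_bind[OF tms_star_fold, where k' = 1], use False h in \<open>auto intro!: tms_ret simp: join_def\<close>)
    qed
  qed
qed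

definition hids :: "nat list list \<Rightarrow> nat list list" where
  "hids us = filter hid us"

text \<open>The hidden blocks are numbered in order from 0, and the name \<open>n + i\<close>
  denotes the centre of block number \<open>i\<close>. Old names keep their meaning.\<close>

definition \<sigma>' :: "nat \<Rightarrow> nat" where
  "\<sigma>' x = (if n \<le> x \<and> x < n + length (hids Bs) then bcls (hids Bs ! (x - n)) else \<sigma> x)"

lemma \<sigma>'_old: "x < n \<Longrightarrow> \<sigma>' x = \<sigma> x"
  by (simp add: \<sigma>'_def)

lemma \<sigma>'_Y: "x \<in> set Y \<Longrightarrow> \<sigma>' x = \<sigma> x"
  using Y(2) by (intro \<sigma>'_old) auto

text \<open>Images are taken under \<open>\<sigma>'\<close>, which depends on the full list
  \<open>Bs\<close> and not on the prefix \<open>us\<close>. So the image of an edge does not change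
  while blocks are being processed.\<close>

definition joined :: "edge_list \<Rightarrow> nat list list \<Rightarrow> nat list \<times> (nat \<times> nat list) list \<times> edge_list \<times> nat \<Rightarrow> bool" where
  "joined T us = (\<lambda>(kept, hs, T', m).
     kept = rev (map keep (filter (\<lambda>B. \<not> hid B) us)) \<and>
     m = n + length (hids us) \<and> hs = rev (zip [n..<m] (hids us)) \<and>
     image_edges \<sigma>' T' = image_edges \<sigma>' T \<union> (\<lambda>i. {i, par i}) ` (removed \<inter> \<sigma> ` set (concat us)) \<and>
     length T' = length T + card (removed \<inter> \<sigma> ` set (concat us)) \<and>
     (\<forall>(a, b)\<in>set T'. (a, b) \<in> set T \<or> {a, b} \<subseteq> set Y \<union> {n..<m}))"

lemma joined_step:
  assumes us: "Bs = us @ B # vs" and j: "joined T us s"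
  shows "joined T (us @ [B]) (join B s)"
proof -
  have B: "B \<in> set Bs" using us by simp
  obtain kept hs T' m where s: "s = (kept, hs, T', m)" by (cases s)
  note J = j[unfolded joined_def s prod.case]
  have m: "m = n + length (hids us)" using J by blast
  have dis: "set B \<inter> set (concat us) = {}" using Bs us unfolding blocks_of_def by auto
  have uY: "set (concat us) \<subseteq> set Y" using Bs us unfolding blocks_of_def by auto
  have BY: "set B \<subseteq> set Y" by (rule block(3)[OF B])
  have disj: "(removed \<inter> \<sigma> ` set (concat us)) \<inter> (removed \<inter> \<sigma> ` set B) = {}"
  proof -
    have "\<sigma> ` set B \<inter> \<sigma> ` set (concat us) = \<sigma> ` (set B \<inter> set (concat us))"
      using inj_on_image_Int[OF \<sigma>(1) BY uY] by simp
    then show ?thesis using dis by auto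
  qed
  have un: "removed \<inter> \<sigma> ` set (concat (us @ [B])) = (removed \<inter> \<sigma> ` set (concat us)) \<union> (removed \<inter> \<sigma> ` set B)" by auto
  have crd: "card (removed \<inter> \<sigma> ` set (concat (us @ [B]))) = card (removed \<inter> \<sigma> ` set (concat us)) + card (removed \<inter> \<sigma> ` set B)"
    unfolding un by (rule card_Un_disjoint[OF _ _ disj]) auto
  show ?thesis
  proof (cases "length B = 1")
    case True
    then have nh: "\<not> hid B" by (simp add: hid_def)
    obtain b where b: "B = [b]" using True by (auto simp: length_Suc_conv)
    have "keep B = b" using b by (simp add: keep_def)
    then have e: "removed \<inter> \<sigma> ` set B = {}" using keep_props(3)[OF B nh] b by simp
    have img: "image_edges \<sigma>' T' = image_edges \<sigma>' T \<union> (\<lambda>i. {i, par i}) ` (removed \<inter> \<sigma> ` set (concat (us @ [B])))"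
      unfolding un e using J by simp
    have len: "length T' = length T + card (removed \<inter> \<sigma> ` set (concat (us @ [B])))"
      unfolding crd e using J by simp
    have hu: "hids (us @ [B]) = hids us" using nh by (simp add: hids_def)
    have ku: "keep B # kept = rev (map keep (filter (\<lambda>B. \<not> hid B) (us @ [B])))" using J nh by simp
    show ?thesis unfolding joined_def s join_def prod.case if_P[OF True] hu
      using J by - (intro conjI ku img len; elim conjE; assumption)
  next
    case False
    \<comment> \<open>\<open>c\<close> is the name of the centre, fresh or old; with it the edges of
      both cases are treated alike, and only the bookkeeping of names differs.\<close>
    define c where "c = (if hid B then m else keep B)"
    define m' where "m' = (if hid B then Suc m else m)"
    have mY: "m \<notin> set Y" using m Y(2) by auto
    have c: "\<sigma>' c = bcls B"
    proof (cases "hid B")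
      case True
      have "hids Bs = hids us @ B # hids vs" using us True by (simp add: hids_def)
      then have "hids Bs ! (m - n) = B" "m < n + length (hids Bs)" using m by (simp_all add: nth_append)
      then show ?thesis using True m by (simp add: \<sigma>'_def c_def)
    next
      case nh: False
      then show ?thesis using keep_props[OF B nh] False \<sigma>'_Y BY by (auto simp: c_def)
    qed
    have Bc: "x \<in> set B \<Longrightarrow> x \<noteq> c \<longleftrightarrow> \<sigma> x \<noteq> bcls B" for x
    proof (cases "hid B")
      case True
      assume x: "x \<in> set B"
      have "x \<noteq> m" using x BY mY by blast
      moreover have "\<sigma> x \<noteq> bcls B" using True \<sigma>_V[OF subsetD[OF BY x]] unfolding hid_def by metis
      ultimately show ?thesis using True by (simp add: c_def)
    next
      case nh: False
      assume x: "x \<in> set B"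
      show ?thesis using nh keep_props(1,2)[OF B nh] False \<sigma>_eq[of x "keep B"] x BY by (auto simp: c_def)
    qed
    have rem: "removed \<inter> \<sigma> ` set B = \<sigma> ` (set B - {c})"
    proof (intro equalityI subsetI)
      fix y assume "y \<in> removed \<inter> \<sigma> ` set B"
      then obtain x where x: "x \<in> set B" "y = \<sigma> x" "y \<in> removed" by blast
      have "\<sigma> x \<noteq> bcls B" using removed_leaf(1)[OF x(3)] block_centre(2)[OF B False] x(2) by metis
      then show "y \<in> \<sigma> ` (set B - {c})" using Bc[OF x(1)] x by blast
    next
      fix y assume "y \<in> \<sigma> ` (set B - {c})"
      then obtain x where x: "x \<in> set B" "y = \<sigma> x" "x \<noteq> c" by blast
      then have "\<sigma> x \<in> removed" using block_removed(3)[OF B False x(1)] Bc[OF x(1)] by blast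
      then show "y \<in> removed \<inter> \<sigma> ` set B" using x by blast
    qed
    have ie: "image_edges \<sigma>' (star c B) = (\<lambda>i. {i, par i}) ` (removed \<inter> \<sigma> ` set B)"
      unfolding image_edges_star rem image_image
    proof (rule image_cong[OF refl])
      fix x assume x: "x \<in> set B - {c}"
      then have "par (\<sigma> x) = bcls B" using block_removed(2)[OF B False] Bc by blast
      moreover have "\<sigma>' x = \<sigma> x" using x BY \<sigma>'_Y by blast
      ultimately show "{\<sigma>' c, \<sigma>' x} = {\<sigma> x, par (\<sigma> x)}" using c by (simp add: insert_commute)
    qed
    have ls: "length (star c B) = card (removed \<inter> \<sigma> ` set B)"
      unfolding rem length_star[OF block(2)[OF B]]
      by (rule card_image[symmetric], rule inj_on_subset[OF \<sigma>(1)]) (use BY in blast)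
    have st: "{a, b} \<subseteq> set Y \<union> {n..<m'}" if "(a, b) \<in> set (star c B)" for a b
    proof -
      have "a = c" "b \<in> set B" using that by (auto simp: star_def)
      then show ?thesis using BY keep_props(1)[OF B] m by (auto simp: c_def m'_def)
    qed
    have mm: "m' = n + length (hids (us @ [B]))" using m by (simp add: m'_def hids_def)
    have Tn: "\<forall>(a, b)\<in>set (star c B @ T'). (a, b) \<in> set T \<or> {a, b} \<subseteq> set Y \<union> {n..<m'}"
    proof
      fix e assume e: "e \<in> set (star c B @ T')"
      obtain a b where ab: "e = (a, b)" by (cases e)
      have "(a, b) \<in> set T \<or> {a, b} \<subseteq> set Y \<union> {n..<m'}"
      proof (cases "(a, b) \<in> set (star c B)")
        case True
        then show ?thesis using st by metis
      next
        case False
        then have "(a, b) \<in> set T'" using e ab by simp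
        then have "(a, b) \<in> set T \<or> {a, b} \<subseteq> set Y \<union> {n..<m}" using J by blast
        moreover have "set Y \<union> {n..<m} \<subseteq> set Y \<union> {n..<m'}" by (auto simp: m'_def)
        ultimately show ?thesis by (meson order_trans)
      qed
      then show "case e of (a, b) \<Rightarrow> (a, b) \<in> set T \<or> {a, b} \<subseteq> set Y \<union> {n..<m'}" unfolding ab by simp
    qed
    have img: "image_edges \<sigma>' (star c B @ T') = image_edges \<sigma>' T \<union> (\<lambda>i. {i, par i}) ` (removed \<inter> \<sigma> ` set (concat (us @ [B])))"
      unfolding image_edges_append ie un using J by blast
    have len: "length (star c B @ T') = length T + card (removed \<inter> \<sigma> ` set (concat (us @ [B])))"
      unfolding crd length_append ls using J by simp
    show ?thesis
    proof (cases "hid B")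
      case True
      have "rev (zip [n..<m'] (hids (us @ [B]))) = (m, B) # hs"
      proof -
        have "[n..<m'] = [n..<m] @ [m]" using True m by (simp add: m'_def)
        moreover have "hids (us @ [B]) = hids us @ [B]" using True by (simp add: hids_def)
        ultimately show ?thesis using J m by simp
      qed
      then show ?thesis unfolding joined_def s join_def prod.case if_not_P[OF False] if_P[OF True]
        using J True mm Tn img len unfolding c_def m'_def by (simp del: concat_append)
    next
      case nh: False
      have "hids (us @ [B]) = hids us" using nh by (simp add: hids_def)
      then show ?thesis unfolding joined_def s join_def prod.case if_not_P[OF False] if_not_P[OF nh]
        using J nh mm Tn img len unfolding c_def m'_def by (simp del: concat_append)
    qed
  qed
qed

lemma tms_join_blocks:
  "tms (fold_tm (join_block dd Y) Bs ([], [], T, n)) ((2 * (length Y)\<^sup>2 + 2 * length Y + 6) * length Y + 1) (joined T Bs)"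
proof -
  let ?c = "2 * (length Y)\<^sup>2 + 2 * length Y + 6"
  have "tms (fold_tm (join_block dd Y) Bs ([], [], T, n)) (sum_list (map (\<lambda>B. ?c * length B) Bs) + 1) (joined T Bs)"
  proof (rule tms_fold[where I = "joined T" and k = "\<lambda>B. ?c * length B"])
    fix us B vs s assume us: "Bs = us @ B # vs" and j: "joined T us s"
    obtain kept hs T' m where s: "s = (kept, hs, T', m)" by (cases s)
    have "n \<le> m" using j unfolding joined_def s by simp
    from tms_join_block[OF _ this, of B kept hs T']
    show "tms (join_block dd Y B s) (?c * length B) (joined T (us @ [B]))"
      using joined_step[OF us j] us unfolding s by (auto elim: tms_weaken)
  next
    show "joined T [] ([], [], T, n)" unfolding joined_def by (auto simp: hids_def)
  qed
  moreover have "sum_list (map (\<lambda>B. ?c * length B) Bs) = ?c * length Y"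
  proof -
    have "sum_list (map (\<lambda>B. ?c * length B) Bs) = ?c * length (concat Bs)"
      by (simp add: sum_list_const_mult length_concat)
    also have "length (concat Bs) = length Y" using blocks_of_length(1)[OF Bs] distinct_card[OF Y(1)] by simp
    finally show ?thesis .
  qed
  ultimately show ?thesis by simp
qed

text \<open>Every write during a round involves a name that is at least \<open>n\<close>, so
  distances between old names survive; both folds rely on reading them unchanged.\<close>

definition base :: "dist \<Rightarrow> bool" where
  "base dd' \<longleftrightarrow> (\<forall>a<n. \<forall>b<n. dd' a b = dd a b)"

lemma base_set: "base dd' \<Longrightarrow> n \<le> h \<Longrightarrow> base (set_dist dd' a h x)"
  "base dd' \<Longrightarrow> n \<le> h \<Longrightarrow> base (set_dist dd' h a x)"
  unfolding base_def set_dist_apply by auto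

lemma base_Y: "base dd' \<Longrightarrow> a \<in> set Y \<Longrightarrow> b \<in> set Y \<Longrightarrow> a \<noteq> b \<Longrightarrow> dd' a b = d (\<sigma> a) (\<sigma> b)"
  using dd Y(2) unfolding base_def by (metis lessThan_iff subsetD)

context
  fixes kept :: "nat list" and hs :: "(nat \<times> nat list) list" and m :: nat
  assumes kept: "kept = rev (map keep (filter (\<lambda>B. \<not> hid B) Bs))"
    and m: "m = n + length (hids Bs)" and hs: "hs = rev (zip [n..<m] (hids Bs))"
begin

lemma hs_D:
  assumes "(h, C) \<in> set hs"
  shows "C \<in> set Bs" "hid C" "length C \<noteq> 1" "n \<le> h" "h < m" "\<sigma>' h = bcls C" "bcls C \<notin> V"
proof -
  have len: "length [n..<m] = length (hids Bs)" using m by simp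
  obtain i where i: "i < length (hids Bs)" "h = [n..<m] ! i" "C = hids Bs ! i"
    using assms len unfolding hs by (auto simp: in_set_zip)
  have h: "h = n + i" using i(1,2) m by simp
  have "C \<in> set (hids Bs)" using i(1,3) nth_mem by blast
  then show "C \<in> set Bs" "hid C" by (simp_all add: hids_def)
  then show "length C \<noteq> 1" "bcls C \<notin> V" by (simp_all add: hid_def)
  show "n \<le> h" "h < m" using h i(1) m by simp_all
  show "\<sigma>' h = bcls C" using h i(1,3) by (simp add: \<sigma>'_def)
qed

lemma hs_fst: "map fst hs = rev [n..<m]"
proof -
  have "map fst (zip [n..<m] (hids Bs)) = [n..<m]" using m by (intro map_fst_zip) simp
  then show ?thesis unfolding hs rev_map[symmetric] by simp
qed

lemma hs_ex: "h \<in> {n..<m} \<Longrightarrow> \<exists>C. (h, C) \<in> set hs"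
proof -
  assume "h \<in> {n..<m}"
  then have "h \<in> set (map fst hs)" unfolding hs_fst by simp
  then show ?thesis by auto
qed

text \<open>All members of such a block are leaves with the hidden centre as parent, so every path
  from a member starts with the edge to the centre. All distance formulas of the round come down to
  this.\<close>

lemma hs_leaf:
  assumes hC: "(h, C) \<in> set hs" and i: "i \<in> set C" and k: "k \<in> W" "k \<noteq> \<sigma> i"
  shows "d (\<sigma> i) k = d (\<sigma> i) (\<sigma>' h) + d (\<sigma>' h) k"
proof -
  have iY: "i \<in> set Y" using block(3)[OF hs_D(1)[OF hC]] i by blast
  have "\<sigma> i \<noteq> bcls C" using \<sigma>_V[OF iY] hs_D(7)[OF hC] by metis
  note r = block_removed[OF hs_D(1,3)[OF hC] i this]
  show ?thesis using leaf_side(2)[OF r(1) k] r(2) hs_D(6)[OF hC] by simp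
qed

lemma hs_W: "(h, C) \<in> set hs \<Longrightarrow> \<sigma>' h \<in> W"
  using block_centre(3)[OF hs_D(1) hs_D(3)] hs_D(6) by metis

lemma lengths: "length kept \<le> length Y" "length hs \<le> length Y" "(h, C) \<in> set hs \<Longrightarrow> length C \<le> length Y"
proof -
  have b: "length Bs \<le> length Y" using blocks_of_length(2)[OF Bs] distinct_card[OF Y(1)] by simp
  show "length kept \<le> length Y" unfolding kept length_rev length_map by (rule order_trans[OF length_filter_le b])
  have "length (hids Bs) \<le> length Bs" unfolding hids_def by (rule length_filter_le)
  then show "length hs \<le> length Y" unfolding hs using m b by simp
  show "length C \<le> length Y" if "(h, C) \<in> set hs"
    using blocks_of_length(3)[OF Bs _ hs_D(1)[OF that]] distinct_card[OF Y(1)] by simp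
qed

lemma tms_child_dists:
  assumes hC: "(h, C) \<in> set hs" and b: "base dd0"
  shows "tms (child_dists Y (h, C) dd0) ((4 * length Y + 3) * length Y + 1)
    (\<lambda>dd'. base dd' \<and> (\<forall>i\<in>set C. stored \<sigma>' d dd' i h) \<and> (\<forall>p q. stored \<sigma>' d dd0 p q \<longrightarrow> stored \<sigma>' d dd' p q))"
proof -
  define I where "I us dd' \<longleftrightarrow> base dd' \<and> (\<forall>i\<in>set us. stored \<sigma>' d dd' i h) \<and>
    (\<forall>p q. stored \<sigma>' d dd0 p q \<longrightarrow> stored \<sigma>' d dd' p q)" for us :: "nat list" and dd' :: dist
  have CY: "set C \<subseteq> set Y" by (rule block(3)[OF hs_D(1)[OF hC]])
  define body where "body i dd' = bind_tm (filter_tm (\<lambda>j. ret (j \<noteq> i)) C) (\<lambda>js.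
      bind_tm (filter_tm (\<lambda>k. ret (k \<noteq> i \<and> k \<noteq> hd js)) Y) (\<lambda>ks.
        ret (set_dist dd' i h ((dd' i (hd js) + \<Phi> dd' i (hd js) (hd ks)) / 2))))" for i and dd' :: dist
  have step: "tms (body i dd') (4 * length Y + 3) (I (us @ [i]))" if C: "C = us @ i # vs" and J: "I us dd'" for us i vs dd'
  proof -
    have iC: "i \<in> set C" using C by simp
    have iY: "i \<in> set Y" using iC CY by blast
    show ?thesis
      unfolding body_def
    proof (rule tms_bind[where k' = "2 * length Y + 2"])
      show "tms (filter_tm (\<lambda>j. ret (j \<noteq> i)) C) ((1 + 1) * length C + 1) (\<lambda>js. js = filter (\<lambda>j. j \<noteq> i) C)"
        by (rule tms_filter) (simp add: tms_ret)
    next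
      show "(1 + 1) * length C + 1 + (2 * length Y + 2) \<le> 4 * length Y + 3" using lengths(3)[OF hC] by simp
    next
      fix js assume js: "js = filter (\<lambda>j. j \<noteq> i) C"
      obtain j0 where "j0 \<in> set C" "j0 \<noteq> i" using other_member[OF hs_D(1,3)[OF hC]] by metis
      then have "js \<noteq> []" unfolding js filter_empty_conv by metis
      then have "hd js \<in> set js" by simp
      then have jC: "hd js \<in> set C" "hd js \<noteq> i" unfolding js by simp_all
      define j where "j = hd js"
      have j: "j \<in> set C" "j \<noteq> i" "j \<in> set Y" using jC CY unfolding j_def by auto
      show "tms (bind_tm (filter_tm (\<lambda>k. ret (k \<noteq> i \<and> k \<noteq> hd js)) Y) (\<lambda>ks.
          ret (set_dist dd' i h ((dd' i (hd js) + \<Phi> dd' i (hd js) (hd ks)) / 2)))) (2 * length Y + 2) (I (us @ [i]))"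
        unfolding j_def[symmetric]
      proof (rule tms_bind[where k' = 1])
        show "tms (filter_tm (\<lambda>k. ret (k \<noteq> i \<and> k \<noteq> j)) Y) ((1 + 1) * length Y + 1) (\<lambda>ks. ks = filter (\<lambda>k. k \<noteq> i \<and> k \<noteq> j) Y)"
          by (rule tms_filter) (simp add: tms_ret)
      next
        fix ks assume ks: "ks = filter (\<lambda>k. k \<noteq> i \<and> k \<noteq> j) Y"
        have "ks \<noteq> []" using third_active[of i j] unfolding ks filter_empty_conv by metis
        then have "hd ks \<in> set ks" by simp
        then have k: "hd ks \<in> set Y" "hd ks \<noteq> i" "hd ks \<noteq> j" unfolding ks by simp_all
        have bs: "base dd'" using J unfolding I_def by blast
        have si: "\<sigma> j \<noteq> \<sigma> i" "\<sigma> (hd ks) \<noteq> \<sigma> i" "\<sigma> (hd ks) \<noteq> \<sigma> j" using \<sigma>_eq iY j(2,3) k by auto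
        have "dd' i j = d (\<sigma> i) (\<sigma>' h) + d (\<sigma>' h) (\<sigma> j)"
          using base_Y[OF bs iY j(3)] j(2) hs_leaf[OF hC iC \<sigma>_W[OF j(3)] si(1)] by simp
        moreover have "dd' i (hd ks) = d (\<sigma> i) (\<sigma>' h) + d (\<sigma>' h) (\<sigma> (hd ks))"
          using base_Y[OF bs iY k(1)] k(2) hs_leaf[OF hC iC \<sigma>_W[OF k(1)] si(2)] by simp
        moreover have "dd' j (hd ks) = d (\<sigma> j) (\<sigma>' h) + d (\<sigma>' h) (\<sigma> (hd ks))"
          using base_Y[OF bs j(3) k(1)] k(3) hs_leaf[OF hC j(1) \<sigma>_W[OF k(1)] si(3)] by simp
        moreover have "d (\<sigma>' h) (\<sigma> j) = d (\<sigma> j) (\<sigma>' h)" by (rule d_sym[OF hs_W[OF hC] \<sigma>_W[OF j(3)]])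
        \<comment> \<open>The paths from \<open>i\<close> to \<open>j\<close>, from \<open>i\<close>
          to the third node and from \<open>j\<close> to the third node all decompose at
          \<open>h\<close>. In the combination the other parts cancel and the distance from
          \<open>i\<close> to \<open>h\<close> is left twice.\<close>
        ultimately have val: "(dd' i j + \<Phi> dd' i j (hd ks)) / 2 = d (\<sigma>' i) (\<sigma>' h)"
          unfolding \<Phi>_def \<sigma>'_Y[OF iY] by simp
        have sy: "d (\<sigma>' i) (\<sigma>' h) = d (\<sigma>' h) (\<sigma>' i)" unfolding \<sigma>'_Y[OF iY] by (rule d_sym[OF \<sigma>_W[OF iY] hs_W[OF hC]])
        have "I (us @ [i]) (set_dist dd' i h (d (\<sigma>' i) (\<sigma>' h)))"
          using J stored_set[where \<sigma> = \<sigma>' and d = d and a = i and b = h, OF refl sy] base_set(1)[OF bs hs_D(4)[OF hC]]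
          unfolding I_def by auto
        then show "tms (ret (set_dist dd' i h ((dd' i j + \<Phi> dd' i j (hd ks)) / 2))) 1 (I (us @ [i]))"
          unfolding val by (intro tms_ret) simp_all
      qed simp
    qed
  qed
  have "tms (fold_tm body C dd0) ((4 * length Y + 3) * length C + 1) (I C)"
    by (rule tms_fold_const[where I = I]) (use step b in \<open>auto simp: I_def\<close>)
  then have "tms (child_dists Y (h, C) dd0) ((4 * length Y + 3) * length C + 1) (I C)"
    unfolding child_dists_def prod.case body_def[abs_def] .
  then show ?thesis
    by (rule tms_weaken) (use lengths(3)[OF hC] in \<open>auto simp: I_def\<close>)
qed

lemma kept_Y:
  assumes "l \<in> set kept" shows "l \<in> set Y" "\<sigma> l \<notin> removed"
proof -
  obtain B where B: "B \<in> set Bs" "\<not> hid B" "l = keep B" using assms unfolding kept by auto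
  show "l \<in> set Y" "\<sigma> l \<notin> removed" using keep_props(1,3)[OF B(1,2)] block(3)[OF B(1)] B(3) by auto
qed

text \<open>For two new nodes \<open>h\<close> and \<open>l\<close> the path between their first
  children is cut at both ends. This reads the distance from \<open>l\<close> to its child, so all
  child distances must be in place before the first call.\<close>

lemma tms_other_dists:
  assumes hC: "(h, C) \<in> set hs" and b: "base dd0"
    and ch: "\<And>l C' i. (l, C') \<in> set hs \<Longrightarrow> i \<in> set C' \<Longrightarrow> stored \<sigma>' d dd0 i l"
  shows "tms (other_dists kept hs (h, C) dd0) (2 * length Y + 2)
    (\<lambda>dd'. base dd' \<and> (\<forall>l\<in>set kept \<union> fst ` set hs. l \<noteq> h \<longrightarrow> stored \<sigma>' d dd' h l) \<and>
      (\<forall>p q. stored \<sigma>' d dd0 p q \<longrightarrow> stored \<sigma>' d dd' p q))"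
proof -
  define c where "c = hd C"
  have cC: "c \<in> set C" "c \<in> set Y" using block(3,4)[OF hs_D(1)[OF hC]] unfolding c_def by auto
  define I where "I S dd' \<longleftrightarrow> base dd' \<and> (\<forall>l\<in>S. l \<noteq> h \<longrightarrow> stored \<sigma>' d dd' h l) \<and>
    (\<forall>p q. stored \<sigma>' d dd0 p q \<longrightarrow> stored \<sigma>' d dd' p q)" for S :: "nat set" and dd' :: dist
  have hW: "\<sigma>' h \<in> W" by (rule hs_W[OF hC])
  have wr: "I (insert l S) (set_dist dd' h l x)" if J: "I S dd'" and x: "x = d (\<sigma>' h) (\<sigma>' l)" and lW: "\<sigma>' l \<in> W" for S dd' l x
    using J stored_set[where \<sigma> = \<sigma>' and d = d and a = h and b = l, OF x d_sym[OF hW lW]] base_set(2)[of dd' h, OF _ hs_D(4)[OF hC]]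
    unfolding I_def by auto
  have ch': "dd' i l = d (\<sigma> i) (\<sigma>' l)" "dd' l i = d (\<sigma> i) (\<sigma>' l)" if "I S dd'" "(l, C') \<in> set hs" "i \<in> set C'" for S dd' l C' i
  proof -
    have "stored \<sigma>' d dd' i l" using ch[OF that(2,3)] that(1) unfolding I_def by blast
    moreover have "i \<in> set Y" using block(3)[OF hs_D(1)[OF that(2)]] that(3) by blast
    ultimately show "dd' i l = d (\<sigma> i) (\<sigma>' l)" "dd' l i = d (\<sigma> i) (\<sigma>' l)" unfolding stored_def using \<sigma>'_Y by simp_all
  qed
  \<comment> \<open>The child \<open>c\<close> is removed in this round, hence differs from all kept
    nodes.\<close>
  have rc: "\<sigma> c \<in> removed"
    by (rule block_removed(3)[OF hs_D(1,3)[OF hC] cC(1)]) (use \<sigma>_V[OF cC(2)] hs_D(7)[OF hC] in metis)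
  have f1: "tms (fold_tm (\<lambda>l d. ret (set_dist d h l (d c l - d c h))) kept dd0) (1 * length kept + 1) (I (set kept))"
  proof (rule tms_fold_const[where I = "\<lambda>us. I (set us)"])
    fix us l vs dd' assume k: "kept = us @ l # vs" and J: "I (set us) dd'"
    have l: "l \<in> set Y" "\<sigma> l \<notin> removed" using kept_Y[of l] k by simp_all
    have ne: "\<sigma> l \<noteq> \<sigma> c" using rc l(2) by metis
    then have "c \<noteq> l" by metis
    then have "dd' c l = d (\<sigma> c) (\<sigma> l)" using base_Y[OF _ cC(2) l(1)] J unfolding I_def by blast
    then have "dd' c l - dd' c h = d (\<sigma>' h) (\<sigma>' l)"
      using hs_leaf[OF hC cC(1) \<sigma>_W[OF l(1)] ne] ch'(1)[OF J hC cC(1)] \<sigma>'_Y[OF l(1)] by simp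
    then have "I (insert l (set us)) (set_dist dd' h l (dd' c l - dd' c h))"
      by (intro wr[OF J]) (use \<sigma>'_Y[OF l(1)] \<sigma>_W[OF l(1)] in simp_all)
    then show "tms (ret (set_dist dd' h l (dd' c l - dd' c h))) 1 (I (set (us @ [l])))" by (intro tms_ret) simp_all
  next
    show "I (set []) dd0" unfolding I_def using b by simp
  qed
  have f2: "tms (fold_tm (\<lambda>(l, C') d. ret (if l = h then d else set_dist d h l (d c (hd C') - d c h - d l (hd C')))) hs dd1)
      (1 * length hs + 1) (I (set kept \<union> fst ` set hs))" if J1: "I (set kept) dd1" for dd1
  proof (rule tms_fold_const[where I = "\<lambda>us. I (set kept \<union> fst ` set us)"])
    fix us e vs dd' assume k: "hs = us @ e # vs" and J: "I (set kept \<union> fst ` set us) dd'"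
    obtain l C' where e: "e = (l, C')" by (cases e)
    have lC: "(l, C') \<in> set hs" using k e by simp
    define c' where "c' = hd C'"
    have c': "c' \<in> set C'" "c' \<in> set Y" using block(3,4)[OF hs_D(1)[OF lC]] unfolding c'_def by auto
    have res: "I (insert l (set kept \<union> fst ` set us)) (if l = h then dd' else set_dist dd' h l (dd' c c' - dd' c h - dd' l c'))"
    proof (cases "l = h")
      case True
      then show ?thesis using J unfolding I_def by auto
    next
      case False
      have CC: "C \<noteq> C'"
      proof
        assume "C = C'"
        then have "(h, C') \<in> set (zip [n..<m] (hids Bs))" "(l, C') \<in> set (zip [n..<m] (hids Bs))"
          using hC lC unfolding hs by simp_all
        moreover have "distinct (hids Bs)" using distinct_Bs unfolding hids_def by simp
        ultimately show False using False m by (auto simp: in_set_zip nth_eq_iff_index_eq)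
      qed
      have "set C \<inter> set C' = {}"
        using Bs hs_D(1)[OF hC] hs_D(1)[OF lC] CC unfolding blocks_of_def distinct_concat_iff by blast
      then have cc: "c \<noteq> c'" "c' \<notin> set C" using cC(1) c'(1) by auto
      have ne: "\<sigma> c' \<noteq> \<sigma> c" using \<sigma>_eq[OF c'(2) cC(2)] cc(1) by simp
      have lW: "\<sigma>' l \<in> W" by (rule hs_W[OF lC])
      have hc': "\<sigma>' h \<noteq> \<sigma> c'" using hs_D(6,7)[OF hC] \<sigma>_V[OF c'(2)] by metis
      have "dd' c c' = d (\<sigma> c) (\<sigma> c')" using base_Y[OF _ cC(2) c'(2) cc(1)] J unfolding I_def by blast
      also have "\<dots> = d (\<sigma> c) (\<sigma>' h) + d (\<sigma>' h) (\<sigma> c')" by (rule hs_leaf[OF hC cC(1) \<sigma>_W[OF c'(2)] ne])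
      also have "d (\<sigma>' h) (\<sigma> c') = d (\<sigma> c') (\<sigma>' l) + d (\<sigma>' h) (\<sigma>' l)"
        using hs_leaf[OF lC c'(1) hW hc'] d_sym[OF hW \<sigma>_W[OF c'(2)]] d_sym[OF lW hW] by simp
      finally have "dd' c c' - dd' c h - dd' l c' = d (\<sigma>' h) (\<sigma>' l)"
        using ch'(1)[OF J hC cC(1)] ch'(2)[OF J lC c'(1)] by simp
      from wr[OF J this lW] show ?thesis using False by simp
    qed
    then show "tms ((case e of (l, C') \<Rightarrow> \<lambda>d. ret (if l = h then d else set_dist d h l (d c (hd C') - d c h - d l (hd C')))) dd') 1
        (I (set kept \<union> fst ` set (us @ [e])))"
      unfolding e prod.case c'_def by (intro tms_ret) simp_all
  next
    show "I (set kept \<union> fst ` set []) dd1" using J1 by simp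
  qed
  have "tms (other_dists kept hs (h, C) dd0) (2 * length Y + 2) (I (set kept \<union> fst ` set hs))"
    unfolding other_dists_def prod.case c_def[symmetric]
    by (rule tms_bind[OF f1 f2]) (use lengths(1,2) in simp_all)
  then show ?thesis unfolding I_def .
qed

lemma tms_all_dists:
  shows "tms (fold_tm (child_dists Y) hs dd) (((4 * length Y + 3) * length Y + 1) * length Y + 1)
    (\<lambda>dd'. base dd' \<and> (\<forall>(l, C')\<in>set hs. \<forall>i\<in>set C'. stored \<sigma>' d dd' i l))"
    and "base dd1 \<Longrightarrow> (\<forall>(l, C')\<in>set hs. \<forall>i\<in>set C'. stored \<sigma>' d dd1 i l) \<Longrightarrow>
    tms (fold_tm (other_dists kept hs) hs dd1) ((2 * length Y + 2) * length Y + 1)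
    (\<lambda>dd'. base dd' \<and> (\<forall>(l, C')\<in>set hs. \<forall>i\<in>set C'. stored \<sigma>' d dd' i l) \<and>
      (\<forall>h\<in>fst ` set hs. \<forall>l\<in>set kept \<union> fst ` set hs. l \<noteq> h \<longrightarrow> stored \<sigma>' d dd' h l))"
proof -
  have "tms (fold_tm (child_dists Y) hs dd) (((4 * length Y + 3) * length Y + 1) * length hs + 1)
    (\<lambda>dd'. base dd' \<and> (\<forall>(l, C')\<in>set hs. \<forall>i\<in>set C'. stored \<sigma>' d dd' i l))"
  proof (rule tms_fold_const[where I = "\<lambda>us dd'. base dd' \<and> (\<forall>(l, C')\<in>set us. \<forall>i\<in>set C'. stored \<sigma>' d dd' i l)"])
    fix us e vs dd' assume k: "hs = us @ e # vs" and J: "base dd' \<and> (\<forall>(l, C')\<in>set us. \<forall>i\<in>set C'. stored \<sigma>' d dd' i l)"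
    obtain h C where e: "e = (h, C)" by (cases e)
    have hC: "(h, C) \<in> set hs" using k e by simp
    show "tms (child_dists Y e dd') ((4 * length Y + 3) * length Y + 1)
        (\<lambda>dd'. base dd' \<and> (\<forall>(l, C')\<in>set (us @ [e]). \<forall>i\<in>set C'. stored \<sigma>' d dd' i l))"
      unfolding e by (rule tms_weaken[OF tms_child_dists[OF hC]]) (use J in auto)
  qed (simp add: base_def)
  then show "tms (fold_tm (child_dists Y) hs dd) (((4 * length Y + 3) * length Y + 1) * length Y + 1)
    (\<lambda>dd'. base dd' \<and> (\<forall>(l, C')\<in>set hs. \<forall>i\<in>set C'. stored \<sigma>' d dd' i l))"
    by (rule tms_weaken) (intro add_mono mult_le_mono2 lengths(2) le_refl, assumption)
  assume b: "base dd1" and ch: "\<forall>(l, C')\<in>set hs. \<forall>i\<in>set C'. stored \<sigma>' d dd1 i l"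
  define J where "J us dd' \<longleftrightarrow> base dd' \<and> (\<forall>(l, C')\<in>set hs. \<forall>i\<in>set C'. stored \<sigma>' d dd' i l) \<and>
      (\<forall>h\<in>fst ` set us. \<forall>l\<in>set kept \<union> fst ` set hs. l \<noteq> h \<longrightarrow> stored \<sigma>' d dd' h l)" for us :: "(nat \<times> nat list) list" and dd' :: dist
  have "tms (fold_tm (other_dists kept hs) hs dd1) ((2 * length Y + 2) * length hs + 1) (J hs)"
  proof (rule tms_fold_const[where I = J])
    fix us e vs dd' assume k: "hs = us @ e # vs" and Jd: "J us dd'"
    obtain h C where e: "e = (h, C)" by (cases e)
    have hC: "(h, C) \<in> set hs" using k e by simp
    have "tms (other_dists kept hs (h, C) dd') (2 * length Y + 2)
      (\<lambda>dd''. base dd'' \<and> (\<forall>l\<in>set kept \<union> fst ` set hs. l \<noteq> h \<longrightarrow> stored \<sigma>' d dd'' h l) \<and>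
      (\<forall>p q. stored \<sigma>' d dd' p q \<longrightarrow> stored \<sigma>' d dd'' p q))"
      by (rule tms_other_dists[OF hC]) (use Jd in \<open>auto simp: J_def\<close>)
    then show "tms (other_dists kept hs e dd') (2 * length Y + 2) (J (us @ [e]))"
      unfolding e
    proof (rule tms_weaken)
      fix dd'' assume D: "base dd'' \<and> (\<forall>l\<in>set kept \<union> fst ` set hs. l \<noteq> h \<longrightarrow> stored \<sigma>' d dd'' h l) \<and>
        (\<forall>p q. stored \<sigma>' d dd' p q \<longrightarrow> stored \<sigma>' d dd'' p q)"
      show "J (us @ [(h, C)]) dd''"
        unfolding J_def
      proof (intro conjI ballI impI)
        show "base dd''" using D by blast
        show "case x of (l, C') \<Rightarrow> \<forall>i\<in>set C'. stored \<sigma>' d dd'' i l" if "x \<in> set hs" for x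
          using that Jd D unfolding J_def by (cases x) auto
        show "stored \<sigma>' d dd'' h' l" if "h' \<in> fst ` set (us @ [(h, C)])" "l \<in> set kept \<union> fst ` set hs" "l \<noteq> h'" for h' l
        proof (cases "h' = h")
          case True
          then show ?thesis using D that(2,3) by blast
        next
          case False
          then have "h' \<in> fst ` set us" using that(1) by auto
          then have "stored \<sigma>' d dd' h' l" using Jd that(2,3) unfolding J_def by blast
          then show ?thesis using D by blast
        qed
      qed
    qed simp
  qed (use b ch in \<open>simp add: J_def\<close>)
  then show "tms (fold_tm (other_dists kept hs) hs dd1) ((2 * length Y + 2) * length Y + 1)
    (\<lambda>dd'. base dd' \<and> (\<forall>(l, C')\<in>set hs. \<forall>i\<in>set C'. stored \<sigma>' d dd' i l) \<and>
      (\<forall>h\<in>fst ` set hs. \<forall>l\<in>set kept \<union> fst ` set hs. l \<noteq> h \<longrightarrow> stored \<sigma>' d dd' h l))"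
    unfolding J_def by (rule tms_weaken) (intro add_mono mult_le_mono2 lengths(2) le_refl, assumption)
qed

lemma active_image: "\<sigma>' ` (set kept \<union> {n..<m}) = active'"
proof (intro equalityI subsetI)
  fix v assume "v \<in> \<sigma>' ` (set kept \<union> {n..<m})"
  then obtain x where x: "x \<in> set kept \<union> {n..<m}" "v = \<sigma>' x" by blast
  show "v \<in> active'"
  proof (cases "x \<in> set kept")
    case True
    then show ?thesis using kept_Y[OF True] \<sigma>'_Y \<sigma>_V x(2) by auto
  next
    case False
    then obtain C where C: "(x, C) \<in> set hs" using hs_ex x(1) by blast
    then show ?thesis using block_centre(4)[OF hs_D(1,3)[OF C]] hs_D(6)[OF C] x(2) by auto
  qed
next
  fix v assume v: "v \<in> active'"
  have centre: "bcls B \<in> \<sigma>' ` (set kept \<union> {n..<m})" if B: "B \<in> set Bs" "length B \<noteq> 1" for B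
  proof (cases "hid B")
    case True
    then have "B \<in> set (hids Bs)" using B by (simp add: hids_def)
    then obtain i where i: "i < length (hids Bs)" "B = hids Bs ! i" by (metis in_set_conv_nth)
    then have "\<sigma>' (n + i) = bcls B" "n + i \<in> {n..<m}" using m by (simp_all add: \<sigma>'_def)
    then show ?thesis by (metis UnI2 image_eqI)
  next
    case False
    have "keep B \<in> set kept" using B(1) False unfolding kept by simp
    moreover have "\<sigma>' (keep B) = bcls B"
      using keep_props(1,2)[OF B(1) False] B(2) block(3)[OF B(1)] \<sigma>'_Y by (metis subsetD)
    ultimately show ?thesis by (metis UnI1 image_eqI)
  qed
  have blk: "\<exists>B\<in>set Bs. x \<in> set B" if "x \<in> set Y" for x using Bs that unfolding blocks_of_def by auto
  from v show "v \<in> \<sigma>' ` (set kept \<union> {n..<m})"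
  proof
    assume "v \<in> V - removed"
    then obtain x where x: "x \<in> set Y" "v = \<sigma> x" "\<sigma> x \<notin> removed" using \<sigma>(2) by blast
    obtain B where B: "B \<in> set Bs" "x \<in> set B" using blk[OF x(1)] by blast
    show ?thesis
    proof (cases "length B = 1")
      case True
      then have "B = [x]" using B(2) by (auto simp: length_Suc_conv)
      then have "keep B = x" "\<not> hid B" by (simp_all add: keep_def hid_def)
      then have "x \<in> set kept" using B(1) unfolding kept by force
      then show ?thesis using \<sigma>'_Y[OF x(1)] x(2) by (metis UnI1 image_eqI)
    next
      case False
      then have "\<sigma> x = bcls B" using block_removed(3)[OF B(1) False B(2)] x(3) by blast
      then show ?thesis using centre[OF B(1) False] x(2) by simp
    qed
  next
    assume "v \<in> par ` removed"
    then obtain i where i: "i \<in> removed" "v = par i" by blast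
    obtain x where x: "x \<in> set Y" "i = \<sigma> x" using removed_leaf(2)[OF i(1)] \<sigma>(2) by blast
    obtain B where B: "B \<in> set Bs" "x \<in> set B" using blk[OF x(1)] by blast
    have "length B \<noteq> 1"
    proof
      assume "length B = 1"
      then have "B = [x]" using B(2) by (auto simp: length_Suc_conv)
      then have "keep B = x" "\<not> hid B" by (simp_all add: keep_def hid_def)
      then show False using keep_props(3)[OF B(1)] i(1) x(2) by metis
    qed
    moreover have "bcls B = v"
      using block(5)[OF B] removed_leaf(1)[OF i(1)] i(2) x(2) by (simp add: cls_def)
    ultimately show ?thesis using centre[OF B(1)] by blast
  qed
qed

lemma bcls_inj: "inj_on bcls (set Bs)"
proof -
  show "inj_on bcls (set Bs)"
  proof (rule inj_onI)
    fix B B' assume B: "B \<in> set Bs" "B' \<in> set Bs" "bcls B = bcls B'"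
    have "hd B \<in> set B'" using block(6)[OF B(2), of "hd B"] block(3,4)[OF B(1)] B(3) unfolding bcls_def by blast
    then have "set B \<inter> set B' \<noteq> {}" using block(4)[OF B(1)] by blast
    then show "B = B'" using Bs B(1,2) unfolding blocks_of_def distinct_concat_iff by blast
  qed
qed

lemma active_inj: "inj_on \<sigma>' (set kept \<union> {n..<m})"
proof (rule inj_onI)
  have hid_name: "\<exists>C. (x, C) \<in> set hs \<and> \<sigma>' x \<notin> V" if "x \<in> {n..<m}" for x
    using hs_ex[OF that] hs_D(6,7) by metis
  have kept_name: "\<sigma>' x \<in> V \<and> x \<in> set Y" if "x \<in> set kept" for x
    using kept_Y(1)[OF that] \<sigma>'_Y \<sigma>_V by simp
  fix x y assume xy: "x \<in> set kept \<union> {n..<m}" "y \<in> set kept \<union> {n..<m}" "\<sigma>' x = \<sigma>' y"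
  \<comment> \<open>Kept names denote previously active nodes, new names denote centres that were
    not active; so the two kinds cannot collide.\<close>
  have "\<sigma>' z \<in> V \<longleftrightarrow> z \<in> set kept" if "z \<in> set kept \<union> {n..<m}" for z
    using that hid_name[of z] kept_name[of z] by blast
  from this[OF xy(1)] this[OF xy(2)] have "x \<in> set kept \<longleftrightarrow> y \<in> set kept" using xy(3) by simp
  then consider "x \<in> set kept" "y \<in> set kept" | "x \<in> {n..<m}" "y \<in> {n..<m}" using xy(1,2) by blast
  then show "x = y"
  proof cases
    case 1
    then show ?thesis using kept_name \<sigma>'_Y \<sigma>_eq xy(3) by metis
  next
    case 2
    have "\<sigma>' z = bcls (hids Bs ! (z - n)) \<and> z - n < length (hids Bs)" if "z \<in> {n..<m}" for z
      using that m by (auto simp: \<sigma>'_def)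
    then have "bcls (hids Bs ! (x - n)) = bcls (hids Bs ! (y - n))" "x - n < length (hids Bs)" "y - n < length (hids Bs)"
      using 2 xy(3) by metis+
    moreover have "set (hids Bs) \<subseteq> set Bs" "distinct (hids Bs)" using distinct_Bs by (auto simp: hids_def)
    ultimately have "x - n = y - n"
      using bcls_inj by (metis inj_on_eq_iff nth_eq_iff_index_eq nth_mem subsetD)
    then show ?thesis using 2 by auto
  qed
qed

lemma kept_distinct: "distinct kept"
proof -
  have "inj_on keep (set (filter (\<lambda>B. \<not> hid B) Bs))"
  proof (rule inj_onI)
    fix B B' assume a: "B \<in> set (filter (\<lambda>B. \<not> hid B) Bs)" "B' \<in> set (filter (\<lambda>B. \<not> hid B) Bs)" "keep B = keep B'"
    then have B: "B \<in> set Bs" "\<not> hid B" "B' \<in> set Bs" "\<not> hid B'" by auto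
    have "keep B \<in> set B \<inter> set B'" using keep_props(1)[OF B(1,2)] keep_props(1)[OF B(3,4)] a(3) by simp
    then show "B = B'" using Bs B(1,3) unfolding blocks_of_def distinct_concat_iff by blast
  qed
  then show ?thesis unfolding kept using distinct_Bs by (simp add: distinct_map)
qed

end

end

text \<open>The new map agrees with \<open>\<sigma>\<close> on all names below \<open>n\<close>, so
  what was known about earlier edges and witnesses can be transported. The existential hides how new
  names are attached to blocks.\<close>

definition round_ok :: "edge_list \<Rightarrow> (nat \<times> nat \<times> nat) list \<Rightarrow> rg_state \<Rightarrow> bool" where
  "round_ok T new = (\<lambda>(Y', T', dd', n', new'). \<exists>\<tau> ws. new' = new @ ws \<and> n \<le> n' \<and> (\<forall>x<n. \<tau> x = \<sigma> x) \<and>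
     distinct Y' \<and> set Y' \<subseteq> set Y \<union> {n..<n'} \<and> {n..<n'} \<subseteq> set Y' \<and> inj_on \<tau> (set Y') \<and> \<tau> ` set Y' = active' \<and>
     \<tau> ` {n..<n'} \<inter> V = {} \<and>
     (\<forall>a\<in>set Y'. \<forall>b\<in>set Y'. a \<noteq> b \<longrightarrow> dd' a b = d (\<tau> a) (\<tau> b)) \<and> (\<forall>a<n. \<forall>b<n. dd' a b = dd a b) \<and>
     image_edges \<tau> T' = image_edges \<tau> T \<union> (\<lambda>i. {i, par i}) ` removed \<and> length T' = length T + card removed \<and>
     (\<forall>(a, b)\<in>set T'. (a, b) \<in> set T \<or> {a, b} \<subseteq> set Y \<union> {n..<n'}) \<and>
     distinct (map fst ws) \<and> fst ` set ws = {n..<n'} \<and>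
     (\<forall>(h, i, j)\<in>set ws. i \<in> set Y \<and> j \<in> set Y \<and> d (\<tau> i) (\<tau> j) = d (\<tau> i) (\<tau> h) + d (\<tau> h) (\<tau> j) \<and>
        stored \<tau> d dd' i h \<and> stored \<tau> d dd' j h))"

lemma tms_rg_step:
  "tms (rg_step (Y, T, dd, n, new)) (60 * length Y ^ 3 + length new) (round_ok T new)"
proof -
  define N where "N = length Y"
  have N: "1 \<le> N" using length_Y V3 by (simp add: N_def)
  let ?c1 = "((8 * N + 6 + 3) * N + 1) * N + 1"
  let ?c2 = "(2 * N\<^sup>2 + 2 * N + 6) * N + 1"
  let ?c3 = "((4 * N + 3) * N + 1) * N + 1"
  let ?c4 = "(2 * N + 2) * N + 1"
  let ?r4 = "8 * N + length new + 8"
  have total: "?c1 + (?c2 + (?c3 + (?c4 + ?r4))) \<le> 60 * N ^ 3 + length new"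
  proof -
    have "N \<le> N ^ 3" "N ^ 2 \<le> N ^ 3" "1 \<le> N ^ 3" using N by (auto intro: power_increasing self_le_power)
    \<comment> \<open>Bounding each power of \<open>N\<close> by the cube gives 14 + 16 + 18 + 12 =
      60.\<close>
    moreover have "?c1 + (?c2 + (?c3 + (?c4 + ?r4))) = 14 * N ^ 3 + 16 * N ^ 2 + 18 * N + 12 + length new"
      by (simp add: algebra_simps power2_eq_square power3_eq_cube)
    ultimately show ?thesis by linarith
  qed
  have g: "tms (grouping (related dd Y) Y) ?c1 (blocks_of (\<lambda>a. cls (\<sigma> a)) (set Y))"
    unfolding N_def by (rule tms_grouping[OF tms_related Y(1)])
  show ?thesis
    unfolding rg_step_def prod.case N_def[symmetric]
  proof (rule tms_bind[OF g _ total])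
    fix Bs assume Bs: "blocks_of (\<lambda>a. cls (\<sigma> a)) (set Y) Bs"
    show "tms (bind_tm (fold_tm (join_block dd Y) Bs ([], [], T, n)) (\<lambda>(kept, hs, T', n').
        bind_tm (fold_tm (child_dists Y) hs dd) (\<lambda>d'. bind_tm (fold_tm (other_dists kept hs) hs d') (\<lambda>d''.
        bind_tm (map_tm (\<lambda>(h, C). ret h) hs) (\<lambda>hidden. bind_tm (append_tm kept hidden) (\<lambda>Y'.
        bind_tm (map_tm (\<lambda>(h, C). ret (h, hd C, hd (tl C))) hs) (\<lambda>witnesses. bind_tm (append_tm new witnesses) (\<lambda>new'.
        ret (Y', T', d'', n', new'))))))))) (?c2 + (?c3 + (?c4 + ?r4))) (round_ok T new)"
    proof (rule tms_bind[OF tms_join_blocks[OF Bs, unfolded N_def[symmetric]]])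
      fix s assume j: "joined Bs T Bs s"
      obtain kept hs T' m where s: "s = (kept, hs, T', m)" by (cases s)
      note J = j[unfolded joined_def[OF Bs] s prod.case]
      have kept: "kept = rev (map keep (filter (\<lambda>B. \<not> hid B) Bs))" and m: "m = n + length (hids Bs)"
        and hs: "hs = rev (zip [n..<m] (hids Bs))" using J by blast+
      note ctx = Bs kept m hs
      have lk: "length kept \<le> N" "length hs \<le> N" using lengths(1,2)[OF ctx] unfolding N_def by blast+
      show "tms (case s of (kept, hs, T', n') \<Rightarrow>
        bind_tm (fold_tm (child_dists Y) hs dd) (\<lambda>d'. bind_tm (fold_tm (other_dists kept hs) hs d') (\<lambda>d''.
        bind_tm (map_tm (\<lambda>(h, C). ret h) hs) (\<lambda>hidden. bind_tm (append_tm kept hidden) (\<lambda>Y'.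
        bind_tm (map_tm (\<lambda>(h, C). ret (h, hd C, hd (tl C))) hs) (\<lambda>witnesses. bind_tm (append_tm new witnesses) (\<lambda>new'.
        ret (Y', T', d'', n', new')))))))) (?c3 + (?c4 + ?r4)) (round_ok T new)"
        unfolding s prod.case
      proof (rule tms_bind[OF tms_all_dists(1)[OF ctx, unfolded N_def[symmetric]]])
        fix d1 assume d1: "base d1 \<and> (\<forall>(l, C')\<in>set hs. \<forall>i\<in>set C'. stored (\<sigma>' Bs) d d1 i l)"
        show "tms (bind_tm (fold_tm (other_dists kept hs) hs d1) (\<lambda>d''.
          bind_tm (map_tm (\<lambda>(h, C). ret h) hs) (\<lambda>hidden. bind_tm (append_tm kept hidden) (\<lambda>Y'.
          bind_tm (map_tm (\<lambda>(h, C). ret (h, hd C, hd (tl C))) hs) (\<lambda>witnesses. bind_tm (append_tm new witnesses) (\<lambda>new'.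
          ret (Y', T', d'', m, new'))))))) (?c4 + ?r4) (round_ok T new)"
        proof (rule tms_bind[OF tms_all_dists(2)[OF ctx, unfolded N_def[symmetric]]])
          show "base d1" "\<forall>(l, C')\<in>set hs. \<forall>i\<in>set C'. stored (\<sigma>' Bs) d d1 i l" using d1 by blast+
        next
          fix d2 assume d2: "base d2 \<and> (\<forall>(l, C')\<in>set hs. \<forall>i\<in>set C'. stored (\<sigma>' Bs) d d2 i l) \<and>
            (\<forall>h\<in>fst ` set hs. \<forall>l\<in>set kept \<union> fst ` set hs. l \<noteq> h \<longrightarrow> stored (\<sigma>' Bs) d d2 h l)"
          have d2a: "\<forall>a<n. \<forall>b<n. d2 a b = dd a b" using d2[THEN conjunct1] unfolding base_def[OF Bs] .
          have d2b: "stored (\<sigma>' Bs) d d2 i h" if "(h, C) \<in> set hs" "i \<in> set C" for h C i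
            using bspec[OF d2[THEN conjunct2, THEN conjunct1] that(1), unfolded prod.case] that(2) by (rule bspec)
          define ws where "ws = map (\<lambda>(h, C). (h, hd C, hd (tl C))) hs"
          have fs: "fst ` set hs = {n..<m}" using hs_fst[OF ctx] by (metis set_map set_rev set_upt)
          have wf: "map fst ws = rev [n..<m]" using hs_fst[OF ctx] unfolding ws_def by (simp add: comp_def case_prod_beta)
          have ok: "round_ok T new (kept @ map fst hs, T', d2, m, new @ ws)"
            unfolding round_ok_def prod.case
          proof (intro exI[of _ "\<sigma>' Bs"] exI[of _ ws] conjI)
            have sY: "set (kept @ map fst hs) = set kept \<union> {n..<m}" using fs by simp
            have kY: "set kept \<subseteq> set Y" using kept_Y(1)[OF ctx] by blast
            show "n \<le> m" using m by simp
            show "\<forall>x<n. \<sigma>' Bs x = \<sigma> x" using \<sigma>'_old[OF Bs] by blast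
            show "distinct (kept @ map fst hs)"
              unfolding hs_fst[OF ctx] using kept_distinct[OF ctx] kY Y(2) by auto
            show "set (kept @ map fst hs) \<subseteq> set Y \<union> {n..<m}" "{n..<m} \<subseteq> set (kept @ map fst hs)"
              unfolding sY using kY by blast+
            show "inj_on (\<sigma>' Bs) (set (kept @ map fst hs))" unfolding sY by (rule active_inj[OF ctx])
            show "\<sigma>' Bs ` set (kept @ map fst hs) = active'" unfolding sY by (rule active_image[OF ctx])
            show "\<sigma>' Bs ` {n..<m} \<inter> V = {}"
            proof -
              have "\<sigma>' Bs h \<notin> V" if h: "h \<in> {n..<m}" for h
              proof -
                obtain C where "(h, C) \<in> set hs" using hs_ex[OF ctx h] by (elim exE)
                then show ?thesis using hs_D(6,7)[OF ctx] by simp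
              qed
              then show ?thesis by auto
            qed
            show "\<forall>a\<in>set (kept @ map fst hs). \<forall>b\<in>set (kept @ map fst hs). a \<noteq> b \<longrightarrow> d2 a b = d (\<sigma>' Bs a) (\<sigma>' Bs b)"
            proof (intro ballI impI)
              fix a b assume ab: "a \<in> set (kept @ map fst hs)" "b \<in> set (kept @ map fst hs)" "a \<noteq> b"
              have st: "d2 h l = d (\<sigma>' Bs h) (\<sigma>' Bs l) \<and> d2 l h = d (\<sigma>' Bs l) (\<sigma>' Bs h)"
                if "h \<in> fst ` set hs" "l \<in> set kept \<union> fst ` set hs" "l \<noteq> h" for h l
              proof -
                have "\<sigma>' Bs h \<in> W" using that(1) hs_W[OF ctx] by auto
                moreover have "\<sigma>' Bs l \<in> W"
                  using that(2) hs_W[OF ctx] kept_Y(1)[OF ctx, of l] \<sigma>'_Y[OF Bs, of l] \<sigma>_W[of l] by auto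
                moreover have "stored (\<sigma>' Bs) d d2 h l" using d2 that by blast
                ultimately show ?thesis unfolding stored_def using d_sym by metis
              qed
              show "d2 a b = d (\<sigma>' Bs a) (\<sigma>' Bs b)"
              proof (cases "a \<in> set kept \<and> b \<in> set kept")
                case True
                then have "a \<in> set Y" "b \<in> set Y" using kY by blast+
                then show ?thesis using base_Y[OF Bs, of d2 a b] d2 ab(3) \<sigma>'_Y[OF Bs] by simp
              next
                case False
                then show ?thesis using st[of a b] st[of b a] ab by auto
              qed
            qed
            show "\<forall>a<n. \<forall>b<n. d2 a b = dd a b" by (rule d2a)
            have rem: "removed \<inter> \<sigma> ` set (concat Bs) = removed"
            proof -
              have "set (concat Bs) = set Y" using Bs unfolding blocks_of_def by simp
              then have "\<sigma> ` set (concat Bs) = V" using \<sigma>(2) by simp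
              then show ?thesis using removed_leaf(2) by blast
            qed
            show "image_edges (\<sigma>' Bs) T' = image_edges (\<sigma>' Bs) T \<union> (\<lambda>i. {i, par i}) ` removed"
              using J unfolding rem by (elim conjE)
            show "length T' = length T + card removed" using J unfolding rem by (elim conjE)
            show "\<forall>(a, b)\<in>set T'. (a, b) \<in> set T \<or> {a, b} \<subseteq> set Y \<union> {n..<m}" using J by (elim conjE)
            show "distinct (map fst ws)" unfolding wf by simp
            show "fst ` set ws = {n..<m}" using arg_cong[OF wf, of set] by simp
            show "\<forall>(h, i, j)\<in>set ws. i \<in> set Y \<and> j \<in> set Y \<and> d (\<sigma>' Bs i) (\<sigma>' Bs j) = d (\<sigma>' Bs i) (\<sigma>' Bs h) + d (\<sigma>' Bs h) (\<sigma>' Bs j) \<and>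
              stored (\<sigma>' Bs) d d2 i h \<and> stored (\<sigma>' Bs) d d2 j h"
            proof
              fix w assume "w \<in> set ws"
              then obtain h C where hC: "(h, C) \<in> set hs" "w = (h, hd C, hd (tl C))" unfolding ws_def by auto
              note B = block[OF Bs hs_D(1)[OF ctx hC(1)]]
              obtain i j C' where C: "C = i # j # C'" using B(1) hs_D(3)[OF ctx hC(1)] by (cases C; cases "tl C") auto
              have ij: "i \<in> set C" "j \<in> set C" "i \<noteq> j" using C B(2) by auto
              have Yij: "i \<in> set Y" "j \<in> set Y" using ij B(3) by blast+
              have "\<sigma> j \<noteq> \<sigma> i" using \<sigma>_eq[OF Yij(2,1)] ij(3) by simp
              from hs_leaf[OF ctx hC(1) ij(1) \<sigma>_W[OF Yij(2)] this]
              have "d (\<sigma>' Bs i) (\<sigma>' Bs j) = d (\<sigma>' Bs i) (\<sigma>' Bs h) + d (\<sigma>' Bs h) (\<sigma>' Bs j)"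
                using \<sigma>'_Y[OF Bs] Yij by simp
              moreover have "stored (\<sigma>' Bs) d d2 i h" "stored (\<sigma>' Bs) d d2 j h" by (rule d2b[OF hC(1) ij(1)], rule d2b[OF hC(1) ij(2)])
              ultimately show "case w of (h, i, j) \<Rightarrow> i \<in> set Y \<and> j \<in> set Y \<and> d (\<sigma>' Bs i) (\<sigma>' Bs j) = d (\<sigma>' Bs i) (\<sigma>' Bs h) + d (\<sigma>' Bs h) (\<sigma>' Bs j) \<and>
                stored (\<sigma>' Bs) d d2 i h \<and> stored (\<sigma>' Bs) d d2 j h" unfolding hC(2) C using Yij by simp
            qed
          qed simp
          have m1: "tms (map_tm (\<lambda>(h, C). ret h) hs) ((1 + 1) * length hs + 1) (\<lambda>ys. ys = map fst hs)"
            by (rule tms_map) (auto intro: tms_ret)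
          have m2: "tms (map_tm (\<lambda>(h, C). ret (h, hd C, hd (tl C))) hs) ((1 + 1) * length hs + 1) (\<lambda>ys. ys = ws)"
            unfolding ws_def by (rule tms_map) (auto intro: tms_ret)
          show "tms (bind_tm (map_tm (\<lambda>(h, C). ret h) hs) (\<lambda>hidden. bind_tm (append_tm kept hidden) (\<lambda>Y'.
            bind_tm (map_tm (\<lambda>(h, C). ret (h, hd C, hd (tl C))) hs) (\<lambda>witnesses. bind_tm (append_tm new witnesses) (\<lambda>new'.
            ret (Y', T', d2, m, new')))))) ?r4 (round_ok T new)"
            by (rule tms_bind[OF m1, where k' = "N + 1 + (2 * N + 1 + (length new + 2))"],
              rule tms_bind[OF tms_append, where k' = "2 * N + 1 + (length new + 2)"],
              rule tms_bind[OF m2, where k' = "length new + 2"],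
              rule tms_bind[OF tms_append, where k' = 1])
              (use ok lk in \<open>simp_all add: tms_ret\<close>)
        qed simp
      qed simp
    qed simp
  qed
qed

end

end

section \<open>Recursive grouping\<close>

text \<open>A hidden node may have children that were introduced earlier in the same call, so the
  set of admissible children grows along the list.\<close>

fun witnesses :: "(nat \<Rightarrow> nat) \<Rightarrow> dist \<Rightarrow> dist \<Rightarrow> nat set \<Rightarrow> (nat \<times> nat \<times> nat) list \<Rightarrow> bool" where
  "witnesses \<sigma> d dd X [] \<longleftrightarrow> True"
| "witnesses \<sigma> d dd X ((h, i, j) # ws) \<longleftrightarrow> i \<in> X \<and> j \<in> X \<and>
     d (\<sigma> i) (\<sigma> j) = d (\<sigma> i) (\<sigma> h) + d (\<sigma> h) (\<sigma> j) \<and> stored \<sigma> d dd i h \<and> stored \<sigma> d dd j h \<and>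
     witnesses \<sigma> d dd (insert h X) ws"

lemma witnesses_append:
  "witnesses \<sigma> d dd X (us @ vs) \<longleftrightarrow> witnesses \<sigma> d dd X us \<and> witnesses \<sigma> d dd (X \<union> fst ` set us) vs"
  by (induction us arbitrary: X) (auto simp: insert_commute)

lemma witnessesI:
  assumes "\<And>h i j. (h, i, j) \<in> set ws \<Longrightarrow> i \<in> X \<and> j \<in> X \<and>
     d (\<sigma> i) (\<sigma> j) = d (\<sigma> i) (\<sigma> h) + d (\<sigma> h) (\<sigma> j) \<and> stored \<sigma> d dd i h \<and> stored \<sigma> d dd j h"
  shows "witnesses \<sigma> d dd X ws"
  using assms
proof (induction ws arbitrary: X)
  case (Cons w ws)
  obtain h i j where w: "w = (h, i, j)" by (cases w)
  have "witnesses \<sigma> d dd (insert h X) ws" by (rule Cons.IH) (use Cons.prems in auto)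
  then show ?case using Cons.prems[of h i j] w by simp
qed simp

lemma witnesses_cong:
  assumes "witnesses \<sigma> d dd X ws" "X \<subseteq> M" "fst ` set ws \<subseteq> M"
    and "\<And>a. a \<in> M \<Longrightarrow> \<sigma>' a = \<sigma> a" "\<And>a b. a \<in> M \<Longrightarrow> b \<in> M \<Longrightarrow> dd' a b = dd a b"
  shows "witnesses \<sigma>' d dd' X ws"
  using assms(1-3)
proof (induction ws arbitrary: X)
  case (Cons w ws)
  obtain h i j where w: "w = (h, i, j)" by (cases w)
  have M: "h \<in> M" "i \<in> M" "j \<in> M" using Cons.prems w by auto
  have "witnesses \<sigma>' d dd' (insert h X) ws" by (rule Cons.IH) (use Cons.prems w in auto)
  then show ?case using Cons.prems(1) M unfolding w by (simp add: stored_def assms(4,5))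
qed simp

lemma image_edges_cong:
  assumes "\<And>a b. (a, b) \<in> set T \<Longrightarrow> \<sigma> a = \<tau> a \<and> \<sigma> b = \<tau> b"
  shows "image_edges \<sigma> T = image_edges \<tau> T"
  unfolding image_edges_def by (rule image_cong[OF refl]) (use assms in auto)

text \<open>Specification of the output of recursive grouping on the names \<open>A\<close> of the active nodes.\<close>

definition regrouped ::
    "nat set \<Rightarrow> edge_set \<Rightarrow> dist \<Rightarrow> nat list \<Rightarrow> (nat \<Rightarrow> nat) \<Rightarrow> dist \<Rightarrow> nat \<Rightarrow>
      edge_list \<times> dist \<times> nat \<times> (nat \<times> nat \<times> nat) list \<Rightarrow> bool" where
  "regrouped W E d A \<sigma>0 dd0 n0 = (\<lambda>(T, dd, n, new). \<exists>\<tau>. n0 \<le> n \<and> inj_on \<tau> (set A \<union> {n0..<n}) \<and> (\<forall>x<n0. \<tau> x = \<sigma>0 x) \<and>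
     (\<forall>(a, b)\<in>set T. a \<in> set A \<union> {n0..<n} \<and> b \<in> set A \<union> {n0..<n}) \<and> (\<forall>a<n0. \<forall>b<n0. dd a b = dd0 a b) \<and>
     distinct (map fst new) \<and> fst ` set new = {n0..<n} \<and> witnesses \<tau> d dd (set A) new \<and>
     \<tau> ` (set A \<union> {n0..<n}) = W \<and> image_edges \<tau> T = E \<and> length T = card E)"

section \<open>The invariant of the rounds\<close>

context latent
begin

lemma card_active': "card active' \<le> card V"
proof -
  have rV: "removed \<subseteq> V" using removed_leaf(2) by blast
  then have fr: "finite removed" using finite_V by (rule finite_subset)
  have "card active' \<le> card (V - removed) + card (par ` removed)" by (rule card_Un_le)
  also have "card (par ` removed) \<le> card removed" by (rule card_image_le[OF fr])
  also have "card (V - removed) = card V - card removed" by (rule card_Diff_subset[OF fr rV])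
  finally show ?thesis using card_mono[OF finite_V rV] by simp
qed

context
  fixes A :: "nat list" and \<sigma>0 :: "nat \<Rightarrow> nat" and dd0 :: dist and n0 :: nat
  assumes A: "distinct A" "set A \<subseteq> {..<n0}" "3 \<le> length A" and \<sigma>0: "inj_on \<sigma>0 (set A)" "\<sigma>0 ` set A = V"
    and dd0: "\<forall>a\<in>set A. \<forall>b\<in>set A. a \<noteq> b \<longrightarrow> dd0 a b = d (\<sigma>0 a) (\<sigma>0 b)"
begin

lemma length_A: "length A = card V"
  using card_image[OF \<sigma>0(1)] \<sigma>0(2) distinct_card[OF A(1)] by simp

definition names :: "nat \<Rightarrow> nat set" where
  "names n = set A \<union> {n0..<n}"

text \<open>Bounds the rounds still to come. The root is quantified, because it moves to its parent
  when it is removed.\<close>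

definition hops :: "nat \<Rightarrow> nat set \<Rightarrow> edge_set \<Rightarrow> bool" where
  "hops L Wc Ec \<longleftrightarrow> (\<exists>h r. tree_metric Wc Ec h \<and> (\<forall>x y. {x, y} \<in> Ec \<longrightarrow> h x y = 1) \<and> r \<in> Wc \<and> (\<forall>x\<in>Wc. h r x \<le> real L))"

definition common :: "nat \<Rightarrow> (nat \<Rightarrow> nat) \<Rightarrow> edge_list \<Rightarrow> dist \<Rightarrow> (nat \<times> nat \<times> nat) list \<Rightarrow> bool" where
  "common n \<tau> T dd new \<longleftrightarrow> n0 \<le> n \<and> inj_on \<tau> (names n) \<and> (\<forall>x<n0. \<tau> x = \<sigma>0 x) \<and>
     (\<forall>(a, b)\<in>set T. a \<in> names n \<and> b \<in> names n) \<and> (\<forall>a<n0. \<forall>b<n0. dd a b = dd0 a b) \<and>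
     distinct (map fst new) \<and> fst ` set new = {n0..<n} \<and> witnesses \<tau> d dd (set A) new"

text \<open>\<open>Wc\<close> and \<open>Ec\<close> form the part of the tree not yet resolved. It
  overlaps the named nodes only in active ones, and the count of edges rules out that an edge is
  emitted while still open, or emitted twice.\<close>

definition current :: "nat \<Rightarrow> nat set \<Rightarrow> edge_set \<Rightarrow> (nat \<Rightarrow> nat) \<Rightarrow> nat list \<Rightarrow> edge_list \<Rightarrow> dist \<Rightarrow> bool" where
  "current n Wc Ec \<tau> Y T dd \<longleftrightarrow> latent Wc Ec d (\<tau> ` set Y) \<and> distinct Y \<and> set Y \<subseteq> names n \<and> length Y \<le> length A \<and>
     \<tau> ` names n \<union> Wc = W \<and> \<tau> ` names n \<inter> Wc \<subseteq> \<tau> ` set Y \<and>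
     Ec \<subseteq> E \<and> image_edges \<tau> T \<union> Ec = E \<and> length T + card Ec = card E \<and>
     (\<forall>a\<in>set Y. \<forall>b\<in>set Y. a \<noteq> b \<longrightarrow> dd a b = d (\<tau> a) (\<tau> b))"

definition rg_inv :: "rg_state \<Rightarrow> nat \<Rightarrow> bool" where
  "rg_inv = (\<lambda>(Y, T, dd, n, new) L. \<exists>\<tau> Wc Ec. common n \<tau> T dd new \<and> current n Wc Ec \<tau> Y T dd \<and> hops L Wc Ec)"

lemma regroupedI:
  assumes "common n \<tau> T dd new" "\<tau> ` names n = W" "image_edges \<tau> T = E" "length T = card E"
  shows "regrouped W E d A \<sigma>0 dd0 n0 (T, dd, n, new)"
  unfolding regrouped_def prod.case
  using assms(1)[unfolded common_def names_def] assms(2)[unfolded names_def] assms(3,4)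
  by (intro exI[of _ \<tau>]) (elim conjE, intro conjI; assumption)

lemma names_less: "x \<in> names n \<Longrightarrow> n0 \<le> n \<Longrightarrow> x < n"
  unfolding names_def using A(2) by auto

text \<open>New names denote pairwise different hidden nodes, and by \<open>card_hidden\<close>
  there are at most as many of these as active ones at the start.\<close>

lemma length_new:
  assumes c: "common n \<tau> T dd new" and W: "\<tau> ` names n \<subseteq> W"
  shows "length new \<le> length A"
proof -
  note C = c[unfolded common_def]
  have inj: "inj_on \<tau> (names n)" using C by blast
  have s0: "\<tau> ` set A = V"
    unfolding \<sigma>0(2)[symmetric] by (rule image_cong[OF refl]) (use C A(2) in auto)
  have "length new = card {n0..<n}" using distinct_card[of "map fst new"] C by simp
  also have "\<dots> = card (\<tau> ` {n0..<n})"
    by (rule card_image[symmetric], rule inj_on_subset[OF inj]) (simp add: names_def)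
  also have "\<dots> \<le> card (W - V)"
  proof (rule card_mono)
    show "finite (W - V)" using finite_W by simp
    have "{n0..<n} \<inter> set A = {}" using A(2) by auto
    then have "\<tau> ` {n0..<n} \<inter> \<tau> ` set A = {}"
      using inj_on_image_Int[OF inj, of "{n0..<n}" "set A"] unfolding names_def by auto
    moreover have "\<tau> ` {n0..<n} \<subseteq> W" using W unfolding names_def by blast
    ultimately show "\<tau> ` {n0..<n} \<subseteq> W - V" unfolding s0 by blast
  qed
  finally show ?thesis using card_hidden length_A by simp
qed

lemma rg_inv_step:
  assumes inv: "rg_inv (Y, T, dd, n, new) L" and Y3: "3 \<le> length Y"
  shows "\<exists>L'. L = Suc L' \<and> tms (rg_step (Y, T, dd, n, new)) (60 * length A ^ 3 + length A) (\<lambda>s'. rg_inv s' L')"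
proof -
  obtain \<sigma> Wc Ec where com: "common n \<sigma> T dd new" and cur: "current n Wc Ec \<sigma> Y T dd" and hop: "hops L Wc Ec"
    using inv unfolding rg_inv_def prod.case by (elim exE conjE)
  have c1: "n0 \<le> n" and c2: "inj_on \<sigma> (names n)" and c3: "\<forall>x<n0. \<sigma> x = \<sigma>0 x"
    and c4: "\<forall>(a, b)\<in>set T. a \<in> names n \<and> b \<in> names n" and c5: "\<forall>a<n0. \<forall>b<n0. dd a b = dd0 a b"
    and c6: "distinct (map fst new)" and c7: "fst ` set new = {n0..<n}" and c8: "witnesses \<sigma> d dd (set A) new"
    using com unfolding common_def by - (elim conjE, assumption)+
  have u1: "latent Wc Ec d (\<sigma> ` set Y)" and u2: "distinct Y" and u3: "set Y \<subseteq> names n" and u4: "length Y \<le> length A"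
    and u5: "\<sigma> ` names n \<union> Wc = W" and u6: "\<sigma> ` names n \<inter> Wc \<subseteq> \<sigma> ` set Y" and u7: "Ec \<subseteq> E"
    and u8: "image_edges \<sigma> T \<union> Ec = E" and u9: "length T + card Ec = card E"
    and u10: "\<forall>a\<in>set Y. \<forall>b\<in>set Y. a \<noteq> b \<longrightarrow> dd a b = d (\<sigma> a) (\<sigma> b)"
    using cur unfolding current_def by - (elim conjE, assumption)+
  interpret C: latent Wc Ec d "\<sigma> ` set Y" by (rule u1)
  have inj: "inj_on \<sigma> (set Y)" by (rule inj_on_subset[OF c2 u3])
  have cY: "card (\<sigma> ` set Y) = length Y" using card_image[OF inj] distinct_card[OF u2] by simp
  have V3: "3 \<le> card (\<sigma> ` set Y)" using cY Y3 by simp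
  have Yn: "set Y \<subseteq> {..<n}" using u3 names_less c1 by blast
  have round: "tms (rg_step (Y, T, dd, n, new)) (60 * length Y ^ 3 + length new) (C.round_ok Y \<sigma> dd n T new)"
    by (rule C.tms_rg_step[OF V3 u2 Yn inj refl u10])
  have cost: "60 * length Y ^ 3 + length new \<le> 60 * length A ^ 3 + length A"
    using length_new[OF com] u5 u4 by (intro add_mono mult_left_mono power_mono) auto
  obtain h r where h: "tree_metric Wc Ec h" "\<forall>x y. {x, y} \<in> Ec \<longrightarrow> h x y = 1" "r \<in> Wc" "\<forall>x\<in>Wc. h r x \<le> real L"
    using hop unfolding hops_def by (elim exE conjE)
  have "\<exists>L'. L = Suc L' \<and> (\<exists>r'\<in>Wc - C.removed. \<forall>x\<in>Wc - C.removed. h r' x \<le> real L')"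
    by (rule C.round_hops[OF V3 h(1) _ h(3)]) (use h(2,4) in simp_all)
  then obtain L' r' where L': "L = Suc L'" "r' \<in> Wc - C.removed" "\<forall>x\<in>Wc - C.removed. h r' x \<le> real L'" by (elim exE conjE bexE)
  let ?Wn = "Wc - C.removed" and ?En = "{e \<in> Ec. e \<subseteq> Wc - C.removed}"
  let ?act = "(\<sigma> ` set Y - C.removed) \<union> C.par ` C.removed"
  have hop': "hops L' ?Wn ?En"
    unfolding hops_def using C.round_metric[OF V3 h(1)] h(2) L'(2,3) by (intro exI[of _ h] exI[of _ r']) simp
  have "rg_inv (Y', T', dd', n', new') L'" if ok: "C.round_ok Y \<sigma> dd n T new (Y', T', dd', n', new')" for Y' T' dd' n' new'
  proof -
    obtain \<tau> ws where r1: "new' = new @ ws" and r2: "n \<le> n'" and r3: "\<forall>x<n. \<tau> x = \<sigma> x"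
      and r4: "distinct Y'" and r5: "set Y' \<subseteq> set Y \<union> {n..<n'}" and r6: "{n..<n'} \<subseteq> set Y'" and r7: "inj_on \<tau> (set Y')"
      and r8: "\<tau> ` set Y' = ?act" and r9: "\<tau> ` {n..<n'} \<inter> \<sigma> ` set Y = {}"
      and r10: "\<forall>a\<in>set Y'. \<forall>b\<in>set Y'. a \<noteq> b \<longrightarrow> dd' a b = d (\<tau> a) (\<tau> b)" and r11: "\<forall>a<n. \<forall>b<n. dd' a b = dd a b"
      and r12: "image_edges \<tau> T' = image_edges \<tau> T \<union> (\<lambda>i. {i, C.par i}) ` C.removed" and r13: "length T' = length T + card C.removed"
      and r14: "\<forall>(a, b)\<in>set T'. (a, b) \<in> set T \<or> {a, b} \<subseteq> set Y \<union> {n..<n'}"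
      and r15: "distinct (map fst ws)" and r16: "fst ` set ws = {n..<n'}"
      and r17: "\<forall>(h, i, j)\<in>set ws. i \<in> set Y \<and> j \<in> set Y \<and> d (\<tau> i) (\<tau> j) = d (\<tau> i) (\<tau> h) + d (\<tau> h) (\<tau> j) \<and>
        stored \<tau> d dd' i h \<and> stored \<tau> d dd' j h"
      using ok unfolding C.round_ok_def[OF V3 u2 Yn inj refl u10] prod.case
      by (elim exE conjE) (rule that; assumption)
    have nm: "names n' = names n \<union> {n..<n'}" unfolding names_def using c1 r2 by auto
    have old: "\<tau> x = \<sigma> x" if "x \<in> names n" for x using r3 names_less[OF that c1] by simp
    have imo: "\<tau> ` names n = \<sigma> ` names n" by (rule image_cong[OF refl old])
    have actW: "?act \<subseteq> ?Wn"
      using latent.V_sub[OF C.round_latent[OF V3]] .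
    have newW: "\<tau> ` {n..<n'} \<subseteq> ?act" unfolding r8[symmetric] by (rule image_mono[OF r6])
    \<comment> \<open>A name assigned in this round denotes a node of the unresolved part that was
      not active before, whereas every named node in that part was active. Hence there is no
      clash.\<close>
    have injn: "inj_on \<tau> (names n')"
      unfolding nm inj_on_Un
    proof (intro conjI)
      show "inj_on \<tau> (names n)" using c2 inj_on_cong[of "names n" \<tau> \<sigma>, OF old] by blast
      show "inj_on \<tau> {n..<n'}" by (rule inj_on_subset[OF r7 r6])
      have "\<tau> ` names n \<inter> \<tau> ` {n..<n'} \<subseteq> \<sigma> ` set Y" unfolding imo using u6 newW actW by blast
      then have "\<tau> ` names n \<inter> \<tau> ` {n..<n'} = {}" using r9 by blast
      then show "\<tau> ` (names n - {n..<n'}) \<inter> \<tau> ` ({n..<n'} - names n) = {}" by blast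
    qed
    have T_old: "\<sigma> a = \<tau> a \<and> \<sigma> b = \<tau> b" if "(a, b) \<in> set T" for a b using that c4 old by auto
    have imT: "image_edges \<tau> T = image_edges \<sigma> T" by (rule image_edges_cong[symmetric]) (rule T_old)
    have com': "common n' \<tau> T' dd' new'"
      unfolding common_def
    proof (intro conjI)
      show "n0 \<le> n'" using c1 r2 by simp
      show "inj_on \<tau> (names n')" by (rule injn)
      show "\<forall>x<n0. \<tau> x = \<sigma>0 x" using r3 c3 c1 by simp
      show "\<forall>(a, b)\<in>set T'. a \<in> names n' \<and> b \<in> names n'"
      proof (rule ballI)
        fix e assume e: "e \<in> set T'"
        obtain a b where ab: "e = (a, b)" by (cases e)
        have "(a, b) \<in> set T \<or> {a, b} \<subseteq> set Y \<union> {n..<n'}" using r14 e ab by auto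
        then have "a \<in> names n \<union> {n..<n'} \<and> b \<in> names n \<union> {n..<n'}" using c4 u3 by auto
        then show "case e of (a, b) \<Rightarrow> a \<in> names n' \<and> b \<in> names n'" unfolding nm ab by simp
      qed
      show "\<forall>a<n0. \<forall>b<n0. dd' a b = dd0 a b" using r11 c5 c1 by simp
      show "distinct (map fst new')" unfolding r1 using c6 r15 c7 r16 by auto
      show "fst ` set new' = {n0..<n'}" unfolding r1 set_append image_Un c7 r16 using c1 r2 by auto
      show "witnesses \<tau> d dd' (set A) new'"
        unfolding r1 witnesses_append c7
      proof
        show "witnesses \<tau> d dd' (set A) new"
        proof (rule witnesses_cong[OF c8, of "names n"])
          show "set A \<subseteq> names n" "fst ` set new \<subseteq> names n" unfolding names_def c7 by simp_all
          show "dd' a b = dd a b" if "a \<in> names n" "b \<in> names n" for a b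
            using r11 names_less[OF that(1) c1] names_less[OF that(2) c1] by simp
        qed (rule old)
        show "witnesses \<tau> d dd' (set A \<union> {n0..<n}) ws"
          by (rule witnessesI) (use r17 u3 in \<open>auto simp: names_def\<close>)
      qed
    qed
    have cur': "current n' ?Wn ?En \<tau> Y' T' dd'"
      unfolding current_def
    proof (intro conjI)
      show "latent ?Wn ?En d (\<tau> ` set Y')" unfolding r8 by (rule C.round_latent[OF V3])
      show "distinct Y'" by (rule r4)
      show "set Y' \<subseteq> names n'" unfolding nm using r5 u3 by blast
      have "length Y' = card ?act" using card_image[OF r7] distinct_card[OF r4] r8 by simp
      then show "length Y' \<le> length A" using C.card_active' cY u4 by simp
      have rem: "C.removed \<subseteq> \<sigma> ` names n" using C.removed_leaf(2) u3 by blast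
      show "\<tau> ` names n' \<union> ?Wn = W" unfolding nm image_Un imo using u5 rem newW actW by blast
      have "\<sigma> ` names n \<inter> ?Wn \<subseteq> ?act" using u6 by blast
      then show "\<tau> ` names n' \<inter> ?Wn \<subseteq> \<tau> ` set Y'" unfolding nm image_Un imo r8 using newW by blast
      show "?En \<subseteq> E" using u7 by blast
      show "image_edges \<tau> T' \<union> ?En = E" unfolding r12 imT using u8 C.round_edges(1)[OF V3] by blast
      show "length T' + card ?En = card E" unfolding r13 using u9 C.round_edges(2)[OF V3] by linarith
      show "\<forall>a\<in>set Y'. \<forall>b\<in>set Y'. a \<noteq> b \<longrightarrow> dd' a b = d (\<tau> a) (\<tau> b)" by (rule r10)
    qed
    show ?thesis unfolding rg_inv_def prod.case using com' cur' hop' by (intro exI conjI)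
  qed
  then have "tms (rg_step (Y, T, dd, n, new)) (60 * length A ^ 3 + length A) (\<lambda>s'. rg_inv s' L')"
    by (intro tms_weaken[OF round cost]) (metis prod_cases5)
  then show ?thesis using L'(1) by blast
qed

lemma rg_inv_end:
  assumes inv: "rg_inv (Y, T, dd, n, new) L" and Y3: "length Y < 3"
  shows "regrouped W E d A \<sigma>0 dd0 n0 (case Y of [a, b] \<Rightarrow> (a, b) # T | _ \<Rightarrow> T, dd, n, new)"
proof -
  obtain \<sigma> Wc Ec where com: "common n \<sigma> T dd new" and cur: "current n Wc Ec \<sigma> Y T dd"
    using inv unfolding rg_inv_def prod.case by (elim exE conjE)
  have u1: "latent Wc Ec d (\<sigma> ` set Y)" and u2: "distinct Y" and u3: "set Y \<subseteq> names n"
    and u5: "\<sigma> ` names n \<union> Wc = W" and u8: "image_edges \<sigma> T \<union> Ec = E" and u9: "length T + card Ec = card E"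
    using cur unfolding current_def by - (elim conjE, assumption)+
  have c2: "inj_on \<sigma> (names n)" using com unfolding common_def by (elim conjE)
  interpret C: latent Wc Ec d "\<sigma> ` set Y" by (rule u1)
  have inj: "inj_on \<sigma> (set Y)" by (rule inj_on_subset[OF c2 u3])
  have cY: "card (\<sigma> ` set Y) = length Y" using card_image[OF inj] distinct_card[OF u2] by simp
  have few: "card (\<sigma> ` set Y) \<le> 2" using cY Y3 by simp
  have "Wc = \<sigma> ` set Y" by (rule C.few_active(1)[OF few])
  then have W: "\<sigma> ` names n = W" using u5 u3 by blast
  have "Y \<noteq> []" using C.V_ne by auto
  then consider a where "Y = [a]" | a b where "Y = [a, b]"
    using Y3 by (cases Y; cases "tl Y") auto
  then show ?thesis
  proof cases
    case 1
    then have "Ec = {}" using C.few_active(2)[OF few] cY by simp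
    then show ?thesis using regroupedI[OF com W] u8 u9 1 by simp
  next
    case 2
    have ab: "\<sigma> ` set Y = {\<sigma> a, \<sigma> b}" "\<sigma> a \<noteq> \<sigma> b" using 2 u2 inj by auto
    have Ec: "Ec = {{\<sigma> a, \<sigma> b}}" by (rule C.few_active(3)[OF few ab])
    have "image_edges \<sigma> ((a, b) # T) = E" using u8 unfolding Ec image_edges_def by simp
    moreover have "length ((a, b) # T) = card E" using u9 unfolding Ec by simp
    moreover have "common n \<sigma> ((a, b) # T) dd new" using com u3 2 unfolding common_def by simp
    ultimately show ?thesis using regroupedI[OF _ W] 2 by simp
  qed
qed

lemma tms_rg:
  assumes h: "tree_metric W E h" "\<And>x y. {x, y} \<in> E \<Longrightarrow> h x y = 1" "r \<in> W" "\<And>x. x \<in> W \<Longrightarrow> h r x \<le> real L"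
  shows "tms (rg A dd0 n0) (63 * (L + 1) * length A ^ 3) (regrouped W E d A \<sigma>0 dd0 n0)"
proof -
  let ?k = "60 * length A ^ 3 + length A"
  have "common n0 \<sigma>0 [] dd0 []" unfolding common_def names_def using \<sigma>0 by simp
  moreover have "current n0 W E \<sigma>0 A [] dd0"
    unfolding current_def names_def \<sigma>0(2) image_edges_def using A \<sigma>0(2) dd0 latent_axioms Un_absorb1[OF V_sub] by simp
  moreover have "hops L W E" unfolding hops_def using h by blast
  ultimately have start: "rg_inv (A, [], dd0, n0, []) L" unfolding rg_inv_def prod.case by (intro exI conjI)
  obtain L1 where L1: "L = Suc L1" "tms (rg_step (A, [], dd0, n0, [])) ?k (\<lambda>s'. rg_inv s' L1)"
    using rg_inv_step[OF start A(3)] by (elim exE conjE)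
  have loop: "tms (while_tm (\<lambda>(Y, _). length Y \<ge> 3) rg_step s) (L1 * ?k + 1)
      (\<lambda>s'. \<not> (case s' of (Y, _) \<Rightarrow> length Y \<ge> 3) \<and> (\<exists>n'. rg_inv s' n'))" if "rg_inv s L1" for s
  proof (rule tms_while[where Inv = rg_inv, OF _ that])
    fix s m assume s: "rg_inv s m" "case s of (Y, _) \<Rightarrow> length Y \<ge> 3"
    obtain Y T dd n new where e: "s = (Y, T, dd, n, new)" by (cases s)
    show "\<exists>n'. m = Suc n' \<and> tms (rg_step s) ?k (\<lambda>s'. rg_inv s' n')"
      unfolding e by (rule rg_inv_step) (use s e in simp_all)
  qed
  have A3: "length A \<le> length A ^ 3" "1 \<le> length A ^ 3" using A(3) by (auto intro: self_le_power)
  \<comment> \<open>The charge is for \<open>L\<close> rounds, each at most 61 times the cube, and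
    two further units; 63 leaves room for all.\<close>
  have total: "?k + ((L1 * ?k + 1) + 1) \<le> 63 * (L + 1) * length A ^ 3"
  proof -
    have "?k \<le> 61 * length A ^ 3" using A3 by simp
    then have "L * ?k \<le> L * (61 * length A ^ 3)" by (rule mult_le_mono2)
    then show ?thesis using A3 unfolding L1(1) by (simp add: algebra_simps)
  qed
  show ?thesis
    unfolding rg_def
  proof (rule tms_bind[OF L1(2) _ total])
    fix s assume "rg_inv s L1"
    show "tms (bind_tm (while_tm (\<lambda>(Y, _). length Y \<ge> 3) rg_step s)
        (\<lambda>(Y, T, d', n', new). ret (case Y of [a, b] \<Rightarrow> (a, b) # T | _ \<Rightarrow> T, d', n', new))) ((L1 * ?k + 1) + 1) (regrouped W E d A \<sigma>0 dd0 n0)"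
    proof (rule tms_bind[OF loop[OF \<open>rg_inv s L1\<close>], where k' = 1])
      fix s' assume s': "\<not> (case s' of (Y, _) \<Rightarrow> length Y \<ge> 3) \<and> (\<exists>n'. rg_inv s' n')"
      obtain Y T dd n new where e: "s' = (Y, T, dd, n, new)" by (cases s')
      obtain m where m: "rg_inv (Y, T, dd, n, new) m" and "length Y < 3" using s' unfolding e by auto
      from rg_inv_end[OF this]
      show "tms (case s' of (Y, T, d', n', new) \<Rightarrow> ret (case Y of [a, b] \<Rightarrow> (a, b) # T | _ \<Rightarrow> T, d', n', new)) 1 (regrouped W E d A \<sigma>0 dd0 n0)"
        unfolding e prod.case by (rule tms_ret) simp
    qed simp
  qed
qed

end

end

section \<open>CLRG\<close>

text \<open>Includes the diagonal: \<open>extend_dist\<close> runs over all of \<open>N\<close> and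
  reads \<open>d i x\<close> also for \<open>x = i\<close>.\<close>

definition exact :: "(nat \<Rightarrow> nat) \<Rightarrow> dist \<Rightarrow> dist \<Rightarrow> nat set \<Rightarrow> bool" where
  "exact \<sigma> d dd X \<longleftrightarrow> (\<forall>a\<in>X. \<forall>b\<in>X. dd a b = d (\<sigma> a) (\<sigma> b))"

lemma witnesses_mono:
  assumes "witnesses \<sigma> d dd X ws" "X \<subseteq> X'" "\<And>p q. stored \<sigma> d dd p q \<Longrightarrow> stored \<sigma> d dd' p q"
  shows "witnesses \<sigma> d dd' X' ws"
  using assms(1,2)
proof (induction ws arbitrary: X X')
  case (Cons w ws)
  obtain h i j where w: "w = (h, i, j)" by (cases w)
  have "witnesses \<sigma> d dd' (insert h X') ws" by (rule Cons.IH[of "insert h X"]) (use Cons.prems w in auto)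
  then show ?case using Cons.prems assms(3) unfolding w by auto
qed simp

lemma image_edges_iff: "e \<in> image_edges \<sigma> T \<longleftrightarrow> (\<exists>a b. (a, b) \<in> set T \<and> e = {\<sigma> a, \<sigma> b})"
  unfolding image_edges_def by auto

section \<open>Distances from new hidden nodes to all nodes found so far\<close>

context tree_metric
begin

text \<open>\<open>between_fork\<close> puts \<open>h\<close> on the path to \<open>x\<close> from
  one of the two children, where the difference is exact; the triangle inequality bounds the
  other.\<close>

lemma extend_value:
  assumes "h \<in> W" "i \<in> W" "j \<in> W" "x \<in> W" "d i j = d i h + d h j"
  shows "max (d i x - d i h) (d j x - d j h) = d h x"
proof -
  have "d i x = d i h + d h x \<or> d j x = d j h + d h x" using between_fork[of i h j x] assms by simp
  moreover have "d i x \<le> d i h + d h x" "d j x \<le> d j h + d h x" using triangle assms by simp_all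
  ultimately show ?thesis by (auto simp: max_def)
qed

lemma tms_extend_dist:
  assumes ex: "exact \<sigma> d dd (set N)" and W: "\<sigma> ` set N \<subseteq> W" "\<sigma> h \<in> W" and ij: "i \<in> set N" "j \<in> set N" "h \<notin> set N"
    and bt: "d (\<sigma> i) (\<sigma> j) = d (\<sigma> i) (\<sigma> h) + d (\<sigma> h) (\<sigma> j)" and st: "stored \<sigma> d dd i h" "stored \<sigma> d dd j h"
  shows "tms (extend_dist (h, i, j) (N, dd)) (length N + 2)
    (\<lambda>s. \<exists>dd'. s = (h # N, dd') \<and> exact \<sigma> d dd' (set (h # N)) \<and> (\<forall>p q. stored \<sigma> d dd p q \<longrightarrow> stored \<sigma> d dd' p q))"
proof -
  define I where "I us dd' \<longleftrightarrow> (\<forall>p q. stored \<sigma> d dd p q \<longrightarrow> stored \<sigma> d dd' p q) \<and> stored \<sigma> d dd' h h \<and>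
    (\<forall>x\<in>set us. stored \<sigma> d dd' h x)" for us :: "nat list" and dd' :: dist
  have NW: "\<sigma> x \<in> W" if "x \<in> set N" for x using W(1) that by blast
  have base: "stored \<sigma> d dd a b" if "a \<in> set N" "b \<in> set N" for a b
    using ex that d_sym[OF NW[OF that(1)] NW[OF that(2)]] unfolding exact_def stored_def by simp
  have f: "tms (fold_tm (\<lambda>x d. ret (set_dist d h x (max (d i x - d i h) (d j x - d j h)))) N (set_dist dd h h 0)) (1 * length N + 1) (I N)"
  proof (rule tms_fold_const[where I = I])
    fix us x vs dd' assume N: "N = us @ x # vs" and J: "I us dd'"
    have x: "x \<in> set N" using N by simp
    have "stored \<sigma> d dd' i x" "stored \<sigma> d dd' j x" "stored \<sigma> d dd' i h" "stored \<sigma> d dd' j h"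
      using J base[OF ij(1) x] base[OF ij(2) x] st unfolding I_def by simp_all
    then have v: "max (dd' i x - dd' i h) (dd' j x - dd' j h) = d (\<sigma> h) (\<sigma> x)"
      using extend_value[OF W(2) NW[OF ij(1)] NW[OF ij(2)] NW[OF x] bt] unfolding stored_def by simp
    have "I (us @ [x]) (set_dist dd' h x (d (\<sigma> h) (\<sigma> x)))"
      using J stored_set[where \<sigma> = \<sigma> and d = d and a = h and b = x, OF refl d_sym[OF W(2) NW[OF x]]] unfolding I_def by auto
    then show "tms (ret (set_dist dd' h x (max (dd' i x - dd' i h) (dd' j x - dd' j h)))) 1 (I (us @ [x]))"
      unfolding v by (intro tms_ret) simp_all
  next
    have "0 = d (\<sigma> h) (\<sigma> h)" using d_refl[OF W(2)] by simp
    from stored_set[where \<sigma> = \<sigma> and d = d and a = h and b = h, OF this refl]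
    show "I [] (set_dist dd h h 0)" unfolding I_def by simp
  qed
  have fin: "exact \<sigma> d dd' (set (h # N))" if J: "I N dd'" for dd'
    unfolding exact_def
  proof (intro ballI)
    fix a b assume ab: "a \<in> set (h # N)" "b \<in> set (h # N)"
    consider "a = h" "b = h" | "a = h" "b \<in> set N" | "b = h" "a \<in> set N" | "a \<in> set N" "b \<in> set N" using ab by auto
    then show "dd' a b = d (\<sigma> a) (\<sigma> b)"
    proof cases
      case 3
      then have "stored \<sigma> d dd' h a" using J unfolding I_def by simp
      then show ?thesis using 3 d_sym[OF W(2) NW[OF 3(2)]] unfolding stored_def by simp
    next
      case 4
      then have "stored \<sigma> d dd' a b" using J base[OF 4] unfolding I_def by simp
      then show ?thesis unfolding stored_def by simp
    qed (use J in \<open>simp_all add: I_def stored_def\<close>)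
  qed
  show ?thesis
    unfolding extend_dist_def prod.case
    by (rule tms_bind[OF f, where k' = 1]) (use fin in \<open>auto simp: I_def intro!: tms_ret\<close>)
qed

lemma tms_extend_all:
  assumes "exact \<sigma> d dd (set N)" "\<sigma> ` set N \<subseteq> W" "\<sigma> ` fst ` set new \<subseteq> W" "witnesses \<sigma> d dd (set N) new"
    "distinct (map fst new)" "fst ` set new \<inter> set N = {}"
  shows "tms (fold_tm extend_dist new (N, dd)) (length new * (length N + length new + 2) + 1)
    (\<lambda>(N', dd'). N' = rev (map fst new) @ N \<and> exact \<sigma> d dd' (set N'))"
  using assms
proof (induction new arbitrary: N dd)
  case Nil
  then show ?case by (simp add: tms_ret)
next
  case (Cons w ws)
  obtain h i j where w: "w = (h, i, j)" by (cases w)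
  have s: "tms (extend_dist w (N, dd)) (length N + 2)
    (\<lambda>s. \<exists>dd'. s = (h # N, dd') \<and> exact \<sigma> d dd' (set (h # N)) \<and> (\<forall>p q. stored \<sigma> d dd p q \<longrightarrow> stored \<sigma> d dd' p q))"
    unfolding w by (rule tms_extend_dist) (use Cons.prems w in auto)
  show ?case
    unfolding fold_tm.simps
  proof (rule tms_bind[OF s, where k' = "length ws * (length (h # N) + length ws + 2) + 1"])
    fix s assume "\<exists>dd'. s = (h # N, dd') \<and> exact \<sigma> d dd' (set (h # N)) \<and> (\<forall>p q. stored \<sigma> d dd p q \<longrightarrow> stored \<sigma> d dd' p q)"
    then obtain dd' where s: "s = (h # N, dd')" "exact \<sigma> d dd' (set (h # N))" "\<And>p q. stored \<sigma> d dd p q \<Longrightarrow> stored \<sigma> d dd' p q"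
      by auto
    have ws: "witnesses \<sigma> d dd (insert h (set N)) ws" using Cons.prems(4) w by simp
    have "tms (fold_tm extend_dist ws (h # N, dd')) (length ws * (length (h # N) + length ws + 2) + 1)
        (\<lambda>(N', dd'). N' = rev (map fst ws) @ h # N \<and> exact \<sigma> d dd' (set N'))"
    proof (rule Cons.IH[OF s(2)])
      show "witnesses \<sigma> d dd' (set (h # N)) ws" by (rule witnesses_mono[OF ws _ s(3)]) simp
    qed (use Cons.prems w in auto)
    then show "tms (fold_tm extend_dist ws s) (length ws * (length (h # N) + length ws + 2) + 1)
        (\<lambda>(N', dd'). N' = rev (map fst (w # ws)) @ N \<and> exact \<sigma> d dd' (set N'))"
      unfolding s(1) w by simp
  qed simp
qed

end

section \<open>The invariant of CLRG and a single step\<close>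

context latent
begin

lemma card_E: "card E \<le> 2 * card V" and card_W: "card W \<le> 2 * card V"
proof -
  have "card W = card V + card (W - V)" using card_Diff_subset[OF finite_V V_sub] card_mono[OF finite_W V_sub] by simp
  then show W: "card W \<le> 2 * card V" using card_hidden by simp
  show "card E \<le> 2 * card V" using ltree_card[OF tree_ltree[OF is_tree]] W by simp
qed

text \<open>\<open>P\<close> is the set of nodes whose fibre is still contracted. Fixing the length
  of \<open>T\<close> excludes repeated edges, so a scan of \<open>T\<close> lists each neighbour of
  a node once.\<close>

definition clrg_ok :: "nat set \<Rightarrow> (nat \<Rightarrow> nat) \<Rightarrow> nat list \<Rightarrow> edge_list \<Rightarrow> dist \<Rightarrow> nat \<Rightarrow> bool" where
  "clrg_ok P \<sigma> N T dd n \<longleftrightarrow> distinct N \<and> set N \<subseteq> {..<n} \<and> V \<subseteq> set N \<and> inj_on \<sigma> (set N) \<and> (\<forall>v\<in>V. \<sigma> v = v) \<and>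
     \<sigma> ` set N = V \<union> (\<Union>v\<in>V - P. fibre v) \<and> image_edges \<sigma> T = contr P \<and> length T = card (contr P) \<and>
     (\<forall>(a, b)\<in>set T. a \<in> set N \<and> b \<in> set N) \<and> exact \<sigma> d dd (set N)"

definition clrg_inv :: "nat set \<Rightarrow> nat list \<times> edge_list \<times> dist \<times> nat \<Rightarrow> bool" where
  "clrg_inv P = (\<lambda>(N, T, dd, n). \<exists>\<sigma>. clrg_ok P \<sigma> N T dd n)"

lemma fibre_W: "fibre v \<subseteq> W"
  unfolding fibre_def by blast

lemma fibre_disjoint: "v \<noteq> w \<Longrightarrow> fibre v \<inter> fibre w = {}"
  unfolding fibre_def by blast

lemma fibre_V: "x \<in> fibre v \<Longrightarrow> x \<in> V \<Longrightarrow> x = v"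
  unfolding fibre_def using Sg_self by auto

definition incident :: "nat \<Rightarrow> edge_list \<Rightarrow> edge_list" where
  "incident v T = filter (\<lambda>(a, b). a = v \<or> b = v) T"

definition other_ends :: "nat \<Rightarrow> edge_list \<Rightarrow> nat list" where
  "other_ends v T = map (\<lambda>(a, b). if a = v then b else a) (incident v T)"

lemma clrg_edges:
  assumes ok: "clrg_ok P \<sigma> N T dd n"
  shows "distinct (map (\<lambda>(a, b). {\<sigma> a, \<sigma> b}) T)" "length T \<le> 2 * card V" "length N \<le> 2 * card V"
    "v \<in> V \<Longrightarrow> x \<in> set N \<Longrightarrow> \<sigma> x = v \<longleftrightarrow> x = v"
proof -
  note O = ok[unfolded clrg_ok_def]
  have inj: "inj_on \<sigma> (set N)" and VN: "V \<subseteq> set N" and \<sigma>V: "\<forall>v\<in>V. \<sigma> v = v" using O by - (elim conjE, assumption)+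
  have "set (map (\<lambda>(a, b). {\<sigma> a, \<sigma> b}) T) = contr P" "length T = card (contr P)" using O unfolding image_edges_def set_map by - (elim conjE, assumption)+
  then show "distinct (map (\<lambda>(a, b). {\<sigma> a, \<sigma> b}) T)" by (intro card_distinct) simp
  show "length T \<le> 2 * card V" using \<open>length T = card (contr P)\<close> card_contr[of P] card_E by simp
  have dN: "distinct N" and im: "\<sigma> ` set N = V \<union> (\<Union>v\<in>V - P. fibre v)" using O by - (elim conjE, assumption)+
  have "length N = card (\<sigma> ` set N)" using card_image[OF inj] distinct_card[OF dN] by simp
  also have "\<dots> \<le> card W" unfolding im by (rule card_mono[OF finite_W]) (use V_sub fibre_W in blast)
  finally show "length N \<le> 2 * card V" using card_W by simp
  assume v: "v \<in> V" and x: "x \<in> set N"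
  have "v \<in> set N" "\<sigma> v = v" using v VN \<sigma>V by auto
  then show "\<sigma> x = v \<longleftrightarrow> x = v" using inj_on_eq_iff[OF inj x \<open>v \<in> set N\<close>] by simp
qed

lemma clrg_incident:
  assumes ok: "clrg_ok P \<sigma> N T dd n" and v: "v \<in> P" "P \<subseteq> V"
  shows "distinct (other_ends v T)" "set (other_ends v T) \<subseteq> set N" "v \<notin> set (other_ends v T)"
    "\<sigma> ` set (other_ends v T) = nbrs P v" "length (other_ends v T) = card (exits v)"
proof -
  note O = ok[unfolded clrg_ok_def]
  have inj: "inj_on \<sigma> (set N)" and VN: "V \<subseteq> set N" and \<sigma>V: "\<forall>v\<in>V. \<sigma> v = v"
    and TN: "\<forall>(a, b)\<in>set T. a \<in> set N \<and> b \<in> set N" and im: "image_edges \<sigma> T = contr P"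
    using O by - (elim conjE, assumption)+
  have vV: "v \<in> V" using v by blast
  have \<sigma>v: "\<sigma> v = v" using \<sigma>V vV by simp
  have N: "a \<in> set N" "b \<in> set N" if "(a, b) \<in> set T" for a b using TN that by auto
  have "map (\<lambda>(a, b). {\<sigma> a, \<sigma> b}) (incident v T) = map (\<lambda>x. {v, \<sigma> x}) (other_ends v T)"
    unfolding other_ends_def map_map by (rule map_cong[OF refl]) (auto simp: incident_def \<sigma>v)
  moreover have "distinct (map (\<lambda>(a, b). {\<sigma> a, \<sigma> b}) (incident v T))"
    unfolding incident_def by (rule distinct_map_filter[OF clrg_edges(1)[OF ok]])
  ultimately show dis: "distinct (other_ends v T)" by (metis distinct_map)
  show sN: "set (other_ends v T) \<subseteq> set N" unfolding other_ends_def incident_def using N by auto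
  have "nbrs P v = {x. {v, x} \<in> image_edges \<sigma> T}" unfolding contr_neighbours[OF v, symmetric] neighbours_def im ..
  also have "\<dots> = \<sigma> ` set (other_ends v T)"
  proof (intro equalityI subsetI)
    fix x assume "x \<in> {x. {v, x} \<in> image_edges \<sigma> T}"
    then obtain a b where ab: "(a, b) \<in> set T" "{v, x} = {\<sigma> a, \<sigma> b}" unfolding image_edges_def by auto
    consider "\<sigma> a = v" "\<sigma> b = x" | "\<sigma> b = v" "\<sigma> a = x" using ab(2) by (auto simp: doubleton_eq_iff)
    then show "x \<in> \<sigma> ` set (other_ends v T)"
    proof cases
      case 1
      then have "a = v" using clrg_edges(4)[OF ok vV N(1)[OF ab(1)]] by simp
      then have "b \<in> set (other_ends v T)" unfolding other_ends_def incident_def using ab(1) by force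
      then show ?thesis using 1 by blast
    next
      case 2
      then have b: "b = v" using clrg_edges(4)[OF ok vV N(2)[OF ab(1)]] by simp
      then have "a \<in> set (other_ends v T)" unfolding other_ends_def incident_def using ab(1) by force
      then show ?thesis using 2 by blast
    qed
  next
    fix x assume "x \<in> \<sigma> ` set (other_ends v T)"
    then obtain a b where ab: "(a, b) \<in> set T" "a = v \<and> x = \<sigma> b \<or> b = v \<and> x = \<sigma> a"
      unfolding other_ends_def incident_def by auto
    then have "{v, x} = {\<sigma> a, \<sigma> b}" using \<sigma>v by auto
    then show "x \<in> {x. {v, x} \<in> image_edges \<sigma> T}" using ab(1) unfolding image_edges_def by auto
  qed
  finally show eq: "\<sigma> ` set (other_ends v T) = nbrs P v" by (rule sym)
  show "v \<notin> set (other_ends v T)"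
  proof
    assume "v \<in> set (other_ends v T)"
    then have "v \<in> nbrs P v" unfolding eq[symmetric] using \<sigma>v by force
    then show False using nbrs_Sg Sg_self[OF vV] by blast
  qed
  show "length (other_ends v T) = card (exits v)"
    using card_nbrs[of P v] card_image[OF inj_on_subset[OF inj sN]] distinct_card[OF dis] unfolding eq by simp
qed

text \<open>While \<open>v\<close> is unprocessed, \<open>v\<close> is the only node of the
  contraction with surrogate \<open>v\<close>. This keeps the edges away from \<open>v\<close>
  disjoint from the new local edges.\<close>

lemma contr_edge_at:
  assumes e: "e \<in> contr P" "x \<in> e" "Sg x = v" and v: "v \<in> P"
  shows "v \<in> e"
proof -
  obtain a b where ab: "e = {rep P a, rep P b}" using e(1) by (rule contrE)
  have "x = v" if "x = rep P y" for y
    using that e(3) v Sg_rep[of P y] unfolding rep_def by simp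
  then show ?thesis using e(2) ab by blast
qed

lemma tms_clrg_step:
  assumes ok: "clrg_ok P \<sigma> N T dd n" and v: "v \<in> P" "P \<subseteq> V" and ex: "2 \<le> card (exits v)"
    and L: "\<And>h z. tree_metric (local_nodes P v) (local_edges P v) h \<Longrightarrow>
      (\<And>x y. {x, y} \<in> local_edges P v \<Longrightarrow> h x y = 1) \<Longrightarrow> z \<in> local_nodes P v \<Longrightarrow> h z v \<le> real L"
  shows "tms (clrg_step v (N, T, dd, n)) (63 * (L + 1) * (card (exits v) + 1) ^ 3 + 20 * card V + 4 * card V * card (fibre v))
    (clrg_inv (P - {v}))"
proof -
  note O = ok[unfolded clrg_ok_def]
  have dN: "distinct N" and Nn: "set N \<subseteq> {..<n}" and VN: "V \<subseteq> set N" and inj: "inj_on \<sigma> (set N)" and \<sigma>V: "\<forall>v\<in>V. \<sigma> v = v"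
    and \<sigma>N: "\<sigma> ` set N = V \<union> (\<Union>v\<in>V - P. fibre v)" and im: "image_edges \<sigma> T = contr P" and lT: "length T = card (contr P)"
    and TN: "\<forall>(a, b)\<in>set T. a \<in> set N \<and> b \<in> set N" and exN: "exact \<sigma> d dd (set N)"
    using O by - (elim conjE, assumption)+
  have vV: "v \<in> V" using v by blast
  have \<sigma>v: "\<sigma> v = v" using \<sigma>V vV by simp
  note inc = clrg_incident[OF ok v]
  define A where "A = v # other_ends v T"
  interpret loc: latent "local_nodes P v" "local_edges P v" d "insert v (nbrs P v)" by (rule local_latent[OF vV])
  have AN: "set A \<subseteq> set N" unfolding A_def using inc(2) vV VN by auto
  have dA: "distinct A" unfolding A_def using inc(1,3) by simp
  have An: "set A \<subseteq> {..<n}" using AN Nn by blast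
  have lA: "length A = card (exits v) + 1" unfolding A_def using inc(5) by simp
  have A3: "3 \<le> length A" using lA ex by simp
  have iA: "inj_on \<sigma> (set A)" by (rule inj_on_subset[OF inj AN])
  have \<sigma>A: "\<sigma> ` set A = insert v (nbrs P v)" unfolding A_def using inc(4) \<sigma>v by simp
  have dA': "\<forall>a\<in>set A. \<forall>b\<in>set A. a \<noteq> b \<longrightarrow> dd a b = d (\<sigma> a) (\<sigma> b)"
  proof (intro ballI impI)
    fix a b assume "a \<in> set A" "b \<in> set A"
    then have "a \<in> set N" "b \<in> set N" using AN by auto
    then show "dd a b = d (\<sigma> a) (\<sigma> b)" using exN unfolding exact_def by simp
  qed
  obtain h where h: "tree_metric (local_nodes P v) (local_edges P v) h" "\<forall>x y. {x, y} \<in> local_edges P v \<longrightarrow> h x y = 1"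
    using ltree_hop[OF tree_ltree[OF loc.is_tree]] by (elim exE conjE)
  have vL: "v \<in> local_nodes P v" using fibre_self[OF vV] unfolding local_nodes_def by simp
  have hL: "h v x \<le> real L" if "x \<in> local_nodes P v" for x
    using L[OF h(1) _ that] h(2) tree_metric.d_sym[OF h(1) vL that] by simp
  have rgt: "tms (rg A dd n) (63 * (L + 1) * length A ^ 3) (regrouped (local_nodes P v) (local_edges P v) d A \<sigma> dd n)"
    by (rule loc.tms_rg[OF dA An A3 iA \<sigma>A dA' h(1) _ vL hL]) (use h(2) in simp_all)
  define R where "R = filter (\<lambda>(a, b). a \<noteq> v \<and> b \<noteq> v) T"
  define m where "m = card V"
  define f where "f = card (fibre v)"
  have lTm: "length T \<le> 2 * m" using clrg_edges(2)[OF ok] unfolding m_def .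
  have m1: "1 \<le> m" using finite_V V_ne unfolding m_def by (simp add: Suc_leI card_gt_0_iff)
  have t1: "tms (filter_tm (\<lambda>(a, b). ret (a = v \<or> b = v)) T) ((1 + 1) * length T + 1) (\<lambda>xs. xs = incident v T)"
    unfolding incident_def by (rule tms_filter) (auto intro: tms_ret)
  have t2: "tms (map_tm (\<lambda>(a, b). ret (if a = v then b else a)) (incident v T)) ((1 + 1) * length (incident v T) + 1) (\<lambda>xs. xs = other_ends v T)"
    unfolding other_ends_def by (rule tms_map) (auto intro: tms_ret)
  have t3: "tms (filter_tm (\<lambda>(a, b). ret (a \<noteq> v \<and> b \<noteq> v)) T) ((1 + 1) * length T + 1) (\<lambda>xs. xs = R)"
    unfolding R_def by (rule tms_filter) (auto intro: tms_ret)
  have li: "length (incident v T) \<le> 2 * m" using lTm unfolding incident_def by (meson length_filter_le order_trans)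
  let ?c5 = "f * (2 * m + 2) + 1"
  let ?c4 = "2 * m + 1 + (?c5 + 1)"
  let ?c3 = "(1 + 1) * length T + 1 + ?c4"
  let ?c2 = "63 * (L + 1) * length A ^ 3 + ?c3"
  let ?c1 = "4 * m + 1 + ?c2"
  have key: "tms (bind_tm (filter_tm (\<lambda>(a, b). ret (a \<noteq> v \<and> b \<noteq> v)) T) (\<lambda>rest. bind_tm (append_tm S rest)
      (\<lambda>T'. bind_tm (fold_tm extend_dist new (N, dd')) (\<lambda>(N', d''). ret (N', T', d'', n'))))) ?c3 (clrg_inv (P - {v}))"
    if rok: "regrouped (local_nodes P v) (local_edges P v) d A \<sigma> dd n (S, dd', n', new)" for S dd' n' new
  proof -
    obtain \<tau> where s1: "n \<le> n'" and s2: "inj_on \<tau> (set A \<union> {n..<n'})" and s3: "\<forall>x<n. \<tau> x = \<sigma> x"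
      and s4: "\<forall>(a, b)\<in>set S. a \<in> set A \<union> {n..<n'} \<and> b \<in> set A \<union> {n..<n'}" and s5: "\<forall>a<n. \<forall>b<n. dd' a b = dd a b"
      and s6: "distinct (map fst new)" and s7: "fst ` set new = {n..<n'}" and s8: "witnesses \<tau> d dd' (set A) new"
      and s9: "\<tau> ` (set A \<union> {n..<n'}) = local_nodes P v" and s10: "image_edges \<tau> S = local_edges P v" and s11: "length S = card (local_edges P v)"
      using rok unfolding regrouped_def prod.case by (elim exE conjE) (rule that; assumption)
    have old: "\<tau> x = \<sigma> x" if "x \<in> set N" for x using s3 that Nn by auto
    have \<tau>N: "\<tau> ` set N = \<sigma> ` set N" by (rule image_cong[OF refl old])
    have \<tau>A: "\<tau> ` set A = insert v (nbrs P v)" unfolding \<sigma>A[symmetric] by (rule image_cong[OF refl]) (use old AN in blast)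
    have "set A \<inter> {n..<n'} = {}" using An by auto
    then have "\<tau> ` set A \<inter> \<tau> ` {n..<n'} = {}" using inj_on_image_Int[OF s2, of "set A" "{n..<n'}"] by simp
    moreover have "fibre v \<inter> nbrs P v = {}" using nbrs_Sg unfolding fibre_def by blast
    \<comment> \<open>The names in \<open>A\<close> already cover \<open>v\<close> and the attached
      leaves, so the new ones must denote the rest of the fibre.\<close>
    ultimately have new_im: "\<tau> ` {n..<n'} = fibre v - {v}"
      using s9 unfolding image_Un \<tau>A local_nodes_def by blast
    have lnew: "length new \<le> f"
    proof -
      have "length new = card {n..<n'}" using distinct_card[OF s6] s7 by simp
      also have "\<dots> = card (\<tau> ` {n..<n'})" by (rule card_image[symmetric], rule inj_on_subset[OF s2]) simp
      also have "\<dots> \<le> f" unfolding new_im f_def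
        by (rule card_mono) (use finite_subset[OF fibre_W finite_W] in auto)
      finally show ?thesis .
    qed
    \<comment> \<open>Nodes of the fibre other than \<open>v\<close> are hidden and belong to no
      other fibre, so none of them had a name before this call.\<close>
    have disj: "\<tau> ` set N \<inter> \<tau> ` {n..<n'} = {}"
    proof (rule ccontr)
      assume "\<tau> ` set N \<inter> \<tau> ` {n..<n'} \<noteq> {}"
      then obtain x where x: "x \<in> \<sigma> ` set N" "x \<in> fibre v" "x \<noteq> v" unfolding \<tau>N new_im by auto
      then have "x \<notin> V" using fibre_V by blast
      then obtain w where "w \<in> V - P" "x \<in> fibre w" using x(1) unfolding \<sigma>N by auto
      then show False using fibre_disjoint[of v w] x(2) v by auto
    qed
    define N' where "N' = rev (map fst new) @ N"
    have sN': "set N' = set N \<union> {n..<n'}" unfolding N'_def using s7 by auto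
    have inj': "inj_on \<tau> (set N')"
      unfolding sN' inj_on_Un
    proof (intro conjI)
      show "inj_on \<tau> (set N)" using inj inj_on_cong[of "set N" \<tau> \<sigma>, OF old] by blast
      show "inj_on \<tau> {n..<n'}" by (rule inj_on_subset[OF s2]) simp
      show "\<tau> ` (set N - {n..<n'}) \<inter> \<tau> ` ({n..<n'} - set N) = {}" using disj by blast
    qed
    have imN': "\<tau> ` set N' = V \<union> (\<Union>w\<in>V - (P - {v}). fibre w)"
    proof -
      have "V - (P - {v}) = insert v (V - P)" using vV by blast
      then show ?thesis unfolding sN' image_Un \<tau>N \<sigma>N new_im using vV by auto
    qed
    have lN': "length N + length new \<le> 2 * m"
    proof -
      have "distinct N'" unfolding N'_def using dN s6 s7 Nn by auto
      then have "length N' = card (\<tau> ` set N')" using card_image[OF inj'] distinct_card by metis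
      also have "\<dots> \<le> card W" unfolding imN' by (rule card_mono[OF finite_W]) (use V_sub fibre_W in blast)
      finally show ?thesis using card_W unfolding N'_def m_def by simp
    qed
    have imR: "image_edges \<tau> R = {e \<in> contr P. v \<notin> e}"
    proof -
      have RT: "(a, b) \<in> set R \<longleftrightarrow> (a, b) \<in> set T \<and> v \<notin> {\<sigma> a, \<sigma> b}" for a b
      proof (cases "(a, b) \<in> set T")
        case True
        then have "a \<in> set N" "b \<in> set N" using TN by auto
        then have "\<sigma> a = v \<longleftrightarrow> a = v" "\<sigma> b = v \<longleftrightarrow> b = v" using clrg_edges(4)[OF ok vV] by simp_all
        then show ?thesis using True unfolding R_def by auto
      qed (simp add: R_def)
      have "image_edges \<tau> R = image_edges \<sigma> R"
        by (rule image_edges_cong) (use old TN in \<open>auto simp: R_def\<close>)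
      also have "\<dots> = {e \<in> image_edges \<sigma> T. v \<notin> e}"
        by (rule Set.set_eqI) (auto simp: image_edges_iff RT)
      finally show ?thesis unfolding im .
    qed
    have lR: "length R = card {e \<in> contr P. v \<notin> e}"
    proof -
      have "distinct (map (\<lambda>(a, b). {\<sigma> a, \<sigma> b}) R)" unfolding R_def by (rule distinct_map_filter[OF clrg_edges(1)[OF ok]])
      then have "length R = card (image_edges \<sigma> R)" using distinct_card[of "map (\<lambda>(a, b). {\<sigma> a, \<sigma> b}) R"] unfolding image_edges_def by simp
      moreover have "image_edges \<sigma> R = image_edges \<tau> R"
        by (rule image_edges_cong) (use old TN in \<open>auto simp: R_def\<close>)
      ultimately show ?thesis unfolding imR by simp
    qed
    have "{e \<in> contr P. v \<notin> e} \<inter> local_edges P v = {}"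
    proof -
      have "\<exists>x\<in>e. Sg x = v" if "e \<in> local_edges P v" for e
        using that exitD(2) unfolding local_edges_def by blast
      then show ?thesis using contr_edge_at v(1) by blast
    qed
    then have cT': "card (contr (P - {v})) = card {e \<in> contr P. v \<notin> e} + card (local_edges P v)"
      unfolding contr_step[OF v] by (intro card_Un_disjoint) (simp_all add: finite_contr loc.finite_E)
    have lS: "length S \<le> 2 * m" using cT' s11 card_contr[of "P - {v}"] card_E unfolding m_def by simp
    have fin: "clrg_inv (P - {v}) (N', S @ R, dd'', n')" if ex': "exact \<tau> d dd'' (set N')" for dd''
      unfolding clrg_inv_def clrg_ok_def prod.case
    proof (intro exI[of _ \<tau>] conjI)
      show "distinct N'" unfolding N'_def using dN s6 s7 Nn by auto
      show "set N' \<subseteq> {..<n'}" unfolding sN' using Nn s1 by auto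
      show "V \<subseteq> set N'" using VN unfolding sN' by blast
      show "inj_on \<tau> (set N')" by (rule inj')
      show "\<forall>v\<in>V. \<tau> v = v" using \<sigma>V old VN by auto
      show "\<tau> ` set N' = V \<union> (\<Union>v\<in>V - (P - {v}). fibre v)" by (rule imN')
      show "image_edges \<tau> (S @ R) = contr (P - {v})" unfolding image_edges_append s10 imR contr_step[OF v] by blast
      show "length (S @ R) = card (contr (P - {v}))" using cT' s11 lR by simp
      show "\<forall>(a, b)\<in>set (S @ R). a \<in> set N' \<and> b \<in> set N'"
      proof (rule ballI)
        fix e assume e: "e \<in> set (S @ R)"
        obtain a b where ab: "e = (a, b)" by (cases e)
        have "(a, b) \<in> set S \<or> (a, b) \<in> set T" using e ab unfolding R_def by auto
        then have "a \<in> set N' \<and> b \<in> set N'"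
        proof
          assume "(a, b) \<in> set S"
          then have "a \<in> set A \<union> {n..<n'} \<and> b \<in> set A \<union> {n..<n'}" using s4 by auto
          then show ?thesis unfolding sN' using AN by blast
        next
          assume "(a, b) \<in> set T"
          then have "a \<in> set N \<and> b \<in> set N" using TN by auto
          then show ?thesis unfolding sN' by blast
        qed
        then show "case e of (a, b) \<Rightarrow> a \<in> set N' \<and> b \<in> set N'" unfolding ab by simp
      qed
      show "exact \<tau> d dd'' (set N')" by (rule ex')
    qed
    have t5: "tms (fold_tm extend_dist new (N, dd')) (length new * (length N + length new + 2) + 1)
        (\<lambda>(N'', dd''). N'' = rev (map fst new) @ N \<and> exact \<tau> d dd'' (set N''))"
    proof (rule tms_extend_all)
      show "exact \<tau> d dd' (set N)"
        unfolding exact_def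
      proof (intro ballI)
        fix a b assume ab: "a \<in> set N" "b \<in> set N"
        then have "a < n" "b < n" using Nn by auto
        then show "dd' a b = d (\<tau> a) (\<tau> b)" using s5 exN ab old unfolding exact_def by simp
      qed
      show "\<tau> ` set N \<subseteq> W" unfolding \<tau>N \<sigma>N using V_sub fibre_W by blast
      show "\<tau> ` fst ` set new \<subseteq> W" unfolding s7 new_im using fibre_W by blast
      show "witnesses \<tau> d dd' (set N) new" by (rule witnesses_mono[OF s8 AN])
      show "distinct (map fst new)" by (rule s6)
      show "fst ` set new \<inter> set N = {}" unfolding s7 using Nn by auto
    qed
    have c5: "length new * (length N + length new + 2) + 1 \<le> ?c5" using mult_le_mono[OF lnew, of "length N + length new + 2" "2 * m + 2"] lN' by simp
    show ?thesis
    proof (rule tms_bind[OF t3, where k' = ?c4])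
      fix rest assume rest: "rest = R"
      show "tms (bind_tm (append_tm S rest) (\<lambda>T'. bind_tm (fold_tm extend_dist new (N, dd')) (\<lambda>(N', d''). ret (N', T', d'', n')))) ?c4 (clrg_inv (P - {v}))"
      proof (rule tms_bind[OF tms_append, where k' = "?c5 + 1"])
        fix T' assume T': "T' = S @ rest"
        show "tms (bind_tm (fold_tm extend_dist new (N, dd')) (\<lambda>(N', d''). ret (N', T', d'', n'))) (?c5 + 1) (clrg_inv (P - {v}))"
        proof (rule tms_bind[OF t5, where k' = 1])
          fix s assume s: "case s of (N'', dd'') \<Rightarrow> N'' = rev (map fst new) @ N \<and> exact \<tau> d dd'' (set N'')"
          obtain dd'' where s': "s = (N', dd'')" "exact \<tau> d dd'' (set N')" using s unfolding N'_def by (cases s) simp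
          show "tms (case s of (N', d'') \<Rightarrow> ret (N', T', d'', n')) 1 (clrg_inv (P - {v}))"
            unfolding s'(1) prod.case T' rest using fin[OF s'(2)] by (intro tms_ret) simp_all
        qed (use c5 in simp)
      qed (use lS in simp)
    qed simp
  qed
  have total: "(1 + 1) * length T + 1 + ?c1 \<le> 63 * (L + 1) * (card (exits v) + 1) ^ 3 + 20 * card V + 4 * card V * card (fibre v)"
  proof -
    have "(1 + 1) * length T + 1 + (4 * m + 1 + ((1 + 1) * length T + 1 + ?c4)) = 6 + 2 * f + 2 * (f * m) + 4 * length T + 6 * m"
      by (simp add: algebra_simps)
    moreover have "f \<le> f * m" using m1 by simp
    moreover have "20 * m + 4 * m * f = 20 * m + 4 * (f * m)" by simp
    ultimately have "(1 + 1) * length T + 1 + (4 * m + 1 + ((1 + 1) * length T + 1 + ?c4)) \<le> 20 * m + 4 * m * f"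
      using lTm m1 by linarith
    then show ?thesis unfolding lA m_def[symmetric] f_def[symmetric] by simp
  qed
  show ?thesis
    unfolding clrg_step_def prod.case
  proof (rule tms_bind[OF t1 _ total])
    fix xs assume xs: "xs = incident v T"
    show "tms (bind_tm (map_tm (\<lambda>(a, b). ret (if a = v then b else a)) xs) (\<lambda>nbs. bind_tm (rg (v # nbs) dd n) (\<lambda>(S, d', n', new).
        bind_tm (filter_tm (\<lambda>(a, b). ret (a \<noteq> v \<and> b \<noteq> v)) T) (\<lambda>rest. bind_tm (append_tm S rest)
        (\<lambda>T'. bind_tm (fold_tm extend_dist new (N, d')) (\<lambda>(N', d''). ret (N', T', d'', n'))))))) ?c1 (clrg_inv (P - {v}))"
      unfolding xs
    proof (rule tms_bind[OF t2, where k' = ?c2])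
      fix nbs assume nbs: "nbs = other_ends v T"
      show "tms (bind_tm (rg (v # nbs) dd n) (\<lambda>(S, d', n', new).
        bind_tm (filter_tm (\<lambda>(a, b). ret (a \<noteq> v \<and> b \<noteq> v)) T) (\<lambda>rest. bind_tm (append_tm S rest)
        (\<lambda>T'. bind_tm (fold_tm extend_dist new (N, d')) (\<lambda>(N', d''). ret (N', T', d'', n')))))) ?c2 (clrg_inv (P - {v}))"
        unfolding nbs A_def[symmetric]
      proof (rule tms_bind[OF rgt, where k' = ?c3])
        fix s assume s: "regrouped (local_nodes P v) (local_edges P v) d A \<sigma> dd n s"
        obtain S dd' n' new where e: "s = (S, dd', n', new)" by (cases s)
        show "tms (case s of (S, d', n', new) \<Rightarrow>
          bind_tm (filter_tm (\<lambda>(a, b). ret (a \<noteq> v \<and> b \<noteq> v)) T) (\<lambda>rest. bind_tm (append_tm S rest)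
          (\<lambda>T'. bind_tm (fold_tm extend_dist new (N, d')) (\<lambda>(N', d''). ret (N', T', d'', n'))))) ?c3 (clrg_inv (P - {v}))"
          unfolding e prod.case by (rule key) (use s e in simp)
      qed simp
    qed (use li in simp)
  qed
qed

end

section \<open>The final state and the total running time\<close>

context latent
begin

text \<open>An observed node outside \<open>J\<close> has fewer than two exits, hence by
  \<open>hidden_fibre_exits\<close> no hidden node in its fibre; leaving that fibre contracted moves
  nothing.\<close>

lemma rep_done:
  assumes J: "\<And>v. v \<in> V \<Longrightarrow> 2 \<le> card (exits v) \<Longrightarrow> v \<in> J" and x: "x \<in> W"
  shows "rep (V - J) x = x" "x \<in> V \<or> x \<in> fibre (Sg x) \<and> Sg x \<in> J"
proof -
  have "x \<in> fibre (Sg x)" using x unfolding fibre_def by simp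
  then have "x \<notin> V \<Longrightarrow> Sg x \<in> J" using J[OF Sg_props(1)] hidden_fibre_exits[OF _ _ Sg_props(1)] by simp
  then show "rep (V - J) x = x" "x \<in> V \<or> x \<in> fibre (Sg x) \<and> Sg x \<in> J"
    using Sg_self[of x] \<open>x \<in> fibre (Sg x)\<close> unfolding rep_def by (cases "x \<in> V"; simp)+
qed

lemma contr_done:
  assumes J: "\<And>v. v \<in> V \<Longrightarrow> 2 \<le> card (exits v) \<Longrightarrow> v \<in> J"
  shows "contr (V - J) = E"
proof (intro equalityI subsetI)
  fix e assume "e \<in> contr (V - J)"
  then obtain x y where e: "{x, y} \<in> E" "e = {rep (V - J) x, rep (V - J) y}" by (rule contrE)
  have "x \<in> W" "y \<in> W" using edge_W[OF e(1)] by simp_all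
  then show "e \<in> E" using e rep_done(1)[OF J] by simp
next
  fix e assume e: "e \<in> E"
  obtain x y where xy: "e = {x, y}" using edge_pair[OF e] by (elim exE)
  have "x \<in> W" "y \<in> W" "x \<noteq> y" using edge_W[of x y] e xy by simp_all
  then show "e \<in> contr (V - J)" using contrI[of x y "V - J"] e xy rep_done(1)[OF J] by simp
qed

lemma fibres_done:
  assumes J: "\<And>v. v \<in> V \<Longrightarrow> 2 \<le> card (exits v) \<Longrightarrow> v \<in> J" "J \<subseteq> V"
  shows "V \<union> (\<Union>v\<in>V - (V - J). fibre v) = W"
proof -
  have "V - (V - J) = J" using J(2) by blast
  moreover have "W \<subseteq> V \<union> (\<Union>v\<in>J. fibre v)" using rep_done(2)[OF J(1)] by blast
  moreover have "(\<Union>v\<in>J. fibre v) \<subseteq> W" by (rule UN_least) (rule fibre_W)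
  ultimately show ?thesis using V_sub by (simp add: equalityI)
qed

text \<open>\<open>same_latent_tree\<close> asks for a renaming of the true nodes into output names,
  so it is the inverse of \<open>\<sigma>\<close> that is supplied.\<close>

lemma same_tree:
  assumes "inj_on \<sigma> (set N)" "V \<subseteq> set N" "\<forall>v\<in>V. \<sigma> v = v" "\<sigma> ` set N = W" "image_edges \<sigma> T = E"
    and TN: "\<forall>(a, b)\<in>set T. a \<in> set N \<and> b \<in> set N"
  shows "same_latent_tree V W E (set N) (edges T)"
proof -
  have "bij_betw \<sigma> (set N) W" using assms(1,4) unfolding bij_betw_def by simp
  then have bij: "bij_betw (inv_into (set N) \<sigma>) W (set N)" by (rule bij_betw_inv_into)
  have fix_V: "inv_into (set N) \<sigma> v = v" if "v \<in> V" for v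
  proof -
    have "v \<in> set N" "\<sigma> v = v" using that assms(2,3) by auto
    then show ?thesis using inv_into_f_f[OF assms(1), of v] by simp
  qed
  have "inv_into (set N) \<sigma> ` \<sigma> ` e = e" if "e \<in> edges T" for e
    by (rule inv_into_image_cancel[OF assms(1)]) (use that TN in \<open>auto simp: edges_def\<close>)
  then have "(\<lambda>e. inv_into (set N) \<sigma> ` \<sigma> ` e) ` edges T = edges T" by simp
  then have "edges T = (\<lambda>e. inv_into (set N) \<sigma> ` e) ` E"
    unfolding assms(5)[symmetric] image_edges_eq image_image by simp
  then show ?thesis unfolding same_latent_tree_def using bij fix_V by (intro exI[of _ "inv_into (set N) \<sigma>"]) simp
qed

text \<open>Fibres are disjoint, so bounds for single calls that involve the deep nodes or all nodes
  of a fibre add up to bounds in terms of the whole tree.\<close>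

lemma sum_disjoint_cards:
  assumes "J \<subseteq> V" "X \<subseteq> W" shows "(\<Sum>v\<in>J. card (X \<inter> fibre v)) \<le> card X"
proof -
  have fX: "finite X" using assms(2) finite_W by (rule finite_subset)
  have "(\<Sum>v\<in>J. card (X \<inter> fibre v)) = card (\<Union>v\<in>J. X \<inter> fibre v)"
  proof (rule card_UN_disjoint[symmetric])
    show "finite J" using assms(1) finite_V by (rule finite_subset)
    show "\<forall>i\<in>J. finite (X \<inter> fibre i)" using fX by simp
    show "\<forall>i\<in>J. \<forall>j\<in>J. i \<noteq> j \<longrightarrow> (X \<inter> fibre i) \<inter> (X \<inter> fibre j) = {}" using fibre_disjoint by blast
  qed
  also have "\<dots> \<le> card X" by (rule card_mono[OF fX]) blast
  finally show ?thesis .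
qed

lemma tms_clrg:
  assumes vs: "distinct vs" "set vs = V" and V2: "2 \<le> card V" and D: "\<And>a b. a \<in> V \<Longrightarrow> b \<in> V \<Longrightarrow> D a b = d a b"
    and mst: "tms (mst vs D) (20 * (card V)\<^sup>2) (\<lambda>M'. M' = M)" and M: "ltree V (edges M)" "edges M = contr V" "length M = card V - 1"
    and l: "0 < l" "\<And>x y. {x, y} \<in> E \<Longrightarrow> l \<le> d x y" and u: "0 < u" "\<And>x y. {x, y} \<in> E \<Longrightarrow> d x y \<le> u"
  shows "tms (clrg vs D)
      (60 * (card V)\<^sup>2 + 504 * (nat \<lceil>u / l\<rceil> + 3) * card (V - leaves V (edges M)) * max_degree V (edges M) ^ 3)
      (\<lambda>(N, T). same_latent_tree V W E (set N) (edges T))"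
proof -
  define m where "m = card V"
  define q where "q = nat \<lceil>u / l\<rceil>"
  define \<Delta> where "\<Delta> = max_degree V (edges M)"
  define J where "J = filter (\<lambda>v. length (incident v M) \<noteq> 1) vs"
  have lvs: "length vs = m" using distinct_card[OF vs(1)] vs(2) unfolding m_def by simp
  have start: "clrg_ok V id vs M D n" if "\<forall>v\<in>set vs. v < n" for n
    unfolding clrg_ok_def
  proof (intro conjI)
    show "image_edges id M = contr V" unfolding image_edges_eq M(2)[symmetric] by simp
    show "length M = card (contr V)" using ltree_card[OF M(1)] M(2,3) by simp
    show "\<forall>(a, b)\<in>set M. a \<in> set vs \<and> b \<in> set vs"
    proof (rule ballI)
      fix e assume e: "e \<in> set M"
      obtain a b where ab: "e = (a, b)" by (cases e)
      have "{a, b} \<in> edges M" using e ab unfolding edges_def by auto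
      moreover have "edges M \<subseteq> Pow V" using ltree_tree[OF M(1)] unfolding tree_def by auto
      ultimately show "case e of (a, b) \<Rightarrow> a \<in> set vs \<and> b \<in> set vs" unfolding ab vs(2) by auto
    qed
    show "exact id d D (set vs)" unfolding exact_def using D vs(2) by simp
  qed (use vs that in auto)
  \<comment> \<open>Any bound on the names in use would serve here; one is fixed to let
    \<open>clrg_incident\<close> speak about the spanning tree.\<close>
  have start0: "clrg_ok V id vs M D (Suc (Max V))"
    by (rule start) (use vs(2) finite_V in \<open>auto simp: le_imp_less_Suc\<close>)
  have deg: "degree (edges M) v = card (exits v)" "length (incident v M) = card (exits v)" if "v \<in> V" for v
    using contr_neighbours[OF that subset_refl] card_nbrs[of V v] clrg_incident(5)[OF start0 that subset_refl]
    unfolding degree_def M(2) other_ends_def by simp_all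
  \<comment> \<open>With two or more nodes no node is isolated, so failing the leaf test of
    \<open>internal_nodes\<close> means having at least two exits.\<close>
  have deg1: "1 \<le> card (exits v)" if v: "v \<in> V" for v
  proof -
    have "\<not> V \<subseteq> {v}" using card_mono[of "{v}" V] V2 by auto
    then obtain w where w: "w \<in> V" "w \<noteq> v" by auto
    have "(v, w) \<in> (adjacent (edges M))\<^sup>*" using ltree_tree[OF M(1)] v w(1) unfolding tree_def by blast
    then obtain y where "(v, y) \<in> adjacent (edges M)" using w(2) by (metis converse_rtranclE)
    then have "y \<in> neighbours (edges M) v" unfolding adjacent_def neighbours_def by simp
    moreover have "finite (neighbours (edges M) v)"
      using contr_neighbours[OF v subset_refl] finite_exits unfolding M(2) nbrs_def by simp
    ultimately show ?thesis using deg(1)[OF v] unfolding degree_def by (metis One_nat_def Suc_leI card_gt_0_iff empty_iff)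
  qed
  have sJ: "set J = V - leaves V (edges M)" unfolding J_def leaves_def using vs(2) deg by auto
  have sJ2: "set J = {v \<in> V. 2 \<le> card (exits v)}"
  proof (rule Set.set_eqI)
    fix v
    show "v \<in> set J \<longleftrightarrow> v \<in> {v \<in> V. 2 \<le> card (exits v)}"
    proof (cases "v \<in> V")
      case True
      then show ?thesis using deg1[OF True] deg(2)[OF True] vs(2) unfolding J_def by auto
    qed (use vs(2) in \<open>simp add: J_def\<close>)
  qed
  have dJ: "distinct J" unfolding J_def using vs(1) by simp
  have JV: "set J \<subseteq> V" unfolding sJ by blast
  have \<Delta>: "card (exits v) \<le> \<Delta>" if "v \<in> V" for v
    unfolding \<Delta>_def max_degree_def deg(1)[OF that, symmetric] by (rule Max_ge) (use finite_V that in auto)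
  define L where "L v = q + card (deep u \<inter> fibre v) + 1" for v
  define k where "k v = 63 * (L v + 1) * (card (exits v) + 1) ^ 3 + 20 * m + 4 * m * card (fibre v)" for v
  have t1: "tms (internal_nodes vs M) ((2 * length M + 2 + 1) * length vs + 1) (\<lambda>J'. J' = J)"
    unfolding internal_nodes_def J_def
  proof (rule tms_filter)
    fix v
    have "tms (filter_tm (\<lambda>(a, b). ret (a = v \<or> b = v)) M) ((1 + 1) * length M + 1) (\<lambda>xs. xs = incident v M)"
      unfolding incident_def by (rule tms_filter) (auto intro: tms_ret)
    then show "tms (bind_tm (filter_tm (\<lambda>(a, b). ret (a = v \<or> b = v)) M) (\<lambda>xs. ret (case xs of [_] \<Rightarrow> False | _ \<Rightarrow> True)))
        (2 * length M + 2) (\<lambda>b. b = (length (incident v M) \<noteq> 1))"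
      by (rule tms_bind[where k' = 1]) (auto intro!: tms_ret split: list.split)
  qed
  have t2: "tms (fold_tm (\<lambda>v n. ret (max n (Suc v))) vs 0) (1 * length vs + 1) (\<lambda>n. \<forall>v\<in>set vs. v < n)"
    by (rule tms_fold_const[where I = "\<lambda>us n. \<forall>v\<in>set us. v < n"]) (auto intro!: tms_ret)
  have hop: "h z v \<le> real (L v)" if v: "v \<in> V" and h: "tree_metric (local_nodes P v) (local_edges P v) h"
    "\<And>x y. {x, y} \<in> local_edges P v \<Longrightarrow> h x y = 1" "z \<in> local_nodes P v" for h z v P
  proof -
    have "h z v \<le> u / l + real (card (deep u \<inter> fibre v)) + 1"
      by (rule local_hops[OF v _ l h]) (use u(1) in simp_all)
    moreover have "u / l \<le> real q" unfolding q_def by (rule real_nat_ceiling_ge)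
    ultimately show ?thesis unfolding L_def by simp
  qed
  have t3: "tms (fold_tm clrg_step J (vs, M, D, n)) (sum_list (map k J) + 1) (clrg_inv (V - set J))"
    if n: "\<forall>v\<in>set vs. v < n" for n
  proof (rule tms_fold[where I = "\<lambda>us. clrg_inv (V - set us)" and k = k])
    fix us v ws s assume Js: "J = us @ v # ws" and s: "clrg_inv (V - set us) s"
    obtain N T dd n' where e: "s = (N, T, dd, n')" by (cases s)
    obtain \<sigma> where ok: "clrg_ok (V - set us) \<sigma> N T dd n'" using s unfolding e clrg_inv_def prod.case by (elim exE)
    have v: "v \<in> set J" "v \<in> V - set us" "v \<in> V" using Js dJ JV by auto
    have "tms (clrg_step v (N, T, dd, n')) (k v) (clrg_inv (V - set us - {v}))"
      unfolding k_def m_def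
    proof (rule tms_clrg_step[OF ok v(2) Diff_subset])
      show "2 \<le> card (exits v)" using v(1) unfolding sJ2 by simp
    qed (rule hop[OF v(3)])
    moreover have "V - set us - {v} = V - set (us @ [v])" by auto
    ultimately show "tms (clrg_step v s) (k v) (clrg_inv (V - set (us @ [v])))" unfolding e by simp
  next
    show "clrg_inv (V - set []) (vs, M, D, n)" unfolding clrg_inv_def prod.case using start[OF n] by auto
  qed
  have J: "v \<in> set J" if "v \<in> V" "2 \<le> card (exits v)" for v using that unfolding sJ2 by simp
  have final_tree: "same_latent_tree V W E (set N) (edges T)" if i: "clrg_inv (V - set J) (N, T, dd, n)" for N T dd n
  proof -
    obtain \<sigma> where "clrg_ok (V - set J) \<sigma> N T dd n" using i unfolding clrg_inv_def prod.case by (elim exE)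
    moreover have "contr (V - set J) = E" by (rule contr_done) (rule J)
    moreover have "V \<union> (\<Union>v\<in>V - (V - set J). fibre v) = W" by (rule fibres_done) (use J JV in simp_all)
    ultimately have O: "clrg_ok (V - set J) \<sigma> N T dd n" "contr (V - set J) = E" "V \<union> (\<Union>v\<in>V - (V - set J). fibre v) = W"
      by simp_all
    note O = O(1)[unfolded clrg_ok_def O(2,3)]
    show ?thesis using O by - (rule same_tree[of \<sigma>], (elim conjE, assumption)+)
  qed
  let ?c3 = "sum_list (map k J) + 1 + 1"
  let ?c2 = "1 * length vs + 1 + ?c3"
  let ?c1 = "(2 * length M + 2 + 1) * length vs + 1 + ?c2"
  have total: "20 * (card V)\<^sup>2 + ?c1 \<le> 60 * (card V)\<^sup>2 + 504 * (q + 3) * card (set J) * \<Delta> ^ 3"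
  proof -
    have sk: "sum_list (map k J) = (\<Sum>v\<in>set J. k v)" by (rule sum_list_distinct_conv_sum_set[OF dJ])
    have kv: "k v \<le> 504 * \<Delta> ^ 3 * (q + 2) + 504 * \<Delta> ^ 3 * card (deep u \<inter> fibre v) + 20 * m + 4 * m * card (W \<inter> fibre v)"
      if v: "v \<in> set J" for v
    proof -
      have "2 \<le> card (exits v)" "v \<in> V" using v sJ2 by auto
      \<comment> \<open>The closed neighbourhood has at most \<open>\<Delta> + 1\<close>, hence at
        most \<open>2 * \<Delta>\<close> members; cubing turns 63 into 504.\<close>
      then have "card (exits v) + 1 \<le> 2 * \<Delta>" using \<Delta>[of v] by simp
      then have "(card (exits v) + 1) ^ 3 \<le> (2 * \<Delta>) ^ 3" by (rule power_mono) simp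
      then have "63 * (L v + 1) * (card (exits v) + 1) ^ 3 \<le> 63 * (L v + 1) * (2 * \<Delta>) ^ 3" by (rule mult_le_mono2)
      also have "\<dots> = 504 * \<Delta> ^ 3 * (q + 2) + 504 * \<Delta> ^ 3 * card (deep u \<inter> fibre v)"
        unfolding L_def by (simp add: power_mult_distrib algebra_simps)
      finally have "63 * (L v + 1) * (card (exits v) + 1) ^ 3 \<le> 504 * \<Delta> ^ 3 * (q + 2) + 504 * \<Delta> ^ 3 * card (deep u \<inter> fibre v)" .
      moreover have "W \<inter> fibre v = fibre v" using fibre_W by blast
      ultimately show ?thesis unfolding k_def by simp
    qed
    have cJ: "card (set J) \<le> m" unfolding m_def by (rule card_mono[OF finite_V JV])
    \<comment> \<open>The bound on the rounds of a call grows with the deep nodes in its fibre, but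
      over all calls these number at most \<open>card (set J)\<close>; this raises
      \<open>q + 2\<close> to \<open>q + 3\<close>.\<close>
    have dp: "(\<Sum>v\<in>set J. card (deep u \<inter> fibre v)) \<le> card (set J)"
    proof -
      have "(\<Sum>v\<in>set J. card (deep u \<inter> fibre v)) \<le> card (deep u)"
        by (rule sum_disjoint_cards[OF JV]) (auto simp: deep_def)
      also have "\<dots> \<le> card (set J)" unfolding sJ2 by (rule card_deep) (use u in simp_all)
      finally show ?thesis .
    qed
    have fb: "(\<Sum>v\<in>set J. card (W \<inter> fibre v)) \<le> 2 * m"
      using sum_disjoint_cards[OF JV subset_refl] card_W unfolding m_def by simp
    have "(\<Sum>v\<in>set J. k v) \<le> (\<Sum>v\<in>set J. 504 * \<Delta> ^ 3 * (q + 2) + 504 * \<Delta> ^ 3 * card (deep u \<inter> fibre v) + 20 * m + 4 * m * card (W \<inter> fibre v))"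
      by (rule sum_mono[OF kv])
    also have "\<dots> = card (set J) * (504 * \<Delta> ^ 3 * (q + 2)) + 504 * \<Delta> ^ 3 * (\<Sum>v\<in>set J. card (deep u \<inter> fibre v))
        + card (set J) * (20 * m) + 4 * m * (\<Sum>v\<in>set J. card (W \<inter> fibre v))"
      by (simp add: sum.distrib sum_distrib_left)
    also have "\<dots> \<le> card (set J) * (504 * \<Delta> ^ 3 * (q + 2)) + 504 * \<Delta> ^ 3 * card (set J) + m * (20 * m) + 4 * m * (2 * m)"
      using dp fb cJ by (intro add_mono mult_le_mono order_refl)
    also have "\<dots> = 504 * (q + 3) * card (set J) * \<Delta> ^ 3 + 28 * m\<^sup>2"
      by (simp add: algebra_simps power2_eq_square)
    finally have S: "sum_list (map k J) \<le> 504 * (q + 3) * card (set J) * \<Delta> ^ 3 + 28 * m\<^sup>2" unfolding sk .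
    have "(2 * length M + 2 + 1) * m \<le> (2 * m + 1) * m" using M(3) V2 unfolding m_def by (intro mult_le_mono1) simp
    also have "\<dots> = 2 * m\<^sup>2 + m" by (simp add: algebra_simps power2_eq_square)
    finally have "(2 * length M + 2 + 1) * m \<le> 2 * m\<^sup>2 + m" .
    moreover have "m \<le> m\<^sup>2" "1 \<le> m\<^sup>2" using V2 unfolding m_def by (simp_all add: power2_eq_square)
    \<comment> \<open>Quadratic terms: 20 from Prim, 2 from the search for internal nodes, 28 from
      the calls; the lower-order terms fit below 60.\<close>
    ultimately show ?thesis using S unfolding lvs m_def[symmetric] by linarith
  qed
  show ?thesis
    unfolding q_def[symmetric] sJ[symmetric] \<Delta>_def[symmetric] clrg_def
  proof (rule tms_bind[OF mst _ total])
    fix M' assume M': "M' = M"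
    show "tms (bind_tm (internal_nodes vs M') (\<lambda>J. bind_tm (fold_tm (\<lambda>v n. ret (max n (Suc v))) vs 0)
        (\<lambda>n. bind_tm (fold_tm clrg_step J (vs, M', D, n)) (\<lambda>(N, T, d', n'). ret (N, T))))) ?c1
        (\<lambda>(N, T). same_latent_tree V W E (set N) (edges T))"
      unfolding M'
    proof (rule tms_bind[OF t1, where k' = ?c2])
      fix J' assume J': "J' = J"
      show "tms (bind_tm (fold_tm (\<lambda>v n. ret (max n (Suc v))) vs 0)
        (\<lambda>n. bind_tm (fold_tm clrg_step J' (vs, M, D, n)) (\<lambda>(N, T, d', n'). ret (N, T)))) ?c2
        (\<lambda>(N, T). same_latent_tree V W E (set N) (edges T))"
        unfolding J'
      proof (rule tms_bind[OF t2, where k' = ?c3])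
        fix n assume n: "\<forall>v\<in>set vs. v < n"
        show "tms (bind_tm (fold_tm clrg_step J (vs, M, D, n)) (\<lambda>(N, T, d', n'). ret (N, T))) ?c3
          (\<lambda>(N, T). same_latent_tree V W E (set N) (edges T))"
        proof (rule tms_bind[OF t3[OF n], where k' = 1])
          fix s assume s: "clrg_inv (V - set J) s"
          obtain N T dd n' where e: "s = (N, T, dd, n')" by (cases s)
          show "tms (case s of (N, T, d', n') \<Rightarrow> ret (N, T)) 1 (\<lambda>(N, T). same_latent_tree V W E (set N) (edges T))"
            unfolding e prod.case by (intro tms_ret) (use final_tree s e in simp_all)
        qed simp
      qed simp
    qed simp
  qed
qed

end

section \<open>Degenerate inputs and the final bound\<close>

lemma while_tm_False: "\<not> b s \<Longrightarrow> while_tm b c s = Result s 1"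
  unfolding while_tm_def by (subst while_option_unfold) (simp add: ret_def)

lemma rg_single: "\<exists>t. rg [v] D n = Result ([], D, n, []) t"
  by (simp add: rg_def rg_step_def grouping_def join_block_def ret_def while_tm_False)

text \<open>A single node has no incident edge and hence counts as internal, so \<open>rg\<close> is
  called once, on a one-element list. The general analysis of a call assumes three or more names;
  here the run is computed.\<close>

lemma clrg_single: "\<exists>s t. mst [v] D = Result [] s \<and> clrg [v] D = Result ([v], []) t"
proof -
  obtain t where "rg [v] D (Suc v) = Result ([], D, Suc v, []) t" using rg_single by blast
  then show ?thesis by (simp add: clrg_def mst_def internal_nodes_def clrg_step_def ret_def)
qed

text \<open>Rules out a tree of hidden nodes only, so that there is an observed node.\<close>

lemma ltree_small_degree:
  assumes t: "ltree W E" shows "\<exists>x\<in>W. degree E x < 3"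
proof (cases "2 \<le> card W")
  case True
  obtain x where "x \<in> W" "degree E x = 1" using ltree_has_leaf[OF t True] by blast
  then show ?thesis by (intro bexI[of _ x]) simp_all
next
  case False
  then have "E = {}" using ltree_card[OF t] ltree_edges[OF t] by simp
  then show ?thesis using ltree_edges[OF t] by (auto simp: degree_def neighbours_def)
qed

theorem theorem10:
  fixes l u :: real
  assumes "0 < l" and "0 < u"
  shows "\<exists>C>0. \<forall>(V::nat set) (H::nat set) (E::nat set set) (p::(nat \<Rightarrow> real) measure)
           (\<delta>::nat \<Rightarrow> nat \<Rightarrow> real) (D::nat \<Rightarrow> nat \<Rightarrow> real) (vs::nat list).
      minimal_latent_tree V H E \<and>
      tree_model p (V \<union> H) E \<delta> \<and>
      (\<forall>i j. {i, j} \<in> E \<longrightarrow> l \<le> \<delta> i j \<and> \<delta> i j \<le> u) \<and>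
      (\<forall>i\<in>V. \<forall>j\<in>V. D i j = \<delta> i j) \<and>
      distinct vs \<and> set vs = V
      \<longrightarrow>
      (\<exists>M s N T t.
         mst vs D = Result M s \<and> is_mst V D (edges M) \<and>
         clrg vs D = Result (N, T) t \<and>
         same_latent_tree V (V \<union> H) E (set N) (edges T) \<and>
         (card V \<ge> 2 \<longrightarrow>
            card (V - leaves V (edges M)) < card V \<and>
            real t \<le> C * ((real (card V))\<^sup>2 * ln (real (card V)) +
                          real (card (V - leaves V (edges M))) *
                          real (max_degree V (edges M)) ^ 3)))"
proof -
  define q where "q = nat \<lceil>u / l\<rceil>"
  \<comment> \<open>For \<open>m \<ge> 2\<close> the quadratic part \<open>60 * m\<^sup>2\<close> is
    at most \<open>60 / ln 2\<close> times \<open>m\<^sup>2 * ln m\<close>; the second summand is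
    the factor from \<open>tms_clrg\<close>. The model enters only through
    \<open>u / l\<close>.\<close>
  define C where "C = 60 / ln 2 + 504 * (real q + 3)"
  have "0 < ln (2 :: real)" by simp
  then have C: "0 < C" "60 / ln 2 \<le> C" "504 * (real q + 3) \<le> C" unfolding C_def by (simp_all add: add_pos_nonneg)
  have main: "\<exists>M s N T t. mst vs D = Result M s \<and> is_mst V D (edges M) \<and> clrg vs D = Result (N, T) t \<and>
      same_latent_tree V (V \<union> H) E (set N) (edges T) \<and>
      (card V \<ge> 2 \<longrightarrow> card (V - leaves V (edges M)) < card V \<and>
         real t \<le> C * ((real (card V))\<^sup>2 * ln (real (card V)) +
           real (card (V - leaves V (edges M))) * real (max_degree V (edges M)) ^ 3))"
    if tr: "minimal_latent_tree V H E" and model: "tree_model p (V \<union> H) E \<delta>"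
      and lu: "\<forall>i j. {i, j} \<in> E \<longrightarrow> l \<le> \<delta> i j \<and> \<delta> i j \<le> u" and D: "\<forall>i\<in>V. \<forall>j\<in>V. D i j = \<delta> i j"
      and vs: "distinct vs" "set vs = V"
    for V H :: "nat set" and E :: "nat set set" and p :: "(nat \<Rightarrow> real) measure" and \<delta> D :: "nat \<Rightarrow> nat \<Rightarrow> real" and vs
  proof -
    have t: "tree (V \<union> H) E" "V \<inter> H = {}" "\<forall>h\<in>H. 3 \<le> degree E h"
      using tr unfolding minimal_latent_tree_def latent_tree_def by auto
    interpret tree_metric "V \<union> H" E \<delta>
      by (rule information_distance_additive[OF t(1) model]) (use lu assms(1) in force)
    have "V \<noteq> {}"
    proof
      assume "V = {}"
      then obtain x where "x \<in> H" "degree E x < 3" using ltree_small_degree[OF tree_ltree[OF t(1)]] by auto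
      then show False using t(3) by force
    qed
    interpret latent "V \<union> H" E \<delta> V
      by unfold_locales (use \<open>V \<noteq> {}\<close> t(3) in \<open>auto simp: degree_def\<close>)
    have D': "D a b = \<delta> a b" if "a \<in> V" "b \<in> V" for a b using D that by blast
    have "vs \<noteq> []" using \<open>V \<noteq> {}\<close> vs(2) by auto
    have lvs: "length vs = card V" using distinct_card[OF vs(1)] vs(2) by simp
    obtain M s where M: "mst vs D = Result M s" "s \<le> 20 * (card V)\<^sup>2" "ltree V (edges M)" "length M = card V - 1"
      "\<forall>e\<in>set M. greedy_edge V D e"
      using mst_greedy[OF vs \<open>vs \<noteq> []\<close>, of D] unfolding tms_def lvs by auto
    have "e \<in> contr V" if e: "e \<in> edges M" for e
    proof -
      obtain a b where ab: "(a, b) \<in> set M" "e = {a, b}" using e by (auto simp: edges_def)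
      show ?thesis unfolding ab(2) by (rule greedy_contracted[OF _ D']) (use M(5) ab(1) in simp_all)
    qed
    then have eM: "edges M = contr V" by (intro mst_contraction[OF M(3)] subsetI)
    have mst: "is_mst V D (edges M)" unfolding eM by (rule contraction_is_mst[OF _ D']) (use M(3) eM in simp_all)
    show ?thesis
    proof (cases "2 \<le> card V")
      case True
      obtain x where x: "x \<in> V" "degree (edges M) x = 1" using ltree_has_leaf[OF M(3) True] by blast
      then have "V - leaves V (edges M) \<subset> V" unfolding leaves_def by blast
      then have less: "card (V - leaves V (edges M)) < card V" by (rule psubset_card_mono[OF finite_V])
      have "tms (clrg vs D)
        (60 * (card V)\<^sup>2 + 504 * (nat \<lceil>u / l\<rceil> + 3) * card (V - leaves V (edges M)) * max_degree V (edges M) ^ 3)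
        (\<lambda>(N, T). same_latent_tree V (V \<union> H) E (set N) (edges T))"
        by (rule tms_clrg[OF vs True D' _ M(3) eM M(4) assms(1) _ assms(2)])
          (use M(1,2) lu in \<open>auto simp: tms_def\<close>)
      then obtain N T t where r: "clrg vs D = Result (N, T) t" "same_latent_tree V (V \<union> H) E (set N) (edges T)"
        "t \<le> 60 * (card V)\<^sup>2 + 504 * (q + 3) * card (V - leaves V (edges M)) * max_degree V (edges M) ^ 3"
        unfolding tms_def q_def by auto
      define J where "J = real (card (V - leaves V (edges M))) * real (max_degree V (edges M)) ^ 3"
      have "real t \<le> real (60 * (card V)\<^sup>2 + 504 * (q + 3) * card (V - leaves V (edges M)) * max_degree V (edges M) ^ 3)"
        using r(3) by (rule of_nat_mono)
      also have "\<dots> = 60 * (real (card V))\<^sup>2 + 504 * (real q + 3) * J" unfolding J_def by (simp add: algebra_simps)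
      also have "\<dots> \<le> C * ((real (card V))\<^sup>2 * ln (real (card V))) + C * J"
      proof (rule add_mono)
        have "ln 2 \<le> ln (real (card V))" using True by simp
        then have "60 / ln 2 * ln 2 \<le> C * ln (real (card V))" using C by (intro mult_mono) simp_all
        then have "60 * (real (card V))\<^sup>2 \<le> C * ln (real (card V)) * (real (card V))\<^sup>2"
          by (intro mult_right_mono) simp_all
        then show "60 * (real (card V))\<^sup>2 \<le> C * ((real (card V))\<^sup>2 * ln (real (card V)))" by (simp add: algebra_simps)
        show "504 * (real q + 3) * J \<le> C * J" by (rule mult_right_mono[OF C(3)]) (simp add: J_def)
      qed
      also have "\<dots> = C * ((real (card V))\<^sup>2 * ln (real (card V)) + J)" by (simp add: algebra_simps)
      finally show ?thesis using M(1) mst r(1,2) less unfolding J_def by (intro exI conjI impI)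
    next
      case False
      have "0 < card V" using \<open>V \<noteq> {}\<close> finite_V by (simp add: card_gt_0_iff)
      then have c1: "card V = 1" using False by linarith
      then obtain v where v: "vs = [v]" using lvs by (auto simp: length_Suc_conv)
      obtain s' t where r: "mst vs D = Result [] s'" "clrg vs D = Result ([v], []) t" using clrg_single unfolding v by blast
      have "V \<union> H = V" "E = {}" using few_active(1,2) c1 by simp_all
      then have "same_latent_tree V (V \<union> H) E (set [v]) (edges [])"
        using same_tree[of id "[v]" "[]"] vs(2) v by (simp add: image_edges_def)
      moreover have "is_mst V D (edges [])" using mst r(1) M(1) by simp
      ultimately show ?thesis using r False by blast
    qed
  qed
  show ?thesis by (rule exI[of _ C], rule conjI[OF C(1)], intro allI impI, elim conjE, rule main)
qed

end
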